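(* Let $n\ge2$ and let $C\subset\mathbb A^{n+2}$ be the cone given by $$x_0^{\frac12}+x_1^{\frac12}+\dots+x_{n+1}^{\frac12}=0.$$ Then $C$ (and therefore its projectively dual cone $\hat C$) is admissible with rank equal to $(n+1)!$.
   Context: $\mathbf k$ is an algebraically closed field of characteristic $0$; functions are germs of analytic functions (if $\mathbf k=\mathbb C$) or formal germs over $\mathbf k$. The equation of $C$ means the irreducible conical hypersurface obtained as the image of the hyperplane $u_0+\dots+u_{n+1}=0$ under $x_i=u_i^2$. **Admissible pairs.** Let $f$ be a function of $x=(x_1,\dots,x_n)$ whose Hessian matrix $H=(\partial_i\partial_j f)$ has $\det H\not\equiv 0$, and $g$ another function. At points $t$ with $\det H(t)\neq0$ put $R_t(u)=f(t+u)-f(t)-\sum_i\partial_if(t)u_i-\frac12\sum_{i,j}H_{ij}(t)u_iu_j$, $\Delta_t=-\frac12\sum_{i,j}(H(t)^{-1})_{ij}\partial_{u_i}\partial_{u_j}$, and $$A_k(t)=\sum_{v=0}^{2k}\frac{1}{v!\,(k+v)!}\,\Delta_t^{\,k+v}\big[g(t+u)R_t(u)^v\big]\Big|_{u=0},\qquad k\ge0$$ (coefficients of the formal stationary phase expansion of $\int g\,e^{(f+x\cdot y)/\hbar}dx$). The pair $(f,g)$ is *admissible* if $\det H\not\equiv0$, $g\not\equiv 0$ and $A_k\equiv0$ for all $k\ge1$. $V_f=\{g: (f,g)\text{ admissible or }g=0\}$ is a vector space; the *rank* of $f$ is $\dim V_f$ and $f$ is admissible if its rank is $>0$. **Cones.**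 A conical hypersurface $C\subset\mathbb A^{n+2}$ whose projectivization has generically immersive Gauss map is, near a generic point (after a linear change of coordinates if needed), given by $x_{n+1}=x_0f(x_1/x_0,\dots,x_n/x_0)$ with Hessian of $f$ not identically zero. $C$ is *admissible* if $f$ is, and the *rank* of $C$ is the rank of $f$ (as a germ at a generic point); this does not depend on the choice of linear coordinates. The dual cone $\hat C\subset(\mathbb A^{n+2})^*$ is the cone over the projectively dual hypersurface. *)

theory Defs
  imports
    "HOL-Analysis.Analysis"
    "HOL-Library.Poly_Mapping"
    "HOL-Computational_Algebra.Fraction_Field"
    "HOL-Computational_Algebra.Fundamental_Theorem_Algebra"
begin

section \<open>Formal power series in several variables\<close>

text \<open>Variables are indexed by \<open>'n\<close>, multi-indices are finitely supported functions
  \<open>'n \<Rightarrow>\<^sub>0 nat\<close>.\<close>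

abbreviation (input) lookup where "lookup \<equiv> Poly_Mapping.lookup"
abbreviation (input) keys where "keys \<equiv> Poly_Mapping.keys"

typedef ('a, 'n) mps = "UNIV :: (('n \<Rightarrow>\<^sub>0 nat) \<Rightarrow> 'a) set"
  morphisms coeff_mps Abs_mps ..

setup_lifting type_definition_mps

lemma mps_eqI: "(\<And>m. coeff_mps f m = coeff_mps g m) \<Longrightarrow> f = g"
  by (metis coeff_mps_inject ext)

instantiation mps :: (ab_group_add, type) ab_group_add
begin
lift_definition zero_mps :: "('a, 'b) mps" is "\<lambda>_. 0" .
lift_definition plus_mps :: "('a, 'b) mps \<Rightarrow> ('a, 'b) mps \<Rightarrow> ('a, 'b) mps" is "\<lambda>f g m. f m + g m" .
lift_definition minus_mps :: "('a, 'b) mps \<Rightarrow> ('a, 'b) mps \<Rightarrow> ('a, 'b) mps" is "\<lambda>f g m. f m - g m" .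
lift_definition uminus_mps :: "('a, 'b) mps \<Rightarrow> ('a, 'b) mps" is "\<lambda>f m. - f m" .
instance
  by standard (transfer; simp add: fun_eq_iff algebra_simps)+
end

lemma finite_le_multi_index: "finite {a :: 'n \<Rightarrow>\<^sub>0 nat. \<forall>i. lookup a i \<le> lookup m i}"
proof -
  let ?S = "{a :: 'n \<Rightarrow>\<^sub>0 nat. \<forall>i. lookup a i \<le> lookup m i}"
  let ?F = "\<lambda>a :: 'n \<Rightarrow>\<^sub>0 nat. restrict (lookup a) (keys m)"
  have "?F ` ?S \<subseteq> (\<Pi>\<^sub>E i\<in>keys m. {..lookup m i})"
    by auto
  then have fin: "finite (?F ` ?S)"
    by (rule finite_subset) (simp add: finite_PiE)
  have "inj_on ?F ?S"
  proof (rule inj_onI, rule poly_mapping_eqI)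
    fix a b :: "'n \<Rightarrow>\<^sub>0 nat" and i
    assume a: "a \<in> ?S" and b: "b \<in> ?S" and eq: "?F a = ?F b"
    show "lookup a i = lookup b i"
    proof (cases "i \<in> keys m")
      case True
      then show ?thesis using fun_cong[OF eq, of i] by simp
    next
      case False
      then have "lookup m i = 0" by (simp add: in_keys_iff)
      then show ?thesis using a b by (metis (mono_tags, lifting) le_zero_eq mem_Collect_eq)
    qed
  qed
  then show ?thesis using fin finite_imageD by blast
qed

lemma finite_splits: "finite {(a, b). a + b = (m :: 'n \<Rightarrow>\<^sub>0 nat)}"
proof (rule finite_subset)
  let ?S = "{a :: 'n \<Rightarrow>\<^sub>0 nat. \<forall>i. lookup a i \<le> lookup m i}"
  show "{(a, b). a + b = m} \<subseteq> ?S \<times> ?S"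
    by (auto simp: lookup_add)
  show "finite (?S \<times> ?S)"
    using finite_le_multi_index by blast
qed

instantiation mps :: (comm_ring_1, type) comm_ring_1
begin

lift_definition one_mps :: "('a, 'b) mps" is "\<lambda>m. if m = 0 then 1 else 0" .

lift_definition times_mps :: "('a, 'b) mps \<Rightarrow> ('a, 'b) mps \<Rightarrow> ('a, 'b) mps"
  is "\<lambda>f g m. \<Sum>(a, b)\<in>{(a, b). a + b = m}. f a * g b" .

instance
proof
  fix f g h :: "('a, 'b) mps"
  show "f * g * h = f * (g * h)"
  proof (rule mps_eqI)
    fix m
    let ?c = coeff_mps
    have "?c (f * g * h) m
        = (\<Sum>(x, c)\<in>{(x, c). x + c = m}. \<Sum>(a, b)\<in>{(a, b). a + b = x}. ?c f a * ?c g b * ?c h c)"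
      by (simp add: times_mps.rep_eq sum_distrib_right case_prod_unfold)
    also have "\<dots> = (\<Sum>((x, c), (a, b))\<in>Sigma {(x, c). x + c = m} (\<lambda>(x, c). {(a, b). a + b = x}).
        ?c f a * ?c g b * ?c h c)"
      by (subst sum.Sigma[symmetric]) (auto simp: finite_splits finite_splits[unfolded case_prod_unfold] case_prod_unfold)
    also have "\<dots> = (\<Sum>((a, y), (b, c))\<in>Sigma {(a, y). a + y = m} (\<lambda>(a, y). {(b, c). b + c = y}).
        ?c f a * ?c g b * ?c h c)"
      by (rule sum.reindex_bij_witness[where i = "\<lambda>((a, y), (b, c)). ((a + b, c), (a, b))"
            and j = "\<lambda>((x, c), (a, b)). ((a, b + c), (b, c))"])
         (auto simp: add.assoc)
    also have "\<dots> = (\<Sum>(a, y)\<in>{(a, y). a + y = m}. \<Sum>(b, c)\<in>{(b, c). b + c = y}.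
        ?c f a * ?c g b * ?c h c)"
      by (subst sum.Sigma[symmetric]) (auto simp: finite_splits finite_splits[unfolded case_prod_unfold] case_prod_unfold)
    also have "\<dots> = ?c (f * (g * h)) m"
      by (simp add: times_mps.rep_eq sum_distrib_left case_prod_unfold mult.assoc)
    finally show "?c (f * g * h) m = ?c (f * (g * h)) m" .
  qed
  show "f * g = g * f"
  proof (rule mps_eqI)
    fix m
    show "coeff_mps (f * g) m = coeff_mps (g * f) m"
      unfolding times_mps.rep_eq
      by (rule sum.reindex_bij_witness[where i = prod.swap and j = prod.swap])
         (auto simp: add.commute mult.commute)
  qed
  show "1 * f = f"
  proof (rule mps_eqI)
    fix m
    have "coeff_mps (1 * f) m = (\<Sum>x\<in>{(a, b). a + b = m}. coeff_mps 1 (fst x) * coeff_mps f (snd x))"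
      by (simp add: times_mps.rep_eq case_prod_unfold)
    also have "\<dots> = (\<Sum>x\<in>{(0, m)}. coeff_mps 1 (fst x) * coeff_mps f (snd x))"
      by (rule sum.mono_neutral_right[OF finite_splits]) (auto simp: one_mps.rep_eq)
    finally show "coeff_mps (1 * f) m = coeff_mps f m" by (simp add: one_mps.rep_eq)
  qed
  show "(f + g) * h = f * h + g * h"
    by (rule mps_eqI)
       (simp add: times_mps.rep_eq plus_mps.rep_eq case_prod_unfold distrib_right sum.distrib)
  show "(0 :: ('a, 'b) mps) \<noteq> 1"
  proof
    assume "(0 :: ('a, 'b) mps) = 1"
    then have "coeff_mps (0 :: ('a, 'b) mps) 0 = coeff_mps 1 0" by simp
    then show False by (simp add: zero_mps.rep_eq one_mps.rep_eq)
  qed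
qed

end

lemma minimal_multi_indices:
  fixes S T :: "('n \<Rightarrow>\<^sub>0 nat) set"
  assumes "finite I" "S \<noteq> {}" "T \<noteq> {}"
  shows "\<exists>a\<in>S. \<exists>b\<in>T. \<forall>a'\<in>S. \<forall>b'\<in>T. a' + b' = a + b \<longrightarrow>
           (\<forall>i\<in>I. lookup a' i = lookup a i \<and> lookup b' i = lookup b i)"
  using assms
proof (induction I arbitrary: S T rule: finite_induct)
  case empty
  then show ?case by auto
next
  case (insert i I)
  define p where "p = (LEAST k. \<exists>a\<in>S. lookup a i = k)"
  define q where "q = (LEAST k. \<exists>b\<in>T. lookup b i = k)"
  have "\<exists>k. \<exists>a\<in>S. lookup a i = k" using insert.prems(1) by blast
  then have p_ex: "\<exists>a\<in>S. lookup a i = p"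
    unfolding p_def by (rule LeastI_ex)
  have "\<exists>k. \<exists>b\<in>T. lookup b i = k" using insert.prems(2) by blast
  then have q_ex: "\<exists>b\<in>T. lookup b i = q"
    unfolding q_def by (rule LeastI_ex)
  have p_le: "p \<le> lookup a i" if "a \<in> S" for a
    unfolding p_def by (rule Least_le) (use that in blast)
  have q_le: "q \<le> lookup b i" if "b \<in> T" for b
    unfolding q_def by (rule Least_le) (use that in blast)
  let ?S = "{a \<in> S. lookup a i = p}" and ?T = "{b \<in> T. lookup b i = q}"
  obtain a b where ab: "a \<in> ?S" "b \<in> ?T" and
    min: "\<forall>a'\<in>?S. \<forall>b'\<in>?T. a' + b' = a + b \<longrightarrow>
           (\<forall>i\<in>I. lookup a' i = lookup a i \<and> lookup b' i = lookup b i)"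
    using insert.IH[of ?S ?T] p_ex q_ex by blast
  have "\<forall>j\<in>insert i I. lookup a' j = lookup a j \<and> lookup b' j = lookup b j"
    if "a' \<in> S" "b' \<in> T" and eq: "a' + b' = a + b" for a' b'
  proof -
    have "lookup a' i + lookup b' i = p + q"
      using arg_cong[OF eq, of "\<lambda>m. lookup m i"] ab by (simp add: lookup_add)
    then have "lookup a' i = p" "lookup b' i = q"
      using p_le[OF that(1)] q_le[OF that(2)] by linarith+
    then have mem: "a' \<in> ?S" "b' \<in> ?T" using that by simp_all
    then have "\<forall>j\<in>I. lookup a' j = lookup a j \<and> lookup b' j = lookup b j"
      using min eq by blast
    with mem show ?thesis using ab by simp
  qed
  moreover have "a \<in> S" "b \<in> T" using ab by simp_all
  ultimately show ?case by meson
qed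

instance mps :: (idom, finite) idom
proof
  fix f g :: "('a, 'b) mps"
  assume "f \<noteq> 0" "g \<noteq> 0"
  let ?S = "{a. coeff_mps f a \<noteq> 0}" and ?T = "{b. coeff_mps g b \<noteq> 0}"
  have "?S \<noteq> {}" "?T \<noteq> {}"
    using \<open>f \<noteq> 0\<close> \<open>g \<noteq> 0\<close> by (auto intro!: mps_eqI simp: zero_mps.rep_eq)
  then obtain a b where ab: "a \<in> ?S" "b \<in> ?T" and
    min: "\<forall>a'\<in>?S. \<forall>b'\<in>?T. a' + b' = a + b \<longrightarrow>
           (\<forall>i\<in>UNIV. lookup a' i = lookup a i \<and> lookup b' i = lookup b i)"
    using minimal_multi_indices[OF finite_class.finite_UNIV, of ?S ?T] by blast
  have uniq: "a' = a \<and> b' = b" if "a' \<in> ?S" "b' \<in> ?T" "a' + b' = a + b" for a' b'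
  proof -
    have "\<forall>i\<in>UNIV. lookup a' i = lookup a i \<and> lookup b' i = lookup b i"
      using min that by blast
    then show ?thesis by (simp add: poly_mapping_eqI)
  qed
  have "coeff_mps (f * g) (a + b)
      = (\<Sum>x\<in>{(a', b'). a' + b' = a + b}. coeff_mps f (fst x) * coeff_mps g (snd x))"
    by (simp add: times_mps.rep_eq case_prod_unfold)
  also have "\<dots> = (\<Sum>x\<in>{(a, b)}. coeff_mps f (fst x) * coeff_mps g (snd x))"
  proof (rule sum.mono_neutral_right[OF finite_splits])
    show "\<forall>x\<in>{(a', b'). a' + b' = a + b} - {(a, b)}. coeff_mps f (fst x) * coeff_mps g (snd x) = 0"
    proof
      fix x
      assume x: "x \<in> {(a', b'). a' + b' = a + b} - {(a, b)}"
      then have "fst x + snd x = a + b" "\<not> (fst x = a \<and> snd x = b)"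
        by (auto simp: prod_eq_iff)
      then have "coeff_mps f (fst x) = 0 \<or> coeff_mps g (snd x) = 0"
        using uniq[of "fst x" "snd x"] by blast
      then show "coeff_mps f (fst x) * coeff_mps g (snd x) = 0" by auto
    qed
  qed simp
  also have "\<dots> \<noteq> 0" using ab by simp
  finally show "f * g \<noteq> 0" by (auto simp: zero_mps.rep_eq)
qed

lift_definition const_mps :: "'a::zero \<Rightarrow> ('a, 'n) mps"
  is "\<lambda>c m. if m = 0 then c else 0" .

lift_definition var_mps :: "'n \<Rightarrow> ('a::{zero,one}, 'n) mps"
  is "\<lambda>i m. if m = Poly_Mapping.single i 1 then 1 else 0" .

lift_definition map_mps :: "('a \<Rightarrow> 'b) \<Rightarrow> ('a, 'n) mps \<Rightarrow> ('b, 'n) mps"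
  is "\<lambda>h f m. h (f m)" .

lift_definition scale_mps :: "'a::times \<Rightarrow> ('a, 'n) mps \<Rightarrow> ('a, 'n) mps"
  is "\<lambda>c f m. c * f m" .

lift_definition pderiv_mps :: "'n \<Rightarrow> ('a::semiring_1, 'n) mps \<Rightarrow> ('a, 'n) mps"
  is "\<lambda>i f m. of_nat (Suc (lookup m i)) * f (m + Poly_Mapping.single i 1)" .

abbreviation eval0_mps :: "('a, 'n) mps \<Rightarrow> 'a"
  where "eval0_mps f \<equiv> coeff_mps f 0"

text \<open>The expansion of \<open>f (t + u)\<close> as a power series in \<open>u\<close> whose coefficients are
  power series in \<open>t\<close>: the coefficient of \<open>u\<^sup>m t\<^sup>a\<close> is
  \<open>(\<Prod>i. (a\<^sub>i + m\<^sub>i) choose m\<^sub>i) f\<^sub>a\<^sub>+\<^sub>m\<close>.\<close>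

definition shift_mps :: "('a::comm_ring_1, 'n::finite) mps \<Rightarrow> (('a, 'n) mps, 'n) mps" where
  "shift_mps f = Abs_mps (\<lambda>m. Abs_mps (\<lambda>a.
     of_nat (\<Prod>i\<in>UNIV. (lookup a i + lookup m i) choose lookup m i) * coeff_mps f (a + m)))"

interpretation mps: vector_space "scale_mps :: 'a::field \<Rightarrow> ('a, 'n) mps \<Rightarrow> ('a, 'n) mps"
  by standard (transfer; simp add: algebra_simps)+

section \<open>Admissible pairs of germs\<close>

definition hessian :: "('a::comm_ring_1, 'n::finite) mps \<Rightarrow> ('a, 'n) mps ^ 'n ^ 'n" where
  "hessian f = (\<chi> i j. pderiv_mps i (pderiv_mps j f))"

text \<open>For germs \<open>f, g\<close> the point \<open>t\<close> is taken to be the generic point of the formal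
  neighbourhood: all quantities depending on \<open>t\<close> live in the fraction field of the ring of power
  series in \<open>t\<close>, in which the Hessian matrix is invertible as soon as its determinant is not
  identically zero.\<close>

type_synonym ('a, 'n) merom = "('a, 'n) mps fract"

abbreviation to_merom :: "('a::idom, 'n::finite) mps \<Rightarrow> ('a, 'n) merom"
  where "to_merom \<equiv> \<lambda>h. Fract h 1"

definition at_shift :: "('a::field, 'n::finite) mps \<Rightarrow> (('a, 'n) merom, 'n) mps" where
  "at_shift f = map_mps to_merom (shift_mps f)"

definition hessian_at :: "('a::field, 'n::finite) mps \<Rightarrow> ('a, 'n) merom ^ 'n ^ 'n" where
  "hessian_at f = (\<chi> i j. to_merom (hessian f $ i $ j))"

definition taylor_rest :: "('a::field, 'n::finite) mps \<Rightarrow> (('a, 'n) merom, 'n) mps" where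
  "taylor_rest f = at_shift f - const_mps (to_merom f)
     - (\<Sum>i\<in>UNIV. const_mps (to_merom (pderiv_mps i f)) * var_mps i)
     - const_mps (1 / 2) * (\<Sum>i\<in>UNIV. \<Sum>j\<in>UNIV.
         const_mps (hessian_at f $ i $ j) * var_mps i * var_mps j)"

definition phase_laplacian ::
  "('a::field, 'n::finite) mps \<Rightarrow> (('a, 'n) merom, 'n) mps \<Rightarrow> (('a, 'n) merom, 'n) mps" where
  "phase_laplacian f h = const_mps (- 1 / 2) * (\<Sum>i\<in>UNIV. \<Sum>j\<in>UNIV.
     const_mps (matrix_inv (hessian_at f) $ i $ j) * pderiv_mps i (pderiv_mps j h))"

definition stationary_phase_coeff ::
  "('a::field, 'n::finite) mps \<Rightarrow> ('a, 'n) mps \<Rightarrow> nat \<Rightarrow> ('a, 'n) merom" where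
  "stationary_phase_coeff f g k = (\<Sum>v\<le>2 * k.
     1 / of_nat (fact v * fact (k + v)) *
     eval0_mps ((phase_laplacian f ^^ (k + v)) (at_shift g * taylor_rest f ^ v)))"

definition admissible_pair :: "('a::field, 'n::finite) mps \<Rightarrow> ('a, 'n) mps \<Rightarrow> bool" where
  "admissible_pair f g \<longleftrightarrow>
     det (hessian f) \<noteq> 0 \<and> g \<noteq> 0 \<and> (\<forall>k\<ge>1. stationary_phase_coeff f g k = 0)"

text \<open>The class \<open>\<G>\<close> of admitted germs is a parameter; it is instantiated with the formal and
  with the analytic germs.\<close>

definition formal_germs :: "('a, 'n) mps set" where
  "formal_germs = UNIV"

definition analytic_germs :: "(complex, 'n::finite) mps set" where
  "analytic_germs = {f. \<exists>r>0.
     (\<lambda>m. norm (coeff_mps f m) * r ^ (\<Sum>i\<in>UNIV. lookup m i)) summable_on UNIV}"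

definition amplitudes ::
  "('a::field, 'n::finite) mps set \<Rightarrow> ('a, 'n) mps \<Rightarrow> ('a, 'n) mps set" where
  "amplitudes \<G> f = {g \<in> \<G>. admissible_pair f g \<or> g = 0}"

text \<open>The case distinction is needed because \<open>mps.dim\<close> is \<open>0\<close> on infinite-dimensional spaces.\<close>

definition germ_rank :: "('a::field, 'n::finite) mps set \<Rightarrow> ('a, 'n) mps \<Rightarrow> enat" where
  "germ_rank \<G> f =
     (if \<exists>B. finite B \<and> mps.span B = amplitudes \<G> f then enat (mps.dim (amplitudes \<G> f)) else \<infinity>)"

definition germ_admissible :: "('a::field, 'n::finite) mps set \<Rightarrow> ('a, 'n) mps \<Rightarrow> bool" where
  "germ_admissible \<G> f \<longleftrightarrow> germ_rank \<G> f > 0"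

section \<open>Affine space of dimension \<open>n + 2\<close>\<close>

text \<open>Index set of the coordinates \<open>x\<^sub>0, x\<^sub>1, \<dots>, x\<^sub>n, x\<^sub>n\<^sub>+\<^sub>1\<close>, where \<open>n = CARD('n)\<close>.\<close>

datatype 'n cone_index = First | Mid 'n | Last

lemma UNIV_cone_index: "UNIV = insert First (insert Last (range Mid))"
  using cone_index.exhaust by auto

instance cone_index :: (finite) finite
  by standard (simp add: UNIV_cone_index)

type_synonym ('a, 'v) mpoly = "('v \<Rightarrow>\<^sub>0 nat) \<Rightarrow>\<^sub>0 'a"

text \<open>Evaluation of a polynomial in an algebra with structure map \<open>\<phi>\<close>.\<close>

definition eval_mpoly ::
  "('a::zero \<Rightarrow> 'b::comm_semiring_1) \<Rightarrow> ('a, 'v::finite) mpoly \<Rightarrow> ('v \<Rightarrow> 'b) \<Rightarrow> 'b" where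
  "eval_mpoly \<phi> F x = (\<Sum>m\<in>keys F. \<phi> (lookup F m) * (\<Prod>i\<in>UNIV. x i ^ lookup m i))"

abbreviation eval_at :: "('a::comm_semiring_1, 'v::finite) mpoly \<Rightarrow> 'a ^ 'v \<Rightarrow> 'a" where
  "eval_at F x \<equiv> eval_mpoly id F (($) x)"

definition mpoly_pderiv_at :: "'v \<Rightarrow> ('a::comm_semiring_1, 'v::finite) mpoly \<Rightarrow> 'a ^ 'v \<Rightarrow> 'a" where
  "mpoly_pderiv_at i F x = (\<Sum>m\<in>keys F. lookup F m * of_nat (lookup m i) *
     (\<Prod>j\<in>UNIV. (x $ j) ^ (if j = i then lookup m j - 1 else lookup m j)))"

definition vanishing_ideal :: "('a::field ^ 'v::finite) set \<Rightarrow> ('a, 'v) mpoly set" where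
  "vanishing_ideal S = {F. \<forall>x\<in>S. eval_at F x = 0}"

definition zariski_closure :: "('a::field ^ 'v::finite) set \<Rightarrow> ('a ^ 'v) set" where
  "zariski_closure S = {x. \<forall>F\<in>vanishing_ideal S. eval_at F x = 0}"

text \<open>\<open>P\<close> holds on a Zariski-dense, Zariski-open subset of the nonempty set \<open>C\<close>.\<close>

definition generically_on :: "('a::field ^ 'v::finite) set \<Rightarrow> ('a ^ 'v \<Rightarrow> bool) \<Rightarrow> bool" where
  "generically_on C P \<longleftrightarrow> C \<noteq> {} \<and>
     (\<exists>Z. zariski_closure Z = Z \<and> C \<subseteq> zariski_closure (C - Z) \<and> (\<forall>p\<in>C - Z. P p))"

definition zariski_tangent_space ::
  "('a::field ^ 'v::finite) set \<Rightarrow> 'a ^ 'v \<Rightarrow> ('a ^ 'v) set" where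
  "zariski_tangent_space C p =
     {w. \<forall>F\<in>vanishing_ideal C. (\<Sum>i\<in>UNIV. mpoly_pderiv_at i F p * w $ i) = 0}"

text \<open>For a hypersurface the tangent space at a singular point is the whole space, at a smooth
  point it is a hyperplane.\<close>

definition smooth_point :: "('a::field ^ 'v::finite) set \<Rightarrow> 'a ^ 'v \<Rightarrow> bool" where
  "smooth_point C p \<longleftrightarrow> p \<in> C \<and> zariski_tangent_space C p \<noteq> UNIV"

text \<open>The cone over the projectively dual hypersurface: closure of the set of all linear forms
  vanishing on some tangent hyperplane. The dual space is identified with the coordinate space by
  means of the dual basis.\<close>

definition dual_cone :: "('a::field ^ 'v::finite) set \<Rightarrow> ('a ^ 'v) set" where
  "dual_cone C = zariski_closure
     {y. \<exists>p. smooth_point C p \<and> (\<forall>w\<in>zariski_tangent_space C p. (\<Sum>i\<in>UNIV. y $ i * w $ i) = 0)}"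

section \<open>Rank of a conical hypersurface\<close>

text \<open>The formal point \<open>(1, a + u, f (u))\<close> of the graph of \<open>f\<close>, where \<open>f\<close> is a germ at \<open>a\<close>
  written as a power series in \<open>u\<close>.\<close>

fun graph_point :: "('n \<Rightarrow> 'a) \<Rightarrow> ('a::comm_ring_1, 'n) mps \<Rightarrow> 'n cone_index \<Rightarrow> ('a, 'n) mps" where
  "graph_point a f First = 1"
| "graph_point a f (Mid i) = const_mps (a i) + var_mps i"
| "graph_point a f Last = f"

text \<open>In the linear coordinates \<open>z\<close> with \<open>x = N *v z\<close>, the cone \<open>C\<close> is given near its smooth
  point \<open>p\<close> by \<open>z\<^sub>n\<^sub>+\<^sub>1 = z\<^sub>0 f (z\<^sub>1/z\<^sub>0, \<dots>, z\<^sub>n/z\<^sub>0)\<close>, \<open>f\<close> being a germ at the image of \<open>p\<close> with Hessian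
  not identically zero. At a smooth point of a hypersurface it suffices that the graph lies in
  \<open>C\<close>: both have the same dimension and \<open>C\<close> is locally irreducible.\<close>

definition graph_germ ::
  "('a::field ^ 'n::finite cone_index) set \<Rightarrow> 'a ^ 'n cone_index ^ 'n cone_index \<Rightarrow>
   'a ^ 'n cone_index \<Rightarrow> ('a, 'n) mps \<Rightarrow> bool" where
  "graph_germ C N p f \<longleftrightarrow> invertible N \<and> smooth_point C p \<and>
     (\<exists>z. p = N *v z \<and> z $ First \<noteq> 0 \<and> eval0_mps f = z $ Last / z $ First \<and>
       (\<forall>F\<in>vanishing_ideal C. eval_mpoly const_mps F (\<lambda>i. \<Sum>j\<in>UNIV. const_mps (N $ i $ j) *
          graph_point (\<lambda>l. z $ Mid l / z $ First) f j) = 0)) \<and>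
     det (hessian f) \<noteq> 0"

text \<open>\<open>P\<close> holds for the germ of the function \<open>f\<close> describing \<open>C\<close> near a generic point, in every
  linear coordinate system in which there is such an \<open>f\<close> (and there is at least one).\<close>

definition generic_germ ::
  "('a::field, 'n::finite) mps set \<Rightarrow> ('a ^ 'n cone_index) set \<Rightarrow> (('a, 'n) mps \<Rightarrow> bool) \<Rightarrow> bool"
  where
  "generic_germ \<G> C P \<longleftrightarrow> generically_on C (\<lambda>p.
     (\<exists>N. \<exists>f\<in>\<G>. graph_germ C N p f) \<and> (\<forall>N. \<forall>f\<in>\<G>. graph_germ C N p f \<longrightarrow> P f))"

definition cone_admissible ::
  "('a::field, 'n::finite) mps set \<Rightarrow> ('a ^ 'n cone_index) set \<Rightarrow> bool" where
  "cone_admissible \<G> C \<longleftrightarrow> generic_germ \<G> C (germ_admissible \<G>)"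

definition cone_has_rank ::
  "('a::field, 'n::finite) mps set \<Rightarrow> ('a ^ 'n cone_index) set \<Rightarrow> nat \<Rightarrow> bool" where
  "cone_has_rank \<G> C r \<longleftrightarrow> generic_germ \<G> C (\<lambda>f. germ_rank \<G> f = enat r)"

text \<open>The cone \<open>x\<^sub>0\<^sup>1\<^sup>/\<^sup>2 + \<dots> + x\<^sub>n\<^sub>+\<^sub>1\<^sup>1\<^sup>/\<^sup>2 = 0\<close>.\<close>

definition sqrt_cone :: "('a::field ^ 'n::finite cone_index) set" where
  "sqrt_cone = {x. \<exists>u :: 'a ^ 'n cone_index. (\<Sum>i\<in>UNIV. u $ i) = 0 \<and> (\<forall>i. x $ i = (u $ i)\<^sup>2)}"

end

(* Near the point x_l = u_l^2 of the cone, sum u = 0, the conormal direction is 1/u. With r = u_0 and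
   w = u/u_0 the phase f(t+u) - f(t) - df(t) u is therefore kappa * sum_l w_l(t)^{-1} (r^2 w_l^2)(t+u):
   in the coordinates w it is a quadratic form times r^2. Moreover 1/r^2 is a quadratic form Q in w.
   Write an amplitude as g = W r^(n+2) P, where W is the Jacobian determinant of w, and extend P
   homogeneously. Integration by parts computes the coefficients A_k recursively: A_k = 0 for all
   k >= 1 if and only if N_k (Q^(k-1) P) = 0 for all k >= 1, where N_k is the normally ordered k-th
   power of sum_i u_i d_i^2. Commutators of these operators generate the operators
   L_k = sum_i u_i d_i^k, and the condition implies L_k P = 0 for all k >= 2.

   On the jet of P at a point, these equations define the dual of the quotient of a polynomial ring by
   weighted power sums sum_i c_i xi_i^k (k >= 1) all of whose subsums of weights are nonzero; its
   dimension is at most (n+1)!. Conversely each ordering x_0, ..., x_n of the coordinates gives the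
   solution P = (u_0 + ... + u_n) * prod_j u_{x_j} / (u_{x_j} + ... + u_{x_n}), and these (n+1)!
   solutions are linearly independent.

   The dual cone sum_l 1/y_l = 0 leads to the same kind of phase after a Legendre transformation. The
   stationary phase transforms of a function and of its Legendre transform are mutually inverse:
   their composition commutes with multiplication by the new coordinates, so it is multiplication by
   a function, which is 1 by homogeneity. Hence the spaces of amplitudes correspond, up to the factor
   sqrt (det H). *)
theory Submission
  imports
    Defs
    "HOL-Library.Multiset"
    "HOL-Computational_Algebra.Formal_Power_Series"
begin

section \<open>Calculus of formal power series\<close>

text \<open>Admissibility is defined over a fraction field, but at the chosen base points the
  Hessian determinant is a unit. So the computation runs over power series and meets the definition
  in \<open>stationary_phase_coeff_eq\<close>.

  With L_k for \<open>NO [k]\<close> one has [L_j, L_k] = (j - k) L_(j+k-1), up to sign the bracket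
  of the vector fields x^k d/dx. Thus L_2 climbs from L_3 to all higher operators, but [L_2, L_2] =
  0 does not reach L_3. This one comes from L_2^2 = N_2 + 2 L_3, and A_2 controls N_2. The powers of
  Q can be moved past the operators because Q is a combination of the squares u_i^2, including that
  of u_(n+1) = -(u_0 + ... + u_n).

  The upper bound is local: the leading part of a jet sees the coordinates u_i only through their
  values at the base point, and these are the weights c_i. Nonvanishing of the subset sums of u
  serves both these weights and the denominators of the solutions. To make it an open condition on x
  = u^2, \<open>generic_vec\<close> includes all choices of signs.\<close>

abbreviation mdeg :: "('n::finite \<Rightarrow>\<^sub>0 nat) \<Rightarrow> nat" where
  "mdeg m \<equiv> (\<Sum>i\<in>UNIV. lookup m i)"

lemma mdeg_add: "mdeg (a + b) = mdeg a + mdeg b"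
  by (simp add: lookup_add sum.distrib)

lemma mdeg_single [simp]: "mdeg (Poly_Mapping.single i k) = k"
  by (simp add: lookup_single when_def)

lemma mdeg_eq_0_iff: "mdeg m = 0 \<longleftrightarrow> m = 0"
  by (auto intro: poly_mapping_eqI)

lemma multi_index_cases:
  fixes m :: "'n::finite \<Rightarrow>\<^sub>0 nat"
  obtains "m = 0" | a i where "m = a + Poly_Mapping.single i 1"
proof (cases "m = 0")
  case False
  then obtain i where "lookup m i \<noteq> 0"
    by (metis lookup_zero poly_mapping_eqI)
  then have "m = (m - Poly_Mapping.single i 1) + Poly_Mapping.single i 1"
    by (intro poly_mapping_eqI) (auto simp: lookup_add lookup_minus lookup_single when_def)
  then show ?thesis using that(2) by blast
qed blast

lemma multi_index_induct [case_names zero step]: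
  fixes m :: "'n::finite \<Rightarrow>\<^sub>0 nat"
  assumes "P 0" "\<And>a i. P a \<Longrightarrow> P (a + Poly_Mapping.single i 1)"
  shows "P m"
proof (induction "mdeg m" arbitrary: m)
  case 0
  then show ?case using assms(1) mdeg_eq_0_iff by metis
next
  case (Suc d)
  show ?case
  proof (cases m rule: multi_index_cases)
    case 1
    then show ?thesis using assms(1) by simp
  next
    case (2 a i)
    then have "mdeg a = d" using Suc.hyps(2) by (simp add: mdeg_add del: One_nat_def)
    then show ?thesis using Suc.hyps(1) assms(2) 2 by blast
  qed
qed

lemma coeff_mps_zero [simp]: "coeff_mps 0 m = 0"
  and coeff_mps_add [simp]: "coeff_mps (f + g) m = coeff_mps f m + coeff_mps g m"
  and coeff_mps_diff [simp]: "coeff_mps (f - g) m = coeff_mps f m - coeff_mps g m"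
  and coeff_mps_uminus [simp]: "coeff_mps (- f) m = - coeff_mps f m"
  by (simp_all add: zero_mps.rep_eq plus_mps.rep_eq minus_mps.rep_eq uminus_mps.rep_eq)

lemma coeff_mps_sum [simp]: "coeff_mps (sum f A) m = (\<Sum>x\<in>A. coeff_mps (f x) m)"
  by (induction A rule: infinite_finite_induct) auto

lemma coeff_mps_mult:
  "coeff_mps (f * g) m = (\<Sum>(a, b)\<in>{(a, b). a + b = m}. coeff_mps f a * coeff_mps g b)"
  by (simp add: times_mps.rep_eq)

lemma coeff_mps_one: "coeff_mps 1 m = (if m = 0 then 1 else 0)"
  by (simp add: one_mps.rep_eq)

lemma coeff_const_mps: "coeff_mps (const_mps c) m = (if m = 0 then c else 0)"
  by (simp add: const_mps.rep_eq)

lemma coeff_const_mult [simp]: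
  fixes c :: "'a::comm_ring_1" and f :: "('a, 'n) mps"
  shows "coeff_mps (const_mps c * f) m = c * coeff_mps f m"
proof -
  have "coeff_mps (const_mps c * f) m
      = (\<Sum>x\<in>{(a, b). a + b = m}. coeff_mps (const_mps c) (fst x) * coeff_mps f (snd x))"
    by (simp add: coeff_mps_mult case_prod_unfold)
  also have "\<dots> = (\<Sum>x\<in>{(0 :: 'n \<Rightarrow>\<^sub>0 nat, m)}. coeff_mps (const_mps c) (fst x) * coeff_mps f (snd x))"
    by (rule sum.mono_neutral_right[OF finite_splits]) (auto simp: coeff_const_mps)
  finally show ?thesis by (simp add: coeff_const_mps)
qed

lemma const_mps_0 [simp]: "const_mps 0 = 0"
  and const_mps_1 [simp]: "const_mps 1 = 1"
  and const_mps_add: "const_mps (c + d) = const_mps c + const_mps d"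
  and const_mps_diff: "const_mps (c - d) = const_mps c - const_mps d"
  and const_mps_uminus: "const_mps (- c) = - const_mps c"
  and const_mps_mult: "const_mps (c * d) = const_mps c * const_mps d"
  for c d :: "'a::comm_ring_1"
  by (rule mps_eqI, simp add: coeff_const_mps coeff_mps_one)+

lemma const_mps_sum: "const_mps (\<Sum>x\<in>A. f x) = (\<Sum>x\<in>A. const_mps (f x :: 'a::comm_ring_1))"
  by (induction A rule: infinite_finite_induct) (auto simp: const_mps_add)

lemma const_mps_power: "const_mps (c ^ k) = const_mps (c :: 'a::comm_ring_1) ^ k"
  by (induction k) (auto simp: const_mps_mult)

lemma const_mps_of_nat: "const_mps (of_nat k) = (of_nat k :: ('a::comm_ring_1, 'n) mps)"
  by (induction k) (auto simp: const_mps_add)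

lemma const_mps_inverse_of_nat:
  "n > 0 \<Longrightarrow> of_nat n * const_mps (1 / of_nat n :: 'a::field_char_0) = 1"
  unfolding const_mps_of_nat[symmetric] const_mps_mult[symmetric] by simp

lemma scale_mps_eq: "scale_mps c f = const_mps (c :: 'a::comm_ring_1) * f"
  by (rule mps_eqI) (simp add: scale_mps.rep_eq)

lemma splits_zero: "{(a, b). a + b = (0 :: 'n \<Rightarrow>\<^sub>0 nat)} = {(0, 0)}"
proof -
  have "a = 0 \<and> b = 0" if "a + b = 0" for a b :: "'n \<Rightarrow>\<^sub>0 nat"
  proof -
    have "lookup a i + lookup b i = 0" for i
      using arg_cong[OF that, of "\<lambda>m. lookup m i"] by (simp add: lookup_add)
    then show ?thesis by (intro conjI poly_mapping_eqI) simp_all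
  qed
  then have "a + b = 0 \<longleftrightarrow> a = 0 \<and> b = 0" for a b :: "'n \<Rightarrow>\<^sub>0 nat"
    by (metis add_0)
  then show ?thesis by simp
qed

lemma eval0_mult [simp]: "eval0_mps (f * g) = eval0_mps f * eval0_mps (g :: ('a::comm_ring_1, 'n) mps)"
  by (simp add: coeff_mps_mult splits_zero)

lemma eval0_one [simp]: "eval0_mps (1 :: ('a::comm_ring_1, 'n) mps) = 1"
  by (simp add: coeff_mps_one)

lemma eval0_const [simp]: "eval0_mps (const_mps c) = c"
  by (simp add: coeff_const_mps)

lemma eval0_power [simp]: "eval0_mps (f ^ k) = eval0_mps (f :: ('a::comm_ring_1, 'n) mps) ^ k"
  by (induction k) auto

lemma eval0_of_nat [simp]: "eval0_mps (of_nat k :: ('a::comm_ring_1, 'n) mps) = of_nat k"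
  by (induction k) auto

lemma eval0_var [simp]: "eval0_mps (var_mps i) = (0 :: 'a::zero_neq_one)"
proof -
  have "(0 :: 'b \<Rightarrow>\<^sub>0 nat) \<noteq> Poly_Mapping.single i 1"
    by (metis lookup_single_eq lookup_zero zero_neq_one)
  then show ?thesis by (simp add: var_mps.rep_eq)
qed

lemma coeff_pderiv_mps:
  "coeff_mps (pderiv_mps i f) m
     = of_nat (Suc (lookup m i)) * coeff_mps f (m + Poly_Mapping.single i 1)"
  by (simp add: pderiv_mps.rep_eq)

lemma pderiv_mps_add [simp]: "pderiv_mps i (f + g) = pderiv_mps i f + pderiv_mps i g"
  and pderiv_mps_0 [simp]: "pderiv_mps i (0 :: ('a, 'n) mps) = 0"
  and pderiv_mps_diff [simp]: "pderiv_mps i (f - g) = pderiv_mps i f - pderiv_mps i g"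
  and pderiv_mps_uminus [simp]: "pderiv_mps i (- f) = - pderiv_mps i f"
  for f g :: "('a::comm_ring_1, 'n) mps"
  by (rule mps_eqI, simp add: coeff_pderiv_mps algebra_simps)+

lemma pderiv_mps_sum [simp]:
  "pderiv_mps i (sum f A) = (\<Sum>x\<in>A. pderiv_mps i (f x :: ('a::comm_ring_1, 'n) mps))"
  by (induction A rule: infinite_finite_induct) auto

lemma pderiv_mps_commute:
  "pderiv_mps i (pderiv_mps j f) = pderiv_mps j (pderiv_mps i (f :: ('a::comm_ring_1, 'n) mps))"
  by (rule mps_eqI) (auto simp: coeff_pderiv_mps lookup_add lookup_single when_def algebra_simps)

lemma single_one_ne_0 [simp]: "m + Poly_Mapping.single i (Suc 0) \<noteq> 0"
  by (metis Zero_not_Suc add_is_0 lookup_add lookup_single_eq lookup_zero)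

lemma pderiv_const_mps [simp]: "pderiv_mps i (const_mps (c :: 'a::comm_ring_1)) = 0"
  by (rule mps_eqI) (simp add: coeff_pderiv_mps coeff_const_mps)

lemma pderiv_mps_one [simp]: "pderiv_mps i (1 :: ('a::comm_ring_1, 'n) mps) = 0"
  using pderiv_const_mps[of i 1] by simp

lemma pderiv_mps_of_nat [simp]: "pderiv_mps i (of_nat k :: ('a::comm_ring_1, 'n) mps) = 0"
  by (metis const_mps_of_nat pderiv_const_mps)

lemma pderiv_mps_numeral [simp]: "pderiv_mps i (numeral k :: ('a::comm_ring_1, 'n) mps) = 0"
  by (metis of_nat_numeral pderiv_mps_of_nat)

lemma pderiv_var_mps: "pderiv_mps i (var_mps j :: ('a::comm_ring_1, 'n) mps) = (if i = j then 1 else 0)"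
proof (rule mps_eqI)
  fix m :: "'n \<Rightarrow>\<^sub>0 nat"
  have "m + Poly_Mapping.single i 1 = Poly_Mapping.single j 1 \<longleftrightarrow> m = 0 \<and> i = j"
  proof
    assume eq: "m + Poly_Mapping.single i 1 = Poly_Mapping.single j 1"
    then have "lookup m i + 1 = (if j = i then 1 else 0)"
      by (metis lookup_add lookup_single_eq lookup_single_not_eq)
    then have "i = j" by (auto split: if_splits)
    with eq show "m = 0 \<and> i = j" by simp
  qed auto
  then show "coeff_mps (pderiv_mps i (var_mps j :: ('a, 'n) mps)) m = coeff_mps (if i = j then 1 else 0) m"
    by (auto simp: coeff_pderiv_mps var_mps.rep_eq coeff_mps_one)
qed

lemma pderiv_mps_mult:
  fixes f g :: "('a::comm_ring_1, 'n) mps"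
  shows "pderiv_mps i (f * g) = pderiv_mps i f * g + f * pderiv_mps i g"
proof (rule mps_eqI)
  fix m :: "'n \<Rightarrow>\<^sub>0 nat"
  let ?e = "Poly_Mapping.single i (1::nat)" and ?S = "{(a, b). a + b = m + Poly_Mapping.single i 1}"
  have minus: "a - ?e + ?e = a" if "lookup a i > 0" for a :: "'n \<Rightarrow>\<^sub>0 nat"
    using that by (intro poly_mapping_eqI) (auto simp: lookup_add lookup_minus lookup_single when_def)
  have split: "(\<Sum>(a, b)\<in>?S. of_nat (lookup a i) * (F a * G b))
      = (\<Sum>(a, b)\<in>{(a, b). a + b = m}. of_nat (Suc (lookup a i)) * F (a + ?e) * G b)"
    for F G :: "('n \<Rightarrow>\<^sub>0 nat) \<Rightarrow> 'a"
  proof -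
    have "(\<Sum>(a, b)\<in>?S. of_nat (lookup a i) * (F a * G b))
        = (\<Sum>(a, b)\<in>{(a, b). a + b = m + ?e \<and> lookup a i > 0}. of_nat (lookup a i) * (F a * G b))"
      by (rule sum.mono_neutral_right[OF finite_splits]) (auto intro!: Nat.gr0I)
    also have "\<dots> = (\<Sum>(a, b)\<in>{(a, b). a + b = m}. of_nat (Suc (lookup a i)) * F (a + ?e) * G b)"
    proof (rule sum.reindex_bij_witness[where i = "\<lambda>(a, b). (a + ?e, b)" and j = "\<lambda>(a, b). (a - ?e, b)"],
           goal_cases)
      case (2 x)
      then obtain a b where x: "x = (a, b)" "a + b = m + ?e" "lookup a i > 0" by auto
      have "a - ?e + b + ?e = m + ?e" using x minus[of a] by (metis add.assoc add.commute)
      then show ?case using x(1) by simp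
    next
      case (1 x)
      then show ?case using minus by auto
    next
      case (5 x)
      then obtain a b where x: "x = (a, b)" "lookup a i > 0" by auto
      have "Suc (lookup (a - ?e) i) = lookup a i" using x by (simp add: lookup_minus)
      then show ?case using x minus[of a] by (simp add: mult.assoc del: of_nat_Suc)
    qed (auto simp: algebra_simps lookup_add)
    finally show ?thesis .
  qed
  have swap: "(\<Sum>(a, b)\<in>{(a, b). a + b = m'}. T a b) = (\<Sum>(a, b)\<in>{(a, b). a + b = m'}. T b a)"
    for T :: "('n \<Rightarrow>\<^sub>0 nat) \<Rightarrow> ('n \<Rightarrow>\<^sub>0 nat) \<Rightarrow> 'a" and m'
    by (rule sum.reindex_bij_witness[where i = prod.swap and j = prod.swap]) (auto simp: add.commute)
  have "coeff_mps (pderiv_mps i (f * g)) m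
      = (\<Sum>(a, b)\<in>?S. of_nat (lookup (m + ?e) i) * (coeff_mps f a * coeff_mps g b))"
    by (simp add: coeff_pderiv_mps coeff_mps_mult sum_distrib_left case_prod_unfold lookup_add)
  also have "\<dots> = (\<Sum>(a, b)\<in>?S. of_nat (lookup a i) * (coeff_mps f a * coeff_mps g b)
                      + of_nat (lookup b i) * (coeff_mps g b * coeff_mps f a))"
  proof (rule sum.cong[OF refl], clarify)
    fix a b assume "a + b = m + ?e"
    then have "lookup (m + ?e) i = lookup a i + lookup b i" by (metis lookup_add)
    then show "of_nat (lookup (m + ?e) i) * (coeff_mps f a * coeff_mps g b)
      = of_nat (lookup a i) * (coeff_mps f a * coeff_mps g b)
        + of_nat (lookup b i) * (coeff_mps g b * coeff_mps f a)"
      by (simp add: algebra_simps)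
  qed
  also have "\<dots> = (\<Sum>(a, b)\<in>?S. of_nat (lookup a i) * (coeff_mps f a * coeff_mps g b))
                + (\<Sum>(a, b)\<in>?S. of_nat (lookup a i) * (coeff_mps g a * coeff_mps f b))"
    using swap[where m' = "m + ?e" and T = "\<lambda>a b. of_nat (lookup b i) * (coeff_mps g b * coeff_mps f a)"]
    by (simp add: case_prod_unfold sum.distrib)
  also have "\<dots> = coeff_mps (pderiv_mps i f * g + f * pderiv_mps i g) m"
    unfolding split coeff_mps_add coeff_mps_mult
    using swap[where m' = m and T = "\<lambda>a b. of_nat (Suc (lookup a i)) * coeff_mps g (a + ?e) * coeff_mps f b"]
    by (simp add: coeff_pderiv_mps case_prod_unfold mult_ac)
  finally show "coeff_mps (pderiv_mps i (f * g)) m = coeff_mps (pderiv_mps i f * g + f * pderiv_mps i g) m" .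
qed

lemma pderiv_const_mult [simp]:
  "pderiv_mps i (const_mps c * f) = const_mps c * pderiv_mps i (f :: ('a::comm_ring_1, 'n) mps)"
  by (simp add: pderiv_mps_mult)

instance mps :: ("{comm_ring_1, ring_char_0}", type) ring_char_0
proof
  show "inj (of_nat :: nat \<Rightarrow> ('a, 'b) mps)"
    by (rule injI) (metis eval0_of_nat of_nat_eq_iff)
qed

text \<open>In characteristic 0 every coefficient is, up to a nonzero integer, the value at the
  origin of an iterated derivative. Working with a whole set \<open>P\<close> allows identities to
  be proved by differentiation alone, the Leibniz terms being collected in \<open>P\<close>.\<close>

lemma mps_zero_principle:
  fixes P :: "('a::{idom, ring_char_0}, 'n::finite) mps set"
  assumes "X \<in> P" "\<And>X. X \<in> P \<Longrightarrow> eval0_mps X = 0" "\<And>X i. X \<in> P \<Longrightarrow> pderiv_mps i X \<in> P"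
  shows "X = 0"
proof (rule mps_eqI)
  fix m
  have "\<forall>X\<in>P. coeff_mps X m = 0"
  proof (induction m rule: multi_index_induct)
    case zero
    then show ?case using assms(2) by blast
  next
    case (step a i)
    show ?case
    proof
      fix X assume "X \<in> P"
      then have "coeff_mps (pderiv_mps i X) a = 0" using assms(3) step by blast
      then show "coeff_mps X (a + Poly_Mapping.single i 1) = 0"
        unfolding coeff_pderiv_mps by (simp del: of_nat_Suc)
    qed
  qed
  then show "coeff_mps X m = coeff_mps 0 m" using assms(1) by simp
qed

subsection \<open>Vanishing order\<close>

definition vanishes_to :: "nat \<Rightarrow> ('a::comm_ring_1, 'n::finite) mps \<Rightarrow> bool" where
  "vanishes_to d X \<longleftrightarrow> (\<forall>m. mdeg m < d \<longrightarrow> coeff_mps X m = 0)"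

lemma vanishes_to_0 [simp]: "vanishes_to 0 X"
  by (simp add: vanishes_to_def)

lemma vanishes_to_mono: "vanishes_to d X \<Longrightarrow> e \<le> d \<Longrightarrow> vanishes_to e X"
  by (auto simp: vanishes_to_def)

lemma vanishes_to_all_imp_0: "(\<And>d. vanishes_to d X) \<Longrightarrow> X = 0"
  by (rule mps_eqI) (metis coeff_mps_zero lessI vanishes_to_def)

lemma vanishes_to_add: "vanishes_to d X \<Longrightarrow> vanishes_to d Y \<Longrightarrow> vanishes_to d (X + Y)"
  by (simp add: vanishes_to_def)

lemma vanishes_to_sum: "(\<And>x. x \<in> A \<Longrightarrow> vanishes_to d (f x)) \<Longrightarrow> vanishes_to d (sum f A)"
  by (simp add: vanishes_to_def)

lemma vanishes_to_mult:
  assumes "vanishes_to d X" "vanishes_to e Y"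
  shows "vanishes_to (d + e) (X * Y)"
  unfolding vanishes_to_def
proof (intro allI impI)
  fix m :: "'b \<Rightarrow>\<^sub>0 nat" assume m: "mdeg m < d + e"
  have "coeff_mps X a * coeff_mps Y b = 0" if "a + b = m" for a b
  proof -
    have "mdeg a < d \<or> mdeg b < e" using m that mdeg_add[of a b] by force
    then show ?thesis using assms by (auto simp: vanishes_to_def)
  qed
  then show "coeff_mps (X * Y) m = 0"
    by (simp add: coeff_mps_mult case_prod_unfold)
qed

lemma vanishes_to_power: "vanishes_to d X \<Longrightarrow> vanishes_to (d * k) (X ^ k)"
  by (induction k) (auto intro: vanishes_to_mult)

lemma vanishes_to_pderiv: "vanishes_to (Suc d) X \<Longrightarrow> vanishes_to d (pderiv_mps i X)"
  by (simp add: vanishes_to_def coeff_pderiv_mps mdeg_add del: One_nat_def)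

lemma vanishes_to_SucI:
  fixes X :: "('a::{idom, ring_char_0}, 'n::finite) mps"
  assumes "eval0_mps X = 0" "\<And>i. vanishes_to d (pderiv_mps i X)"
  shows "vanishes_to (Suc d) X"
  unfolding vanishes_to_def
proof (intro allI impI)
  fix m :: "'n \<Rightarrow>\<^sub>0 nat" assume m: "mdeg m < Suc d"
  show "coeff_mps X m = 0"
  proof (cases m rule: multi_index_cases)
    case (2 a i)
    then have "mdeg a < d" using m by (simp add: mdeg_add del: One_nat_def)
    then have "coeff_mps (pderiv_mps i X) a = 0" using assms(2) by (simp add: vanishes_to_def)
    then show ?thesis using 2 unfolding coeff_pderiv_mps by (simp del: of_nat_Suc)
  qed (use assms in simp)
qed

subsection \<open>Units\<close>

text \<open>With h = 1 - c x of vanishing constant term the inverse is a multiple of the geometric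
  series in h; each of its coefficients is read off from a finite partial sum.\<close>

lemma mps_unitI:
  fixes x :: "('a::comm_ring_1, 'n::finite) mps"
  assumes "eval0_mps x * c = 1"
  shows "x dvd 1"
proof -
  define h where "h = 1 - const_mps c * x"
  have h1: "vanishes_to 1 h"
    using assms by (auto simp: h_def vanishes_to_def mdeg_eq_0_iff mult.commute)
  have hk: "vanishes_to k (h ^ k)" for k
    using vanishes_to_power[OF h1, of k] by simp
  define z where "z = Abs_mps (\<lambda>m. coeff_mps (\<Sum>k\<le>mdeg m. h ^ k) m)"
  have z: "vanishes_to (Suc d) (z - (\<Sum>k\<le>d. h ^ k))" for d
    unfolding vanishes_to_def
  proof (intro allI impI)
    fix m :: "'n \<Rightarrow>\<^sub>0 nat" assume "mdeg m < Suc d"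
    then have "(\<Sum>k\<le>d. coeff_mps (h ^ k) m) = (\<Sum>k\<le>mdeg m. coeff_mps (h ^ k) m)"
      by (intro sum.mono_neutral_right) (use hk in \<open>auto simp: vanishes_to_def\<close>)
    then show "coeff_mps (z - (\<Sum>k\<le>d. h ^ k)) m = 0"
      by (simp add: z_def Abs_mps_inverse)
  qed
  have "vanishes_to d ((1 - h) * z - 1)" for d
  proof -
    have "(1 - h) * z - 1 = (1 - h) * (z - (\<Sum>k\<le>d. h ^ k)) - h ^ Suc d"
      using one_diff_power_eq[of h "Suc d"] by (simp add: algebra_simps flip: lessThan_Suc_atMost)
    moreover have "vanishes_to (Suc d) ((1 - h) * (z - (\<Sum>k\<le>d. h ^ k)))"
      using vanishes_to_mult[OF vanishes_to_0 z] by simp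
    ultimately have "vanishes_to (Suc d) ((1 - h) * z - 1)"
      using hk[of "Suc d"] by (simp add: vanishes_to_def)
    then show ?thesis by (rule vanishes_to_mono) simp
  qed
  then have "(1 - h) * z - 1 = 0" by (rule vanishes_to_all_imp_0)
  then have "x * (const_mps c * z) = 1"
    by (simp add: h_def algebra_simps)
  then show "x dvd 1" by (metis dvdI)
qed

lemma mps_unit_iff:
  fixes x :: "('a::field, 'n::finite) mps"
  shows "x dvd 1 \<longleftrightarrow> eval0_mps x \<noteq> 0"
proof
  assume "x dvd 1"
  then obtain y where "1 = x * y" by (elim dvdE)
  then have "eval0_mps x * eval0_mps y = 1" by (metis eval0_mult eval0_one)
  then show "eval0_mps x \<noteq> 0" by auto
next
  assume "eval0_mps x \<noteq> 0"
  then show "x dvd 1" by (intro mps_unitI[of x "1 / eval0_mps x"]) simp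
qed

subsection \<open>Coefficientwise maps and Taylor shift\<close>

lemma coeff_map_mps [simp]: "coeff_mps (map_mps h f) m = h (coeff_mps f m)"
  by (simp add: map_mps.rep_eq)

text \<open>Derivatives, moments and all later expansion coefficients are additive, but few of them
  are ring maps; the locale gives them a common stock of rules.\<close>

locale additive_map =
  fixes h :: "'a::comm_ring_1 \<Rightarrow> 'b::comm_ring_1"
  assumes add: "h (x + y) = h x + h y"
begin

lemma zero [simp]: "h 0 = 0"
  using add[of 0 0] by simp

lemma uminus: "h (- x) = - h x"
  using add[of x "- x"] by (simp add: eq_neg_iff_add_eq_0 add.commute)

lemma diff: "h (x - y) = h x - h y"
  using add[of x "- y"] by (simp add: uminus)

lemma sum: "h (sum f A) = (\<Sum>x\<in>A. h (f x))"
  by (induction A rule: infinite_finite_induct) (auto simp: add)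

lemma of_nat_mult: "h (of_nat k * x) = of_nat k * h x"
  by (induction k) (auto simp: add algebra_simps)

lemma map_mps_add: "map_mps h (X + Y) = map_mps h X + map_mps h Y"
  by (rule mps_eqI) (simp add: add)

lemma map_mps_pderiv: "map_mps h (pderiv_mps i X) = pderiv_mps i (map_mps h X)"
  by (rule mps_eqI) (simp add: coeff_pderiv_mps of_nat_mult del: of_nat_Suc)

end

locale derivation = additive_map d for d :: "'a::comm_ring_1 \<Rightarrow> 'a" +
  assumes mult: "d (x * y) = d x * y + x * d y"
begin

lemma one [simp]: "d 1 = 0"
  using mult[of 1 1] by simp

lemma of_nat [simp]: "d (of_nat k) = 0"
  by (induction k) (auto simp: add)

lemma power: "d (x ^ Suc k) = of_nat (Suc k) * x ^ k * d x"
  by (induction k) (auto simp: mult algebra_simps)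

lemma map_mps_derivation: "derivation (map_mps d :: ('a, 'n) mps \<Rightarrow> _)"
proof
  fix X Y :: "('a, 'n) mps"
  show "map_mps d (X + Y) = map_mps d X + map_mps d Y" by (rule map_mps_add)
  show "map_mps d (X * Y) = map_mps d X * Y + X * map_mps d Y"
    by (rule mps_eqI) (simp add: coeff_mps_mult sum mult sum.distrib case_prod_unfold)
qed

lemma map_mps_const: "map_mps d (const_mps c) = const_mps (d c)"
  by (rule mps_eqI) (simp add: coeff_const_mps)

lemma map_mps_var: "map_mps d (var_mps i) = 0"
  by (rule mps_eqI) (simp add: var_mps.rep_eq)

end

lemma derivation_pderiv_mps: "derivation (pderiv_mps i :: ('a::comm_ring_1, 'n) mps \<Rightarrow> _)"
  by standard (simp_all add: pderiv_mps_mult)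

locale ring_hom_1 = additive_map h for h :: "'a::comm_ring_1 \<Rightarrow> 'b::comm_ring_1" +
  assumes mult: "h (x * y) = h x * h y" and one [simp]: "h 1 = 1"
begin

lemma power: "h (x ^ k) = h x ^ k"
  by (induction k) (auto simp: mult)

lemma prod: "h (prod f A) = (\<Prod>x\<in>A. h (f x))"
  by (induction A rule: infinite_finite_induct) (auto simp: mult)

lemma of_nat [simp]: "h (of_nat k) = of_nat k"
  by (induction k) (auto simp: add)

lemma numeral [simp]: "h (numeral k) = numeral k"
  by (metis of_nat of_nat_numeral)

lemma map_mps_hom: "ring_hom_1 (map_mps h :: ('a, 'n) mps \<Rightarrow> _)"
proof
  fix X Y :: "('a, 'n) mps"
  show "map_mps h (X + Y) = map_mps h X + map_mps h Y" by (rule map_mps_add)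
  show "map_mps h (X * Y) = map_mps h X * map_mps h Y"
    by (rule mps_eqI) (simp add: coeff_mps_mult sum mult case_prod_unfold)
  show "map_mps h (1 :: ('a, 'n) mps) = 1"
    by (rule mps_eqI) (simp add: coeff_mps_one)
qed

lemma map_mps_const: "map_mps h (const_mps c) = const_mps (h c)"
  by (rule mps_eqI) (simp add: coeff_const_mps)

lemma map_mps_var: "map_mps h (var_mps i) = var_mps i"
  by (rule mps_eqI) (simp add: var_mps.rep_eq)

end

lemma ring_hom_const_mps: "ring_hom_1 (const_mps :: 'a::comm_ring_1 \<Rightarrow> ('a, 'n) mps)"
  by standard (simp_all add: const_mps_add const_mps_mult)

lemma coeff_shift_mps:
  "coeff_mps (coeff_mps (shift_mps f) m) a
     = of_nat (\<Prod>i\<in>UNIV. (lookup a i + lookup m i) choose lookup m i) * coeff_mps f (a + m)"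
  by (simp add: shift_mps_def Abs_mps_inverse)

lemma shift_mps_additive: "additive_map (shift_mps :: ('a::comm_ring_1, 'n::finite) mps \<Rightarrow> _)"
  by standard (intro mps_eqI, simp add: coeff_shift_mps algebra_simps)

text \<open>The two identities express that f(t + u) has the same derivative in t_i and in u_i. They
  are (q+1) C(p+q+1, q+1) = (p+q+1) C(p+q, q) and (p+1) C(p+q+1, q) = (p+q+1) C(p+q, q) in the i-th
  factor.\<close>

lemma binomial_shift_prod:
  fixes a m :: "'n::finite \<Rightarrow>\<^sub>0 nat" and i :: 'n
  defines "e \<equiv> Poly_Mapping.single i (1::nat)"
  shows "Suc (lookup m i) * (\<Prod>j\<in>UNIV. (lookup a j + lookup (m + e) j) choose lookup (m + e) j)
       = Suc (lookup (a + m) i) * (\<Prod>j\<in>UNIV. (lookup a j + lookup m j) choose lookup m j)"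
    and "Suc (lookup a i) * (\<Prod>j\<in>UNIV. (lookup (a + e) j + lookup m j) choose lookup m j)
       = Suc (lookup (a + m) i) * (\<Prod>j\<in>UNIV. (lookup a j + lookup m j) choose lookup m j)"
proof -
  have rest: "(\<Prod>j\<in>UNIV - {i}. (lookup a j + lookup (m + e) j) choose lookup (m + e) j)
        = (\<Prod>j\<in>UNIV - {i}. (lookup a j + lookup m j) choose lookup m j)"
       "(\<Prod>j\<in>UNIV - {i}. (lookup (a + e) j + lookup m j) choose lookup m j)
        = (\<Prod>j\<in>UNIV - {i}. (lookup a j + lookup m j) choose lookup m j)"
    by (rule prod.cong; simp add: e_def lookup_add lookup_single when_def)+
  have lk: "lookup (m + e) i = Suc (lookup m i)" "lookup (a + e) i = Suc (lookup a i)"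
       "lookup (a + m) i = lookup a i + lookup m i"
    by (simp_all add: e_def lookup_add)
  have one: "Suc q * ((p + Suc q) choose Suc q) = Suc (p + q) * ((p + q) choose q)" for p q :: nat
    using Suc_times_binomial[of q "p + q"] by simp
  have two: "Suc p * ((Suc p + q) choose q) = Suc (p + q) * ((p + q) choose q)" for p q :: nat
  proof -
    have "(Suc p + q) choose q = (q + Suc p) choose Suc p" "(p + q) choose q = (q + p) choose p"
      using binomial_symmetric[of q "Suc p + q"] binomial_symmetric[of q "p + q"] by (simp_all add: add.commute)
    then show ?thesis using one[of p q] by (metis add.commute)
  qed
  show "Suc (lookup m i) * (\<Prod>j\<in>UNIV. (lookup a j + lookup (m + e) j) choose lookup (m + e) j)
       = Suc (lookup (a + m) i) * (\<Prod>j\<in>UNIV. (lookup a j + lookup m j) choose lookup m j)"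
    unfolding prod.remove[OF finite UNIV_I[of i]] rest
    unfolding lk mult.assoc[symmetric] by (simp only: one)
  show "Suc (lookup a i) * (\<Prod>j\<in>UNIV. (lookup (a + e) j + lookup m j) choose lookup m j)
       = Suc (lookup (a + m) i) * (\<Prod>j\<in>UNIV. (lookup a j + lookup m j) choose lookup m j)"
    unfolding prod.remove[OF finite UNIV_I[of i]] rest
    unfolding lk mult.assoc[symmetric] by (simp only: two)
qed

lemma pderiv_shift_mps: "pderiv_mps i (shift_mps f) = shift_mps (pderiv_mps i f)"
  for f :: "('a::comm_ring_1, 'n::finite) mps"
proof (intro mps_eqI)
  fix m a
  let ?e = "Poly_Mapping.single i (1::nat)"
  have "coeff_mps (coeff_mps (pderiv_mps i (shift_mps f)) m) a
      = of_nat (Suc (lookup m i)) * coeff_mps (coeff_mps (shift_mps f) (m + ?e)) a"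
    by (simp add: coeff_pderiv_mps flip: const_mps_of_nat del: of_nat_Suc)
  also have "\<dots> = of_nat (Suc (lookup m i) * (\<Prod>j\<in>UNIV. (lookup a j + lookup (m + ?e) j) choose lookup (m + ?e) j))
        * coeff_mps f (a + m + ?e)"
    by (simp only: coeff_shift_mps of_nat_mult mult.assoc add.assoc)
  also have "\<dots> = coeff_mps (coeff_mps (shift_mps (pderiv_mps i f)) m) a"
    unfolding binomial_shift_prod(1)
    by (simp only: coeff_shift_mps coeff_pderiv_mps of_nat_mult mult_ac)
  finally show "coeff_mps (coeff_mps (pderiv_mps i (shift_mps f)) m) a
      = coeff_mps (coeff_mps (shift_mps (pderiv_mps i f)) m) a" .
qed

lemma map_pderiv_shift_mps: "map_mps (pderiv_mps i) (shift_mps f) = shift_mps (pderiv_mps i f)"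
  for f :: "('a::comm_ring_1, 'n::finite) mps"
proof (intro mps_eqI)
  fix m a
  let ?e = "Poly_Mapping.single i (1::nat)"
  have "coeff_mps (coeff_mps (map_mps (pderiv_mps i) (shift_mps f)) m) a
      = of_nat (Suc (lookup a i) * (\<Prod>j\<in>UNIV. (lookup (a + ?e) j + lookup m j) choose lookup m j))
        * coeff_mps f (a + m + ?e)"
    by (simp only: coeff_map_mps coeff_pderiv_mps coeff_shift_mps of_nat_mult mult_ac add_ac)
  also have "\<dots> = coeff_mps (coeff_mps (shift_mps (pderiv_mps i f)) m) a"
    unfolding binomial_shift_prod(2)
    by (simp only: coeff_shift_mps coeff_pderiv_mps of_nat_mult mult_ac)
  finally show "coeff_mps (coeff_mps (map_mps (pderiv_mps i) (shift_mps f)) m) a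
      = coeff_mps (coeff_mps (shift_mps (pderiv_mps i f)) m) a" .
qed

lemma eval0_shift_mps [simp]: "eval0_mps (shift_mps f) = (f :: ('a::comm_ring_1, 'n::finite) mps)"
  by (rule mps_eqI) (simp add: coeff_shift_mps)

text \<open>Multiplicativity without a Vandermonde convolution: the defects vanish at u = 0, and by
  the Leibniz rule the u-derivative of a defect is a sum of defects, so
  \<open>mps_zero_principle\<close> applies.\<close>

lemma shift_mps_hom: "ring_hom_1 (shift_mps :: ('a::{idom, ring_char_0}, 'n::finite) mps \<Rightarrow> _)"
proof -
  interpret additive_map "shift_mps :: ('a, 'n) mps \<Rightarrow> _" by (rule shift_mps_additive)
  show ?thesis
  proof
    \<comment> \<open>Finite sums of defects, so that the set is closed under addition.\<close>
    define P :: "(('a, 'n) mps, 'n) mps set" where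
      "P = {\<Sum>x\<in>A. shift_mps (f x * g x) - shift_mps (f x) * shift_mps (g x) | A f g. finite (A :: nat set)}"
    have P_pair: "shift_mps (f * g) - shift_mps f * shift_mps g \<in> P" for f g
      unfolding P_def by (rule CollectI, rule exI[of _ "{0}"], rule exI[of _ "\<lambda>_. f"], rule exI[of _ "\<lambda>_. g"]) auto
    have P_add: "X + Y \<in> P" if "X \<in> P" "Y \<in> P" for X Y
    proof -
      let ?E = "\<lambda>f g x. shift_mps (f x * g x) - shift_mps (f x) * shift_mps (g x :: ('a, 'n) mps)"
      from that obtain A f g B f' g' where
        X: "finite (A :: nat set)" "X = sum (?E f g) A" and
        Y: "finite (B :: nat set)" "Y = sum (?E f' g') B"
        unfolding P_def by blast
      \<comment> \<open>Even and odd numbers keep the two index sets disjoint.\<close>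
      define C where "C = (\<lambda>x. 2 * x) ` A \<union> (\<lambda>x. 2 * x + 1) ` B"
      define F where "F = (\<lambda>x::nat. if even x then f (x div 2) else f' (x div 2))"
      define G where "G = (\<lambda>x::nat. if even x then g (x div 2) else g' (x div 2))"
      have "sum (?E F G) C = sum (?E F G) ((\<lambda>x. 2 * x) ` A) + sum (?E F G) ((\<lambda>x. 2 * x + 1) ` B)"
        unfolding C_def by (rule sum.union_disjoint) (use X Y in \<open>auto, presburger\<close>)
      also have "sum (?E F G) ((\<lambda>x. 2 * x) ` A) = X"
        unfolding X(2) by (subst sum.reindex) (auto simp: inj_on_def F_def G_def)
      also have "sum (?E F G) ((\<lambda>x. 2 * x + 1) ` B) = Y"
        unfolding Y(2) by (subst sum.reindex) (auto simp: inj_on_def F_def G_def)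
      finally have "X + Y = sum (?E F G) C" ..
      moreover have "finite C" using X Y by (simp add: C_def)
      ultimately show ?thesis unfolding P_def by blast
    qed
    have P_0: "0 \<in> P"
      unfolding P_def by (rule CollectI, rule exI[of _ "{}"]) auto
    have P_sum: "sum h A \<in> P" if "\<And>x. x \<in> A \<Longrightarrow> h x \<in> P" "finite (A :: nat set)" for h A
      using that(2,1) by (induction A rule: finite_induct) (auto simp: P_0 P_add)
    fix f g :: "('a, 'n) mps"
    have "shift_mps (f * g) - shift_mps f * shift_mps g = 0"
    proof (rule mps_zero_principle[of _ P])
      show "shift_mps (f * g) - shift_mps f * shift_mps g \<in> P" by (rule P_pair)
      show "eval0_mps X = 0" if "X \<in> P" for X using that by (auto simp: P_def)
      show "pderiv_mps i X \<in> P" if "X \<in> P" for X i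
      proof -
        from that obtain A f g where A: "finite (A :: nat set)"
          "X = (\<Sum>x\<in>A. shift_mps (f x * g x) - shift_mps (f x) * shift_mps (g x))"
          unfolding P_def by blast
        have "pderiv_mps i X = (\<Sum>x\<in>A.
             (shift_mps (pderiv_mps i (f x) * g x) - shift_mps (pderiv_mps i (f x)) * shift_mps (g x))
           + (shift_mps (f x * pderiv_mps i (g x)) - shift_mps (f x) * shift_mps (pderiv_mps i (g x))))"
          unfolding A by (simp add: pderiv_mps_mult pderiv_shift_mps add algebra_simps)
        also have "\<dots> \<in> P" by (intro P_sum P_add P_pair A)
        finally show ?thesis .
      qed
    qed
    then show "shift_mps (f * g) = shift_mps f * shift_mps g" by simp
  next
    show "shift_mps (1 :: ('a, 'n) mps) = 1"
    proof (rule mps_eqI)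
      fix m :: "'n \<Rightarrow>\<^sub>0 nat"
      have "a + m = 0 \<longleftrightarrow> a = 0 \<and> m = 0" for a :: "'n \<Rightarrow>\<^sub>0 nat"
        using splits_zero[where 'n = 'n] by (simp add: set_eq_iff)
      then show "coeff_mps (shift_mps (1 :: ('a, 'n) mps)) m = coeff_mps 1 m"
        by (intro mps_eqI) (auto simp: coeff_shift_mps coeff_mps_one)
    qed
  qed
qed

lemma shift_const_mps:
  "shift_mps (const_mps c :: ('a::comm_ring_1, 'n::finite) mps) = const_mps (const_mps c)"
proof (intro mps_eqI)
  fix m a :: "'n \<Rightarrow>\<^sub>0 nat"
  have "a + m = 0 \<longleftrightarrow> a = 0 \<and> m = 0"
    using splits_zero[where 'n = 'n] by (simp add: set_eq_iff)
  then show "coeff_mps (coeff_mps (shift_mps (const_mps c)) m) a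
      = coeff_mps (coeff_mps (const_mps (const_mps c)) m) a"
    by (auto simp: coeff_shift_mps coeff_const_mps)
qed

lemma shift_var_mps: "shift_mps (var_mps i) = const_mps (var_mps i) + (var_mps i :: (('a::{idom, ring_char_0}, 'n::finite) mps, 'n) mps)"
proof -
  have "shift_mps (var_mps i) - (const_mps (var_mps i) + (var_mps i :: (('a, 'n) mps, 'n) mps)) = 0"
  proof (rule mps_zero_principle[of _ "{0, shift_mps (var_mps i) - (const_mps (var_mps i) + var_mps i)}"])
    interpret ring_hom_1 "shift_mps :: ('a, 'n) mps \<Rightarrow> _" by (rule shift_mps_hom)
    fix X :: "(('a, 'n) mps, 'n) mps" and j
    assume "X \<in> {0, shift_mps (var_mps i) - (const_mps (var_mps i) + var_mps i)}"
    then show "pderiv_mps j X \<in> {0, shift_mps (var_mps i) - (const_mps (var_mps i) + var_mps i)}"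
      by (auto simp: pderiv_shift_mps pderiv_var_mps)
  qed auto
  then show ?thesis by simp
qed

section \<open>The stationary phase functional\<close>

lemma (in additive_map) const_linear_sum:
  assumes "\<And>c x. h (k c * x) = k' c * h x"
  shows "h (\<Sum>x\<in>A. k (c x) * f x) = (\<Sum>x\<in>A. k' (c x) * h (f x))"
  by (simp add: sum assms)

text \<open>\<open>gmom G m\<close> is the Gaussian moment of order \<open>2 m\<close> of the quadratic form with inverse matrix \<open>G\<close>.\<close>

definition glap :: "('n::finite \<Rightarrow> 'n \<Rightarrow> ('k::field_char_0, 'm::finite) mps) \<Rightarrow>
    (('k, 'm) mps, 'n) mps \<Rightarrow> (('k, 'm) mps, 'n) mps" where
  "glap G X = const_mps (const_mps (- 1 / 2)) *
     (\<Sum>i\<in>UNIV. \<Sum>j\<in>UNIV. const_mps (G i j) * pderiv_mps i (pderiv_mps j X))"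

definition gmom :: "('n::finite \<Rightarrow> 'n \<Rightarrow> ('k::field_char_0, 'm::finite) mps) \<Rightarrow> nat \<Rightarrow>
    (('k, 'm) mps, 'n) mps \<Rightarrow> ('k, 'm) mps" where
  "gmom G m X = const_mps (1 / fact m) * eval0_mps ((glap G ^^ m) X)"

lemma glap_add: "glap G (X + Y) = glap G X + glap G Y"
  by (simp add: glap_def sum.distrib algebra_simps)

lemma glap_const: "glap G (const_mps c * X) = const_mps c * glap G X"
  by (simp add: glap_def sum_distrib_left mult.left_commute)

lemma glap_pow_add: "(glap G ^^ m) (X + Y) = (glap G ^^ m) X + (glap G ^^ m) Y"
  by (induction m) (auto simp: glap_add)

lemma glap_pow_const: "(glap G ^^ m) (const_mps c * X) = const_mps c * (glap G ^^ m) X"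
  by (induction m) (auto simp: glap_const)

lemma gmom_additive: "additive_map (gmom G m)"
  by standard (simp add: gmom_def glap_pow_add algebra_simps)

lemmas gmom_add = additive_map.add[OF gmom_additive]
lemmas gmom_sum = additive_map.sum[OF gmom_additive]
lemmas gmom_diff = additive_map.diff[OF gmom_additive]
lemmas gmom_of_nat_mult = additive_map.of_nat_mult[OF gmom_additive]

lemma gmom_const: "gmom G m (const_mps c * X) = c * gmom G m X"
  by (simp add: gmom_def glap_pow_const mult.left_commute)

lemma gmom_0 [simp]: "gmom G 0 X = eval0_mps X"
  by (simp add: gmom_def)

lemma gmom_glap:
  fixes G :: "'n::finite \<Rightarrow> 'n \<Rightarrow> ('k::field_char_0, 'm::finite) mps"
  shows "gmom G m (glap G X) = of_nat (Suc m) * gmom G (Suc m) X"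
proof -
  have "(of_nat (Suc m) :: ('k, 'm) mps) * const_mps (1 / fact (Suc m)) = const_mps (1 / fact m)"
    unfolding const_mps_of_nat[symmetric] const_mps_mult[symmetric]
    by (simp add: field_simps del: of_nat_Suc)
  then show ?thesis
    unfolding gmom_def mult.assoc[symmetric] by (simp only: funpow_Suc_right comp_apply)
qed

lemma of_nat_Suc_cancel:
  fixes x y :: "'a::{idom, ring_char_0}"
  assumes "of_nat (Suc m) * x = of_nat (Suc m) * y" shows "x = y"
  using assms by (simp del: of_nat_Suc)

text \<open>Commutator of the Laplacian with a coordinate. The two mixed terms agree by symmetry of
  \<open>G\<close>, and their factor 2 cancels the 1/2 in \<open>glap\<close>.\<close>

lemma glap_var:
  fixes G :: "'n::finite \<Rightarrow> 'n \<Rightarrow> ('k::field_char_0, 'm::finite) mps"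
  assumes sym: "\<And>i j. G i j = G j i"
  shows "glap G (var_mps i * Y) = var_mps i * glap G Y - (\<Sum>j\<in>UNIV. const_mps (G i j) * pderiv_mps j Y)"
proof -
  have h: "const_mps (const_mps (-1/2 :: 'k)) * ((2 :: (('k, 'm) mps, 'n) mps) * x) = - x" for x
  proof -
    have "const_mps (const_mps (-1/2 :: 'k)) * (2 :: (('k, 'm) mps, 'n) mps)
        = const_mps (const_mps (-1/2 :: 'k)) * const_mps (const_mps 2)"
      by (metis const_mps_of_nat of_nat_numeral)
    also have "\<dots> = - 1"
      by (simp flip: const_mps_mult) (simp add: const_mps_uminus)
    finally show ?thesis by (simp add: mult.assoc[symmetric])
  qed
  have d: "pderiv_mps a (pderiv_mps b (var_mps i * Y)) = var_mps i * pderiv_mps a (pderiv_mps b Y)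
      + (if b = i then pderiv_mps a Y else 0) + (if a = i then pderiv_mps b Y else 0)" for a b
    by (simp add: pderiv_mps_mult pderiv_var_mps)
  have "(\<Sum>a\<in>UNIV. \<Sum>b\<in>UNIV. const_mps (G a b) * pderiv_mps a (pderiv_mps b (var_mps i * Y)))
      = var_mps i * (\<Sum>a\<in>UNIV. \<Sum>b\<in>UNIV. const_mps (G a b) * pderiv_mps a (pderiv_mps b Y))
        + (\<Sum>a\<in>UNIV. \<Sum>b\<in>UNIV. const_mps (G a b) * (if b = i then pderiv_mps a Y else 0))
        + (\<Sum>a\<in>UNIV. \<Sum>b\<in>UNIV. const_mps (G a b) * (if a = i then pderiv_mps b Y else 0))"
    unfolding d by (simp add: sum.distrib algebra_simps sum_distrib_left del: mult_zero_right)
  also have "(\<Sum>a\<in>UNIV. \<Sum>b\<in>UNIV. const_mps (G a b) * (if b = i then pderiv_mps a Y else 0))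
      = (\<Sum>j\<in>UNIV. const_mps (G i j) * pderiv_mps j Y)"
    by (simp add: if_distrib sym[of _ i] cong: if_cong)
  also have "(\<Sum>a\<in>UNIV. \<Sum>b\<in>UNIV. const_mps (G a b) * (if a = i then pderiv_mps b Y else 0))
      = (\<Sum>j\<in>UNIV. const_mps (G i j) * pderiv_mps j Y)"
    by (subst sum.swap) (simp add: if_distrib cong: if_cong)
  finally have e: "(\<Sum>a\<in>UNIV. \<Sum>b\<in>UNIV. const_mps (G a b) * pderiv_mps a (pderiv_mps b (var_mps i * Y)))
      = var_mps i * (\<Sum>a\<in>UNIV. \<Sum>b\<in>UNIV. const_mps (G a b) * pderiv_mps a (pderiv_mps b Y))
        + 2 * (\<Sum>j\<in>UNIV. const_mps (G i j) * pderiv_mps j Y)" by simp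
  show ?thesis unfolding glap_def e distrib_left h by (simp add: mult_ac)
qed

lemma glap_pderiv: "glap G (pderiv_mps j X) = pderiv_mps j (glap G X)"
  by (simp add: glap_def) (simp add: pderiv_mps_commute[of j])

text \<open>Wick's rule, i.e. integration by parts for a Gaussian: removing a coordinate costs one
  Laplacian and leaves a derivative. The induction compares both sides after multiplication by the
  positive integer from \<open>gmom_glap\<close>.\<close>

lemma gmom_var:
  assumes sym: "\<And>i j. G i j = G j i"
  shows "gmom G (Suc m) (var_mps i * Y) = - (\<Sum>j\<in>UNIV. G i j * gmom G m (pderiv_mps j Y))"
proof (induction m arbitrary: Y)
  case 0
  have "gmom G 0 (glap G (var_mps i * Y)) = of_nat (Suc 0) * gmom G (Suc 0) (var_mps i * Y)"
    by (rule gmom_glap)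
  then show ?case by (simp add: glap_var[of G, OF sym])
next
  case (Suc m)
  have "of_nat (Suc (Suc m)) * gmom G (Suc (Suc m)) (var_mps i * Y)
      = gmom G (Suc m) (var_mps i * glap G Y) - (\<Sum>j\<in>UNIV. G i j * gmom G (Suc m) (pderiv_mps j Y))"
    by (simp only: gmom_glap[symmetric] glap_var[of G, OF sym] gmom_diff gmom_sum gmom_const)
  also have "\<dots> = of_nat (Suc (Suc m)) * (- (\<Sum>j\<in>UNIV. G i j * gmom G (Suc m) (pderiv_mps j Y)))"
    unfolding Suc.IH glap_pderiv[symmetric] gmom_glap
    by (simp add: sum_distrib_left algebra_simps sum_negf sum.distrib)
  finally show ?case by (rule of_nat_Suc_cancel)
qed

text \<open>Each Laplacian lowers the vanishing order by two, so an order above 2 m survives until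
  the evaluation at 0.\<close>

lemma gmom_vanishes: "vanishes_to (Suc (2 * m)) Y \<Longrightarrow> gmom G m Y = 0"
proof (induction m arbitrary: Y)
  case 0
  then show ?case by (simp add: vanishes_to_def mdeg_eq_0_iff)
next
  case (Suc m)
  have "vanishes_to (Suc (2 * m)) (glap G Y)"
  proof -
    have "vanishes_to (Suc (2 * m)) (pderiv_mps i (pderiv_mps j Y))" for i j
      using Suc.prems by (intro vanishes_to_pderiv) (simp add: numeral_eq_Suc)
    then have "vanishes_to (0 + Suc (2 * m)) (const_mps (G i j) * pderiv_mps i (pderiv_mps j Y))" for i j
      by (intro vanishes_to_mult) auto
    then have "vanishes_to (0 + Suc (2 * m)) (glap G Y)"
      unfolding glap_def by (intro vanishes_to_mult vanishes_to_sum) auto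
    then show ?thesis by simp
  qed
  from Suc.IH[OF this] have "of_nat (Suc m) * gmom G (Suc m) Y = of_nat (Suc m) * 0"
    by (simp only: gmom_glap mult_zero_right)
  then show ?case by (rule of_nat_Suc_cancel)
qed

text \<open>A moment of order 2 m sees the homogeneous part of degree 2 m, on which the Euler
  operator is multiplication by 2 m.\<close>

lemma gmom_euler:
  fixes G :: "'n::finite \<Rightarrow> 'n \<Rightarrow> ('k::field_char_0, 'm::finite) mps"
  assumes sym: "\<And>i j. G i j = G j i"
  shows "gmom G m (\<Sum>i\<in>UNIV. var_mps i * pderiv_mps i Y) = of_nat (2 * m) * gmom G m Y"
proof (cases m)
  case (Suc k)
  have h: "const_mps (const_mps (2 :: 'k)) * glap G Y
     = - (\<Sum>i\<in>UNIV. \<Sum>j\<in>UNIV. const_mps (G i j) * pderiv_mps i (pderiv_mps j Y))"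
    unfolding glap_def mult.assoc[symmetric] const_mps_mult[symmetric]
    by (simp add: const_mps_uminus)
  have "gmom G (Suc k) (\<Sum>i\<in>UNIV. var_mps i * pderiv_mps i Y)
      = gmom G k (- (\<Sum>i\<in>UNIV. \<Sum>j\<in>UNIV. const_mps (G i j) * pderiv_mps i (pderiv_mps j Y)))"
    by (simp add: gmom_sum gmom_var[of G, OF sym] additive_map.uminus[OF gmom_additive]
        gmom_const sum_negf pderiv_mps_commute)
  also have "\<dots> = const_mps 2 * (of_nat (Suc k) * gmom G (Suc k) Y)"
    by (simp only: h[symmetric] gmom_const gmom_glap)
  also have "\<dots> = of_nat (2 * Suc k) * gmom G (Suc k) Y"
    by (simp add: const_mps_of_nat[of 2, simplified] algebra_simps)
  finally show ?thesis using Suc by simp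
qed simp

text \<open>A derivation of the base ring acts on the amplitude and on the covariance
  \<open>G\<close>. The Laplacians of \<open>G\<close> and of its derivative have coefficients
  constant in u and commute, so the changes of the m Laplacians are equal, and the factor m turns
  1/m! into 1/(m-1)!.\<close>

lemma gmom_derivation:
  fixes G :: "'n::finite \<Rightarrow> 'n \<Rightarrow> ('k::field_char_0, 'm::finite) mps"
    and Y :: "(('k, 'm) mps, 'n) mps" and d :: "('k, 'm) mps \<Rightarrow> ('k, 'm) mps"
  assumes sym: "\<And>i j. G i j = G j i" and d: "derivation d" and dc: "\<And>c. d (const_mps c) = 0"
  shows "d (gmom G m Y) = gmom G m (map_mps d Y)
     + (case m of 0 \<Rightarrow> 0 | Suc l \<Rightarrow> gmom G l (glap (\<lambda>i j. d (G i j)) Y))"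
proof -
  interpret derivation d by (rule d)
  interpret D: derivation "map_mps d :: (('k, 'm) mps, 'n) mps \<Rightarrow> _" by (rule map_mps_derivation)
  let ?G' = "\<lambda>i j. d (G i j)"
  have D_glap: "map_mps d (glap G Y) = glap G (map_mps d Y) + glap ?G' Y" for Y :: "(('k, 'm) mps, 'n) mps"
    by (simp add: glap_def D.mult D.sum map_mps_const dc map_mps_pderiv sum.distrib algebra_simps)
  have comm: "glap ?G' (glap G Y) = glap G (glap ?G' Y)" for Y :: "(('k, 'm) mps, 'n) mps"
  proof -
    have "glap ?G' (glap G Y) = const_mps (const_mps (- 1 / 2)) *
       (\<Sum>i\<in>UNIV. \<Sum>j\<in>UNIV. const_mps (?G' i j) * glap G (pderiv_mps i (pderiv_mps j Y)))"
      by (simp add: glap_pderiv glap_def[of ?G'])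
    also have "\<dots> = glap G (glap ?G' Y)"
    proof -
      interpret g: additive_map "glap G" by standard (rule glap_add)
      show ?thesis by (simp add: glap_def[of ?G'] glap_const g.sum)
    qed
    finally show ?thesis .
  qed
  show ?thesis
  proof (induction m arbitrary: Y)
    case 0
    then show ?case by simp
  next
    case (Suc m)
    have "of_nat (Suc m) * d (gmom G (Suc m) Y) = d (of_nat (Suc m) * gmom G (Suc m) Y)"
      by (simp only: of_nat_mult)
    also have "\<dots> = d (gmom G m (glap G Y))" by (simp only: gmom_glap)
    also have "\<dots> = gmom G m (map_mps d (glap G Y))
        + (case m of 0 \<Rightarrow> 0 | Suc l \<Rightarrow> gmom G l (glap ?G' (glap G Y)))" by (rule Suc.IH)
    also have "(case m of 0 \<Rightarrow> 0 | Suc l \<Rightarrow> gmom G l (glap ?G' (glap G Y))) = of_nat m * gmom G m (glap ?G' Y)"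
      by (auto simp: comm gmom_glap split: nat.split)
    also have "gmom G m (map_mps d (glap G Y)) = of_nat (Suc m) * gmom G (Suc m) (map_mps d Y) + gmom G m (glap ?G' Y)"
      by (simp only: D_glap gmom_add gmom_glap)
    finally have "of_nat (Suc m) * d (gmom G (Suc m) Y)
        = of_nat (Suc m) * (gmom G (Suc m) (map_mps d Y) + gmom G m (glap ?G' Y))"
      by (simp add: algebra_simps)
    then show ?case using of_nat_Suc_cancel by fastforce
  qed
qed

section \<open>The formal expansion at a nondegenerate critical point: integration by parts,
  scaling, dependence on the base point\<close>

locale phase =
  fixes \<phi> :: "(('k::field_char_0, 'n::finite) mps, 'n) mps" and G :: "'n \<Rightarrow> 'n \<Rightarrow> ('k, 'n) mps"
  assumes ev_phase: "eval0_mps \<phi> = 0" and ev_d_phase: "eval0_mps (pderiv_mps i \<phi>) = 0"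
    and G_sym: "G i j = G j i"
    and G_H: "(\<Sum>j\<in>UNIV. G i j * eval0_mps (pderiv_mps j (pderiv_mps l \<phi>))) = (if i = l then 1 else 0)"
begin

definition "H i j = eval0_mps (pderiv_mps i (pderiv_mps j \<phi>))"

lemma H_sym: "H i j = H j i"
  by (simp add: H_def pderiv_mps_commute)

lemma GH: "(\<Sum>j\<in>UNIV. G i j * H j l) = (if i = l then 1 else 0)"
  using G_H by (simp add: H_def)

lemma HG: "(\<Sum>j\<in>UNIV. H i j * G j l) = (if i = l then 1 else 0)"
  using GH[of l i] by (simp add: G_sym[of l] H_sym[of _ i] mult.commute eq_commute)

definition "Hv i = (\<Sum>j\<in>UNIV. const_mps (H i j) * var_mps j)"

definition "quad = const_mps (const_mps (1 / 2)) * (\<Sum>i\<in>UNIV. Hv i * var_mps i)"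

definition "rest = \<phi> - quad"

text \<open>The coefficient A_k over the power series ring; the factor 1/(k+v)! of the formula is
  part of \<open>gmom\<close>. The phase stays arbitrary because the expansion is applied to Taylor
  remainders and to Legendre dual phases.\<close>

definition stat :: "nat \<Rightarrow> (('k, 'n) mps, 'n) mps \<Rightarrow> ('k, 'n) mps" where
  "stat k X = (\<Sum>v\<le>2 * k. const_mps (1 / fact v) * gmom G (k + v) (X * rest ^ v))"

lemma half_two: "const_mps (const_mps (1 / 2 :: 'k)) * 2 = (1 :: (('k, 'n) mps, 'n) mps)"
proof -
  have "const_mps (const_mps (1/2 :: 'k)) * 2 = const_mps (const_mps (1/2)) * (const_mps (const_mps 2) :: (('k, 'n) mps, 'n) mps)"
    by (metis const_mps_of_nat of_nat_numeral)
  also have "\<dots> = 1" by (simp flip: const_mps_mult)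
  finally show ?thesis .
qed

lemma pderiv_Hv: "pderiv_mps i (Hv j) = const_mps (H j i)"
proof -
  have "(\<Sum>l\<in>UNIV. const_mps (H j l) * (if i = l then 1 else 0)) = (const_mps (H j i) :: (('k, 'n) mps, 'n) mps)"
    by (simp add: if_distrib cong: if_cong)
  then show ?thesis by (simp add: Hv_def pderiv_var_mps)
qed

lemma pderiv_quad: "pderiv_mps i quad = Hv i"
proof -
  have a: "(\<Sum>j\<in>UNIV. const_mps (H j i) * var_mps j) = Hv i"
    by (simp add: Hv_def H_sym[of i])
  have b: "(\<Sum>j\<in>UNIV. Hv j * (if i = j then 1 else 0)) = Hv i"
    by (simp add: if_distrib cong: if_cong)
  show ?thesis
    by (simp add: quad_def pderiv_mps_mult pderiv_Hv pderiv_var_mps sum.distrib a b half_two)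
qed

lemma rest_vanishes: "vanishes_to 3 rest"
  unfolding numeral_3_eq_3 rest_def
  by (intro vanishes_to_SucI)
     (simp_all add: ev_phase ev_d_phase pderiv_quad pderiv_Hv H_def pderiv_mps_commute,
      simp_all add: quad_def Hv_def)

text \<open>\<open>rest ^ v\<close> vanishes to order 3 v, which exceeds 2 (k + v) once v > 2 k. A
  free cutoff makes room for the shifts of v in the recursions.\<close>

lemma stat_eq:
  assumes "2 * k \<le> M"
  shows "stat k X = (\<Sum>v\<le>M. const_mps (1 / fact v) * gmom G (k + v) (X * rest ^ v))"
proof -
  have "gmom G (k + v) (X * rest ^ v) = 0" if "v > 2 * k" for v
  proof (rule gmom_vanishes)
    have "vanishes_to (0 + 3 * v) (X * rest ^ v)"
      by (intro vanishes_to_mult vanishes_to_power rest_vanishes vanishes_to_0)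
    then show "vanishes_to (Suc (2 * (k + v))) (X * rest ^ v)"
      by (rule vanishes_to_mono) (use that in simp)
  qed
  then show ?thesis unfolding stat_def using assms
    by (intro sum.mono_neutral_left) auto
qed

lemma stat_additive: "additive_map (stat k)"
  by standard (simp add: stat_def gmom_add algebra_simps sum.distrib)

lemma stat_const: "stat k (const_mps c * X) = c * stat k X"
  unfolding stat_def mult.assoc gmom_const sum_distrib_left by (simp add: mult.left_commute)

lemma stat_0: "stat 0 X = eval0_mps X"
  by (simp add: stat_def)

text \<open>\<open>Hv i\<close> is the derivative of the quadratic part; contracting Wick's rule
  with the Hessian undoes \<open>G\<close>.\<close>

lemma gmom_Hv: "gmom G (Suc m) (Hv i * Y) = - gmom G m (pderiv_mps i Y)"
proof -
  have "gmom G (Suc m) (Hv i * Y) = (\<Sum>j\<in>UNIV. H i j * gmom G (Suc m) (var_mps j * Y))"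
    by (simp add: Hv_def sum_distrib_right gmom_sum gmom_const mult.assoc)
  also have "\<dots> = - (\<Sum>j\<in>UNIV. \<Sum>l\<in>UNIV. H i j * G j l * gmom G m (pderiv_mps l Y))"
    by (simp add: gmom_var[of G, OF G_sym] sum_distrib_left sum_negf mult.assoc)
  also have "\<dots> = - (\<Sum>l\<in>UNIV. (\<Sum>j\<in>UNIV. H i j * G j l) * gmom G m (pderiv_mps l Y))"
    by (subst sum.swap) (simp add: sum_distrib_right)
  also have "\<dots> = - gmom G m (pderiv_mps i Y)"
    by (simp add: HG if_distrib[of "\<lambda>x. x * _"] cong: if_cong)
  finally show ?thesis .
qed

lemma fact_Suc_const: "const_mps (1 / fact (Suc v)) * of_nat (Suc v) = (const_mps (1 / fact v) :: ('k, 'n) mps)"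
  unfolding const_mps_of_nat[symmetric] const_mps_mult[symmetric]
  by (simp add: field_simps del: of_nat_Suc)

lemma deriv_rest_power:
  assumes "derivation D"
  shows "D (X * rest ^ v) = D X * rest ^ v + of_nat v * (X * D rest * rest ^ (v - 1))"
proof -
  interpret derivation D by (rule assms)
  show ?thesis
    by (cases v) (simp_all add: mult power algebra_simps del: power_Suc of_nat_Suc)
qed

text \<open>The formal version of: the integral of d_i (X exp(\<phi> / hbar)) is zero. In the part
  \<open>Hv i\<close> of d_i \<phi>, Wick's rule lets the derivative fall on X or on
  \<open>rest ^ v\<close>; the latter terms cancel the part d_i \<open>rest\<close> after a shift of
  v.\<close>

theorem stat_by_parts: "stat (Suc k) (X * pderiv_mps i \<phi>) = - stat k (pderiv_mps i X)"
proof -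
  define M where "M = 2 * Suc k"
  let ?c = "\<lambda>v. const_mps (1 / fact v) :: ('k, 'n) mps"
  have D: "pderiv_mps i \<phi> = Hv i + pderiv_mps i rest"
    by (simp add: rest_def pderiv_quad)
  \<comment> \<open>The two cutoffs differ by one, to match the shift of v.\<close>
  have "stat (Suc k) (X * pderiv_mps i \<phi>)
      = (\<Sum>v\<le>Suc M. ?c v * gmom G (Suc (k + v)) (X * Hv i * rest ^ v))
        + (\<Sum>v\<le>M. ?c v * gmom G (Suc (k + v)) (X * pderiv_mps i rest * rest ^ v))"
    unfolding D distrib_left additive_map.add[OF stat_additive]
    by (subst stat_eq[of _ "Suc M"], simp add: M_def, subst stat_eq[of _ M]) (simp_all add: M_def)
  also have "(\<Sum>v\<le>Suc M. ?c v * gmom G (Suc (k + v)) (X * Hv i * rest ^ v))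
      = - (\<Sum>v\<le>Suc M. ?c v * gmom G (k + v) (pderiv_mps i X * rest ^ v))
        - (\<Sum>v\<le>Suc M. ?c v * (of_nat v * gmom G (k + v) (X * pderiv_mps i rest * rest ^ (v - 1))))"
  proof -
    have "gmom G (Suc (k + v)) (X * Hv i * rest ^ v)
        = - gmom G (k + v) (pderiv_mps i X * rest ^ v)
          - of_nat v * gmom G (k + v) (X * pderiv_mps i rest * rest ^ (v - 1))" for v
    proof -
      have "X * Hv i * rest ^ v = Hv i * (X * rest ^ v)" by (simp add: mult_ac)
      show ?thesis
        unfolding \<open>X * Hv i * rest ^ v = Hv i * (X * rest ^ v)\<close> gmom_Hv
          deriv_rest_power[OF derivation_pderiv_mps] gmom_add gmom_of_nat_mult
        by simp
    qed
    then show ?thesis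
      by (simp only: right_diff_distrib mult_minus_right sum_subtractf sum_negf)
  qed
  also have "(\<Sum>v\<le>Suc M. ?c v * (of_nat v * gmom G (k + v) (X * pderiv_mps i rest * rest ^ (v - 1))))
      = (\<Sum>v\<le>M. ?c v * gmom G (Suc (k + v)) (X * pderiv_mps i rest * rest ^ v))"
    unfolding sum.atMost_Suc_shift
    by (simp add: mult.assoc[symmetric] fact_Suc_const del: of_nat_Suc fact_Suc)
  also have "(\<Sum>v\<le>Suc M. ?c v * gmom G (k + v) (pderiv_mps i X * rest ^ v)) = stat k (pderiv_mps i X)"
    by (rule stat_eq[symmetric]) (simp add: M_def)
  finally show ?thesis by simp
qed

text \<open>Wick's rule applied to Hv_i u_i Y: differentiating the u_i contributes n in total, the
  Euler operator on Y contributes 2 m, and \<open>quad\<close> carries a factor 1/2.\<close>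

lemma gmom_quad:
  "gmom G (Suc m) (quad * Y) = - const_mps (of_nat CARD('n) / 2 + of_nat m) * gmom G m Y"
proof -
  have "gmom G (Suc m) (quad * Y) = const_mps (1 / 2) * (\<Sum>i\<in>UNIV. gmom G (Suc m) (Hv i * (var_mps i * Y)))"
    by (simp add: quad_def mult.assoc gmom_const sum_distrib_right gmom_sum)
  also have "(\<Sum>i\<in>UNIV. gmom G (Suc m) (Hv i * (var_mps i * Y)))
      = - (of_nat CARD('n) * gmom G m Y + gmom G m (\<Sum>i\<in>UNIV. var_mps i * pderiv_mps i Y))"
    by (simp add: gmom_Hv pderiv_mps_mult pderiv_var_mps gmom_add gmom_sum sum.distrib sum_negf sum_subtractf)
  also have "\<dots> = - (of_nat (CARD('n) + 2 * m) * gmom G m Y)"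
    by (simp add: gmom_euler[of G, OF G_sym] algebra_simps)
  also have "const_mps (1 / 2) * \<dots> = - const_mps (of_nat CARD('n) / 2 + of_nat m) * gmom G m Y"
    unfolding const_mps_of_nat[symmetric] mult_minus_right mult.assoc[symmetric] const_mps_mult[symmetric]
    by (simp add: field_simps)
  finally show ?thesis .
qed

text \<open>The expansion starts with hbar^(n/2), and \<phi> exp(\<phi> / hbar) = - hbar^2 d/dhbar
  exp(\<phi> / hbar). Comparing powers of hbar gives the factor n/2 + k.\<close>

theorem stat_phase: "stat (Suc k) (\<phi> * X) = - const_mps (of_nat CARD('n) / 2 + of_nat k) * stat k X"
proof -
  define M where "M = 2 * Suc k"
  let ?c = "\<lambda>v. const_mps (1 / fact v) :: ('k, 'n) mps"
  have D: "\<phi> * X = quad * X + rest * X"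
    by (simp add: rest_def algebra_simps)
  have "stat (Suc k) (\<phi> * X)
      = (\<Sum>v\<le>Suc M. ?c v * gmom G (Suc (k + v)) (quad * X * rest ^ v))
        + (\<Sum>v\<le>M. ?c v * gmom G (k + Suc v) (X * rest ^ Suc v))"
    unfolding D additive_map.add[OF stat_additive]
    by (subst stat_eq[of _ "Suc M"], simp add: M_def, subst stat_eq[of _ M]) (simp_all add: M_def mult_ac)
  also have "(\<Sum>v\<le>M. ?c v * gmom G (k + Suc v) (X * rest ^ Suc v))
      = (\<Sum>v\<le>Suc M. ?c v * (of_nat v * gmom G (k + v) (X * rest ^ v)))"
    unfolding sum.atMost_Suc_shift
    by (simp add: mult.assoc[symmetric] fact_Suc_const del: of_nat_Suc fact_Suc power_Suc)
  also have "(\<Sum>v\<le>Suc M. ?c v * gmom G (Suc (k + v)) (quad * X * rest ^ v)) + \<dots>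
      = (\<Sum>v\<le>Suc M. - const_mps (of_nat CARD('n) / 2 + of_nat k) * (?c v * gmom G (k + v) (X * rest ^ v)))"
    unfolding sum.distrib[symmetric]
    by (rule sum.cong[OF refl])
       (simp only: mult.assoc[of quad] gmom_quad, simp add: const_mps_add const_mps_of_nat algebra_simps)
  also have "\<dots> = - const_mps (of_nat CARD('n) / 2 + of_nat k) * stat k X"
    by (subst stat_eq[of _ "Suc M"], simp add: M_def, simp only: sum_distrib_left)
  finally show ?thesis .
qed

text \<open>The last two terms come from the dependence of the phase on the base point.\<close>

theorem stat_derivation:
  assumes d: "derivation d" and dc: "\<And>c. d (const_mps c) = 0"
  shows "d (stat k X) = stat k (map_mps d X) + stat (Suc k) (X * map_mps d \<phi>)
     + const_mps (1 / 2) * (\<Sum>i\<in>UNIV. \<Sum>j\<in>UNIV. G i j * d (H j i)) * stat k X"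
proof -
  interpret derivation d by (rule d)
  interpret D: derivation "map_mps d :: (('k, 'n) mps, 'n) mps \<Rightarrow> _" by (rule map_mps_derivation)
  define M where "M = 2 * Suc k"
  \<comment> \<open>Half the logarithmic derivative of det H: the moments omit the factor
    det(H)^(-1/2) of the Gaussian integral, and this term accounts for its variation.\<close>
  define tr where "tr = const_mps (1 / 2) * (\<Sum>i\<in>UNIV. \<Sum>j\<in>UNIV. G i j * d (H j i))"
  \<comment> \<open>From G H = 1 one gets d G = - G (d H) G.\<close>
  define K where "K a b = (\<Sum>i\<in>UNIV. \<Sum>j\<in>UNIV. G a i * d (H i j) * G j b)" for a b
  have dG: "d (G a b) = - K a b" for a b
  proof -
    have z: "(\<Sum>j\<in>UNIV. d (G a j) * H j l) = - (\<Sum>j\<in>UNIV. G a j * d (H j l))" for l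
    proof -
      have "(\<Sum>j\<in>UNIV. d (G a j) * H j l) + (\<Sum>j\<in>UNIV. G a j * d (H j l)) = d (\<Sum>j\<in>UNIV. G a j * H j l)"
        by (simp add: sum mult sum.distrib)
      also have "\<dots> = 0" by (simp add: GH)
      finally show ?thesis by (simp add: eq_neg_iff_add_eq_0)
    qed
    have "d (G a b) = (\<Sum>j\<in>UNIV. d (G a j) * (\<Sum>l\<in>UNIV. H j l * G l b))"
      by (simp add: HG if_distrib cong: if_cong)
    also have "\<dots> = (\<Sum>l\<in>UNIV. (\<Sum>j\<in>UNIV. d (G a j) * H j l) * G l b)"
      unfolding sum_distrib_left sum_distrib_right by (subst sum.swap) (simp add: mult.assoc)
    also have "\<dots> = - K a b"
      unfolding z K_def by (subst sum.swap) (simp add: sum_negf sum_distrib_right)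
    finally show ?thesis .
  qed
  define \<beta> where "\<beta> = map_mps d quad"
  have \<beta>: "\<beta> = const_mps (const_mps (1 / 2)) *
      (\<Sum>i\<in>UNIV. \<Sum>j\<in>UNIV. const_mps (d (H i j)) * (var_mps i * var_mps j))"
    by (simp add: \<beta>_def quad_def Hv_def D.mult D.sum map_mps_const map_mps_var dc sum_distrib_right sum_distrib_left mult_ac)
  have lapK: "glap (\<lambda>i j. d (G i j)) Y = const_mps (const_mps (1 / 2)) *
      (\<Sum>a\<in>UNIV. \<Sum>b\<in>UNIV. const_mps (K a b) * pderiv_mps a (pderiv_mps b Y))" for Y :: "(('k, 'n) mps, 'n) mps"
    by (simp add: glap_def dG const_mps_uminus sum_negf)
  \<comment> \<open>Wick's rule twice: the two coordinates contract with each other, or both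
    contract with Y.\<close>
  have vv: "gmom G (Suc m) (var_mps i * (var_mps j * Y)) = - G i j * gmom G m Y
      + (case m of 0 \<Rightarrow> 0 | Suc l \<Rightarrow> (\<Sum>a\<in>UNIV. \<Sum>b\<in>UNIV. G i a * G j b * gmom G l (pderiv_mps a (pderiv_mps b Y))))"
    for m i j Y
  proof -
    have "gmom G (Suc m) (var_mps i * (var_mps j * Y))
       = - (\<Sum>a\<in>UNIV. G i a * gmom G m ((if a = j then Y else 0) + var_mps j * pderiv_mps a Y))"
      by (simp add: gmom_var[of G, OF G_sym] pderiv_mps_mult pderiv_var_mps if_distrib[of "\<lambda>x. x * _"] cong: if_cong)
    also have "\<dots> = - (\<Sum>a\<in>UNIV. if a = j then G i a * gmom G m Y else 0)
         - (\<Sum>a\<in>UNIV. G i a * gmom G m (var_mps j * pderiv_mps a Y))"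
      unfolding gmom_add distrib_left sum.distrib
      by (simp add: if_distrib[of "gmom G m"] if_distrib[of "\<lambda>x. _ * x"] additive_map.zero[OF gmom_additive] cong: if_cong)
    also have "(\<Sum>a\<in>UNIV. G i a * gmom G m (var_mps j * pderiv_mps a Y)) =
       - (case m of 0 \<Rightarrow> 0 | Suc l \<Rightarrow> (\<Sum>a\<in>UNIV. \<Sum>b\<in>UNIV. G i a * G j b * gmom G l (pderiv_mps a (pderiv_mps b Y))))"
      by (cases m) (auto simp: gmom_var[of G, OF G_sym] sum_distrib_left sum_negf mult.assoc pderiv_mps_commute)
    finally show ?thesis by simp
  qed
  \<comment> \<open>The heat equation for the Gaussian: a change of covariance amounts to inserting
    the derivative of the quadratic form, up to the trace term.\<close>
  have key: "gmom G (Suc m) (\<beta> * Y) + tr * gmom G m Y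
      = (case m of 0 \<Rightarrow> 0 | Suc l \<Rightarrow> gmom G l (glap (\<lambda>i j. d (G i j)) Y))" for m Y
  proof -
    have "gmom G (Suc m) (\<beta> * Y) = const_mps (1 / 2) *
       (\<Sum>i\<in>UNIV. \<Sum>j\<in>UNIV. d (H i j) * gmom G (Suc m) (var_mps i * (var_mps j * Y)))"
      by (simp add: \<beta> mult.assoc gmom_const sum_distrib_right gmom_sum)
    also have "(\<Sum>i\<in>UNIV. \<Sum>j\<in>UNIV. d (H i j) * gmom G (Suc m) (var_mps i * (var_mps j * Y)))
      = - ((\<Sum>i\<in>UNIV. \<Sum>j\<in>UNIV. G i j * d (H j i)) * gmom G m Y)
        + (case m of 0 \<Rightarrow> 0 | Suc l \<Rightarrow> (\<Sum>a\<in>UNIV. \<Sum>b\<in>UNIV. K a b * gmom G l (pderiv_mps a (pderiv_mps b Y))))"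
    proof (cases m)
      case 0
      then show ?thesis
        unfolding vv by (simp add: sum_distrib_left sum_distrib_right sum_negf H_sym mult_ac)
    next
      case (Suc l)
      have "(\<Sum>i\<in>UNIV. \<Sum>j\<in>UNIV. d (H i j) * (\<Sum>a\<in>UNIV. \<Sum>b\<in>UNIV. G i a * G j b * gmom G l (pderiv_mps a (pderiv_mps b Y))))
        = (\<Sum>a\<in>UNIV. \<Sum>b\<in>UNIV. K a b * gmom G l (pderiv_mps a (pderiv_mps b Y)))"
      proof -
        have swap4: "(\<Sum>i\<in>UNIV. \<Sum>j\<in>UNIV. \<Sum>a\<in>UNIV. \<Sum>b\<in>UNIV. T i j a b) = (\<Sum>a\<in>UNIV. \<Sum>b\<in>UNIV. \<Sum>i\<in>UNIV. \<Sum>j\<in>UNIV. T i j a b)"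
          for T :: "'n \<Rightarrow> 'n \<Rightarrow> 'n \<Rightarrow> 'n \<Rightarrow> ('k, 'n) mps"
        proof -
          have "(\<Sum>i\<in>UNIV. \<Sum>j\<in>UNIV. \<Sum>a\<in>UNIV. \<Sum>b\<in>UNIV. T i j a b) = (\<Sum>i\<in>UNIV. \<Sum>a\<in>UNIV. \<Sum>j\<in>UNIV. \<Sum>b\<in>UNIV. T i j a b)"
            by (rule sum.cong[OF refl], rule sum.swap)
          also have "\<dots> = (\<Sum>a\<in>UNIV. \<Sum>i\<in>UNIV. \<Sum>b\<in>UNIV. \<Sum>j\<in>UNIV. T i j a b)"
            by (subst sum.swap, rule sum.cong[OF refl], rule sum.cong[OF refl], rule sum.swap)
          also have "\<dots> = (\<Sum>a\<in>UNIV. \<Sum>b\<in>UNIV. \<Sum>i\<in>UNIV. \<Sum>j\<in>UNIV. T i j a b)"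
            by (rule sum.cong[OF refl], rule sum.swap)
          finally show ?thesis .
        qed
        show ?thesis
          unfolding sum_distrib_left K_def sum_distrib_right
          by (subst swap4) (intro sum.cong refl, simp add: G_sym mult_ac)
      qed
      then show ?thesis
        unfolding vv using Suc
        by (simp add: sum_distrib_left sum_distrib_right sum_negf H_sym algebra_simps sum.distrib sum_subtractf)
    qed
    finally show ?thesis
      by (cases m) (simp_all add: tr_def lapK gmom_const gmom_sum algebra_simps)
  qed
  let ?c = "\<lambda>v. const_mps (1 / fact v) :: ('k, 'n) mps"
  have step: "d (gmom G m Y) = gmom G m (map_mps d Y) + gmom G (Suc m) (\<beta> * Y) + tr * gmom G m Y" for m Y
    using gmom_derivation[of G, OF G_sym d dc, of m Y] key[of m Y] by (simp add: add.assoc)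
  have "d (stat k X) = (\<Sum>v\<le>Suc M. ?c v * d (gmom G (k + v) (X * rest ^ v)))"
    by (subst stat_eq[of _ "Suc M"], simp add: M_def, simp only: sum mult dc mult_zero_left add_0)
  also have "\<dots> = (\<Sum>v\<le>Suc M. ?c v * gmom G (k + v) (map_mps d X * rest ^ v))
      + (\<Sum>v\<le>Suc M. ?c v * (of_nat v * gmom G (k + v) (X * map_mps d rest * rest ^ (v - 1))))
      + (\<Sum>v\<le>Suc M. ?c v * gmom G (Suc k + v) (X * \<beta> * rest ^ v))
      + tr * (\<Sum>v\<le>Suc M. ?c v * gmom G (k + v) (X * rest ^ v))"
    unfolding step deriv_rest_power[OF map_mps_derivation] gmom_add gmom_of_nat_mult
      sum_distrib_left sum.distrib[symmetric]
    by (rule sum.cong[OF refl]) (simp add: algebra_simps)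
  also have "(\<Sum>v\<le>Suc M. ?c v * (of_nat v * gmom G (k + v) (X * map_mps d rest * rest ^ (v - 1))))
      = (\<Sum>v\<le>M. ?c v * gmom G (Suc k + v) (X * map_mps d rest * rest ^ v))"
    unfolding sum.atMost_Suc_shift
    by (simp add: mult.assoc[symmetric] fact_Suc_const del: of_nat_Suc fact_Suc)
  also have "\<dots> = stat (Suc k) (X * map_mps d rest)"
    by (rule stat_eq[symmetric]) (simp add: M_def)
  also have "(\<Sum>v\<le>Suc M. ?c v * gmom G (Suc k + v) (X * \<beta> * rest ^ v)) = stat (Suc k) (X * \<beta>)"
    by (rule stat_eq[symmetric]) (simp add: M_def)
  also have "(\<Sum>v\<le>Suc M. ?c v * gmom G (k + v) (map_mps d X * rest ^ v)) = stat k (map_mps d X)"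
    by (rule stat_eq[symmetric]) (simp add: M_def)
  also have "(\<Sum>v\<le>Suc M. ?c v * gmom G (k + v) (X * rest ^ v)) = stat k X"
    by (rule stat_eq[symmetric]) (simp add: M_def)
  also have "stat k (map_mps d X) + stat (Suc k) (X * map_mps d rest) + stat (Suc k) (X * \<beta>) + tr * stat k X
     = stat k (map_mps d X) + stat (Suc k) (X * map_mps d \<phi>) + tr * stat k X"
    by (simp add: \<beta>_def rest_def D.diff right_diff_distrib additive_map.diff[OF stat_additive])
  finally show ?thesis by (simp add: tr_def)
qed

end

section \<open>Evaluation of polynomials\<close>

lemma eval_mpoly_superset:
  fixes \<phi> :: "'a::comm_ring_1 \<Rightarrow> 'b::comm_ring_1"
  assumes "ring_hom_1 \<phi>" "finite A" "keys F \<subseteq> A"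
  shows "eval_mpoly \<phi> F x = (\<Sum>m\<in>A. \<phi> (lookup F m) * (\<Prod>i\<in>UNIV. x i ^ lookup m i))"
proof -
  interpret ring_hom_1 \<phi> by fact
  show ?thesis unfolding eval_mpoly_def
    by (rule sum.mono_neutral_left) (use assms in \<open>auto simp: in_keys_iff\<close>)
qed

lemma eval_mpoly_single:
  assumes "ring_hom_1 \<phi>"
  shows "eval_mpoly \<phi> (Poly_Mapping.single m c) x = \<phi> c * (\<Prod>i\<in>UNIV. x i ^ lookup m i)"
  by (subst eval_mpoly_superset[OF assms, of "{m}"]) auto

lemma eval_mpoly_hom:
  fixes \<phi> :: "'a::comm_ring_1 \<Rightarrow> 'b::comm_ring_1" and x :: "'v::finite \<Rightarrow> 'b"
  assumes "ring_hom_1 \<phi>"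
  shows "ring_hom_1 (\<lambda>F. eval_mpoly \<phi> F x)"
proof -
  interpret \<phi>: ring_hom_1 \<phi> by fact
  have add: "eval_mpoly \<phi> (F + G) x = eval_mpoly \<phi> F x + eval_mpoly \<phi> G x" for F G
  proof -
    have "finite (keys F \<union> keys G)" "keys (F + G) \<subseteq> keys F \<union> keys G"
      using Poly_Mapping.keys_add[of F G] by auto
    then show ?thesis
      by (simp add: eval_mpoly_superset[OF assms, of "keys F \<union> keys G"] lookup_add \<phi>.add
          distrib_right sum.distrib)
  qed
  interpret A: additive_map "\<lambda>F. eval_mpoly \<phi> F x" by standard (rule add)
  have upd: "Poly_Mapping.update m c F = F + Poly_Mapping.single m c" if "m \<notin> keys F" for m c and F :: "('a, 'v) mpoly"
    using that by (intro poly_mapping_eqI) (auto simp: lookup_add lookup_update lookup_single in_keys_iff when_def)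
  have mult: "eval_mpoly \<phi> (F * G) x = eval_mpoly \<phi> F x * eval_mpoly \<phi> G x" for F G
  proof (induction F rule: Poly_Mapping.update_induct)
    case const
    then show ?case by simp
  next
    case (update F m c)
    have "eval_mpoly \<phi> (Poly_Mapping.single m c * G) x = eval_mpoly \<phi> (Poly_Mapping.single m c) x * eval_mpoly \<phi> G x"
    proof (induction G rule: Poly_Mapping.update_induct)
      case const
      then show ?case by simp
    next
      case (update G m' c')
      have "eval_mpoly \<phi> (Poly_Mapping.single m c * Poly_Mapping.single m' c') x
          = eval_mpoly \<phi> (Poly_Mapping.single m c) x * eval_mpoly \<phi> (Poly_Mapping.single m' c') x"
        by (simp add: mult_single eval_mpoly_single[OF assms] \<phi>.mult lookup_add power_add prod.distrib mult_ac)
      then show ?case using update by (simp add: upd distrib_left add)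
    qed
    then show ?case using update by (simp add: upd distrib_right add)
  qed
  have "eval_mpoly \<phi> 1 x = 1"
    by (simp flip: single_one add: eval_mpoly_single[OF assms])
  then show ?thesis by unfold_locales (use mult in auto)
qed

abbreviation mconst :: "'a::comm_ring_1 \<Rightarrow> ('a, 'v) mpoly" where
  "mconst c \<equiv> Poly_Mapping.single 0 c"

abbreviation mvar :: "'v \<Rightarrow> ('a::comm_ring_1, 'v) mpoly" where
  "mvar i \<equiv> Poly_Mapping.single (Poly_Mapping.single i 1) 1"

lemma ring_hom_mconst: "ring_hom_1 (mconst :: 'a::comm_ring_1 \<Rightarrow> ('a, 'v) mpoly)"
  by standard (simp_all add: single_add mult_single)

lemma eval_mconst: "ring_hom_1 \<phi> \<Longrightarrow> eval_mpoly \<phi> (mconst c) x = \<phi> c"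
  by (simp add: eval_mpoly_single)

lemma eval_mvar: "ring_hom_1 \<phi> \<Longrightarrow> eval_mpoly \<phi> (mvar i) x = x i"
proof -
  assume a: "ring_hom_1 \<phi>"
  have "(\<Prod>j\<in>UNIV. x j ^ lookup (Poly_Mapping.single i (1::nat)) j) = (\<Prod>j\<in>UNIV. if j = i then x j else 1)"
    by (rule prod.cong) (auto simp: lookup_single when_def)
  also have "\<dots> = x i" by simp
  finally show ?thesis using a by (simp add: eval_mpoly_single ring_hom_1.one del: One_nat_def)
qed

lemma ring_hom_eval_mpoly:
  assumes "ring_hom_1 \<phi>" "ring_hom_1 h"
  shows "h (eval_mpoly \<phi> F x) = eval_mpoly (\<lambda>c. h (\<phi> c)) F (\<lambda>i. h (x i))"
proof -
  interpret h: ring_hom_1 h by fact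
  show ?thesis unfolding eval_mpoly_def by (simp add: h.sum h.mult h.prod h.power)
qed

section \<open>Normally ordered differential operators\<close>

text \<open>An abstract representation of the Weyl algebra, for coordinates that are functions on
  the ring rather than its series variables, such as the homogeneous coordinates of the
  cone.\<close>

locale weyl =
  fixes d :: "'i::finite \<Rightarrow> 'r::{idom, ring_char_0} \<Rightarrow> 'r" and u :: "'i \<Rightarrow> 'r"
  assumes der: "derivation (d i)"
    and d_commute: "d i (d j x) = d j (d i x)"
    and d_u: "d i (u j) = (if i = j then 1 else 0)"
begin

sublocale D: derivation "d i" for i by (rule der)

text \<open>\<open>NO [m\<^sub>1, \<dots>, m\<^sub>k] = \<Sum> u\<^sub>i\<^sub>1 \<cdots> u\<^sub>i\<^sub>k d\<^sub>i\<^sub>1\<^bsup>m\<^sub>1\<^esup> \<cdots> d\<^sub>i\<^sub>k\<^bsup>m\<^sub>k\<^esup>\<close>.\<close>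

primrec NO :: "nat list \<Rightarrow> 'r \<Rightarrow> 'r" where
  "NO [] X = X"
| "NO (m # ms) X = (\<Sum>i\<in>UNIV. u i * NO ms ((d i ^^ m) X))"

definition "w = (\<Sum>i\<in>UNIV. u i)"

definition "is_const c \<longleftrightarrow> (\<forall>i. d i c = 0)"

lemma pow_additive: "additive_map (d i ^^ m)"
  by standard (induction m, auto simp: D.add)

lemmas pow_add = additive_map.add[OF pow_additive]
lemmas pow_sum = additive_map.sum[OF pow_additive]
lemmas pow_0 [simp] = additive_map.zero[OF pow_additive]

lemma d_d_d: "d i (d j (d j X)) = d j (d j (d i X))"
  by (metis d_commute)

lemma pow_d_commute: "(d i ^^ m) (d j X) = d j ((d i ^^ m) X)"
  by (induction m) (auto simp: d_commute)

lemma pow_pow_commute: "(d i ^^ m) ((d j ^^ l) X) = (d j ^^ l) ((d i ^^ m) X)"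
  by (induction l) (auto simp: pow_d_commute)

lemma pow_const: "is_const c \<Longrightarrow> (d i ^^ m) (c * X) = c * (d i ^^ m) X"
  by (induction m) (auto simp: D.mult is_const_def)

lemma pow_u: "(d i ^^ m) (u j * X) = u j * (d i ^^ m) X + (if i = j then of_nat m * (d i ^^ (m - 1)) X else 0)"
proof (induction m)
  case (Suc m)
  then show ?case by (cases m) (auto simp: D.mult D.add d_u algebra_simps)
qed simp

lemma NO_additive: "additive_map (NO ms)"
proof
  show "NO ms (X + Y) = NO ms X + NO ms Y" for X Y
    by (induction ms arbitrary: X Y) (auto simp: pow_add distrib_left sum.distrib)
qed

lemmas NO_add = additive_map.add[OF NO_additive]
lemmas NO_0 [simp] = additive_map.zero[OF NO_additive]
lemmas NO_of_nat = additive_map.of_nat_mult[OF NO_additive]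

lemma NO_const: "is_const c \<Longrightarrow> NO ms (c * X) = c * NO ms X"
  by (induction ms arbitrary: X) (auto simp: pow_const sum_distrib_left mult.left_commute)

lemma NO_swap: "NO (a # b # ms) X = NO (b # a # ms) X"
  by (simp add: sum_distrib_left)
     (subst sum.swap, simp add: pow_pow_commute[where m = a and l = b] mult.left_commute)

text \<open>Normal ordering: \<open>NO [m]\<close> is linear in the coordinates, so at most one
  derivative of \<open>ms\<close> hits its u. A hit on entry p uses up one of \<open>ms ! p\<close>
  equal derivatives and merges the others with d^m; for \<open>ms ! p = 0\<close> the coefficient
  kills the truncated difference.\<close>

lemma NO_NO1:
  "NO ms (NO [m] X) = NO (m # ms) X + (\<Sum>p<length ms. of_nat (ms ! p) * NO (ms[p := ms ! p - 1 + m]) X)"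
proof (induction ms arbitrary: X)
  case (Cons a ms)
  have pow: "(d i ^^ a) (NO [m] X) = NO [m] ((d i ^^ a) X) + of_nat a * (d i ^^ (a - 1 + m)) X" for i
    by (simp add: pow_sum pow_u sum.distrib pow_pow_commute[where m = a and l = m] funpow_add)
  have "NO (a # ms) (NO [m] X)
      = (\<Sum>i\<in>UNIV. u i * NO ms (NO [m] ((d i ^^ a) X))) + of_nat a * NO ((a - 1 + m) # ms) X"
    by (simp only: NO.simps(2)[of a] pow NO_add NO_of_nat distrib_left sum.distrib NO.simps(2)[of "a - 1 + m"]
        sum_distrib_left mult.left_commute)
  also have "(\<Sum>i\<in>UNIV. u i * NO ms (NO [m] ((d i ^^ a) X)))
      = NO (a # m # ms) X + (\<Sum>p<length ms. of_nat (ms ! p) * NO (a # ms[p := ms ! p - 1 + m]) X)"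
    unfolding Cons.IH distrib_left sum.distrib NO.simps(2)[of a] sum_distrib_left
    by (subst sum.swap) (simp add: mult.left_commute)
  finally show ?case
    by (simp only: NO_swap[of a m] sum.lessThan_Suc_shift length_Cons nth_Cons_0 nth_Cons_Suc list_update_code add_ac)
qed simp

lemma NO_zero_entry: "NO (0 # ms) X = w * NO ms X"
  by (simp add: w_def sum_distrib_right)

lemma NO_filter: "NO ms X = w ^ length (filter (\<lambda>m. m = 0) ms) * NO (filter ((\<noteq>) 0) ms) X"
proof (induction ms arbitrary: X)
  case (Cons m ms)
  show ?case
  proof (cases m)
    case 0
    then show ?thesis using Cons[of X] by (simp only: NO_zero_entry) simp
  next
    case (Suc l)
    have "NO (m # ms) X = (\<Sum>i\<in>UNIV. u i * (w ^ length (filter (\<lambda>m. m = 0) ms) * NO (filter ((\<noteq>) 0) ms) ((d i ^^ m) X)))"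
      using Cons by simp
    then show ?thesis using Suc by (simp add: sum_distrib_left mult.left_commute)
  qed
qed simp

definition "annihilated q \<longleftrightarrow> (\<forall>k\<ge>1. NO [k] q = 0)"

text \<open>Solve \<open>NO_NO1\<close> for its leading term: the left side vanishes, and the
  corrections are shorter products whose entries stay positive because m >= 1.\<close>

lemma NO_annihilated_pos:
  assumes q: "annihilated q"
  shows "ms \<noteq> [] \<Longrightarrow> 0 \<notin> set ms \<Longrightarrow> NO ms q = 0"
proof (induction "length ms" arbitrary: ms rule: less_induct)
  case less
  obtain m ms' where ms: "ms = m # ms'" using less.prems by (cases ms) auto
  have m: "m \<ge> 1" using less.prems ms by auto
  have "NO (ms'[p := ms' ! p - 1 + m]) q = 0" if p: "p < length ms'" for p
  proof (rule less.hyps)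
    show "0 \<notin> set (ms'[p := ms' ! p - 1 + m])"
      using set_update_subset_insert[of ms' p "ms' ! p - 1 + m"] less.prems m ms by auto
  qed (use p ms in auto)
  then have "NO ms' (NO [m] q) = NO ms q"
    by (simp only: NO_NO1 ms) simp
  then show ?case using q m by (simp only: annihilated_def) simp
qed

lemma NO_annihilated: "annihilated q \<Longrightarrow> sum_list ms > 0 \<Longrightarrow> NO ms q = 0"
proof -
  assume q: "annihilated q" and s: "sum_list ms > 0"
  have "filter ((\<noteq>) 0) ms \<noteq> []" using s by (induction ms) auto
  then have "NO (filter ((\<noteq>) 0) ms) q = 0" by (rule NO_annihilated_pos[OF q]) auto
  then show ?thesis by (subst NO_filter) simp
qed

text \<open>w is \<open>NO [0]\<close>. By \<open>NO_NO1\<close> moving one factor w through lowers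
  the number of derivatives by at most one, so b factors cannot use up more than b
  derivatives.\<close>

lemma NO_w_power: "annihilated q \<Longrightarrow> sum_list ms > b \<Longrightarrow> NO ms (w ^ b * q) = 0"
proof (induction b arbitrary: ms)
  case 0
  then show ?case by (simp add: NO_annihilated)
next
  case (Suc b)
  have "NO (ms[p := ms ! p - 1]) (w ^ b * q) = 0" if "p < length ms" for p
    by (rule Suc.IH) (use Suc.prems that in \<open>auto simp: sum_list_update\<close>)
  moreover have "NO ms (w ^ b * q) = 0" using Suc by simp
  ultimately have "NO ms (NO [0] (w ^ b * q)) = 0"
    unfolding NO_NO1 by (simp add: NO_zero_entry del: NO.simps(2))
  moreover have "w ^ Suc b * q = NO [0] (w ^ b * q)"
    by (simp only: NO_zero_entry NO.simps(1)) (simp add: mult.assoc)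
  ultimately show ?case by (simp only:)
qed

section \<open>Commuting the normally ordered powers of sum u_i d_i^2 past quadratic forms\<close>

definition "N k = NO (replicate k 2)"

lemma N_0 [simp]: "N 0 X = X"
  by (simp add: N_def)

lemma N_Suc: "N (Suc k) X = (\<Sum>i\<in>UNIV. u i * N k (d i (d i X)))"
  by (simp add: N_def numeral_2_eq_2)

lemma N_additive: "additive_map (N k)"
  unfolding N_def by (rule NO_additive)

lemmas N_add = additive_map.add[OF N_additive]
lemmas N_sum = additive_map.sum[OF N_additive]
lemmas N_zero [simp] = additive_map.zero[OF N_additive]
lemmas N_of_nat = additive_map.of_nat_mult[OF N_additive]

lemma N_const: "is_const c \<Longrightarrow> N k (c * X) = c * N k X"
  by (simp add: N_def NO_const)

lemma N_u: "N k (u i * X) = u i * N k X + of_nat (2 * k) * (u i * N (k - 1) (d i X))"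
proof (induction k arbitrary: X)
  case (Suc k)
  have dd: "d j (d j (u i * X)) = u i * d j (d j X) + (if j = i then of_nat 2 * d i X else 0)" for j
    by (auto simp: D.mult D.add d_u)
  have "N (Suc k) (u i * X) = (\<Sum>j\<in>UNIV. u j * N k (u i * d j (d j X)))
      + (\<Sum>j\<in>UNIV. if j = i then u j * (of_nat 2 * N k (d i X)) else 0)"
    unfolding N_Suc dd N_add distrib_left sum.distrib
    by (simp only: if_distrib[of "N k"] N_of_nat N_zero if_distrib[of "\<lambda>x. _ * x"] mult_zero_right)
  also have "(\<Sum>j\<in>UNIV. u j * N k (u i * d j (d j X)))
      = u i * N (Suc k) X + of_nat (2 * k) * (u i * (\<Sum>j\<in>UNIV. u j * N (k - 1) (d j (d j (d i X)))))"
    unfolding Suc.IH N_Suc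
    by (simp add: sum_distrib_left sum.distrib algebra_simps d_d_d)
  also have "of_nat (2 * k) * (u i * (\<Sum>j\<in>UNIV. u j * N (k - 1) (d j (d j (d i X))))) = of_nat (2 * k) * (u i * N k (d i X))"
    by (cases k) (simp_all add: N_Suc)
  finally show ?case by (simp add: algebra_simps)
qed simp

lemma d_N: "d i (N k X) = N k (d i X) + of_nat k * N (k - 1) (d i (d i X))"
proof (induction k arbitrary: X)
  case (Suc k)
  have "d i (N (Suc k) X) = N k (d i (d i X)) + (\<Sum>j\<in>UNIV. u j * d i (N k (d j (d j X))))"
    by (simp add: N_Suc D.sum D.mult d_u sum.distrib if_distrib[of "\<lambda>x. x * _"] cong: if_cong)
  also have "(\<Sum>j\<in>UNIV. u j * d i (N k (d j (d j X))))
      = N (Suc k) (d i X) + of_nat k * (\<Sum>j\<in>UNIV. u j * N (k - 1) (d j (d j (d i (d i X)))))"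
    unfolding Suc.IH N_Suc
    by (simp add: sum_distrib_left sum.distrib algebra_simps d_d_d)
  also have "of_nat k * (\<Sum>j\<in>UNIV. u j * N (k - 1) (d j (d j (d i (d i X))))) = of_nat k * N k (d i (d i X))"
    by (cases k) (simp_all add: N_Suc)
  finally show ?case by (simp add: algebra_simps)
qed simp

text \<open>Applying \<open>N_u\<close> twice produces N_(k-1) d_i^2, which \<open>d_N\<close>
  absorbs into d_i N_k. Hence multiplication by u_i^2 raises the index from which the operators
  vanish by one and not by two.\<close>

lemma N_u_square:
  "N (Suc k) (u i ^ 2 * X) = u i ^ 2 * N (Suc k) X
     + of_nat (Suc k) * (4 * u i ^ 2 * d i (N k X) + 2 * u i * N k X)"
proof -
  have du: "d i (u i * Y) = Y + u i * d i Y" for Y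
    by (simp add: D.mult d_u)
  have "u i ^ 2 * X = u i * (u i * X)" by (simp add: power2_eq_square)
  then have "N (Suc k) (u i ^ 2 * X) = u i * (u i * N (Suc k) X + of_nat (2 * Suc k) * (u i * N k (d i X)))
      + of_nat (2 * Suc k) * (u i * (N k X + (u i * N k (d i X) + of_nat (2 * k) * (u i * N (k - 1) (d i (d i X))))))"
    by (simp only: N_u du N_add diff_Suc_1)
  then show ?thesis by (simp add: d_N power2_eq_square algebra_simps)
qed

definition "eventually_null e X \<longleftrightarrow> (\<forall>k\<ge>e. N k X = 0)"

lemma eventually_null_u_square: "eventually_null e X \<Longrightarrow> eventually_null (Suc e) (u i ^ 2 * X)"
  unfolding eventually_null_def
proof (intro allI impI)
  fix k assume X: "\<forall>k\<ge>e. N k X = 0" and "Suc e \<le> k"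
  then obtain k' where "k = Suc k'" "e \<le> k'" by (metis Suc_le_D Suc_le_mono)
  then show "N k (u i ^ 2 * X) = 0" using X by (simp add: N_u_square del: of_nat_Suc)
qed

lemma is_const_simps:
  "is_const 0" "is_const a \<Longrightarrow> is_const b \<Longrightarrow> is_const (a + b)" "is_const a \<Longrightarrow> is_const b \<Longrightarrow> is_const (a * b)"
  by (auto simp: is_const_def D.add D.mult)

text \<open>Q is a combination of squares, and each square costs one index.\<close>

theorem N_quadric_power:
  assumes q: "annihilated q" and c: "\<And>i. is_const (c i)" "is_const c'"
  defines "Q \<equiv> (\<Sum>i\<in>UNIV. c i * u i ^ 2) + c' * w ^ 2"
  shows "N (Suc m) (Q ^ m * (w * q)) = 0"
proof -
  \<comment> \<open>The factor w^(2b) absorbs the term w^2 of Q into its exponent. For m = 0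
    derivatives are counted: \<open>N k\<close> has 2 k of them, more than 2 b + 1 when k >= b +
    1.\<close>
  have "eventually_null (m + b + 1) (w ^ (2 * b) * (Q ^ m * (w * q)))" for b
  proof (induction m arbitrary: b)
    case 0
    have "N k (w ^ (2 * b) * (w * q)) = 0" if "k \<ge> b + 1" for k
    proof -
      have "NO (replicate k 2) (w ^ (2 * b + 1) * q) = 0"
        by (rule NO_w_power[OF q]) (use that in \<open>auto simp: sum_list_replicate\<close>)
      then show ?thesis by (simp add: N_def mult_ac)
    qed
    then show ?case by (simp add: eventually_null_def)
  next
    case (Suc m)
    let ?F = "Q ^ m * (w * q)"
    have eq: "w ^ (2 * b) * (Q ^ Suc m * (w * q))
       = (\<Sum>i\<in>UNIV. c i * (u i ^ 2 * (w ^ (2 * b) * ?F))) + c' * (w ^ (2 * Suc b) * ?F)"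
    proof -
      define R where "R = w ^ (2 * b) * ?F"
      have "w ^ (2 * b) * (Q ^ Suc m * (w * q)) = Q * R" by (simp add: R_def mult_ac)
      also have "\<dots> = (\<Sum>i\<in>UNIV. c i * (u i ^ 2 * R)) + c' * (w ^ 2 * R)"
        by (simp add: Q_def distrib_right sum_distrib_right mult.assoc)
      finally show ?thesis by (simp add: R_def power_add mult.assoc power2_eq_square)
    qed
    have "eventually_null (Suc (m + b + 1)) (u i ^ 2 * (w ^ (2 * b) * ?F))" for i
      by (rule eventually_null_u_square[OF Suc.IH])
    moreover have "eventually_null (m + Suc b + 1) (w ^ (2 * Suc b) * ?F)" by (rule Suc.IH)
    ultimately show ?case
      unfolding eq eventually_null_def by (auto simp: N_add N_sum N_const c)
  qed
  from this[of 0] show ?thesis by (simp add: eventually_null_def)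
qed

theorem witt_generation:
  assumes P: "NO [1] P = P" and N1: "N 1 P = 0"
    and c: "\<And>i. is_const (c i)" "is_const c'"
    and N2: "N 2 (((\<Sum>i\<in>UNIV. c i * u i ^ 2) + c' * w ^ 2) * P) = 0"
    and nz: "(\<Sum>i\<in>UNIV. c i * u i ^ 2) + c' * w ^ 2 \<noteq> 0"
    and k: "k \<ge> 2"
  shows "NO [k] P = 0"
proof -
  have two: "NO [2] P = 0" using N1 by (simp add: N_def)
  \<comment> \<open>As \<open>NO [1] P = P\<close>, contracting the Euler operator with
    \<open>ms\<close> counts the derivatives in \<open>ms\<close>.\<close>
  have one: "NO (1 # ms) P = (1 - of_nat (sum_list ms)) * NO ms P" for ms
  proof -
    have "ms[p := ms ! p - 1 + 1] = ms \<or> ms ! p = 0" if "p < length ms" for p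
      using that by (cases "ms ! p = 0") auto
    then have "of_nat (ms ! p) * NO (ms[p := ms ! p - 1 + 1]) P = of_nat (ms ! p) * NO ms P" if "p < length ms" for p
      using that by (metis mult_zero_left of_nat_0)
    then have "NO ms (NO [1] P) = NO (1 # ms) P + (\<Sum>p<length ms. of_nat (ms ! p) * NO ms P)"
      unfolding NO_NO1 by (intro arg_cong2[of _ _ _ _ "(+)"] refl sum.cong) auto
    also have "(\<Sum>p<length ms. of_nat (ms ! p) * NO ms P) = of_nat (sum_list ms) * NO ms P"
      by (simp add: sum_list_sum_nth sum_distrib_right atLeast0LessThan)
    finally have "NO ms (NO [1] P) = NO (1 # ms) P + of_nat (sum_list ms) * NO ms P" .
    then show ?thesis unfolding P left_diff_distrib mult_1_left eq_diff_eq by (rule sym)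
  qed
  \<comment> \<open>N_1 P = 0 removes the correction in \<open>N_u_square\<close>, so u_i^2 passes
    through N_2. The same is shown for w^2; then Q factors out and is cancelled.\<close>
  have "N 2 (u i ^ 2 * P) = u i ^ 2 * N 2 P" for i
    using N_u_square[of 1 i P] N1 by (simp add: numeral_2_eq_2)
  moreover have "N 2 (w ^ 2 * P) = w ^ 2 * N 2 P"
  proof -
    have w1: "NO ms (w * X) = w * NO ms X + (\<Sum>p<length ms. of_nat (ms ! p) * NO (ms[p := ms ! p - 1]) X)" for ms X
      using NO_NO1[of ms 0 X] by (simp only: NO_zero_entry) simp
    have z: "NO [1, 2] P = 0" "NO [1, 1] P = 0" "NO [0, 2] P = 0" "NO [2, 0] P = 0"
      using one[of "[2]"] one[of "[1]"] two P by (simp_all only: NO_zero_entry NO_swap[of 2 0]) simp_all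
    have e1: "NO [2, 2] (w * X) = w * NO [2, 2] X + 4 * NO [1, 2] X" for X
      using NO_swap[of 2 1 "[]" X] by (simp only: w1) (simp add: lessThan_Suc del: NO.simps)
    have e2: "NO [1, 2] (w * P) = 0"
      using z by (simp only: w1) (simp add: lessThan_Suc del: NO.simps)
    have r: "replicate 2 (2::nat) = [2, 2]" by (simp add: numeral_2_eq_2)
    have "NO [2, 2] (w * (w * P)) = w * (w * NO [2, 2] P)"
      unfolding e1 e2 using z by (simp add: distrib_left del: NO.simps)
    then show ?thesis unfolding N_def r by (simp add: power2_eq_square mult.assoc del: NO.simps)
  qed
  ultimately have "((\<Sum>i\<in>UNIV. c i * u i ^ 2) + c' * w ^ 2) * N 2 P = 0"
    using N2 by (simp add: distrib_right N_add N_sum sum_distrib_right N_const c mult.assoc)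
  then have N2P: "NO [2, 2] P = 0" using nz by (simp add: N_def numeral_2_eq_2)
  \<comment> \<open>L_2^2 = N_2 + 2 L_3: either of the two outer derivatives can hit the inner
    coordinate.\<close>
  have three: "NO [3] P = 0"
  proof -
    have "NO [2] (NO [2] P) = NO [2, 2] P + of_nat 2 * NO [3] P"
      by (subst NO_NO1) (simp add: lessThan_Suc numeral_3_eq_3 del: NO.simps)
    then show ?thesis by (simp only: two N2P) simp
  qed
  show ?thesis using k
  proof (induction k rule: dec_induct)
    case base
    then show ?case using two by simp
  next
    case (step k)
    show ?case
    \<comment> \<open>At k = 2 the commutator factor 2 - k is zero, hence the separate argument for
      L_3.\<close>
    proof (cases "k = 2")
      case True
      then show ?thesis using three by simp
    next
      case False
      have "NO [2] (NO [k] P) = NO [k, 2] P + of_nat 2 * NO [Suc k] P"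
        "NO [k] (NO [2] P) = NO [2, k] P + of_nat k * NO [Suc k] P"
        using step.hyps by (subst NO_NO1, simp add: lessThan_Suc del: NO.simps)+
      then have "of_nat 2 * NO [Suc k] P = of_nat k * NO [Suc k] P"
        unfolding step.IH two NO_swap[of k 2] NO_0 by (metis add_left_cancel)
      then have "(of_nat 2 - of_nat k :: 'r) * NO [Suc k] P = 0" by (simp only: left_diff_distrib diff_self)
      moreover have "of_nat 2 - of_nat k \<noteq> (0 :: 'r)"
        using False by (metis eq_iff_diff_eq_0 of_nat_eq_iff)
      ultimately show ?thesis by simp
    qed
  qed
qed

end

section \<open>The solutions attached to permutations\<close>

definition orderings :: "'i::finite list set" where
  "orderings = {xs. distinct xs \<and> set xs = UNIV}"

lemma finite_orderings [simp]: "finite (orderings :: 'i::finite list set)"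
proof (rule finite_subset)
  show "orderings \<subseteq> {xs :: 'i list. set xs \<subseteq> UNIV \<and> length xs \<le> CARD('i)}"
    by (auto simp: orderings_def intro: order.trans[OF _ card_mono] dest: distinct_card)
qed (rule finite_lists_length_le, simp)

lemma card_orderings: "card (orderings :: 'i::finite list set) = fact CARD('i)"
proof -
  have "orderings = {xs :: 'i list. length xs = CARD('i) \<and> distinct xs \<and> set xs \<subseteq> UNIV}"
    unfolding orderings_def by (auto simp: distinct_card[symmetric] intro: card_eq_UNIV_imp_eq_UNIV)
      (metis card_eq_UNIV_imp_eq_UNIV distinct_card finite_class.finite_UNIV UNIV_I)
  then show ?thesis
    using card_lists_distinct_length_eq[of "UNIV :: 'i set" "CARD('i)"] by (simp add: fact_prod)
qed

fun suffix_sets :: "'i list \<Rightarrow> 'i set set" where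
  "suffix_sets [] = {}"
| "suffix_sets (x # xs) = insert (set (x # xs)) (suffix_sets xs)"

lemma suffix_sets_subset: "S \<in> suffix_sets xs \<Longrightarrow> S \<subseteq> set xs \<and> S \<noteq> {}"
  by (induction xs) auto

lemma finite_suffix_sets [simp]: "finite (suffix_sets xs)"
  by (induction xs) auto

lemma not_in_suffix_sets: "distinct (x # xs) \<Longrightarrow> set (x # xs) \<notin> suffix_sets xs"
  using suffix_sets_subset[of "set (x # xs)" xs] by auto

context weyl
begin

lemma additive_recip:
  assumes "r * s = 1" "d i s = 0" shows "d i r = 0"
proof -
  have "d i (r * s) = 0" using assms(1) by simp
  then have "d i r * s = 0" using assms(2) by (simp add: D.mult)
  moreover have "s \<noteq> 0" using assms(1) by auto
  ultimately show ?thesis by simp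
qed

text \<open>With r S the reciprocal of the sum of u over S, this is the product of the u_x divided
  by the sum of u over x and the later entries. Reciprocals are an argument because the ring is not
  a field.\<close>

fun qf :: "('i set \<Rightarrow> 'r) \<Rightarrow> 'i list \<Rightarrow> 'r" where
  "qf r [] = 1"
| "qf r (x # xs) = u x * r (set (x # xs)) * qf r xs"

text \<open>Induction on the list: Y satisfies s Y = u_x q, where s is the sum of the coordinates in
  the list and q is free of u_x. Applying L_k for k >= 2 gives s L_k Y + k L_(k-1) Y on the left and
  a multiple of d_x^(k-1) q = 0 on the right. For k = 1 the correction is s Y, equal to the right
  side u_x q.\<close>

lemma qf_annihilated:
  assumes r: "\<And>S. S \<noteq> {} \<Longrightarrow> r S * (\<Sum>i\<in>S. u i) = 1"
  shows "distinct xs \<Longrightarrow> annihilated (qf r xs) \<and> (\<forall>i. i \<notin> set xs \<longrightarrow> d i (qf r xs) = 0)"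
proof (induction xs)
  case Nil
  have "(d i ^^ k) 1 = 0" if "k \<ge> 1" for i k
    using that by (cases k) (auto simp del: funpow.simps simp: funpow_Suc_right)
  then show ?case by (simp add: annihilated_def)
next
  case (Cons x xs)
  define S where "S = set (x # xs)"
  define s where "s = (\<Sum>i\<in>S. u i)"
  define q where "q = qf r xs"
  define Y where "Y = qf r (x # xs)"
  have x: "x \<notin> set xs" and IH: "annihilated q" "\<And>i. i \<notin> set xs \<Longrightarrow> d i q = 0"
    using Cons by (auto simp: q_def)
  have rs: "r S * s = 1" unfolding s_def by (rule r) (simp add: S_def)
  have s0: "s \<noteq> 0" using rs by auto
  have ds: "d i s = (if i \<in> S then 1 else 0)" for i
    by (simp add: s_def D.sum d_u)
  have Y_eq: "Y = u x * r S * q" by (simp add: Y_def q_def S_def)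
  have sY: "s * Y = u x * q" using rs by (simp add: Y_eq algebra_simps)
  have dY: "d i Y = 0" if "i \<notin> S" for i
  proof -
    have "d i (r S) = 0" using additive_recip[OF rs] ds that by simp
    moreover have "d i (u x) = 0" "d i q = 0" using that IH x by (auto simp: d_u S_def)
    ultimately show ?thesis by (simp add: Y_eq D.mult)
  qed
  have pow_s: "(d i ^^ k) (s * Y) = s * (d i ^^ k) Y + (if i \<in> S then of_nat k * (d i ^^ (k - 1)) Y else 0)" for i k
    unfolding s_def sum_distrib_right pow_sum pow_u sum.distrib by simp
  have pow_Y: "(d i ^^ k) Y = 0" if "i \<notin> S" "k \<ge> 1" for i k
    using that dY by (cases k) (auto simp del: funpow.simps simp: funpow_Suc_right)
  have pow_q: "(d x ^^ k) q = 0" if "k \<ge> 1" for k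
    using that IH x by (cases k) (auto simp del: funpow.simps simp: funpow_Suc_right)
  have NO_s: "NO [k] (s * Y) = s * NO [k] Y + of_nat k * (\<Sum>i\<in>S. u i * (d i ^^ (k - 1)) Y)" for k
  proof -
    have "(\<Sum>i\<in>UNIV. u i * (if i \<in> S then of_nat k * (d i ^^ (k - 1)) Y else 0))
        = (\<Sum>i\<in>S. u i * (of_nat k * (d i ^^ (k - 1)) Y))"
      by (rule sum.mono_neutral_cong_right) auto
    then show ?thesis
      by (simp add: pow_s distrib_left sum.distrib sum_distrib_left mult.left_commute)
  qed
  have NO_q: "NO [k] (u x * q) = of_nat k * (u x * (d x ^^ (k - 1)) q)" if "k \<ge> 1" for k
  proof -
    have "NO [k] (u x * q) = u x * NO [k] q + of_nat k * (u x * (d x ^^ (k - 1)) q)"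
      by (simp add: pow_u distrib_left sum.distrib sum_distrib_left mult.left_commute
          if_distrib[of "\<lambda>x. _ * x"] cong: if_cong)
    then show ?thesis using IH(1) that by (simp add: annihilated_def del: NO.simps)
  qed
  have "NO [k] Y = 0" if "k \<ge> 1" for k
    using that
  proof (induction k rule: dec_induct)
    case base
    have "(\<Sum>i\<in>S. u i * (d i ^^ (1 - 1)) Y) = s * Y" by (simp add: s_def sum_distrib_right)
    then have "s * NO [1] Y + s * Y = u x * q"
      using NO_s[of 1] NO_q[of 1] unfolding sY by (simp del: NO.simps)
    then show ?case using s0 sY by (simp del: NO.simps)
  next
    case (step k)
    have "(\<Sum>i\<in>S. u i * (d i ^^ k) Y) = NO [k] Y"
      using pow_Y step.hyps by simp (rule sum.mono_neutral_left, auto)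
    then have "NO [Suc k] (s * Y) = s * NO [Suc k] Y"
      using NO_s[of "Suc k"] step.IH by (simp del: NO.simps)
    moreover have "NO [Suc k] (s * Y) = 0"
      unfolding sY using NO_q[of "Suc k"] pow_q step.hyps by (simp del: NO.simps)
    ultimately show ?case using s0 by (simp del: NO.simps)
  qed
  then show ?case using dY by (auto simp: annihilated_def Y_def S_def simp del: NO.simps)
qed

lemma qf_denominators:
  assumes r: "\<And>S. S \<noteq> {} \<Longrightarrow> r S * (\<Sum>i\<in>S. u i) = 1"
  shows "distinct xs \<Longrightarrow> qf r xs * (\<Prod>S\<in>suffix_sets xs. \<Sum>i\<in>S. u i) = (\<Prod>x\<in>set xs. u x)"
proof (induction xs)
  case (Cons x xs)
  then have "qf r (x # xs) * (\<Prod>S\<in>suffix_sets (x # xs). \<Sum>i\<in>S. u i)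
     = (r (set (x # xs)) * (\<Sum>i\<in>set (x # xs). u i)) * u x * (qf r xs * (\<Prod>S\<in>suffix_sets xs. \<Sum>i\<in>S. u i))"
    using not_in_suffix_sets[OF Cons.prems] by simp
  also have "\<dots> = (\<Prod>x\<in>set (x # xs). u x)"
    using Cons r[of "set (x # xs)"] by simp
  finally show ?case .
qed simp

section \<open>Algebraic independence of the coordinates over the constants\<close>

lemma transcendental_one:
  assumes "\<And>k. d x (F k) = 0" "(\<Sum>k<K. u x ^ k * F k) = 0" "k < K"
  shows "F k = 0"
  using assms
proof (induction K arbitrary: F k)
  case (Suc K)
  have "d x (\<Sum>k<Suc K. u x ^ k * F k) = (\<Sum>k<K. u x ^ k * (of_nat (Suc k) * F (Suc k)))"
    unfolding sum.lessThan_Suc_shift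
    by (simp add: D.add D.sum D.mult Suc.prems(1) D.power d_u mult_ac del: power_Suc of_nat_Suc)
  then have z: "(\<Sum>k<K. u x ^ k * (of_nat (Suc k) * F (Suc k))) = 0"
    using Suc.prems(2) by simp
  have vanish: "of_nat (Suc k) * F (Suc k) = 0" if "k < K" for k
  proof (rule Suc.IH[of "\<lambda>k. of_nat (Suc k) * F (Suc k)"])
    show "d x (of_nat (Suc k) * F (Suc k)) = 0" for k
      by (simp only: D.of_nat_mult Suc.prems(1) mult_zero_right)
  qed (use that z in auto)
  have pos: "F (Suc k) = 0" if "k < K" for k
    using vanish[OF that] by (simp del: of_nat_Suc)
  then have "F 0 = 0" using Suc.prems(2) unfolding sum.lessThan_Suc_shift by simp
  then show ?case using pos Suc.prems(3) by (cases k) auto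
qed simp

text \<open>One coordinate at a time, grouping monomials by the exponent of x. The third assumption
  says that the exponents on A tell the monomials apart; inside a group it persists after removing
  x.\<close>

lemma transcendental:
  assumes "finite A" "finite M" "\<And>m m'. m \<in> M \<Longrightarrow> m' \<in> M \<Longrightarrow> \<forall>i\<in>A. lookup m i = lookup m' i \<Longrightarrow> m = m'"
    and "\<And>m. m \<in> M \<Longrightarrow> is_const (c m)" "(\<Sum>m\<in>M. c m * (\<Prod>i\<in>A. u i ^ lookup m i)) = 0" "m \<in> M"
  shows "c m = 0"
  using assms
proof (induction A arbitrary: M m rule: finite_induct)
  case empty
  then have "M = {m}" by auto
  then show ?case using empty by simp
next
  case (insert x A)
  define K where "K = Suc (Max ((\<lambda>m. lookup m x) ` M))"
  define F where "F k = (\<Sum>m\<in>{m \<in> M. lookup m x = k}. c m * (\<Prod>i\<in>A. u i ^ lookup m i))" for k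
  have K: "lookup m x < K" if "m \<in> M" for m
    using that insert.prems(1) by (simp add: K_def less_Suc_eq_le)
  have "(\<Sum>k<K. u x ^ k * F k) = (\<Sum>k<K. \<Sum>m\<in>{m \<in> M. lookup m x = k}. c m * (\<Prod>i\<in>insert x A. u i ^ lookup m i))"
    using insert.hyps by (simp add: F_def sum_distrib_left mult_ac)
  also have "\<dots> = (\<Sum>m\<in>M. c m * (\<Prod>i\<in>insert x A. u i ^ lookup m i))"
    by (rule sum.group) (use insert.prems K in auto)
  finally have "(\<Sum>k<K. u x ^ k * F k) = 0" using insert.prems by simp
  moreover have "d x (F k) = 0" for k
  proof -
    have pw: "d x (u i ^ l) = 0" if "i \<in> A" for i l
      using that insert.hyps by (cases l) (auto simp: D.power d_u simp del: power_Suc)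
    have "d x (\<Prod>i\<in>B. u i ^ lookup m i) = 0" if "B \<subseteq> A" for m B
      using finite_subset[OF that insert.hyps(1)] that
      by (induction B rule: finite_induct) (auto simp: D.mult pw)
    then show ?thesis
      using insert.prems(3) by (auto simp: F_def D.sum D.mult is_const_def intro!: sum.neutral)
  qed
  ultimately have "F (lookup m x) = 0"
    using transcendental_one[of x F K] K insert.prems(5) by blast
  then show ?case
    unfolding F_def by (intro insert.IH[of "{m' \<in> M. lookup m' x = lookup m x}" m]) (use insert.prems in auto)
qed

lemma eval_mpoly_inj:
  assumes "ring_hom_1 \<kappa>" "\<And>c. is_const (\<kappa> c)" "\<And>c. \<kappa> c = 0 \<Longrightarrow> c = 0" "eval_mpoly \<kappa> \<Phi> u = 0"
  shows "\<Phi> = 0"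
proof (rule ccontr)
  assume "\<Phi> \<noteq> 0"
  then obtain m where m: "m \<in> keys \<Phi>" by (metis keys_eq_empty all_not_in_conv)
  have "\<kappa> (lookup \<Phi> m) = 0"
    by (rule transcendental[of UNIV "keys \<Phi>" "\<lambda>m. \<kappa> (lookup \<Phi> m)" m])
       (use assms m in \<open>auto simp: eval_mpoly_def intro: poly_mapping_eqI\<close>)
  then show False using assms(3) m by (auto simp: in_keys_iff)
qed

end

text \<open>Specialising \<open>u\<^sub>i\<close> to \<open>X\<^bsup>e i\<^esup>\<close> and letting \<open>X\<close> tend to \<open>0\<close> makes the solution belonging to the
  ordering by \<open>e\<close> tend to \<open>1\<close> and all others to \<open>0\<close>.\<close>

lemma fps_monomial_ratio:
  fixes e :: "'i \<Rightarrow> nat"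
  assumes S: "finite S" "x \<in> S" and inj: "inj_on e S"
  shows "\<exists>y :: 'k::field fps. fps_X ^ e x = y * (\<Sum>i\<in>S. fps_X ^ e i) \<and>
           fps_nth y 0 = (if \<forall>i\<in>S. e x \<le> e i then 1 else 0)"
proof -
  define m where "m = Min (e ` S)"
  have "m \<in> e ` S" unfolding m_def using S by (intro Min_in) auto
  then obtain z where z: "z \<in> S" "e z = m" by auto
  have le: "m \<le> e i" if "i \<in> S" for i using that S by (simp add: m_def)
  define g :: "'k fps" where "g = (\<Sum>i\<in>S. fps_X ^ (e i - m))"
  have "fps_nth g 0 = (\<Sum>i\<in>S. if i = z then 1 else 0)"
    unfolding g_def fps_sum_nth
  proof (rule sum.cong[OF refl])
    fix i assume i: "i \<in> S"
    have "e i - m = 0 \<longleftrightarrow> i = z" using i z le[OF i] inj by (auto simp: inj_on_def)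
    then show "fps_nth (fps_X ^ (e i - m) :: 'k fps) 0 = (if i = z then 1 else 0)" by (simp add: fps_X_power_nth)
  qed
  also have "\<dots> = 1" using S z by simp
  finally have g0: "fps_nth g 0 = 1" .
  have "(\<Sum>i\<in>S. fps_X ^ e i) = fps_X ^ m * g"
    unfolding g_def sum_distrib_left by (rule sum.cong[OF refl]) (use le in \<open>simp flip: power_add\<close>)
  moreover have "fps_X ^ e x = fps_X ^ m * (fps_X ^ (e x - m) :: 'k fps)"
    using le[OF S(2)] by (simp flip: power_add)
  moreover have "inverse g * g = 1" using g0 by (simp add: inverse_mult_eq_1)
  moreover have "(fps_X ^ (e x - m) * inverse g) * (fps_X ^ m * g) = (fps_X ^ m * fps_X ^ (e x - m)) * (inverse g * g)"
    by (simp only: mult_ac)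
  ultimately have "fps_X ^ e x = (fps_X ^ (e x - m) * inverse g) * (\<Sum>i\<in>S. fps_X ^ e i)"
    by (simp only: mult_1_right)
  moreover have "fps_nth (fps_X ^ (e x - m) * inverse g) 0 = (if \<forall>i\<in>S. e x \<le> e i then 1 else 0)"
    using g0 z le S by (auto simp: fps_X_power_nth dest: order.antisym)
  ultimately show ?thesis by blast
qed

text \<open>The factor of x has constant term 1 exactly if x has the least exponent in its suffix.
  All factors together have this property exactly if the list is sorted by e.\<close>

lemma fps_ordering_limit:
  fixes e :: "'i \<Rightarrow> nat"
  assumes inj: "inj e"
  shows "distinct xs \<Longrightarrow> \<exists>y :: 'k::field fps. y * (\<Prod>S\<in>suffix_sets xs. \<Sum>i\<in>S. fps_X ^ e i) = (\<Prod>x\<in>set xs. fps_X ^ e x)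
     \<and> fps_nth y 0 = (if sorted (map e xs) then 1 else 0)"
proof (induction xs)
  case Nil
  show ?case by (rule exI[of _ 1]) simp
next
  case (Cons x xs)
  then obtain y :: "'k fps" where y: "y * (\<Prod>S\<in>suffix_sets xs. \<Sum>i\<in>S. fps_X ^ e i) = (\<Prod>x\<in>set xs. fps_X ^ e x)"
    "fps_nth y 0 = (if sorted (map e xs) then 1 else 0)" by auto
  have "\<exists>z :: 'k fps. fps_X ^ e x = z * (\<Sum>i\<in>set (x # xs). fps_X ^ e i) \<and>
      fps_nth z 0 = (if \<forall>i\<in>set (x # xs). e x \<le> e i then 1 else 0)"
    by (rule fps_monomial_ratio[OF _ _ inj_on_subset[OF inj subset_UNIV]]) auto
  then obtain z :: "'k fps" where z: "fps_X ^ e x = z * (\<Sum>i\<in>set (x # xs). fps_X ^ e i)"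
    "fps_nth z 0 = (if \<forall>i\<in>set (x # xs). e x \<le> e i then 1 else 0)"
    by blast
  have "z * y * (\<Prod>S\<in>suffix_sets (x # xs). \<Sum>i\<in>S. fps_X ^ e i)
      = z * (\<Sum>i\<in>set (x # xs). fps_X ^ e i) * (y * (\<Prod>S\<in>suffix_sets xs. \<Sum>i\<in>S. fps_X ^ e i))"
    using not_in_suffix_sets[OF Cons.prems] by (simp add: mult_ac)
  also have "\<dots> = (\<Prod>x\<in>set (x # xs). fps_X ^ e x)"
    unfolding y z(1)[symmetric] using Cons.prems by simp
  finally show ?case
    by (intro exI[of _ "z * y"]) (auto simp: y z)
qed

text \<open>Clearing denominators turns the relation into a polynomial identity, by
  \<open>eval_mpoly_inj\<close>. It can then be evaluated at u_i = X^(e i), and with e adapted to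
  \<sigma> the constant term is a \<sigma>.\<close>

theorem (in weyl) qf_independent:
  fixes \<kappa> :: "'k::field_char_0 \<Rightarrow> 'r"
  assumes r: "\<And>S. S \<noteq> {} \<Longrightarrow> r S * (\<Sum>i\<in>S. u i) = 1"
    and \<kappa>: "ring_hom_1 \<kappa>" "\<And>c. is_const (\<kappa> c)" "\<And>c. \<kappa> c = 0 \<Longrightarrow> c = 0"
    and z: "(\<Sum>xs\<in>orderings. \<kappa> (a xs) * qf r xs) = 0" and \<sigma>: "\<sigma> \<in> orderings"
  shows "a \<sigma> = 0"
proof -
  define T :: "'i set set" where "T = Pow UNIV - {{}}"
  have fin: "finite T" by (simp add: T_def)
  define U :: "'i set \<Rightarrow> ('k, 'i) mpoly" where "U S = (\<Sum>i\<in>S. mvar i)" for S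
  \<comment> \<open>The common denominator contains the sums over all nonempty sets; each ordering
    uses those over its suffixes.\<close>
  define \<Phi> where "\<Phi> = (\<Sum>xs\<in>orderings. mconst (a xs) * ((\<Prod>x\<in>UNIV. mvar x) * (\<Prod>S\<in>T - suffix_sets xs. U S)))"
  have eval: "eval_mpoly h \<Phi> v = (\<Sum>xs\<in>orderings. h (a xs) * y xs) * (\<Prod>S\<in>T. \<Sum>i\<in>S. v i)"
    if h: "ring_hom_1 h" and y: "\<And>xs. xs \<in> orderings \<Longrightarrow> y xs * (\<Prod>S\<in>suffix_sets xs. \<Sum>i\<in>S. v i) = (\<Prod>x\<in>UNIV. v x)"
    for h :: "'k \<Rightarrow> 'b::comm_ring_1" and v y
  proof -
    interpret h: ring_hom_1 "\<lambda>F. eval_mpoly h F v" by (rule eval_mpoly_hom[OF h])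
    have "(\<Prod>x\<in>UNIV. v x) * (\<Prod>S\<in>T - suffix_sets xs. \<Sum>i\<in>S. v i) = y xs * (\<Prod>S\<in>T. \<Sum>i\<in>S. v i)" if "xs \<in> orderings" for xs
    proof -
      have "suffix_sets xs \<subseteq> T" using suffix_sets_subset[of _ xs] by (auto simp: T_def)
      then have "(\<Prod>S\<in>T. \<Sum>i\<in>S. v i) = (\<Prod>S\<in>suffix_sets xs. \<Sum>i\<in>S. v i) * (\<Prod>S\<in>T - suffix_sets xs. \<Sum>i\<in>S. v i)"
        using fin by (metis prod.subset_diff mult.commute)
      then show ?thesis using y[OF that] by (simp add: mult.assoc[symmetric])
    qed
    then show ?thesis
      by (simp add: \<Phi>_def h.sum h.mult h.prod U_def eval_mconst[OF h] eval_mvar[OF h] sum_distrib_right mult.assoc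
          del: One_nat_def)
  qed
  have "eval_mpoly \<kappa> \<Phi> u = 0"
    by (subst eval[OF \<kappa>(1), of "qf r"]) (use qf_denominators[OF r] z in \<open>auto simp: orderings_def\<close>)
  then have \<Phi>: "\<Phi> = 0" using eval_mpoly_inj[of \<kappa> \<Phi>] \<kappa> by blast
  \<comment> \<open>The position of x in \<sigma>.\<close>
  define e where "e x = (LEAST k. \<sigma> ! k = x)" for x
  have len: "length \<sigma> = CARD('i)" using \<sigma> distinct_card[of \<sigma>] by (auto simp: orderings_def)
  have e: "e (\<sigma> ! k) = k" if "k < length \<sigma>" for k
    unfolding e_def
  proof (rule Least_equality)
    fix l assume "\<sigma> ! l = \<sigma> ! k"
    then show "k \<le> l"
      using that \<sigma> nth_eq_iff_index_eq[of \<sigma> l k] by (cases "l < k") (auto simp: orderings_def)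
  qed simp
  have ee: "\<sigma> ! e x = x \<and> e x < length \<sigma>" for x
  proof -
    have "x \<in> set \<sigma>" using \<sigma> by (auto simp: orderings_def)
    then obtain k where "k < length \<sigma>" "x = \<sigma> ! k" by (metis in_set_conv_nth)
    then show ?thesis using e by auto
  qed
  have inj: "inj e" by (rule inj_on_inverseI[of _ "(!) \<sigma>"]) (use ee in auto)
  have sorted_iff: "sorted (map e xs) \<longleftrightarrow> xs = \<sigma>" if "xs \<in> orderings" for xs
  proof
    assume "sorted (map e xs)"
    moreover have "sorted (map e \<sigma>)" by (auto simp: sorted_iff_nth_mono e)
    moreover have "distinct (map e xs)" "distinct (map e \<sigma>)" "set (map e xs) = set (map e \<sigma>)"
      using that \<sigma> inj by (auto simp: orderings_def distinct_map intro: inj_on_subset)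
    ultimately have "map e xs = map e \<sigma>" by (intro sorted_distinct_set_unique)
    then show "xs = \<sigma>" using inj by (metis inj_map_eq_map)
  next
    assume "xs = \<sigma>"
    then show "sorted (map e xs)" by (auto simp: sorted_iff_nth_mono e)
  qed
  have "\<forall>xs\<in>orderings. \<exists>y :: 'k fps. y * (\<Prod>S\<in>suffix_sets xs. \<Sum>i\<in>S. fps_X ^ e i) = (\<Prod>x\<in>UNIV. fps_X ^ e x)
     \<and> fps_nth y 0 = (if xs = \<sigma> then 1 else 0)"
    using fps_ordering_limit[OF inj] sorted_iff by (fastforce simp: orderings_def)
  then obtain y :: "'i list \<Rightarrow> 'k fps" where
    y: "\<And>xs. xs \<in> orderings \<Longrightarrow> y xs * (\<Prod>S\<in>suffix_sets xs. \<Sum>i\<in>S. fps_X ^ e i) = (\<Prod>x\<in>UNIV. fps_X ^ e x)"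
    and y0: "\<And>xs. xs \<in> orderings \<Longrightarrow> fps_nth (y xs) 0 = (if xs = \<sigma> then 1 else 0)"
    by metis
  have hc: "ring_hom_1 (fps_const :: 'k \<Rightarrow> 'k fps)"
    by standard (simp_all flip: fps_const_add fps_const_mult)
  have "(\<Sum>i\<in>S. fps_X ^ e i) \<noteq> (0 :: 'k fps)" if S: "S \<in> T" for S
  proof
    assume z: "(\<Sum>i\<in>S. fps_X ^ e i) = (0 :: 'k fps)"
    from S obtain x where x: "x \<in> S" by (auto simp: T_def)
    have "fps_nth (\<Sum>i\<in>S. fps_X ^ e i :: 'k fps) (e x) = (\<Sum>i\<in>S. if i = x then 1 else 0)"
      unfolding fps_sum_nth by (rule sum.cong) (use inj in \<open>auto simp: fps_X_power_nth inj_on_def\<close>)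
    then show False using z x by simp
  qed
  then have nz: "(\<Prod>S\<in>T. \<Sum>i\<in>S. fps_X ^ e i) \<noteq> (0 :: 'k fps)" using fin by simp
  have "(\<Sum>xs\<in>orderings. fps_const (a xs) * y xs) * (\<Prod>S\<in>T. \<Sum>i\<in>S. fps_X ^ e i) = 0"
    using eval[OF hc y] \<Phi> by (simp add: eval_mpoly_def)
  then have "(\<Sum>xs\<in>orderings. fps_const (a xs) * y xs) = 0" using nz by simp
  then have "(\<Sum>xs\<in>orderings. a xs * fps_nth (y xs) 0) = 0"
    by (metis (no_types, lifting) fps_mult_left_const_nth fps_sum_nth fps_zero_nth sum.cong)
  then show ?thesis using y0 \<sigma> by (simp add: if_distrib[of "\<lambda>x. _ * x"] cong: if_cong sum.cong)
qed

section \<open>Weighted power sums\<close>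

text \<open>A function on multisets is a functional on polynomials in variables \<xi>_i, given by
  its values on monomials. The condition is that it annihilates the ideal generated by the sums of
  c_i \<xi>_i^k, k >= 1.\<close>

definition power_sum_null :: "'i set \<Rightarrow> ('i \<Rightarrow> 'k::field) \<Rightarrow> ('i multiset \<Rightarrow> 'k) \<Rightarrow> bool" where
  "power_sum_null A c f \<longleftrightarrow> (\<forall>\<beta> k. set_mset \<beta> \<subseteq> A \<longrightarrow> k \<ge> 1 \<longrightarrow> (\<Sum>i\<in>A. c i * f (\<beta> + replicate_mset k i)) = 0)"

text \<open>The grading is recorded because jets are tested one order at a time: a functional of
  degree e does not see the other orders.\<close>

definition homogeneous_functional :: "nat \<Rightarrow> (('i multiset \<Rightarrow> 'k::field) \<Rightarrow> 'k) \<Rightarrow> bool" where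
  "homogeneous_functional e m \<longleftrightarrow>
     (\<forall>f \<mu>. m (\<lambda>\<beta>. f \<beta> + \<mu> \<beta>) = m f + m \<mu>) \<and> (\<forall>a f. m (\<lambda>\<beta>. a * f \<beta>) = a * m f) \<and>
     (\<forall>f \<mu>. (\<forall>\<beta>. size \<beta> = e \<longrightarrow> f \<beta> = \<mu> \<beta>) \<longrightarrow> m f = m \<mu>)"

text \<open>Multiplication by \<open>\<Prod>\<^sub>t (\<xi>\<^sub>i - \<xi>\<^sub>t)\<close>, transposed.\<close>

fun diff_op :: "'i \<Rightarrow> 'i list \<Rightarrow> ('i multiset \<Rightarrow> 'k::field) \<Rightarrow> 'i multiset \<Rightarrow> 'k" where
  "diff_op i [] f = f"
| "diff_op i (t # ts) f = diff_op i ts (\<lambda>\<beta>. f (add_mset i \<beta>) - f (add_mset t \<beta>))"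

lemma diff_op_diff: "diff_op i ts (\<lambda>\<beta>. f \<beta> - \<mu> \<beta>) \<beta> = diff_op i ts f \<beta> - diff_op i ts \<mu> \<beta>"
proof (induction ts arbitrary: f \<mu>)
  case (Cons t ts)
  have "(\<lambda>\<beta>. (f (add_mset i \<beta>) - \<mu> (add_mset i \<beta>)) - (f (add_mset t \<beta>) - \<mu> (add_mset t \<beta>)))
      = (\<lambda>\<beta>. (f (add_mset i \<beta>) - f (add_mset t \<beta>)) - (\<mu> (add_mset i \<beta>) - \<mu> (add_mset t \<beta>)))"
    by (auto simp: algebra_simps)
  then show ?case by (simp add: Cons)
qed simp

lemma diff_op_0 [simp]: "diff_op i ts (\<lambda>\<beta>. 0) = (\<lambda>\<beta>. 0)"
  by (induction ts) auto

lemma diff_op_mem: "i \<in> set ts \<Longrightarrow> diff_op i ts f = (\<lambda>\<beta>. 0)"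
  by (induction ts arbitrary: f) auto

lemma power_sum_null_shift:
  assumes "power_sum_null A c f" "t \<in> A"
  shows "power_sum_null A c (\<lambda>\<beta>. f (add_mset t \<beta>))"
  unfolding power_sum_null_def
proof (intro allI impI)
  fix \<beta> :: "'a multiset" and k :: nat assume "set_mset \<beta> \<subseteq> A" "k \<ge> 1"
  then have "(\<Sum>i\<in>A. c i * f (add_mset t \<beta> + replicate_mset k i)) = 0"
    using assms(1)[unfolded power_sum_null_def, rule_format, of "add_mset t \<beta>" k] assms(2) by simp
  then show "(\<Sum>i\<in>A. c i * f (add_mset t (\<beta> + replicate_mset k i))) = 0" by simp
qed

lemma power_sum_null_diff:
  "power_sum_null A c f \<Longrightarrow> power_sum_null A c \<mu> \<Longrightarrow> power_sum_null A c (\<lambda>\<beta>. f \<beta> - \<mu> \<beta>)"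
  by (simp add: power_sum_null_def right_diff_distrib sum_subtractf)

text \<open>The sum of c_i \<xi>_i^k prod_t (\<xi>_i - \<xi>_t) lies in the ideal: expanded in
  powers of \<xi>_i, its coefficients do not depend on i.\<close>

lemma power_sum_diff_op:
  assumes "power_sum_null A c f" "set ts \<subseteq> A" "k \<ge> 1" "set_mset \<beta> \<subseteq> A"
  shows "(\<Sum>i\<in>A. c i * diff_op i ts (\<lambda>\<beta>. f (\<beta> + replicate_mset k i)) \<beta>) = 0"
  using assms
proof (induction ts arbitrary: f k)
  case Nil
  then show ?case by (simp add: power_sum_null_def)
next
  case (Cons t ts)
  have "(\<Sum>i\<in>A. c i * diff_op i (t # ts) (\<lambda>\<beta>. f (\<beta> + replicate_mset k i)) \<beta>)
      = (\<Sum>i\<in>A. c i * diff_op i ts (\<lambda>\<beta>. f (\<beta> + replicate_mset (Suc k) i)) \<beta>)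
        - (\<Sum>i\<in>A. c i * diff_op i ts (\<lambda>\<beta>. (\<lambda>\<beta>. f (add_mset t \<beta>)) (\<beta> + replicate_mset k i)) \<beta>)"
    by (simp add: diff_op_diff right_diff_distrib sum_subtractf)
  also have "\<dots> = 0"
    using Cons.IH[of f "Suc k"] Cons.IH[of "\<lambda>\<beta>. f (add_mset t \<beta>)" k] Cons.prems power_sum_null_shift[of A c f t]
    by simp
  finally show ?case .
qed

text \<open>Transposed multiplication by \<xi>_a (\<open>None\<close>) or by \<xi>_a - \<xi>_t
  (\<open>Some t\<close>), the factors of the equation satisfied by \<xi>_a in the quotient.\<close>

definition step_op :: "'i \<Rightarrow> 'i option \<Rightarrow> ('i multiset \<Rightarrow> 'k::field) \<Rightarrow> 'i multiset \<Rightarrow> 'k" where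
  "step_op a l f \<beta> = f (add_mset a \<beta>) - (case l of None \<Rightarrow> 0 | Some t \<Rightarrow> f (add_mset t \<beta>))"

fun step_ops :: "'i \<Rightarrow> 'i option list \<Rightarrow> ('i multiset \<Rightarrow> 'k::field) \<Rightarrow> 'i multiset \<Rightarrow> 'k" where
  "step_ops a [] f = f"
| "step_ops a (l # ls) f = step_ops a ls (step_op a l f)"

lemma step_ops_Some: "step_ops a (map Some ts) f = diff_op a ts f"
proof (induction ts arbitrary: f)
  case (Cons t ts)
  have "step_op a (Some t) f = (\<lambda>\<beta>. f (add_mset a \<beta>) - f (add_mset t \<beta>))"
    by (auto simp: step_op_def)
  then show ?case using Cons by simp
qed simp

lemma homogeneous_step:
  assumes "homogeneous_functional e m"
  shows "homogeneous_functional (Suc e) (\<lambda>f. m (step_op a l f))"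
proof -
  have 1: "m (step_op a l (\<lambda>\<beta>. f \<beta> + \<mu> \<beta>)) = m (step_op a l f) + m (step_op a l \<mu>)" for f \<mu>
  proof -
    have "step_op a l (\<lambda>\<beta>. f \<beta> + \<mu> \<beta>) = (\<lambda>\<beta>. step_op a l f \<beta> + step_op a l \<mu> \<beta>)"
      by (auto simp: step_op_def split: option.split)
    then show ?thesis using assms by (simp add: homogeneous_functional_def)
  qed
  have 2: "m (step_op a l (\<lambda>\<beta>. x * f \<beta>)) = x * m (step_op a l f)" for f x
  proof -
    have "step_op a l (\<lambda>\<beta>. x * f \<beta>) = (\<lambda>\<beta>. x * step_op a l f \<beta>)"
      by (auto simp: step_op_def algebra_simps split: option.split)
    then show ?thesis using assms by (simp add: homogeneous_functional_def)
  qed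
  have 3: "m (step_op a l f) = m (step_op a l \<mu>)" if "\<forall>\<beta>. size \<beta> = Suc e \<longrightarrow> f \<beta> = \<mu> \<beta>" for f \<mu>
  proof -
    have "\<forall>\<beta>. size \<beta> = e \<longrightarrow> step_op a l f \<beta> = step_op a l \<mu> \<beta>"
      using that by (auto simp: step_op_def split: option.split)
    then show ?thesis using assms by (simp add: homogeneous_functional_def)
  qed
  show ?thesis using 1 2 3 by (simp add: homogeneous_functional_def)
qed

text \<open>The quotient of the polynomial ring by the weighted power sums has dimension at most \<open>|A|!\<close>:
  it is filtered by the ideals generated by the partial products of
  \<open>\<xi>\<^sub>a \<Prod>\<^sub>t (\<xi>\<^sub>a - \<xi>\<^sub>t) = 0\<close>, and each layer is a quotient of the same kind with one variable less.\<close>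

theorem power_sum_null_determined:
  fixes c :: "'i \<Rightarrow> 'k::field"
  assumes "finite A" "\<And>B. B \<subseteq> A \<Longrightarrow> B \<noteq> {} \<Longrightarrow> sum c B \<noteq> 0"
  shows "\<exists>Ms. length Ms = fact (card A) \<and> (\<forall>(e, m)\<in>set Ms. homogeneous_functional e m) \<and>
     (\<forall>f. power_sum_null A c f \<longrightarrow> (\<forall>(e, m)\<in>set Ms. m f = 0) \<longrightarrow> (\<forall>\<beta>. set_mset \<beta> \<subseteq> A \<longrightarrow> f \<beta> = 0))"
  using assms
proof (induction A arbitrary: c rule: finite_induct)
  case empty
  show ?case
    by (rule exI[of _ "[(0, \<lambda>f. f {#})]"]) (simp add: homogeneous_functional_def)
next
  case (insert a A)
  define A' where "A' = insert a A"
  \<comment> \<open>The weights after substituting \<xi>_a = 0 or \<xi>_a = \<xi>_t: that of a is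
    dropped or added to that of t. Their subset sums are again subset sums of c, hence
    nonzero.\<close>
  define cl where "cl l = (case l of None \<Rightarrow> c | Some t \<Rightarrow> c(t := c t + c a))" for l
  define good where "good l \<longleftrightarrow> (case l of None \<Rightarrow> True | Some t \<Rightarrow> t \<in> A)" for l
  \<comment> \<open>A functional killed by one factor factors through the corresponding
    substitution, and the induction hypothesis with one variable less applies.\<close>
  have layer: "\<exists>Ms. length Ms = fact (card A) \<and> (\<forall>(e, m)\<in>set Ms. homogeneous_functional e m) \<and>
     (\<forall>f. power_sum_null A' c f \<longrightarrow> (\<forall>\<beta>. set_mset \<beta> \<subseteq> A' \<longrightarrow> step_op a l f \<beta> = 0) \<longrightarrow>
        (\<forall>(e, m)\<in>set Ms. m f = 0) \<longrightarrow> (\<forall>\<beta>. set_mset \<beta> \<subseteq> A' \<longrightarrow> f \<beta> = 0))"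
    if l: "good l" for l
  proof -
    have "sum (cl l) B \<noteq> 0" if B: "B \<subseteq> A" "B \<noteq> {}" for B
    proof (cases l)
      case None
      then show ?thesis using insert.prems[of B] B by (auto simp: cl_def)
    next
      case (Some t)
      have fB: "finite B" using B insert.hyps finite_subset by blast
      show ?thesis
      proof (cases "t \<in> B")
        case True
        have "sum (cl l) B = (c t + c a) + sum (cl l) (B - {t})"
          using True fB Some by (simp add: sum.remove cl_def)
        also have "sum (cl l) (B - {t}) = sum c (B - {t})"
          by (rule sum.cong) (auto simp: cl_def Some)
        also have "c t + c a + sum c (B - {t}) = sum c (insert a B)"
          using True fB B insert.hyps by (subst sum.insert) (auto simp: sum.remove)
        finally show ?thesis using insert.prems[of "insert a B"] B by auto
      next
        case False
        then have "sum (cl l) B = sum c B" by (intro sum.cong) (auto simp: cl_def Some)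
        then show ?thesis using insert.prems[of B] B by auto
      qed
    qed
    then obtain Ms where Ms: "length Ms = fact (card A)" "\<forall>(e, m)\<in>set Ms. homogeneous_functional e m"
      "\<And>f. power_sum_null A (cl l) f \<Longrightarrow> (\<forall>(e, m)\<in>set Ms. m f = 0) \<Longrightarrow> (\<forall>\<beta>. set_mset \<beta> \<subseteq> A \<longrightarrow> f \<beta> = 0)"
      using insert.IH[of "cl l"] by blast
    have "\<forall>\<beta>. set_mset \<beta> \<subseteq> A' \<longrightarrow> f \<beta> = 0"
      if f: "power_sum_null A' c f" and kill: "\<And>\<beta>. set_mset \<beta> \<subseteq> A' \<Longrightarrow> step_op a l f \<beta> = 0"
        and m: "\<forall>(e, m)\<in>set Ms. m f = 0" for f
    proof -
      have kill': "f (add_mset a \<beta>) = (case l of None \<Rightarrow> 0 | Some t \<Rightarrow> f (add_mset t \<beta>))"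
        if "set_mset \<beta> \<subseteq> A'" for \<beta>
        using kill[OF that] by (auto simp: step_op_def)
      have rep: "f (\<beta> + replicate_mset k a) = (case l of None \<Rightarrow> 0 | Some t \<Rightarrow> f (\<beta> + replicate_mset k t))"
        if "k \<ge> 1" "set_mset \<beta> \<subseteq> A'" for k \<beta>
        using that
      proof (induction k arbitrary: \<beta>)
        case (Suc k)
        have "f (add_mset a (\<beta> + replicate_mset k a)) = (case l of None \<Rightarrow> 0 | Some t \<Rightarrow> f (add_mset t (\<beta> + replicate_mset k a)))"
          by (rule kill') (use Suc.prems in \<open>auto simp: A'_def\<close>)
        moreover have "f (add_mset t \<beta> + replicate_mset k a) = f (add_mset t \<beta> + replicate_mset k t)" if "l = Some t" for t
        proof (cases "k = 0")
          case False
          have "t \<in> A'" using l that by (simp add: good_def A'_def)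
          then show ?thesis using Suc.IH[of "add_mset t \<beta>"] Suc.prems False that by auto
        qed simp
        ultimately show ?case by (auto split: option.split)
      qed simp
      have "power_sum_null A (cl l) f"
        unfolding power_sum_null_def
      proof (intro allI impI)
        fix \<beta> :: "'i multiset" and k :: nat assume \<beta>: "set_mset \<beta> \<subseteq> A" and k: "k \<ge> 1"
        have "0 = (\<Sum>i\<in>A'. c i * f (\<beta> + replicate_mset k i))"
          using f \<beta> k unfolding power_sum_null_def A'_def by (metis subset_insertI2)
        also have "\<dots> = c a * f (\<beta> + replicate_mset k a) + (\<Sum>i\<in>A. c i * f (\<beta> + replicate_mset k i))"
          using insert.hyps by (simp add: A'_def)
        also have "\<dots> = (\<Sum>i\<in>A. cl l i * f (\<beta> + replicate_mset k i))"
        proof (cases l)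
          case None
          then show ?thesis using rep[OF k, of \<beta>] \<beta> by (auto simp: cl_def A'_def)
        next
          case (Some t)
          then have t: "t \<in> A" using l by (simp add: good_def)
          have "(\<Sum>i\<in>A. cl l i * f (\<beta> + replicate_mset k i))
            = (\<Sum>i\<in>A. c i * f (\<beta> + replicate_mset k i) + (if i = t then c a * f (\<beta> + replicate_mset k t) else 0))"
            by (rule sum.cong) (auto simp: cl_def Some algebra_simps)
          also have "\<dots> = (\<Sum>i\<in>A. c i * f (\<beta> + replicate_mset k i)) + c a * f (\<beta> + replicate_mset k t)"
            using t insert.hyps by (simp add: sum.distrib)
          finally show ?thesis using rep[OF k, of \<beta>] \<beta> Some by (auto simp: A'_def)
        qed
        finally show "(\<Sum>i\<in>A. cl l i * f (\<beta> + replicate_mset k i)) = 0" by simp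
      qed
      then have zA: "f \<beta> = 0" if "set_mset \<beta> \<subseteq> A" for \<beta> using Ms(3)[of f] m that by blast
      show ?thesis
      proof (intro allI impI)
        fix \<beta> assume "set_mset \<beta> \<subseteq> A'"
        then show "f \<beta> = 0"
        \<comment> \<open>The substitution removes the copies of a one by one.\<close>
        proof (induction "count \<beta> a" arbitrary: \<beta>)
          case 0
          then have "a \<notin># \<beta>" by (metis count_eq_zero_iff)
          then show ?case using zA[of \<beta>] 0 by (auto simp: A'_def)
        next
          case (Suc k)
          then have "a \<in># \<beta>" by (metis count_eq_zero_iff nat.distinct(1))
          then obtain \<gamma> where \<gamma>: "\<beta> = add_mset a \<gamma>" by (metis mset_add)
          show ?case
          proof (cases l)
            case None
            then show ?thesis using kill'[of \<gamma>] \<gamma> Suc.prems by auto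
          next
            case (Some t)
            then have t: "t \<in> A" using l by (simp add: good_def)
            then have "f (add_mset t \<gamma>) = 0"
              using Suc \<gamma> insert.hyps by (intro Suc.hyps(1)) (auto simp: A'_def)
            then show ?thesis using kill'[of \<gamma>] \<gamma> Suc.prems Some by auto
          qed
        qed
      qed
    qed
    then show ?thesis using Ms by blast
  qed
  have null_step: "power_sum_null A' c (step_op a l f)" if f: "power_sum_null A' c f" and l: "good l" for l f
  proof (cases l)
    case None
    then have "step_op a l f = (\<lambda>\<beta>. f (add_mset a \<beta>))" by (auto simp: step_op_def)
    then show ?thesis using power_sum_null_shift[OF f, of a] by (simp add: A'_def)
  next
    case (Some t)
    then have "step_op a l f = (\<lambda>\<beta>. f (add_mset a \<beta>) - f (add_mset t \<beta>))" by (auto simp: step_op_def)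
    then show ?thesis
      using power_sum_null_diff[OF power_sum_null_shift[OF f, of a] power_sum_null_shift[OF f, of t]] Some l
      by (simp add: A'_def good_def)
  qed
  \<comment> \<open>Peel off the factors: f composed with the first factor is handled by the
    remaining list, and once it vanishes f belongs to the layer of that factor.\<close>
  have chain: "\<exists>Ms. length Ms = length ls * fact (card A) \<and> (\<forall>(e, m)\<in>set Ms. homogeneous_functional e m) \<and>
     (\<forall>f. power_sum_null A' c f \<longrightarrow> (\<forall>\<beta>. set_mset \<beta> \<subseteq> A' \<longrightarrow> step_ops a ls f \<beta> = 0) \<longrightarrow>
        (\<forall>(e, m)\<in>set Ms. m f = 0) \<longrightarrow> (\<forall>\<beta>. set_mset \<beta> \<subseteq> A' \<longrightarrow> f \<beta> = 0))"
    if "\<forall>l\<in>set ls. good l" for ls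
    using that
  proof (induction ls)
    case Nil
    show ?case by (rule exI[of _ "[]"]) simp
  next
    case (Cons l ls)
    then obtain Ms where Ms: "length Ms = length ls * fact (card A)" "\<forall>(e, m)\<in>set Ms. homogeneous_functional e m"
      "\<And>f. power_sum_null A' c f \<Longrightarrow> (\<forall>\<beta>. set_mset \<beta> \<subseteq> A' \<longrightarrow> step_ops a ls f \<beta> = 0) \<Longrightarrow>
        (\<forall>(e, m)\<in>set Ms. m f = 0) \<Longrightarrow> (\<forall>\<beta>. set_mset \<beta> \<subseteq> A' \<longrightarrow> f \<beta> = 0)"
      by auto
    obtain Ns where Ns: "length Ns = fact (card A)" "\<forall>(e, m)\<in>set Ns. homogeneous_functional e m"
      "\<And>f. power_sum_null A' c f \<Longrightarrow> (\<forall>\<beta>. set_mset \<beta> \<subseteq> A' \<longrightarrow> step_op a l f \<beta> = 0) \<Longrightarrow>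
        (\<forall>(e, m)\<in>set Ns. m f = 0) \<Longrightarrow> (\<forall>\<beta>. set_mset \<beta> \<subseteq> A' \<longrightarrow> f \<beta> = 0)"
      using layer[of l] Cons.prems by auto
    \<comment> \<open>Composition with a linear factor raises the degree of a functional by
      one.\<close>
    define Ls where "Ls = map (\<lambda>(e, m). (Suc e, \<lambda>f. m (step_op a l f))) Ms @ Ns"
    have "length Ls = length (l # ls) * fact (card A)" by (simp add: Ls_def Ms Ns)
    moreover have "\<forall>(e, m)\<in>set Ls. homogeneous_functional e m"
      using Ms(2) Ns(2) homogeneous_step by (fastforce simp: Ls_def)
    moreover have "\<forall>\<beta>. set_mset \<beta> \<subseteq> A' \<longrightarrow> f \<beta> = 0"
      if f: "power_sum_null A' c f" "\<forall>\<beta>. set_mset \<beta> \<subseteq> A' \<longrightarrow> step_ops a (l # ls) f \<beta> = 0"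
        and m: "\<forall>(e, m)\<in>set Ls. m f = 0" for f
    proof (rule Ns(3)[OF f(1)])
      have "\<forall>(e, m)\<in>set Ms. m (step_op a l f) = 0" using m by (fastforce simp: Ls_def)
      then show "\<forall>\<beta>. set_mset \<beta> \<subseteq> A' \<longrightarrow> step_op a l f \<beta> = 0"
        using Ms(3)[OF null_step[OF f(1), of l]] f(2) Cons.prems by simp
      show "\<forall>(e, m)\<in>set Ns. m f = 0" using m by (auto simp: Ls_def)
    qed
    ultimately show ?case by blast
  qed
  obtain ts where ts: "set ts = A" "distinct ts" using insert.hyps finite_distinct_list by metis
  \<comment> \<open>In \<open>power_sum_diff_op\<close> with k = 1 the summand of every i in ts
    contains \<xi>_i - \<xi>_i. What remains is c a times the product of all factors at a, and c a
    is nonzero.\<close>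
  have kill: "step_ops a (None # map Some ts) f \<beta> = 0" if "power_sum_null A' c f" "set_mset \<beta> \<subseteq> A'" for f \<beta>
  proof -
    have "0 = (\<Sum>i\<in>A'. c i * diff_op i ts (\<lambda>\<beta>. f (\<beta> + replicate_mset 1 i)) \<beta>)"
      by (rule power_sum_diff_op[symmetric]) (use that ts in \<open>auto simp: A'_def\<close>)
    also have "\<dots> = c a * diff_op a ts (\<lambda>\<beta>. f (\<beta> + replicate_mset 1 a)) \<beta>
        + (\<Sum>i\<in>A. c i * diff_op i ts (\<lambda>\<beta>. f (\<beta> + replicate_mset 1 i)) \<beta>)"
      unfolding A'_def using insert.hyps by (rule sum.insert)
    also have "(\<Sum>i\<in>A. c i * diff_op i ts (\<lambda>\<beta>. f (\<beta> + replicate_mset 1 i)) \<beta>) = 0"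
      by (rule sum.neutral) (use ts in \<open>simp add: diff_op_mem\<close>)
    finally have "diff_op a ts (\<lambda>\<beta>. f (add_mset a \<beta>)) \<beta> = 0"
      using insert.prems[of "{a}"] by simp
    moreover have "step_op a None f = (\<lambda>\<beta>. f (add_mset a \<beta>))" by (auto simp: step_op_def)
    ultimately show ?thesis by (simp add: step_ops_Some)
  qed
  \<comment> \<open>One layer for \<xi>_a and one for each t: 1 + |A| layers with |A|! functionals
    each.\<close>
  have len: "length (None # map Some ts) * fact (card A) = (fact (card (insert a A)) :: nat)"
    using insert.hyps ts by (simp add: distinct_card[symmetric])
  have "\<forall>l\<in>set (None # map Some ts). good l" using ts by (auto simp: good_def)
  from chain[OF this] obtain Ms where Ms: "length Ms = length (None # map Some ts) * fact (card A)"
    "\<forall>(e, m)\<in>set Ms. homogeneous_functional e m"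
    "\<And>f. power_sum_null A' c f \<Longrightarrow> (\<forall>\<beta>. set_mset \<beta> \<subseteq> A' \<longrightarrow> step_ops a (None # map Some ts) f \<beta> = 0) \<Longrightarrow>
        (\<forall>(e, m)\<in>set Ms. m f = 0) \<Longrightarrow> (\<forall>\<beta>. set_mset \<beta> \<subseteq> A' \<longrightarrow> f \<beta> = 0)"
    by blast
  show ?case
    using Ms(1,2) Ms(3)[OF _ _] kill unfolding len A'_def by (intro exI[of _ Ms]) blast
qed

section \<open>Derivatives of determinants\<close>

lemma (in derivation) derivation_prod:
  "finite A \<Longrightarrow> d (prod f A) = (\<Sum>i\<in>A. d (f i) * prod f (A - {i}))"
proof (induction A rule: finite_induct)
  case (insert x A)
  have "(\<Sum>i\<in>A. d (f i) * prod f (insert x A - {i})) = f x * (\<Sum>i\<in>A. d (f i) * prod f (A - {i}))"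
    unfolding sum_distrib_left
  proof (rule sum.cong[OF refl])
    fix i assume "i \<in> A"
    then have "insert x A - {i} = insert x (A - {i})" using insert.hyps by auto
    then show "d (f i) * prod f (insert x A - {i}) = f x * (d (f i) * prod f (A - {i}))"
      using insert.hyps by (simp add: mult_ac)
  qed
  moreover have "insert x A - {x} = A" using insert.hyps by auto
  ultimately show ?case using insert by (simp add: mult add.commute)
qed simp

text \<open>With M = (d A) B one has d A = M A. Differentiating row by row replaces row i by row i
  of M A, and multilinearity leaves M_ii det A.\<close>

lemma (in derivation) jacobi_formula:
  fixes A B :: "'a ^ 'm::finite ^ 'm"
  assumes BA: "\<And>i j. (\<Sum>k\<in>UNIV. B $ i $ k * A $ k $ j) = (if i = j then 1 else 0)"
  shows "d (det A) = det A * (\<Sum>i\<in>UNIV. \<Sum>k\<in>UNIV. d (A $ i $ k) * B $ k $ i)"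
proof -
  define M where "M i j = (\<Sum>k\<in>UNIV. d (A $ i $ k) * B $ k $ j)" for i j
  have dA: "d (A $ i $ c) = (\<Sum>j\<in>UNIV. M i j * A $ j $ c)" for i c
  proof -
    have "(\<Sum>j\<in>UNIV. M i j * A $ j $ c) = (\<Sum>k\<in>UNIV. d (A $ i $ k) * (\<Sum>j\<in>UNIV. B $ k $ j * A $ j $ c))"
      unfolding M_def sum_distrib_left sum_distrib_right by (subst sum.swap) (simp add: mult.assoc)
    then show ?thesis by (simp add: BA if_distrib[of "\<lambda>x. _ * x"] cong: if_cong)
  qed
  have row: "det (\<chi> l. if l = i then \<chi> c. d (A $ i $ c) else A $ l) = M i i * det A" for i
  proof -
    have e: "(\<chi> c. d (A $ i $ c)) = (\<Sum>j\<in>UNIV. M i j *s A $ j)"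
      by (simp add: vec_eq_iff dA)
    have "det (\<chi> l. if l = i then \<chi> c. d (A $ i $ c) else A $ l)
        = (\<Sum>j\<in>UNIV. det (\<chi> l. if l = i then M i j *s A $ j else A $ l))"
      unfolding e by (rule det_linear_row_sum) simp
    also have "\<dots> = (\<Sum>j\<in>UNIV. M i j * det (\<chi> l. if l = i then A $ j else A $ l))"
      by (rule sum.cong[OF refl], rule det_row_mul)
    also have "\<dots> = (\<Sum>j\<in>UNIV. if j = i then M i i * det A else 0)"
    proof (rule sum.cong[OF refl])
      fix j
      show "M i j * det (\<chi> l. if l = i then A $ j else A $ l) = (if j = i then M i i * det A else 0)"
      proof (cases "j = i")
        case True
        have "(\<chi> l. if l = i then A $ i else A $ l) = A" by (simp add: vec_eq_iff)
        then show ?thesis unfolding True by (simp only: if_True refl)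
      next
        case False
        have "det (\<chi> l. if l = i then A $ j else A $ l) = 0"
          by (rule det_identical_rows[OF False]) (simp add: row_def vec_eq_iff False)
        then show ?thesis using False by simp
      qed
    qed
    finally show ?thesis by simp
  qed
  have "d (det A) = (\<Sum>p\<in>{p. p permutes UNIV}. \<Sum>i\<in>UNIV.
      of_int (sign p) * (d (A $ i $ p i) * (\<Prod>l\<in>UNIV - {i}. A $ l $ p l)))"
  proof -
    have "d (of_int (sign p) * x) = of_int (sign p) * d x" for p :: "'m \<Rightarrow> 'm" and x
      by (simp add: sign_def uminus)
    then show ?thesis by (simp add: det_def sum derivation_prod sum_distrib_left)
  qed
  also have "\<dots> = (\<Sum>i\<in>UNIV. det (\<chi> l. if l = i then \<chi> c. d (A $ i $ c) else A $ l))"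
  proof (subst sum.swap, rule sum.cong[OF refl])
    fix i
    have "(\<Prod>l\<in>UNIV. (\<chi> l. if l = i then \<chi> c. d (A $ i $ c) else A $ l) $ l $ p l)
       = d (A $ i $ p i) * (\<Prod>l\<in>UNIV - {i}. A $ l $ p l)" for p
      by (subst prod.remove[of _ i]) (auto intro!: prod.cong)
    then show "(\<Sum>p\<in>{p. p permutes UNIV}. of_int (sign p) * (d (A $ i $ p i) * (\<Prod>l\<in>UNIV - {i}. A $ l $ p l)))
       = det (\<chi> l. if l = i then \<chi> c. d (A $ i $ c) else A $ l)"
      by (simp add: det_def)
  qed
  also have "\<dots> = det A * (\<Sum>i\<in>UNIV. M i i)"
    by (simp add: row sum_distrib_left mult.commute)
  finally show ?thesis by (simp add: M_def)
qed

section \<open>Quadratic phases in projective coordinates\<close>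

lemma sum_cone_index: "(\<Sum>l\<in>UNIV. f l) = f First + (\<Sum>a\<in>UNIV. f (Mid a)) + f Last"
  for f :: "'n::finite cone_index \<Rightarrow> 'a::comm_monoid_add"
proof -
  have "(\<Sum>l\<in>range Mid. f l) = (\<Sum>a\<in>UNIV. f (Mid a))"
    by (subst sum.reindex) (auto simp: inj_def)
  then show ?thesis
    by (subst UNIV_cone_index, subst sum.insert, simp, force, subst sum.insert) (auto simp: add_ac)
qed

lemma sum_option: "(\<Sum>i\<in>UNIV. f i) = f None + (\<Sum>a\<in>UNIV. f (Some a))"
  for f :: "'n::finite option \<Rightarrow> 'a::comm_monoid_add"
  by (simp add: UNIV_option_conv sum.reindex)

interpretation sh: ring_hom_1 "shift_mps :: ('a::{idom, ring_char_0}, 'n::finite) mps \<Rightarrow> _"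
  by (rule shift_mps_hom)

abbreviation chart_index :: "'n option \<Rightarrow> 'n cone_index" where
  "chart_index i \<equiv> (case i of None \<Rightarrow> First | Some a \<Rightarrow> Mid a)"

text \<open>The point \<open>x = r\<^sup>2 w\<^sup>2\<close> of the cone, \<open>\<Sum> w = 0\<close>, is paired with the conormal \<open>\<kappa> / w\<close>. In the
  coordinates \<open>w\<close>, whose Jacobian matrix has inverse \<open>J\<close>, the phase is a quadratic form times \<open>r\<^sup>2\<close>.\<close>

locale cone_phase =
  fixes w winv :: "'n::finite cone_index \<Rightarrow> ('k::field_char_0, 'n) mps"
    and r rinv \<kappa> \<kappa>inv :: "('k, 'n) mps" and c :: "'n cone_index \<Rightarrow> 'k"
    and J :: "'n \<Rightarrow> 'n \<Rightarrow> ('k, 'n) mps"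
  assumes w_First: "w First = 1" and w_sum: "(\<Sum>l\<in>UNIV. w l) = 0"
    and w_inv: "w l * winv l = 1" and r_inv: "r * rinv = 1" and \<kappa>_inv: "\<kappa> * \<kappa>inv = 1"
    and quadric: "r ^ 2 * (\<Sum>l\<in>UNIV. const_mps (c l) * w l ^ 2) = 1"
    and VJ: "(\<Sum>j\<in>UNIV. pderiv_mps j (w (Mid b)) * J j a) = (if a = b then 1 else 0)"
    and JV: "(\<Sum>a\<in>UNIV. J j a * pderiv_mps i (w (Mid a))) = (if i = j then 1 else 0)"
    and subset_sum_unit: "S \<noteq> {} \<Longrightarrow> (\<Sum>i\<in>S. w (chart_index i)) dvd 1"
begin

definition "phi = const_mps \<kappa> * (\<Sum>l\<in>UNIV. const_mps (winv l) * shift_mps (r ^ 2 * w l ^ 2))"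

text \<open>In the coordinates w the Hessian is 2 \<kappa> r^2 times the sum of diag(1/w_a) and the
  matrix with all entries 1/w_Last. As w_Last plus the sum of the w_a is -1, the rank-one update
  formula inverts this sum to diag(w) + w w^T; \<open>J\<close> transports the result to the
  original coordinates.\<close>

definition "G i j = const_mps (1 / 2) * \<kappa>inv * rinv ^ 2 *
   (\<Sum>a\<in>UNIV. \<Sum>b\<in>UNIV. J i a * ((if a = b then w (Mid a) else 0) + w (Mid a) * w (Mid b)) * J j b)"

text \<open>The partial derivative in w_a, by the chain rule.\<close>

definition "\<delta> a X = (\<Sum>j\<in>UNIV. J j a * pderiv_mps j X)"

lemma derivation_\<delta>: "derivation (\<delta> a)"
  by standard (simp_all add: \<delta>_def pderiv_mps_mult algebra_simps sum.distrib sum_distrib_left)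

sublocale \<delta>: derivation "\<delta> a" for a by (rule derivation_\<delta>)

lemma \<delta>_const [simp]: "\<delta> a (const_mps x) = 0"
  by (simp add: \<delta>_def)

lemma pderiv_w_First [simp]: "pderiv_mps i (w First) = 0"
  by (simp add: w_First)

lemma w_Last: "w Last = - 1 - (\<Sum>a\<in>UNIV. w (Mid a))"
  using w_sum unfolding sum_cone_index w_First by (simp add: eq_neg_iff_add_eq_0 algebra_simps)

lemma \<delta>_w_Mid: "\<delta> a (w (Mid b)) = (if a = b then 1 else 0)"
  using VJ[of b a] by (simp add: \<delta>_def mult.commute)

lemma \<delta>_w_First: "\<delta> a (w First) = 0"
  by (simp add: \<delta>_def)

lemma \<delta>_w_Last: "\<delta> a (w Last) = - 1"
  by (simp add: w_Last \<delta>.diff \<delta>.sum \<delta>_w_Mid \<delta>.uminus)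

lemma pderiv_w_sum: "(\<Sum>l\<in>UNIV. pderiv_mps i (w l)) = 0"
  using w_sum by (metis pderiv_mps_0 pderiv_mps_sum)

lemma pderiv_\<delta>: "pderiv_mps i X = (\<Sum>a\<in>UNIV. pderiv_mps i (w (Mid a)) * \<delta> a X)"
proof -
  have "(\<Sum>a\<in>UNIV. pderiv_mps i (w (Mid a)) * \<delta> a X)
      = (\<Sum>j\<in>UNIV. (\<Sum>a\<in>UNIV. J j a * pderiv_mps i (w (Mid a))) * pderiv_mps j X)"
    unfolding \<delta>_def sum_distrib_left sum_distrib_right by (subst sum.swap) (simp add: mult_ac)
  then show ?thesis by (simp add: JV if_distrib[of "\<lambda>x. x * _"] cong: if_cong)
qed

text \<open>The commutator is a vector field that kills all w_b. These are coordinates, so its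
  components vanish.\<close>

lemma \<delta>_commute: "\<delta> a (\<delta> b X) = \<delta> b (\<delta> a X)"
proof -
  have expand: "\<delta> a (\<delta> b X) = (\<Sum>j\<in>UNIV. \<delta> a (J j b) * pderiv_mps j X)
      + (\<Sum>j\<in>UNIV. \<Sum>i\<in>UNIV. J i a * J j b * pderiv_mps i (pderiv_mps j X))" for a b X
  proof -
    have "\<delta> a (\<delta> b X) = (\<Sum>j\<in>UNIV. \<delta> a (J j b) * pderiv_mps j X + J j b * \<delta> a (pderiv_mps j X))"
      by (simp add: \<delta>_def[of b] \<delta>.sum \<delta>.mult)
    also have "\<dots> = (\<Sum>j\<in>UNIV. \<delta> a (J j b) * pderiv_mps j X)
      + (\<Sum>j\<in>UNIV. \<Sum>i\<in>UNIV. J i a * J j b * pderiv_mps i (pderiv_mps j X))"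
      by (simp add: \<delta>_def[of a "pderiv_mps _ X"] sum.distrib sum_distrib_left mult_ac)
    finally show ?thesis .
  qed
  have sym: "(\<Sum>j\<in>UNIV. \<Sum>i\<in>UNIV. J i a * J j b * pderiv_mps i (pderiv_mps j X))
      = (\<Sum>j\<in>UNIV. \<Sum>i\<in>UNIV. J i b * J j a * pderiv_mps i (pderiv_mps j X))" for X
    by (subst sum.swap) (simp add: mult_ac pderiv_mps_commute)
  define y where "y j = \<delta> a (J j b) - \<delta> b (J j a)" for j
  have com: "\<delta> a (\<delta> b X) - \<delta> b (\<delta> a X) = (\<Sum>j\<in>UNIV. y j * pderiv_mps j X)" for X
    unfolding expand[of a b] expand[of b a] sym by (simp add: y_def left_diff_distrib sum_subtractf)
  have z: "(\<Sum>j\<in>UNIV. y j * pderiv_mps j (w (Mid e))) = 0" for e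
    unfolding com[symmetric] by (simp add: \<delta>_w_Mid)
  have "y i = 0" for i
  proof -
    have "y i = (\<Sum>j\<in>UNIV. y j * (\<Sum>e\<in>UNIV. J i e * pderiv_mps j (w (Mid e))))"
      by (simp add: JV if_distrib[of "\<lambda>x. _ * x"] cong: if_cong)
    also have "\<dots> = (\<Sum>e\<in>UNIV. J i e * (\<Sum>j\<in>UNIV. y j * pderiv_mps j (w (Mid e))))"
      unfolding sum_distrib_left by (subst sum.swap) (simp add: mult_ac)
    finally show ?thesis by (simp add: z)
  qed
  then show ?thesis using com[of X] by simp
qed

section \<open>The Jacobian determinant and the expansion for densities in the coordinates w\<close>

definition "W = det (\<chi> b j. pderiv_mps j (w (Mid b)))"

definition "Winv = det (\<chi> j a. J j a)"

lemma W_inv: "W * Winv = 1"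
proof -
  have "(\<chi> b j. pderiv_mps j (w (Mid b))) ** (\<chi> j a. J j a) = mat 1"
    by (auto simp: matrix_matrix_mult_def mat_def vec_eq_iff VJ)
  then show ?thesis unfolding W_def Winv_def by (metis det_I det_mul)
qed

text \<open>The Piola identity: the columns of W J have divergence zero. Jacobi's formula for d W
  cancels the derivative of J, computed from the constancy of V J. Hence the \<delta> a are skew
  with respect to the density W.\<close>

lemma piola: "(\<Sum>j\<in>UNIV. pderiv_mps j (W * J j a)) = 0"
proof -
  let ?V = "\<lambda>b i. pderiv_mps i (w (Mid b))"
  have dW: "pderiv_mps j W = W * (\<Sum>b\<in>UNIV. \<Sum>i\<in>UNIV. pderiv_mps j (?V b i) * J i b)" for j
    using derivation.jacobi_formula[OF derivation_pderiv_mps, of "\<chi> j a. J j a" "\<chi> b j. ?V b j" j] JV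
    by (simp add: W_def eq_commute)
  have dJ: "(\<Sum>j\<in>UNIV. pderiv_mps i (?V b j) * J j a) = - (\<Sum>j\<in>UNIV. ?V b j * pderiv_mps i (J j a))" for b i
  proof -
    have "(\<Sum>j\<in>UNIV. pderiv_mps i (?V b j) * J j a) + (\<Sum>j\<in>UNIV. ?V b j * pderiv_mps i (J j a))
        = pderiv_mps i (\<Sum>j\<in>UNIV. ?V b j * J j a)"
      by (simp add: pderiv_mps_mult sum.distrib)
    also have "\<dots> = 0" by (simp add: VJ)
    finally show ?thesis by (simp add: eq_neg_iff_add_eq_0)
  qed
  have "(\<Sum>j\<in>UNIV. (\<Sum>b\<in>UNIV. \<Sum>i\<in>UNIV. pderiv_mps j (?V b i) * J i b) * J j a)
      = (\<Sum>b\<in>UNIV. \<Sum>i\<in>UNIV. J i b * (\<Sum>j\<in>UNIV. pderiv_mps i (?V b j) * J j a))"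
    unfolding sum_distrib_left sum_distrib_right
    by (subst sum.swap, rule sum.cong[OF refl], subst sum.swap) (simp add: mult_ac pderiv_mps_commute)
  also have "\<dots> = - (\<Sum>b\<in>UNIV. \<Sum>i\<in>UNIV. \<Sum>j\<in>UNIV. J i b * ?V b j * pderiv_mps i (J j a))"
    unfolding dJ by (simp add: sum_negf sum_distrib_left mult.assoc)
  also have "(\<Sum>b\<in>UNIV. \<Sum>i\<in>UNIV. \<Sum>j\<in>UNIV. J i b * ?V b j * pderiv_mps i (J j a))
      = (\<Sum>i\<in>UNIV. \<Sum>j\<in>UNIV. (\<Sum>b\<in>UNIV. J i b * ?V b j) * pderiv_mps i (J j a))"
    unfolding sum_distrib_right by (subst sum.swap, rule sum.cong[OF refl], subst sum.swap) simp
  also have "\<dots> = (\<Sum>i\<in>UNIV. pderiv_mps i (J i a))"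
    by (simp add: JV if_distrib[of "\<lambda>x. x * _"] cong: if_cong)
  finally have "(\<Sum>j\<in>UNIV. (\<Sum>b\<in>UNIV. \<Sum>i\<in>UNIV. pderiv_mps j (?V b i) * J i b) * J j a)
     = - (\<Sum>i\<in>UNIV. pderiv_mps i (J i a))" .
  then show ?thesis
    by (simp add: pderiv_mps_mult dW sum.distrib mult.assoc flip: sum_distrib_left)
qed

lemma winv_w [simp]: "winv l * (w l * X) = X" "winv l * w l = 1"
  using w_inv[of l] by (simp_all add: mult.assoc[symmetric] mult.commute[of "winv l"])

lemma eval_phi: "eval0_mps phi = 0"
proof -
  have "winv l * (r ^ 2 * w l ^ 2) = r ^ 2 * (winv l * (w l * w l))" for l
    by (simp only: power2_eq_square mult_ac)
  then have "winv l * (r ^ 2 * w l ^ 2) = r ^ 2 * w l" for l by simp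
  then have "(\<Sum>l\<in>UNIV. winv l * (r ^ 2 * w l ^ 2)) = r ^ 2 * (\<Sum>l\<in>UNIV. w l)"
    by (simp only: sum_distrib_left)
  then show ?thesis by (simp add: phi_def w_sum)
qed

lemma deriv_phi_term:
  "winv l * pderiv_mps i (r ^ 2 * w l ^ 2) = pderiv_mps i (r ^ 2) * w l + 2 * r ^ 2 * pderiv_mps i (w l)"
proof -
  have "pderiv_mps i (r ^ 2 * w l ^ 2) = w l * (pderiv_mps i (r ^ 2) * w l + 2 * r ^ 2 * pderiv_mps i (w l))"
    by (simp add: pderiv_mps_mult power2_eq_square algebra_simps)
  then show ?thesis by simp
qed

lemma eval_deriv_phi: "eval0_mps (pderiv_mps i phi) = 0"
proof -
  have "(\<Sum>l\<in>UNIV. winv l * pderiv_mps i (r ^ 2 * w l ^ 2))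
     = pderiv_mps i (r ^ 2) * (\<Sum>l\<in>UNIV. w l) + 2 * r ^ 2 * (\<Sum>l\<in>UNIV. pderiv_mps i (w l))"
    by (simp only: deriv_phi_term sum.distrib sum_distrib_left)
  then show ?thesis
    by (simp add: phi_def pderiv_shift_mps w_sum pderiv_w_sum)
qed

lemma hessian_phi: "eval0_mps (pderiv_mps j (pderiv_mps i phi))
   = 2 * \<kappa> * r ^ 2 * (\<Sum>l\<in>UNIV. winv l * pderiv_mps i (w l) * pderiv_mps j (w l))"
proof -
  have t: "winv l * pderiv_mps j (pderiv_mps i (r ^ 2 * w l ^ 2))
     = pderiv_mps j (pderiv_mps i (r ^ 2)) * w l + 2 * pderiv_mps i (r ^ 2) * pderiv_mps j (w l)
       + 2 * pderiv_mps j (r ^ 2) * pderiv_mps i (w l) + 2 * r ^ 2 * pderiv_mps j (pderiv_mps i (w l))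
       + 2 * r ^ 2 * (winv l * pderiv_mps i (w l) * pderiv_mps j (w l))" for l
  proof -
    have "pderiv_mps j (pderiv_mps i (r ^ 2 * w l ^ 2))
      = w l * (pderiv_mps j (pderiv_mps i (r ^ 2)) * w l + 2 * pderiv_mps i (r ^ 2) * pderiv_mps j (w l)
       + 2 * pderiv_mps j (r ^ 2) * pderiv_mps i (w l) + 2 * r ^ 2 * pderiv_mps j (pderiv_mps i (w l)))
       + 2 * r ^ 2 * pderiv_mps i (w l) * pderiv_mps j (w l)"
      by (simp add: pderiv_mps_mult power2_eq_square algebra_simps)
    then show ?thesis by (simp only: distrib_left[of "winv l"] winv_w) (simp add: mult_ac)
  qed
  have "(\<Sum>l\<in>UNIV. pderiv_mps j (pderiv_mps i (w l))) = 0"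
    using pderiv_w_sum by (metis pderiv_mps_0 pderiv_mps_sum)
  then have "(\<Sum>l\<in>UNIV. winv l * pderiv_mps j (pderiv_mps i (r ^ 2 * w l ^ 2)))
     = 2 * r ^ 2 * (\<Sum>l\<in>UNIV. winv l * pderiv_mps i (w l) * pderiv_mps j (w l))"
    unfolding t sum.distrib sum_distrib_left[symmetric] by (simp add: w_sum pderiv_w_sum)
  then show ?thesis
    by (simp add: phi_def pderiv_shift_mps mult_ac)
qed

lemma G_hessian:
  "(\<Sum>j\<in>UNIV. G i j * eval0_mps (pderiv_mps j (pderiv_mps l phi))) = (if i = l then 1 else 0)"
proof -
  let ?V = "\<lambda>b i. pderiv_mps i (w b)"
  define C where "C a b = (if a = b then w (Mid a) else 0) + w (Mid a) * w (Mid b)" for a b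
  have half: "const_mps (1 / 2 :: 'k) * 2 = (1 :: ('k, 'n) mps)"
    using const_mps_inverse_of_nat[of 2, where 'a = 'k and 'b = 'n] by (simp add: mult.commute)
  have unit: "const_mps (1 / 2 :: 'k) * \<kappa>inv * rinv ^ 2 * (2 * \<kappa> * r ^ 2) = 1"
  proof -
    have "const_mps (1 / 2 :: 'k) * \<kappa>inv * rinv ^ 2 * (2 * \<kappa> * r ^ 2)
       = (const_mps (1 / 2) * 2) * (\<kappa> * \<kappa>inv) * (r * rinv) ^ 2"
      by (simp add: power2_eq_square mult_ac)
    then show ?thesis by (simp only: half \<kappa>_inv r_inv) simp
  qed
  have e: "(\<Sum>j\<in>UNIV. J j b * (\<Sum>m\<in>UNIV. winv m * ?V m l * ?V m j))
      = winv (Mid b) * ?V (Mid b) l - winv Last * ?V Last l" for b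
  proof -
    have "(\<Sum>j\<in>UNIV. J j b * (\<Sum>m\<in>UNIV. winv m * ?V m l * ?V m j))
      = (\<Sum>m\<in>UNIV. winv m * ?V m l * \<delta> b (w m))"
      unfolding \<delta>_def sum_distrib_left by (subst sum.swap) (simp add: mult_ac)
    then show ?thesis
      by (simp add: sum_cone_index \<delta>_w_Mid \<delta>_w_First \<delta>_w_Last if_distrib[of "\<lambda>x. _ * x"] cong: if_cong)
  qed
  have f: "(\<Sum>b\<in>UNIV. C a b * (winv (Mid b) * ?V (Mid b) l - winv Last * ?V Last l)) = ?V (Mid a) l" for a
  proof -
    let ?t = "winv Last * ?V Last l"
    have "(\<Sum>b\<in>UNIV. C a b * (winv (Mid b) * ?V (Mid b) l - ?t))
       = (\<Sum>b\<in>UNIV. (if a = b then w (Mid a) * (winv (Mid b) * ?V (Mid b) l - ?t) else 0))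
         + (\<Sum>b\<in>UNIV. w (Mid a) * (?V (Mid b) l - w (Mid b) * ?t))"
      unfolding sum.distrib[symmetric]
      by (rule sum.cong[OF refl]) (use w_inv in \<open>simp add: C_def algebra_simps\<close>)
    also have "\<dots> = w (Mid a) * (winv (Mid a) * ?V (Mid a) l - ?t)
       + w (Mid a) * ((\<Sum>b\<in>UNIV. ?V (Mid b) l) - (\<Sum>b\<in>UNIV. w (Mid b)) * ?t)"
      by (simp add: sum_distrib_left sum_distrib_right sum_subtractf right_diff_distrib)
    also have "(\<Sum>b\<in>UNIV. ?V (Mid b) l) = - ?V Last l"
      by (simp add: w_Last)
    also have "(\<Sum>b\<in>UNIV. w (Mid b)) = - 1 - w Last"
      by (simp add: w_Last)
    also have "w (Mid a) * (winv (Mid a) * ?V (Mid a) l - ?t) + w (Mid a) * (- ?V Last l - (- 1 - w Last) * ?t)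
       = (w (Mid a) * winv (Mid a)) * ?V (Mid a) l + w (Mid a) * ((w Last * winv Last) * ?V Last l - ?V Last l)"
      by (simp add: algebra_simps)
    finally show ?thesis by (simp add: w_inv)
  qed
  have "(\<Sum>j\<in>UNIV. (\<Sum>a\<in>UNIV. \<Sum>b\<in>UNIV. J i a * C a b * J j b) * E j)
      = (\<Sum>a\<in>UNIV. J i a * (\<Sum>b\<in>UNIV. C a b * (\<Sum>j\<in>UNIV. J j b * E j)))" for E
    unfolding sum_distrib_left sum_distrib_right
    by (subst sum.swap, rule sum.cong[OF refl], subst sum.swap) (simp only: mult.assoc)
  then have "(\<Sum>j\<in>UNIV. (\<Sum>a\<in>UNIV. \<Sum>b\<in>UNIV. J i a * C a b * J j b) * (\<Sum>m\<in>UNIV. winv m * ?V m l * ?V m j))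
      = (\<Sum>a\<in>UNIV. J i a * (\<Sum>b\<in>UNIV. C a b * (\<Sum>j\<in>UNIV. J j b * (\<Sum>m\<in>UNIV. winv m * ?V m l * ?V m j))))"
    by this
  also have "\<dots> = (if i = l then 1 else 0)"
    unfolding e f by (simp add: JV eq_commute)
  finally have "(\<Sum>j\<in>UNIV. (\<Sum>a\<in>UNIV. \<Sum>b\<in>UNIV. J i a * C a b * J j b) * (\<Sum>m\<in>UNIV. winv m * ?V m l * ?V m j))
      = (if i = l then 1 else 0)" .
  moreover have "G i j * eval0_mps (pderiv_mps j (pderiv_mps l phi))
     = const_mps (1 / 2 :: 'k) * \<kappa>inv * rinv ^ 2 * (2 * \<kappa> * r ^ 2) *
       ((\<Sum>a\<in>UNIV. \<Sum>b\<in>UNIV. J i a * C a b * J j b) * (\<Sum>m\<in>UNIV. winv m * ?V m l * ?V m j))" for j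
    unfolding G_def hessian_phi C_def by (simp only: mult_ac)
  ultimately show ?thesis unfolding unit by simp
qed

sublocale ph: phase phi G
proof
  show "G i j = G j i" for i j
  proof -
    have "(\<Sum>a\<in>UNIV. \<Sum>b\<in>UNIV. J i a * ((if a = b then w (Mid a) else 0) + w (Mid a) * w (Mid b)) * J j b)
      = (\<Sum>a\<in>UNIV. \<Sum>b\<in>UNIV. J j a * ((if a = b then w (Mid a) else 0) + w (Mid a) * w (Mid b)) * J i b)"
      by (subst sum.swap, intro sum.cong refl) (simp add: mult_ac)
    then show ?thesis by (simp only: G_def)
  qed
qed (rule eval_phi eval_deriv_phi G_hessian)+

text \<open>The amplitude is given as a density X dw. With the factor W, integration by parts in w
  has no divergence term, by \<open>piola\<close>.\<close>

definition "B k X = ph.stat k (shift_mps (W * X))"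

lemma B_additive: "additive_map (B k)"
  by standard (simp add: B_def distrib_left sh.add additive_map.add[OF ph.stat_additive])

sublocale B: additive_map "B k" for k by (rule B_additive)

lemma B_by_parts: "(\<Sum>l\<in>UNIV. \<kappa> * winv l * B (Suc k) (X * \<delta> a (r ^ 2 * w l ^ 2))) = - B k (\<delta> a X)"
proof -
  interpret st: additive_map "ph.stat l" for l by (rule ph.stat_additive)
  have trm: "shift_mps (X * W * J j a) * pderiv_mps j phi
      = (\<Sum>l\<in>UNIV. const_mps (\<kappa> * winv l) * shift_mps (W * (X * (J j a * pderiv_mps j (r ^ 2 * w l ^ 2)))))" for j
    by (simp add: phi_def pderiv_shift_mps[of _ "_ * _"] sum_distrib_left sh.mult[of W] sh.mult[of X] sh.mult[of "J j a"]
        sh.mult[of _ "J j a"] sh.mult[of _ W] const_mps_mult mult_ac)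
  have "(\<Sum>l\<in>UNIV. \<kappa> * winv l * B (Suc k) (X * \<delta> a (r ^ 2 * w l ^ 2)))
      = (\<Sum>j\<in>UNIV. ph.stat (Suc k) (shift_mps (X * W * J j a) * pderiv_mps j phi))"
    unfolding trm st.sum ph.stat_const B_def \<delta>_def sum_distrib_left sh.sum
    by (rule sum.swap)
  also have "\<dots> = - ph.stat k (shift_mps (\<Sum>j\<in>UNIV. pderiv_mps j (X * (W * J j a))))"
    unfolding ph.stat_by_parts pderiv_shift_mps by (simp add: sum_negf st.sum sh.sum mult.assoc)
  also have "(\<Sum>j\<in>UNIV. pderiv_mps j (X * (W * J j a))) = W * \<delta> a X + X * (\<Sum>j\<in>UNIV. pderiv_mps j (W * J j a))"
    by (simp only: pderiv_mps_mult[of _ X] sum.distrib sum_distrib_left \<delta>_def mult_ac)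
  finally show ?thesis by (simp add: piola B_def)
qed

lemma B_phase:
  "(\<Sum>l\<in>UNIV. \<kappa> * winv l * B (Suc k) (r ^ 2 * w l ^ 2 * X)) = - const_mps (of_nat CARD('n) / 2 + of_nat k) * B k X"
proof -
  interpret st: additive_map "ph.stat l" for l by (rule ph.stat_additive)
  have "phi * shift_mps (W * X) = (\<Sum>l\<in>UNIV. const_mps (\<kappa> * winv l) * shift_mps (W * (r ^ 2 * w l ^ 2 * X)))"
    by (simp add: phi_def sum_distrib_left sum_distrib_right sh.mult const_mps_mult mult_ac)
  then have "(\<Sum>l\<in>UNIV. \<kappa> * winv l * B (Suc k) (r ^ 2 * w l ^ 2 * X)) = ph.stat (Suc k) (phi * shift_mps (W * X))"
    by (simp only: st.sum ph.stat_const B_def)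
  then show ?thesis unfolding ph.stat_phase B_def .
qed

text \<open>The exponent of r makes the derivatives of r drop out of \<open>D_by_parts\<close>:
  differentiating the power of r yields the factor n + 2 k, and by \<open>B_phase\<close> the
  derivative of r^2 in the phase yields 2 (n/2 + k).\<close>

definition "D k F = B k (r ^ (CARD('n) + 2 * k) * F)"

sublocale DD: additive_map "D k" for k
  by standard (simp add: D_def distrib_left B.add)

lemma D_0: "D 0 F = W * r ^ CARD('n) * F"
  by (simp add: D_def B_def ph.stat_0 mult.assoc)

lemma \<delta>_r_power: "\<delta> a (r ^ N) = of_nat N * (\<delta> a r * rinv) * r ^ N"
proof (cases N)
  case (Suc M)
  have "\<delta> a (r ^ Suc M) = of_nat (Suc M) * ((r * rinv) * r ^ M) * \<delta> a r"
    unfolding r_inv mult_1_left by (rule \<delta>.power)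
  then show ?thesis unfolding Suc by (simp only: power_Suc mult_ac)
qed simp

lemma D_by_parts:
  "2 * \<kappa> * (winv (Mid a) * D (Suc k) (w (Mid a) * F) - winv Last * D (Suc k) (w Last * F)) = - D k (\<delta> a F)"
proof -
  define N where "N = CARD('n) + 2 * k"
  define X where "X = r ^ N * F"
  define Z where "Z = \<delta> a r * rinv * X"
  have X: "X * \<delta> a (r ^ 2 * w l ^ 2) = r ^ 2 * w l ^ 2 * (of_nat 2 * Z)
      + of_nat 2 * (r ^ (CARD('n) + 2 * Suc k) * (w l * \<delta> a (w l) * F))" for l
  proof -
    have "X * \<delta> a (r ^ 2 * w l ^ 2) = 2 * (r * \<delta> a r) * w l ^ 2 * X + 2 * (r ^ 2 * (w l * \<delta> a (w l)) * X)"
      by (simp add: \<delta>.mult power2_eq_square algebra_simps)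
    also have "r * \<delta> a r = r * (r * rinv) * \<delta> a r" by (simp add: r_inv)
    finally show ?thesis by (simp add: Z_def X_def N_def power_add power2_eq_square mult_ac)
  qed
  have \<delta>X: "\<delta> a X = r ^ N * \<delta> a F + of_nat N * Z"
    by (simp add: X_def Z_def \<delta>.mult \<delta>_r_power mult_ac)
  have two: "const_mps (of_nat CARD('n) / 2 + of_nat k) * of_nat 2 = (of_nat N :: ('k, 'n) mps)"
  proof -
    have "(of_nat CARD('n) / 2 + of_nat k) * of_nat 2 = (of_nat N :: 'k)" by (simp add: N_def algebra_simps)
    then show ?thesis unfolding const_mps_of_nat[symmetric] const_mps_mult[symmetric] by (simp only:)
  qed
  have "- B k (\<delta> a X) = (\<Sum>l\<in>UNIV. \<kappa> * winv l * B (Suc k) (r ^ 2 * w l ^ 2 * (of_nat 2 * Z)))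
      + (\<Sum>l\<in>UNIV. \<kappa> * winv l * (of_nat 2 * D (Suc k) (w l * \<delta> a (w l) * F)))"
    unfolding B_by_parts[symmetric] X B.add distrib_left sum.distrib B.of_nat_mult[of _ 2 "_ * _"] D_def ..
  also have "(\<Sum>l\<in>UNIV. \<kappa> * winv l * B (Suc k) (r ^ 2 * w l ^ 2 * (of_nat 2 * Z))) = - (of_nat N * B k Z)"
    unfolding B_phase B.of_nat_mult by (simp only: mult_minus_left mult.assoc[symmetric] two)
  also have "B k (\<delta> a X) = D k (\<delta> a F) + of_nat N * B k Z"
    unfolding \<delta>X B.add B.of_nat_mult D_def N_def ..
  finally have "- D k (\<delta> a F) = (\<Sum>l\<in>UNIV. \<kappa> * winv l * (of_nat 2 * D (Suc k) (w l * \<delta> a (w l) * F)))"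
    by simp
  also have "\<dots> = 2 * \<kappa> * (winv (Mid a) * D (Suc k) (w (Mid a) * F) - winv Last * D (Suc k) (w Last * F))"
    by (simp add: sum_cone_index \<delta>_w_Mid \<delta>_w_First \<delta>_w_Last if_distrib[of "\<lambda>x. _ * x"]
        if_distrib[of "\<lambda>x. x * _"] if_distrib[of "D _"] DD.uminus algebra_simps cong: if_cong)
  finally show ?thesis ..
qed

text \<open>Commutator with multiplication by w_l. In \<open>D_by_parts\<close> the terms winv_l w_l
  D_(k+1) F of the two indices cancel, so the commutators satisfy the same relation.\<close>

definition "hat k l F = D (Suc k) (w l * F) - w l * D (Suc k) F"

lemma hat_additive: "additive_map (hat k l)"
  by standard (simp add: hat_def DD.add algebra_simps)

sublocale hat: additive_map "hat k l" for k l by (rule hat_additive)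

lemma hat_by_parts: "2 * \<kappa> * (winv (Mid a) * hat k (Mid a) F - winv Last * hat k Last F) = - D k (\<delta> a F)"
  unfolding D_by_parts[symmetric] hat_def by (simp add: right_diff_distrib)

lemma hat_sum: "(\<Sum>a\<in>UNIV. hat k (Mid a) F) = - hat k Last F"
proof -
  have "(\<Sum>l\<in>UNIV. hat k l F) = D (Suc k) ((\<Sum>l\<in>UNIV. w l) * F) - (\<Sum>l\<in>UNIV. w l) * D (Suc k) F"
    by (simp add: hat_def sum_subtractf sum_distrib_right DD.sum)
  then have "(\<Sum>l\<in>UNIV. hat k l F) = 0" by (simp add: w_sum)
  then have "(\<Sum>a\<in>UNIV. hat k (Mid a) F) + hat k Last F = 0"
    by (simp add: sum_cone_index) (simp add: hat_def w_First)
  then show ?thesis by (simp add: eq_neg_iff_add_eq_0)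
qed

lemma sum_w_Mid: "(\<Sum>a\<in>UNIV. w (Mid a)) = - 1 - w Last"
  by (simp add: w_Last)

lemma hat_Mid': "2 * \<kappa> * hat k (Mid a) F = w (Mid a) * (2 * \<kappa> * winv Last * hat k Last F) - w (Mid a) * D k (\<delta> a F)"
proof -
  have "w (Mid a) * (2 * \<kappa> * (winv (Mid a) * hat k (Mid a) F - winv Last * hat k Last F)) = - (w (Mid a) * D k (\<delta> a F))"
    unfolding hat_by_parts by simp
  moreover have "w (Mid a) * (2 * \<kappa> * (winv (Mid a) * hat k (Mid a) F - winv Last * hat k Last F))
     = (w (Mid a) * winv (Mid a)) * (2 * \<kappa> * hat k (Mid a) F) - w (Mid a) * (2 * \<kappa> * winv Last * hat k Last F)"
    by (simp add: algebra_simps)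
  ultimately have "1 * (2 * \<kappa> * hat k (Mid a) F) - w (Mid a) * (2 * \<kappa> * winv Last * hat k Last F) = - (w (Mid a) * D k (\<delta> a F))"
    by (simp only: w_inv)
  then show ?thesis by (simp add: algebra_simps)
qed

text \<open>The relations \<open>hat_by_parts\<close> for all a together with \<open>hat_sum\<close>
  are a linear system for the commutators. Summing over a, with the w_a adding up to -1 - w_Last,
  solves for the last one.\<close>

lemma hat_Last: "2 * \<kappa> * winv Last * hat k Last F = - (\<Sum>c\<in>UNIV. w (Mid c) * D k (\<delta> c F))"
proof -
  define t where "t = 2 * \<kappa> * winv Last * hat k Last F"
  have "- (2 * \<kappa> * hat k Last F) = (\<Sum>a\<in>UNIV. 2 * \<kappa> * hat k (Mid a) F)"
    by (simp add: hat_sum flip: sum_distrib_left)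
  also have "\<dots> = (\<Sum>a\<in>UNIV. w (Mid a)) * t - (\<Sum>c\<in>UNIV. w (Mid c) * D k (\<delta> c F))"
    by (simp add: hat_Mid' t_def sum_subtractf sum_distrib_right)
  also have "2 * \<kappa> * hat k Last F = (w Last * winv Last) * (2 * \<kappa> * hat k Last F)" by (simp add: w_inv)
  also have "\<dots> = w Last * t" by (simp add: t_def mult_ac)
  finally show ?thesis unfolding sum_w_Mid t_def[symmetric] by (simp add: algebra_simps eq_neg_iff_add_eq_0)
qed

lemma hat_Mid:
  "2 * \<kappa> * hat k (Mid a) F = - (w (Mid a) * (D k (\<delta> a F) + (\<Sum>c\<in>UNIV. w (Mid c) * D k (\<delta> c F))))"
  unfolding hat_Mid' hat_Last by (simp add: algebra_simps)

text \<open>The sum of \<kappa> winv_l D_(k+1) (w_l^2 F) is evaluated twice: by the scaling rule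
  \<open>B_phase\<close>, and by passing to commutators and integrating by parts.\<close>

lemma D_euler: "(\<Sum>a\<in>UNIV. D k (w (Mid a) * \<delta> a F)) = of_nat (2 * k) * D k F + (\<Sum>a\<in>UNIV. w (Mid a) * D k (\<delta> a F))"
proof -
  define N where "N = CARD('n) + 2 * k"
  have two: "2 * (- const_mps (of_nat CARD('n) / 2 + of_nat k) * x) = - (of_nat N * (x :: ('k, 'n) mps))" for x
  proof -
    have "const_mps 2 * const_mps (of_nat CARD('n) / 2 + of_nat k :: 'k) = (of_nat N :: ('k, 'n) mps)"
    proof -
      have "2 * (of_nat CARD('n) / 2 + of_nat k) = (of_nat N :: 'k)" by (simp add: N_def algebra_simps)
      then show ?thesis unfolding const_mps_of_nat[symmetric] const_mps_mult[symmetric] by (simp only:)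
    qed
    then show ?thesis by (simp add: const_mps_of_nat[of 2, simplified] mult.assoc[symmetric])
  qed
  have "r ^ 2 * w l ^ 2 * (r ^ N * F) = r ^ (CARD('n) + 2 * Suc k) * (w l * (w l * F))" for l
    by (simp add: N_def power_add power2_eq_square mult_ac)
  then have "(\<Sum>l\<in>UNIV. \<kappa> * winv l * D (Suc k) (w l * (w l * F))) = - const_mps (of_nat CARD('n) / 2 + of_nat k) * D k F"
    using B_phase[of k "r ^ N * F"] by (simp only: D_def N_def)
  then have "- (of_nat N * D k F) = 2 * (\<Sum>l\<in>UNIV. \<kappa> * winv l * D (Suc k) (w l * (w l * F)))"
    using two[of "D k F"] by (simp only:)
  also have "\<dots> = 2 * \<kappa> * (\<Sum>l\<in>UNIV. winv l * D (Suc k) (w l * (w l * F)))"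
    by (simp add: sum_distrib_left mult_ac)
  also have "(\<Sum>l\<in>UNIV. winv l * D (Suc k) (w l * (w l * F))) = (\<Sum>l\<in>UNIV. winv l * hat k l (w l * F))"
  proof -
    have "(\<Sum>l\<in>UNIV. D (Suc k) (w l * F)) = 0"
      by (simp add: w_sum flip: DD.sum sum_distrib_right)
    then show ?thesis by (simp add: hat_def right_diff_distrib sum_subtractf)
  qed
  also have "\<dots> = (\<Sum>a\<in>UNIV. winv (Mid a) * hat k (Mid a) (w (Mid a) * F)) + winv Last * hat k Last (w Last * F)"
    by (simp add: sum_cone_index) (simp add: hat_def w_First)
  also have "2 * \<kappa> * \<dots> = (\<Sum>a\<in>UNIV. 2 * \<kappa> * (winv (Mid a) * hat k (Mid a) (w (Mid a) * F) - winv Last * hat k Last (w (Mid a) * F)))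
      + 2 * \<kappa> * winv Last * hat k Last ((\<Sum>a\<in>UNIV. w (Mid a)) * F + w Last * F)"
    by (simp add: sum_distrib_right sum_distrib_left hat.add hat.sum distrib_left right_diff_distrib sum_subtractf mult.assoc)
  also have "(\<Sum>a\<in>UNIV. w (Mid a)) * F + w Last * F = - F"
    unfolding sum_w_Mid by (simp add: algebra_simps)
  also have "(\<Sum>a\<in>UNIV. 2 * \<kappa> * (winv (Mid a) * hat k (Mid a) (w (Mid a) * F) - winv Last * hat k Last (w (Mid a) * F)))
      = - (of_nat CARD('n) * D k F) - (\<Sum>a\<in>UNIV. D k (w (Mid a) * \<delta> a F))"
    unfolding hat_by_parts by (simp add: \<delta>.mult \<delta>_w_Mid DD.add sum.distrib sum_negf sum_subtractf)
  also have "2 * \<kappa> * winv Last * hat k Last (- F) = (\<Sum>c\<in>UNIV. w (Mid c) * D k (\<delta> c F))"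
    using hat_Last[of k F] by (simp add: hat.uminus)
  finally show ?thesis by (simp add: N_def algebra_simps)
qed

text \<open>By \<open>D_euler\<close> the left side is 2 \<kappa> times the sum over a of the
  commutators of w_a, applied to the derivative of F in w_a; \<open>hat_Mid\<close> expresses them
  through index m.\<close>

theorem D_recursion:
  "2 * \<kappa> * (of_nat (2 * Suc m) * D (Suc m) F)
     = - (\<Sum>a\<in>UNIV. w (Mid a) * (D m (\<delta> a (\<delta> a F)) + (\<Sum>c\<in>UNIV. w (Mid c) * D m (\<delta> c (\<delta> a F)))))"
proof -
  have "of_nat (2 * Suc m) * D (Suc m) F = (\<Sum>a\<in>UNIV. hat m (Mid a) (\<delta> a F))"
    using D_euler[of "Suc m" F] by (simp add: hat_def sum_subtractf)
  then show ?thesis by (simp add: sum_distrib_left hat_Mid sum_negf)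
qed

end

section \<open>Homogeneous functions on the cone\<close>

text \<open>A function of the homogeneous coordinates is written as a power series in \<open>u\<^sub>0 - 1\<close> with
  coefficients depending on \<open>w\<close>; here \<open>u\<^sub>0 = s\<close>, \<open>u\<^sub>a = s w\<^sub>a\<close>.\<close>

type_synonym ('a, 'm) radial = "(('a, 'm) mps, unit) mps"

context cone_phase
begin

definition s :: "('k, 'n) radial" where "s = 1 + var_mps ()"

definition sinv :: "('k, 'n) radial" where "sinv = (SOME y. s * y = 1)"

lemma s_inv: "s * sinv = 1"
proof -
  have "s dvd 1" by (rule mps_unitI[of _ 1]) (simp add: s_def)
  then have "\<exists>y. s * y = 1" by (metis dvdE)
  then show ?thesis unfolding sinv_def by (rule someI_ex)
qed

abbreviation pd :: "('k, 'n) radial \<Rightarrow> ('k, 'n) radial" where "pd \<equiv> pderiv_mps ()"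

abbreviation md :: "'n \<Rightarrow> ('k, 'n) radial \<Rightarrow> ('k, 'n) radial" where "md a \<equiv> map_mps (\<delta> a)"

sublocale md: derivation "md a" for a by (rule \<delta>.map_mps_derivation)

lemma md_const [simp]: "md a (const_mps x) = const_mps (\<delta> a x)"
  by (rule \<delta>.map_mps_const)

lemma md_pd: "md a (pd X) = pd (md a X)"
  by (rule \<delta>.map_mps_pderiv)

lemma md_md: "md a (md b X) = md b (md a X)"
  by (rule mps_eqI) (simp add: \<delta>_commute)

lemma md_s [simp]: "md a s = 0"
  by (simp add: s_def md.add \<delta>.map_mps_var)

lemma pd_s [simp]: "pd s = 1"
  by (simp add: s_def pderiv_var_mps)

lemma md_sinv [simp]: "md a sinv = 0"
proof -
  have "md a (s * sinv) = 0" unfolding s_inv by simp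
  then have "s * md a sinv = 0" by (simp add: md.mult)
  moreover have "s \<noteq> 0" using s_inv by auto
  ultimately show ?thesis by simp
qed

lemma pd_sinv: "pd sinv = - (sinv * sinv)"
proof -
  have "pd (s * sinv) = 0" unfolding s_inv by simp
  then have "s * pd sinv = - sinv" by (simp add: pderiv_mps_mult eq_neg_iff_add_eq_0 add.commute)
  then have "sinv * (s * pd sinv) = sinv * (- sinv)" by (simp only:)
  then have "(s * sinv) * pd sinv = - (sinv * sinv)" by (simp add: mult_ac)
  then show ?thesis by (simp add: s_inv)
qed

text \<open>The partial derivatives in u_0 = s and u_a = s w_a of a function of s and w. Varying u_0
  at fixed u_a also changes w, hence the correction.\<close>

definition dd :: "'n option \<Rightarrow> ('k, 'n) radial \<Rightarrow> ('k, 'n) radial" where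
  "dd i X = (case i of None \<Rightarrow> pd X - sinv * (\<Sum>c\<in>UNIV. const_mps (w (Mid c)) * md c X) | Some a \<Rightarrow> sinv * md a X)"

definition uu :: "'n option \<Rightarrow> ('k, 'n) radial" where
  "uu i = s * const_mps (w (chart_index i))"

lemma uu_simps: "uu None = s" "uu (Some a) = s * const_mps (w (Mid a))"
  by (simp_all add: uu_def w_First)

lemma dd_None_Some: "dd None (dd (Some a) X) = dd (Some a) (dd None X)"
proof -
  have "dd None (dd (Some a) X) = sinv * md a (pd X) - sinv * sinv * md a X
     - sinv * sinv * (\<Sum>c\<in>UNIV. const_mps (w (Mid c)) * md c (md a X))"
    by (simp add: dd_def pderiv_mps_mult pd_sinv md_pd md.mult sum_distrib_left mult_ac)
  moreover have "md a (\<Sum>c\<in>UNIV. const_mps (w (Mid c)) * md c X)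
     = md a X + (\<Sum>c\<in>UNIV. const_mps (w (Mid c)) * md c (md a X))"
    by (simp add: md.sum md.mult \<delta>_w_Mid sum.distrib if_distrib[of const_mps] if_distrib[of "\<lambda>x. x * _"]
        md_md[of a] cong: if_cong)
  ultimately show ?thesis by (simp add: dd_def md.diff md.mult algebra_simps)
qed

sublocale wy: weyl dd uu
proof
  fix i j :: "'n option" and X Y :: "('k, 'n) radial"
  show "dd i (X + Y) = dd i X + dd i Y"
    by (cases i) (auto simp: dd_def md.add distrib_left sum.distrib algebra_simps)
  show "dd i (X * Y) = dd i X * Y + X * dd i Y"
    by (cases i) (auto simp: dd_def md.mult pderiv_mps_mult algebra_simps sum.distrib sum_distrib_left)
  show "dd i (dd j X) = dd j (dd i X)"
  proof (cases i; cases j)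
    fix a b assume "i = Some a" "j = Some b"
    then show ?thesis by (simp add: dd_def md.mult md_md)
  qed (auto simp: dd_None_Some)
  have s1: "sinv * (s * x) = x" for x using s_inv by (simp add: mult.assoc[symmetric] mult.commute)
  show "dd i (uu j) = (if i = j then 1 else 0)"
  proof (cases i; cases j)
    fix b assume ij: "i = None" "j = Some b"
    have "(\<Sum>c\<in>UNIV. const_mps (w (Mid c)) * md c (uu j)) = s * const_mps (w (Mid b))"
      by (simp add: ij uu_simps md.mult \<delta>_w_Mid if_distrib[of const_mps] if_distrib[of "\<lambda>x. _ * x"] cong: if_cong)
    then show ?thesis by (simp add: ij dd_def uu_simps pderiv_mps_mult s1)
  qed (auto simp: dd_def uu_simps pderiv_mps_mult md.mult \<delta>_w_Mid s1)
qed

text \<open>Euler's equation. Degrees are integers because reciprocals have negative degree.\<close>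

definition hom :: "int \<Rightarrow> ('k, 'n) radial \<Rightarrow> bool" where
  "hom e X \<longleftrightarrow> s * pd X = of_int e * X"

lemma hom_pd: "hom e X \<Longrightarrow> pd X = sinv * (of_int e * X)"
proof -
  assume "hom e X"
  then have "(s * sinv) * pd X = sinv * (of_int e * X)" by (simp add: hom_def mult_ac)
  then show ?thesis unfolding s_inv by simp
qed

lemma hom_const: "hom 0 (const_mps x)"
  by (simp add: hom_def)

lemma hom_s: "hom 1 s"
  by (simp add: hom_def)

lemma hom_mult: "hom a X \<Longrightarrow> hom b Y \<Longrightarrow> hom (a + b) (X * Y)"
proof -
  assume a: "hom a X" "hom b Y"
  have "s * pd (X * Y) = (s * pd X) * Y + X * (s * pd Y)" by (simp add: pderiv_mps_mult algebra_simps)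
  also have "\<dots> = (of_int a * X) * Y + X * (of_int b * Y)" using a by (simp only: hom_def)
  finally show ?thesis by (simp add: hom_def algebra_simps)
qed

lemma hom_add: "hom a X \<Longrightarrow> hom a Y \<Longrightarrow> hom a (X + Y)"
  and hom_diff: "hom a X \<Longrightarrow> hom a Y \<Longrightarrow> hom a (X - Y)"
  by (simp_all add: hom_def algebra_simps)

lemma hom_sum: "(\<And>x. x \<in> A \<Longrightarrow> hom a (f x)) \<Longrightarrow> hom a (sum f A)"
  by (induction A rule: infinite_finite_induct) (auto intro: hom_add simp: hom_def[of _ 0])

lemma hom_sinv: "hom (- 1) sinv"
  using s_inv by (simp add: hom_def pd_sinv mult.assoc[symmetric])

lemma hom_md: "hom e X \<Longrightarrow> hom e (md a X)"
proof -
  assume "hom e X"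
  then have "md a (s * pd X) = md a (of_int e * X)" by (simp add: hom_def)
  moreover have "md a (of_int e * X) = of_int e * md a X"
    by (cases e) (simp_all add: md.of_nat_mult md.uminus del: of_nat_Suc)
  ultimately show ?thesis by (simp add: hom_def md.mult md_pd)
qed

lemma hom_of_int: "hom e X \<Longrightarrow> hom e (of_int k * X)"
proof -
  have "pd (of_int k) = 0" by (cases k) (simp_all del: of_nat_Suc)
  then show "hom e X \<Longrightarrow> hom e (of_int k * X)" by (simp add: hom_def pderiv_mps_mult mult.left_commute)
qed

lemma hom_dd: "hom e X \<Longrightarrow> hom (e - 1) (dd i X)"
proof (cases i)
  case None
  assume X: "hom e X"
  then have eq: "dd i X = sinv * (of_int e * X - (\<Sum>c\<in>UNIV. const_mps (w (Mid c)) * md c X))"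
    by (simp add: None dd_def hom_pd right_diff_distrib)
  have "hom (0 + e) (const_mps (w (Mid c)) * md c X)" for c
    by (intro hom_mult hom_const hom_md X)
  then have "hom (- 1 + e) (dd i X)"
    unfolding eq by (intro hom_mult hom_sinv hom_diff hom_of_int X hom_sum) simp
  then show ?thesis by simp
next
  case (Some a)
  assume X: "hom e X"
  have "hom (- 1 + e) (sinv * md a X)" by (intro hom_mult hom_sinv hom_md X)
  then show ?thesis by (simp add: dd_def Some)
qed

lemma hom_uu: "hom 1 (uu i)"
  using hom_mult[OF hom_s hom_const] by (simp add: uu_def)

lemma hom_N: "hom e X \<Longrightarrow> hom (e - int k) (wy.N k X)"
proof (induction k arbitrary: e X)
  case (Suc k)
  have "hom (1 + (e - 1 - 1 - int k)) (uu i * wy.N k (dd i (dd i X)))" for i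
    by (intro hom_mult hom_uu Suc.IH hom_dd Suc.prems)
  then have "hom (e - int (Suc k)) (wy.N (Suc k) X)"
    unfolding wy.N_Suc by (intro hom_sum) (simp add: algebra_simps)
  then show ?case .
qed simp

text \<open>A homogeneous function is determined by its restriction to s = 1: by Euler's equation
  the multiples of Y are closed under the radial derivative.\<close>

lemma hom_eval0_eq_0: "hom e Y \<Longrightarrow> eval0_mps Y = 0 \<Longrightarrow> Y = 0"
proof -
  assume Y: "hom e Y" "eval0_mps Y = 0"
  show ?thesis
  proof (rule mps_zero_principle[of Y "range (\<lambda>Z. Z * Y)"])
    show "Y \<in> range (\<lambda>Z. Z * Y)" by (rule range_eqI[of _ _ 1]) simp
    show "eval0_mps X = 0" if "X \<in> range (\<lambda>Z. Z * Y)" for X using that Y by auto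
    show "pderiv_mps i X \<in> range (\<lambda>Z. Z * Y)" if "X \<in> range (\<lambda>Z. Z * Y)" for X i
    proof -
      from that obtain Z where "X = Z * Y" by auto
      then have "pderiv_mps i X = (pd Z + Z * sinv * of_int e) * Y"
        using hom_pd[OF Y(1)] by (simp add: pderiv_mps_mult algebra_simps)
      then show ?thesis by blast
    qed
  qed
qed

lemma eval_s [simp]: "eval0_mps s = 1" "eval0_mps sinv = 1"
proof -
  show e: "eval0_mps s = 1" by (simp add: s_def)
  have "eval0_mps (s * sinv) = 1" unfolding s_inv by simp
  then show "eval0_mps sinv = 1" by (simp add: e)
qed

lemma eval_uu [simp]: "eval0_mps (uu i) = w (chart_index i)"
  by (simp add: uu_def)

lemma eval_dd_Some: "eval0_mps (dd (Some a) X) = \<delta> a (eval0_mps X)"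
  by (simp add: dd_def)

definition "E F = (\<Sum>c\<in>UNIV. w (Mid c) * \<delta> c F)"

lemma eval_of_int [simp]: "eval0_mps (of_int e :: ('k, 'n) radial) = of_int e"
  by (cases e) (simp_all del: of_nat_Suc)

lemma eval_dd_None: "hom e X \<Longrightarrow> eval0_mps (dd None X) = of_int e * eval0_mps X - E (eval0_mps X)"
  by (simp add: dd_def hom_pd E_def)

lemma D_E: "D m (E F) = of_nat (2 * m) * D m F + (\<Sum>a\<in>UNIV. w (Mid a) * D m (\<delta> a F))"
  using D_euler by (simp add: E_def DD.sum)

lemma \<delta>_E: "\<delta> a (E F) = \<delta> a F + E (\<delta> a F)"
  by (simp add: E_def \<delta>.sum \<delta>.mult \<delta>_w_Mid sum.distrib if_distrib[of "\<lambda>x. x * _"] \<delta>_commute[of a] cong: if_cong)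

text \<open>With degree 2 m + 1 the factor 2 m from Euler's equation cancels the 2 m of
  \<open>D_E\<close>, once for the outer derivative and once for the inner one.\<close>

lemma D_dd_None:
  assumes X: "hom (2 * int m + 1) X"
  shows "D m (eval0_mps (dd None (dd None X)))
    = (\<Sum>a\<in>UNIV. w (Mid a) * (\<Sum>c\<in>UNIV. w (Mid c) * D m (\<delta> c (\<delta> a (eval0_mps X)))))"
proof -
  define F where "F = eval0_mps X"
  define Y where "Y = of_nat (2 * m + 1) * F - E F"
  have Y: "eval0_mps (dd None X) = Y" using eval_dd_None[OF X] by (simp add: Y_def F_def)
  have "hom (int (2 * m)) (dd None X)" using hom_dd[OF X, of None] by simp
  from eval_dd_None[OF this] have "eval0_mps (dd None (dd None X)) = of_nat (2 * m) * Y - E Y"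
    unfolding Y by simp
  then have "D m (eval0_mps (dd None (dd None X))) = - (\<Sum>a\<in>UNIV. w (Mid a) * D m (\<delta> a Y))"
    unfolding DD.diff[of m] D_E DD.of_nat_mult by (simp only: DD.diff D_E DD.of_nat_mult) simp
  moreover have "D m (\<delta> a Y) = - (\<Sum>c\<in>UNIV. w (Mid c) * D m (\<delta> c (\<delta> a F)))" for a
  proof -
    have "\<delta> a Y = of_nat (2 * m) * \<delta> a F - E (\<delta> a F)"
      unfolding Y_def \<delta>.diff \<delta>_E \<delta>.of_nat_mult by (simp add: algebra_simps)
    then show ?thesis by (simp only: DD.diff DD.of_nat_mult D_E) simp
  qed
  ultimately show ?thesis by (simp add: F_def sum_negf)
qed

lemma D_homogeneous:
  assumes X: "hom (2 * int m + 1) X"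
  shows "4 * \<kappa> * of_nat (Suc m) * D (Suc m) (eval0_mps X)
    = - (\<Sum>i\<in>UNIV. eval0_mps (uu i) * D m (eval0_mps (dd i (dd i X))))"
proof -
  have "4 * \<kappa> * of_nat (Suc m) * D (Suc m) (eval0_mps X) = 2 * \<kappa> * (of_nat (2 * Suc m) * D (Suc m) (eval0_mps X))"
    by (simp add: algebra_simps)
  also have "\<dots> = - (\<Sum>a\<in>UNIV. w (Mid a) * D m (\<delta> a (\<delta> a (eval0_mps X)))) - D m (eval0_mps (dd None (dd None X)))"
    unfolding D_recursion D_dd_None[OF X] by (simp add: distrib_left sum.distrib)
  finally show ?thesis by (simp add: sum_option w_First eval_dd_Some)
qed

text \<open>Each step of the recursion lowers the index, differentiates twice and leaves the
  coordinate outside D. After k steps all coordinates stand left of all derivatives, which is the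
  normal ordering in \<open>N\<close>. The degree 2 k - 1 drops by two with each step.\<close>

theorem D_N:
  "hom (2 * int k - 1) X \<Longrightarrow>
    (- 4 * \<kappa>) ^ k * fact k * D k (eval0_mps X) = W * r ^ CARD('n) * eval0_mps (wy.N k X)"
proof (induction k arbitrary: X)
  case 0
  then show ?case by (simp add: D_0)
next
  case (Suc m)
  have e: "2 * int (Suc m) - 1 = 2 * int m + 1" by simp
  have X: "hom (2 * int m + 1) X" using Suc.prems unfolding e .
  have "(- 4 * \<kappa>) ^ Suc m * fact (Suc m) * D (Suc m) (eval0_mps X)
     = (- 4 * \<kappa>) ^ m * fact m * (- (4 * \<kappa> * of_nat (Suc m) * D (Suc m) (eval0_mps X)))"
    by (simp only: fact_Suc power_Suc of_nat_mult of_nat_fact mult_ac mult_minus_left mult_minus_right)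
  also have "\<dots> = (\<Sum>i\<in>UNIV. eval0_mps (uu i) * ((- 4 * \<kappa>) ^ m * fact m * D m (eval0_mps (dd i (dd i X)))))"
    unfolding D_homogeneous[OF X] by (simp add: sum_distrib_left mult_ac)
  also have "\<dots> = (\<Sum>i\<in>UNIV. eval0_mps (uu i) * (W * r ^ CARD('n) * eval0_mps (wy.N m (dd i (dd i X)))))"
  proof (rule sum.cong[OF refl])
    fix i
    have "hom (2 * int m - 1) (dd i (dd i X))" using hom_dd[OF hom_dd[OF Suc.prems]] by simp
    from Suc.IH[OF this] show "eval0_mps (uu i) * ((- 4 * \<kappa>) ^ m * fact m * D m (eval0_mps (dd i (dd i X))))
        = eval0_mps (uu i) * (W * r ^ CARD('n) * eval0_mps (wy.N m (dd i (dd i X))))" by simp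
  qed
  also have "\<dots> = W * r ^ CARD('n) * eval0_mps (wy.N (Suc m) X)"
    by (simp add: wy.N_Suc sum_distrib_left mult_ac)
  finally show ?case .
qed

lemma nonzero: "\<kappa> \<noteq> 0" "W \<noteq> 0" "r \<noteq> 0"
  using \<kappa>_inv W_inv r_inv by auto

lemma D_eq_0_iff:
  assumes X: "hom (2 * int (Suc m) - 1) X"
  shows "D (Suc m) (eval0_mps X) = 0 \<longleftrightarrow> wy.N (Suc m) X = 0"
proof -
  have "D (Suc m) (eval0_mps X) = 0 \<longleftrightarrow> eval0_mps (wy.N (Suc m) X) = 0"
  proof -
    have "(- 4 * \<kappa>) ^ Suc m * fact (Suc m) \<noteq> 0" "W * r ^ CARD('n) \<noteq> 0" using nonzero by (simp_all del: fact_Suc)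
    then show ?thesis using D_N[OF X] by (metis mult_eq_0_iff)
  qed
  also have "\<dots> \<longleftrightarrow> wy.N (Suc m) X = 0"
    using hom_eval0_eq_0[OF hom_N[OF X, of "Suc m"]] by auto
  finally show ?thesis .
qed

text \<open>The quadratic form that equals 1/r^2 on s = 1; the last coordinate is minus
  \<open>wy.w\<close>, hence the last term.\<close>

definition "Q = (\<Sum>i\<in>UNIV. const_mps (const_mps (c (chart_index i))) * uu i ^ 2) + const_mps (const_mps (c Last)) * wy.w ^ 2"

lemma w_eq: "wy.w = - (s * const_mps (w Last))"
  by (simp add: wy.w_def sum_option uu_simps w_Last const_mps_diff const_mps_uminus const_mps_sum
      sum_distrib_left algebra_simps)

lemma hom_w: "hom 1 wy.w"
  unfolding wy.w_def by (intro hom_sum hom_uu)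

lemma hom_Q: "hom 2 Q"
proof -
  have sq: "hom (0 + (1 + 1)) (const_mps (const_mps x) * (y * y))" if "hom 1 y" for x y
    by (intro hom_mult hom_const that)
  show ?thesis unfolding Q_def power2_eq_square
    by (intro hom_add hom_sum) (use sq[OF hom_uu] sq[OF hom_w] in simp_all)
qed

lemma hom_Q_power: "hom (2 * int m) (Q ^ m)"
proof (induction m)
  case (Suc m)
  then show ?case using hom_mult[OF hom_Q Suc] by (simp add: algebra_simps)
qed (use hom_const[of 1] in simp)

lemma eval_Q: "r ^ 2 * eval0_mps Q = 1"
  using quadric by (simp add: Q_def sum_cone_index sum_option w_First w_eq power2_eq_square)

lemma is_const_const: "wy.is_const (const_mps (const_mps x))"
  unfolding wy.is_const_def
proof
  show "dd i (const_mps (const_mps x)) = 0" for i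
    by (cases i) (auto simp: dd_def)
qed

section \<open>From vanishing coefficients to differential equations\<close>

definition "amp h \<longleftrightarrow> (\<forall>k\<ge>1. ph.stat k (shift_mps h) = 0)"

text \<open>At index m + 1, \<open>D_N\<close> asks for degree 2 m + 1, whereas X has degree 1. The
  factor Q^m supplies the degree, and r^2 Q = 1 turns r^(n+2(m+1)) Q^m into r^(n+2).\<close>

lemma amp_iff:
  assumes X: "hom 1 X"
  shows "amp (W * r ^ (CARD('n) + 2) * eval0_mps X) \<longleftrightarrow> (\<forall>m. wy.N (Suc m) (Q ^ m * X) = 0)"
proof -
  have "ph.stat (Suc m) (shift_mps (W * r ^ (CARD('n) + 2) * eval0_mps X)) = 0 \<longleftrightarrow> wy.N (Suc m) (Q ^ m * X) = 0" for m
  proof -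
    have "r ^ (CARD('n) + 2 * Suc m) = r ^ (CARD('n) + 2) * (r ^ 2) ^ m"
      by (simp add: power_add flip: power_mult)
    then have "r ^ (CARD('n) + 2 * Suc m) * eval0_mps (Q ^ m * X) = (r ^ 2 * eval0_mps Q) ^ m * (r ^ (CARD('n) + 2) * eval0_mps X)"
      by (simp only: power_mult_distrib eval0_mult eval0_power mult_ac)
    then have "r ^ (CARD('n) + 2 * Suc m) * eval0_mps (Q ^ m * X) = r ^ (CARD('n) + 2) * eval0_mps X"
      by (simp only: eval_Q power_one mult_1_left)
    then have "ph.stat (Suc m) (shift_mps (W * r ^ (CARD('n) + 2) * eval0_mps X)) = D (Suc m) (eval0_mps (Q ^ m * X))"
      by (simp only: D_def B_def mult.assoc)
    moreover have "hom (2 * int (Suc m) - 1) (Q ^ m * X)"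
      using hom_mult[OF hom_Q_power X, of m] by (simp add: algebra_simps)
    ultimately show ?thesis by (simp only: D_eq_0_iff)
  qed
  moreover have "(\<forall>k\<ge>1. P k) \<longleftrightarrow> (\<forall>m. P (Suc m))" for P
    by (metis Suc_le_D Suc_le_mono One_nat_def le0)
  ultimately show ?thesis unfolding amp_def by simp
qed

lemma NO_1: "hom e X \<Longrightarrow> wy.NO [1] X = of_int e * X"
proof -
  assume X: "hom e X"
  have "wy.NO [1] X = s * pd X - (s * sinv) * (\<Sum>c\<in>UNIV. const_mps (w (Mid c)) * md c X)
      + (s * sinv) * (\<Sum>c\<in>UNIV. const_mps (w (Mid c)) * md c X)"
    by (simp add: sum_option uu_simps dd_def sum_distrib_left right_diff_distrib mult_ac)
  then show ?thesis using X by (simp add: hom_def)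
qed

definition "lift P = s * const_mps P"

lemma hom_lift: "hom 1 (lift P)"
  using hom_mult[OF hom_s hom_const] by (simp add: lift_def)

lemma eval_lift [simp]: "eval0_mps (lift P) = P"
  by (simp add: lift_def)

text \<open>The coefficients k = 1 and k = 2 give the two operator equations from which
  \<open>wy.witt_generation\<close> starts.\<close>

theorem amp_imp_annihilated:
  assumes "amp (W * r ^ (CARD('n) + 2) * P)" "k \<ge> 2"
  shows "wy.NO [k] (lift P) = 0"
proof -
  have N: "wy.N (Suc m) (Q ^ m * lift P) = 0" for m
    using amp_iff[OF hom_lift, of P] assms by simp
  have "Q \<noteq> 0" using eval_Q by auto
  then show ?thesis
    using wy.witt_generation[of "lift P" "\<lambda>i. const_mps (const_mps (c (chart_index i)))" "const_mps (const_mps (c Last))" k]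
      N[of 0] N[of 1] NO_1[OF hom_lift] is_const_const assms(2) by (simp add: Q_def numeral_2_eq_2 del: wy.NO.simps)
qed

subsection \<open>The amplitudes attached to permutations\<close>

definition "ri S = (SOME y. (\<Sum>i\<in>S. w (chart_index i)) * y = 1)"

lemma ri: "S \<noteq> {} \<Longrightarrow> (\<Sum>i\<in>S. w (chart_index i)) * ri S = 1"
  unfolding ri_def by (rule someI_ex) (metis subset_sum_unit dvdE)

definition "rS S = sinv * const_mps (ri S)"

lemma rS: "S \<noteq> {} \<Longrightarrow> rS S * (\<Sum>i\<in>S. uu i) = 1"
proof -
  assume S: "S \<noteq> {}"
  have "rS S * (\<Sum>i\<in>S. uu i) = (s * sinv) * const_mps ((\<Sum>i\<in>S. w (chart_index i)) * ri S)"
    by (simp add: rS_def uu_def const_mps_mult const_mps_sum mult_ac flip: sum_distrib_left)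
  then show ?thesis by (simp add: s_inv ri[OF S])
qed

lemma hom_rS: "hom (- 1) (rS S)"
  using hom_mult[OF hom_sinv hom_const] by (simp add: rS_def)

lemma hom_qf: "hom 0 (wy.qf rS xs)"
proof (induction xs)
  case Nil
  then show ?case using hom_const[of 1] by simp
next
  case (Cons x xs)
  have "hom (1 + - 1 + 0) (uu x * rS (set (x # xs)) * wy.qf rS xs)"
    by (intro hom_mult hom_uu hom_rS Cons)
  then show ?case by simp
qed

text \<open>The factor \<open>wy.w\<close> provides the degree 1 demanded by \<open>amp_iff\<close>,
  since \<open>wy.qf\<close> has degree 0.\<close>

definition "amp_of xs = W * r ^ (CARD('n) + 2) * eval0_mps (wy.w * wy.qf rS xs)"

theorem amp_amp_of: "xs \<in> orderings \<Longrightarrow> amp (amp_of xs)"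
proof -
  assume xs: "xs \<in> orderings"
  then have "wy.annihilated (wy.qf rS xs)"
    using wy.qf_annihilated[OF rS, of xs] by (simp add: orderings_def)
  then show ?thesis
    unfolding amp_of_def using hom_mult[OF hom_w hom_qf[of xs]]
    by (subst amp_iff) (auto simp: Q_def intro!: wy.N_quadric_power is_const_const)
qed

theorem amp_of_independent:
  assumes z: "(\<Sum>xs\<in>orderings. const_mps (a xs) * amp_of xs) = 0" and xs: "xs \<in> orderings"
  shows "a xs = 0"
proof -
  let ?X = "\<Sum>xs\<in>orderings. const_mps (const_mps (a xs)) * wy.qf rS xs"
  have "W * r ^ (CARD('n) + 2) * eval0_mps (wy.w * ?X) = (\<Sum>xs\<in>orderings. const_mps (a xs) * amp_of xs)"
    by (simp add: amp_of_def sum_distrib_left mult_ac)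
  then have "eval0_mps (wy.w * ?X) = 0" using z nonzero by simp
  moreover have "hom (1 + 0) (wy.w * ?X)"
    by (intro hom_mult hom_w hom_sum) (use hom_mult[OF hom_const hom_qf] in simp)
  ultimately have "wy.w * ?X = 0" using hom_eval0_eq_0 by blast
  moreover have "wy.w \<noteq> 0"
  proof -
    have "w Last \<noteq> 0" using w_inv[of Last] by auto
    moreover have "eval0_mps wy.w = - w Last" by (simp add: w_eq)
    ultimately show ?thesis by auto
  qed
  ultimately have X0: "?X = 0" by simp
  have hom: "ring_hom_1 (\<lambda>c. const_mps (const_mps c) :: ('k, 'n) radial)"
    by standard (simp_all add: const_mps_add const_mps_mult)
  show ?thesis
  proof (rule wy.qf_independent[OF rS hom is_const_const _ X0 xs])
    fix x :: 'k assume "const_mps (const_mps x) = (0 :: ('k, 'n) radial)"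
    then have "eval0_mps (eval0_mps (const_mps (const_mps x) :: ('k, 'n) radial)) = 0" by simp
    then show "x = 0" by simp
  qed
qed

lemma eval_qf: "eval0_mps (wy.qf rS (x # xs)) = w (chart_index x) * ri (set (x # xs)) * eval0_mps (wy.qf rS xs)"
  by (simp add: rS_def)

lemma eval_w: "eval0_mps wy.w = - w Last"
  by (simp add: w_eq)

subsection \<open>Jets of annihilated functions\<close>

definition "DM M X = fold_mset dd X M"

definition "jet X M = eval0_mps (eval0_mps (DM M X))"

lemma comp_fun_commute_dd: "comp_fun_commute dd"
  by standard (auto simp: wy.d_commute)

lemma DM_empty [simp]: "DM {#} X = X"
  by (simp add: DM_def)

lemma DM_add_mset: "DM (add_mset i M) X = dd i (DM M X)"
  by (simp add: DM_def comp_fun_commute.fold_mset_add_mset[OF comp_fun_commute_dd])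

lemma DM_replicate: "DM (M + replicate_mset k i) X = (dd i ^^ k) (DM M X)"
  by (induction k) (simp_all add: DM_add_mset)

lemma DM_additive: "additive_map (DM M)"
  by standard (induction M, simp_all add: DM_add_mset wy.D.add)

lemma DM_pow: "DM M ((dd i ^^ k) X) = DM (M + replicate_mset k i) X"
  unfolding DM_replicate by (induction M) (simp_all add: DM_add_mset wy.pow_d_commute)

lemma DM_uu: "DM M (uu i * Y) = uu i * DM M Y + of_nat (count M i) * DM (M - {#i#}) Y"
proof (induction M)
  case (add j M)
  show ?case
  proof (cases "i \<in># M")
    case True
    then have "dd j (DM (M - {#i#}) Y) = DM (add_mset j M - {#i#}) Y"
      by (metis DM_add_mset add_mset_diff_bothsides insert_DiffM diff_union_swap2 multi_drop_mem_not_eq add_mset_remove_trivial)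
    then show ?thesis using True
      unfolding DM_add_mset add wy.D.add wy.D.mult wy.d_u
      by (cases "i = j") (auto simp: algebra_simps)
  next
    case False
    then have "count M i = 0" by (simp add: count_eq_zero_iff)
    then show ?thesis
      unfolding DM_add_mset add wy.D.add wy.D.mult wy.d_u
      by (cases "i = j") (auto simp: algebra_simps)
  qed
qed simp

text \<open>The functions with all jets zero form an ideal closed under the \<open>dd i\<close>,
  hence also under the radial derivative and the derivatives of the coefficients.
  \<open>mps_zero_principle\<close> applies first to the values on s = 1 and then in s.\<close>

lemma jets_determine: "(\<And>M. jet X M = 0) \<Longrightarrow> X = 0"
proof -
  assume X: "\<And>M. jet X M = 0"
  define P where "P = {Y. \<forall>M. jet Y M = 0}"
  have P_dd: "dd i Y \<in> P" if "Y \<in> P" for i Y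
  proof -
    have "DM M (dd i Y) = DM (add_mset i M) Y" for M
      using DM_pow[where M = M and i = i and k = 1 and X = Y] by simp
    then show ?thesis using that by (auto simp: P_def jet_def)
  qed
  have P_mult: "Z * Y \<in> P" if "Y \<in> P" for Z Y
  proof -
    have "\<forall>Z Y. Y \<in> P \<longrightarrow> eval0_mps (eval0_mps (DM M (Z * Y))) = 0" for M
    proof (induction M)
      case empty
      have "eval0_mps (eval0_mps Y) = 0" if "Y \<in> P" for Y
        using that unfolding P_def jet_def by (auto dest: spec[of _ "{#}"])
      then show ?case by simp
    next
      case (add i M)
      have "DM (add_mset i M) (Z * Y) = DM M (dd i Z * Y) + DM M (Z * dd i Y)" for Z Y
        using DM_pow[where M = M and i = i and k = 1 and X = "Z * Y"] additive_map.add[OF DM_additive] by (simp add: wy.D.mult)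
      then show ?case using add P_dd by auto
    qed
    then show ?thesis using that by (simp add: P_def jet_def)
  qed
  have P_add: "Y + Y' \<in> P" if "Y \<in> P" "Y' \<in> P" for Y Y'
    using that by (auto simp: P_def jet_def additive_map.add[OF DM_additive])
  have P_sum: "finite A \<Longrightarrow> (\<And>x. x \<in> A \<Longrightarrow> f x \<in> P) \<Longrightarrow> sum f A \<in> P" for f :: "'z \<Rightarrow> _" and A
  proof (induction A rule: finite_induct)
    case empty
    show ?case by (auto simp: P_def jet_def additive_map.zero[OF DM_additive])
  qed (auto intro: P_add)
  have P_md: "md a Y \<in> P" if "Y \<in> P" for a Y
  proof -
    have "s * dd (Some a) Y = md a Y" using s_inv by (simp add: dd_def mult.assoc[symmetric])
    then show ?thesis using P_mult[OF P_dd[OF that]] by metis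
  qed
  have P_pd: "pd Y \<in> P" if "Y \<in> P" for Y
  proof -
    have "pd Y = dd None Y + sinv * (\<Sum>c\<in>UNIV. const_mps (w (Mid c)) * md c Y)" by (simp add: dd_def)
    also have "\<dots> \<in> P" by (intro P_add P_dd P_mult P_sum P_md that) simp
    finally show ?thesis .
  qed
  have P_coeff: "map_mps (pderiv_mps i) Y \<in> P" if "Y \<in> P" for i Y
  proof -
    have "map_mps (pderiv_mps i) Y = (\<Sum>a\<in>UNIV. const_mps (pderiv_mps i (w (Mid a))) * md a Y)"
      by (rule mps_eqI) (simp, rule pderiv_\<delta>)
    also have "\<dots> \<in> P" by (intro P_mult P_sum P_md that) simp
    finally show ?thesis .
  qed
  have P_eval: "eval0_mps (eval0_mps Y) = 0" if "Y \<in> P" for Y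
    using that unfolding P_def jet_def by (auto dest: spec[of _ "{#}"])
  have "eval0_mps Y = 0" if "Y \<in> P" for Y
  proof (rule mps_zero_principle[of _ "eval0_mps ` P"])
    show "pderiv_mps i Z \<in> eval0_mps ` P" if "Z \<in> eval0_mps ` P" for Z i
    proof -
      from that obtain Y where "Y \<in> P" "Z = eval0_mps Y" by auto
      then have "pderiv_mps i Z = eval0_mps (map_mps (pderiv_mps i) Y)" by simp
      then show ?thesis using P_coeff \<open>Y \<in> P\<close> by blast
    qed
  qed (use that P_eval in auto)
  then show ?thesis
    by (intro mps_zero_principle[of X P]) (use X P_pd in \<open>auto simp: P_def\<close>)
qed

lemma jet_linear: "jet (X + Y) M = jet X M + jet Y M" "jet (const_mps (const_mps x) * X) M = x * jet X M"
proof -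
  show "jet (X + Y) M = jet X M + jet Y M" by (simp add: jet_def additive_map.add[OF DM_additive])
  have "DM M (const_mps (const_mps x) * X) = const_mps (const_mps x) * DM M X"
    using is_const_const[of x] by (induction M) (simp_all add: DM_add_mset wy.D.mult wy.is_const_def)
  then show "jet (const_mps (const_mps x) * X) M = x * jet X M" by (simp add: jet_def)
qed

text \<open>Differentiate L_k X by \<beta> and evaluate at the base point: the leading terms are
  jets of order |\<beta>| + k weighted by the values of the coordinates, and the others are jets of
  lower order, which vanish. For k = 1 the value X of L_1 X also contributes a jet of lower
  order.\<close>

lemma jet_power_sum_null:
  assumes one: "wy.NO [1] X = X" and ann: "\<And>k. k \<ge> 2 \<Longrightarrow> wy.NO [k] X = 0"
    and low: "\<And>M. size M < e \<Longrightarrow> jet X M = 0"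
  shows "power_sum_null UNIV (\<lambda>i. eval0_mps (w (chart_index i))) (\<lambda>M. if size M = e then jet X M else 0)"
  unfolding power_sum_null_def
proof (intro allI impI)
  fix \<beta> :: "'n option multiset" and k :: nat assume k: "k \<ge> 1"
  interpret DM: additive_map "DM M" for M by (rule DM_additive)
  show "(\<Sum>i\<in>UNIV. eval0_mps (w (chart_index i)) * (if size (\<beta> + replicate_mset k i) = e then jet X (\<beta> + replicate_mset k i) else 0)) = 0"
  proof (cases "size \<beta> + k = e")
    case True
    have "DM \<beta> (wy.NO [k] X) = (\<Sum>i\<in>UNIV. uu i * DM (\<beta> + replicate_mset k i) X
        + of_nat (count \<beta> i) * DM (\<beta> - {#i#} + replicate_mset k i) X)"
      by (simp add: DM.sum DM_uu DM_pow)
    then have "eval0_mps (eval0_mps (DM \<beta> (wy.NO [k] X))) = (\<Sum>i\<in>UNIV. eval0_mps (w (chart_index i)) * jet X (\<beta> + replicate_mset k i)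
        + of_nat (count \<beta> i) * jet X (\<beta> - {#i#} + replicate_mset k i))"
      by (simp add: jet_def)
    moreover have "of_nat (count \<beta> i) * jet X (\<beta> - {#i#} + replicate_mset k i) = 0" for i
    proof (cases "i \<in># \<beta>")
      case mem: True
      then obtain \<gamma> where "\<beta> = add_mset i \<gamma>" by (metis mset_add)
      then have "size (\<beta> - {#i#}) + k < e" using True by simp
      then show ?thesis using low by simp
    qed (simp add: count_eq_zero_iff)
    moreover have "eval0_mps (eval0_mps (DM \<beta> (wy.NO [k] X))) = 0"
    proof (cases "k = 1")
      case k1: True
      then show ?thesis using one low[of \<beta>] True by (simp add: jet_def del: wy.NO.simps)
    next
      case False
      then show ?thesis using ann[of k] k by (simp del: wy.NO.simps)
    qed
    ultimately show ?thesis using True by simp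
  qed simp
qed

text \<open>Jets are shown to vanish order by order. The jet cut down to its lowest order e is null
  for the power sums. A functional of degree e kills it by assumption, and one of another degree
  sees zero.\<close>

theorem amp_functionals:
  "\<exists>\<Psi>. length \<Psi> = fact (CARD('n) + 1) \<and>
     (\<forall>\<psi>\<in>set \<Psi>. (\<forall>h h'. \<psi> (h + h') = \<psi> h + \<psi> h') \<and> (\<forall>x h. \<psi> (const_mps x * h) = x * \<psi> h)) \<and>
     (\<forall>h. amp h \<longrightarrow> (\<forall>\<psi>\<in>set \<Psi>. \<psi> h = 0) \<longrightarrow> h = 0)"
proof -
  let ?c = "\<lambda>i. eval0_mps (w (chart_index i))"
  have "sum ?c S \<noteq> 0" if "S \<noteq> {}" for S
  proof -
    have "sum ?c S = eval0_mps (\<Sum>i\<in>S. w (chart_index i))" by simp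
    then show ?thesis using subset_sum_unit[OF that] mps_unit_iff by metis
  qed
  then obtain Ms where Ms: "length Ms = fact (CARD('n option))" "\<forall>(e, m)\<in>set Ms. homogeneous_functional e m"
    "\<And>f. power_sum_null UNIV ?c f \<Longrightarrow> (\<forall>(e, m)\<in>set Ms. m f = 0) \<Longrightarrow> (\<forall>\<beta>. f \<beta> = 0)"
    using power_sum_null_determined[of UNIV ?c] by auto
  define pr where "pr h = Winv * rinv ^ (CARD('n) + 2) * h" for h
  have pr: "h = W * r ^ (CARD('n) + 2) * pr h" for h
  proof -
    have "W * r ^ (CARD('n) + 2) * pr h = (W * Winv) * (r * rinv) ^ (CARD('n) + 2) * h"
      by (simp add: pr_def power_mult_distrib mult_ac)
    then show ?thesis by (simp add: W_inv r_inv)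
  qed
  define \<Psi> where "\<Psi> = map (\<lambda>(e, m). \<lambda>h. m (jet (lift (pr h)))) Ms"
  have lin: "lift (pr (h + h')) = lift (pr h) + lift (pr h')"
     "lift (pr (const_mps x * h)) = const_mps (const_mps x) * lift (pr h)" for h h' x
    by (simp_all add: lift_def pr_def const_mps_mult const_mps_add algebra_simps)
  have kill: "h = 0" if h: "amp h" "\<forall>\<psi>\<in>set \<Psi>. \<psi> h = 0" for h
  proof -
    define X where "X = lift (pr h)"
    have one: "wy.NO [1] X = X" using NO_1[OF hom_lift] by (simp add: X_def del: wy.NO.simps)
    have ann: "wy.NO [k] X = 0" if "k \<ge> 2" for k
      unfolding X_def by (rule amp_imp_annihilated) (use h pr that in metis, rule that)
    have "\<forall>M. size M = e \<longrightarrow> jet X M = 0" for e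
    proof (induction e rule: less_induct)
      case (less e)
      let ?f = "\<lambda>M. if size M = e then jet X M else 0"
      have "power_sum_null UNIV ?c ?f"
        by (rule jet_power_sum_null[OF one ann]) (use less in auto)
      moreover have "\<forall>(e', m)\<in>set Ms. m ?f = 0"
      proof clarify
        fix e' m assume em: "(e', m) \<in> set Ms"
        then have hf: "homogeneous_functional e' m" using Ms(2) by auto
        have z: "m (\<lambda>M. 0) = 0"
        proof -
          have "m (\<lambda>M. 0 * jet X M) = 0 * m (jet X)"
            by (rule hf[unfolded homogeneous_functional_def, THEN conjunct2, THEN conjunct1, rule_format])
          then show ?thesis by simp
        qed
        show "m ?f = 0"
        proof (cases "e' = e")
          case True
          then have "m ?f = m (jet X)"
            by (intro hf[unfolded homogeneous_functional_def, THEN conjunct2, THEN conjunct2, rule_format]) simp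
          also have "\<dots> = 0" using h(2) em by (force simp: \<Psi>_def X_def)
          finally show ?thesis .
        next
          case False
          then have "\<forall>M. size M = e' \<longrightarrow> ?f M = 0" by auto
          then have "m ?f = m (\<lambda>M. 0)"
            by (intro hf[unfolded homogeneous_functional_def, THEN conjunct2, THEN conjunct2, rule_format]) simp
          then show ?thesis using z by simp
        qed
      qed
      ultimately have "\<forall>M. ?f M = 0" by (rule Ms(3))
      then show ?case by metis
    qed
    then have "X = 0" by (intro jets_determine) auto
    then have "pr h = 0" using eval_lift[of "pr h"] by (simp add: X_def del: eval_lift)
    then show ?thesis using pr[of h] by simp
  qed
  have linear: "\<psi> (h + h') = \<psi> h + \<psi> h' \<and> \<psi> (const_mps x * h) = x * \<psi> h" if "\<psi> \<in> set \<Psi>" for \<psi> h h' x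
  proof -
    from that obtain e m where em: "(e, m) \<in> set Ms" "\<psi> = (\<lambda>h. m (jet (lift (pr h))))"
      by (auto simp: \<Psi>_def)
    then have hf: "homogeneous_functional e m" using Ms(2) by auto
    have "jet (lift (pr (h + h'))) = (\<lambda>M. jet (lift (pr h)) M + jet (lift (pr h')) M)"
      "jet (lift (pr (const_mps x * h))) = (\<lambda>M. x * jet (lift (pr h)) M)"
      by (auto simp: lin jet_linear)
    then show ?thesis using hf unfolding em(2) homogeneous_functional_def by simp
  qed
  have len: "length \<Psi> = fact (CARD('n) + 1)" by (simp add: \<Psi>_def Ms card_UNIV_option)
  show ?thesis
  proof (intro exI[of _ \<Psi>] conjI ballI allI impI len)
    show "\<psi> (h + h') = \<psi> h + \<psi> h'" "\<psi> (const_mps x * h) = x * \<psi> h" if "\<psi> \<in> set \<Psi>" for \<psi> h h' x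
      using linear[OF that] by blast+
    show "h = 0" if "amp h" "\<forall>\<psi>\<in>set \<Psi>. \<psi> h = 0" for h
      by (rule kill[OF that])
  qed
qed

end

section \<open>Inversion of the stationary phase transform\<close>

lemma mps_limit:
  fixes x :: "nat \<Rightarrow> ('a::comm_ring_1, 'n::finite) mps"
  assumes "\<And>p. vanishes_to p (x p)"
  obtains q where "\<And>P. vanishes_to P (q - (\<Sum>p<P. x p))"
proof
  define q where "q = Abs_mps (\<lambda>m. coeff_mps (\<Sum>p<Suc (mdeg m). x p) m)"
  show "vanishes_to P (q - (\<Sum>p<P. x p))" for P
    unfolding vanishes_to_def
  proof (intro allI impI)
    fix m :: "'n \<Rightarrow>\<^sub>0 nat" assume "mdeg m < P"
    then have "(\<Sum>p<P. coeff_mps (x p) m) = (\<Sum>p<Suc (mdeg m). coeff_mps (x p) m)"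
      by (intro sum.mono_neutral_right) (use assms in \<open>auto simp: vanishes_to_def\<close>)
    then show "coeff_mps (q - (\<Sum>p<P. x p)) m = 0"
      by (simp add: q_def Abs_mps_inverse del: sum.lessThan_Suc)
  qed
qed

lemma coeff_var_mult:
  fixes X :: "('a::comm_ring_1, 'n) mps"
  shows "coeff_mps (var_mps j * X) m = (if lookup m j > 0 then coeff_mps X (m - Poly_Mapping.single j 1) else 0)"
proof (cases "lookup m j > 0")
  case True
  have e: "Poly_Mapping.single j 1 + (m - Poly_Mapping.single j 1) = m"
    using True by (intro poly_mapping_eqI) (auto simp: lookup_add lookup_minus lookup_single when_def)
  have "coeff_mps (var_mps j * X) m = (\<Sum>(a, b)\<in>{(a, b). a + b = m}. coeff_mps (var_mps j) a * coeff_mps X b)"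
    by (simp add: coeff_mps_mult)
  also have "\<dots> = (\<Sum>(a, b)\<in>{(Poly_Mapping.single j 1, m - Poly_Mapping.single j 1)}. coeff_mps (var_mps j) a * coeff_mps X b)"
    by (rule sum.mono_neutral_right[OF finite_splits]) (use e in \<open>auto simp: var_mps.rep_eq split: if_splits\<close>)
  also have "\<dots> = coeff_mps X (m - Poly_Mapping.single j 1)"
    by (simp add: var_mps.rep_eq)
  finally show ?thesis using True by simp
next
  case False
  have "coeff_mps (var_mps j) a * coeff_mps X b = 0" if "a + b = m" for a b
  proof -
    have "a \<noteq> Poly_Mapping.single j 1" using False that by (auto simp: lookup_add)
    then show ?thesis by (simp add: var_mps.rep_eq)
  qed
  then show ?thesis using False by (simp add: coeff_mps_mult case_prod_unfold)
qed

text \<open>Each nonconstant monomial is divided by a single one of its variables, selected by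
  \<open>ix\<close>, so nothing is counted twice.\<close>

lemma var_division:
  obtains Dv :: "'n::finite \<Rightarrow> ('a::comm_ring_1, 'n) mps \<Rightarrow> ('a, 'n) mps"
  where "\<And>h. h = const_mps (eval0_mps h) + (\<Sum>j\<in>UNIV. var_mps j * Dv j h)"
    and "\<And>h P j. vanishes_to (Suc P) h \<Longrightarrow> vanishes_to P (Dv j h)"
proof
  define ix where "ix m = (SOME i. lookup m i > 0)" for m :: "'n \<Rightarrow>\<^sub>0 nat"
  define Dv where "Dv j h = Abs_mps (\<lambda>m. if ix (m + Poly_Mapping.single j 1) = j
      then coeff_mps h (m + Poly_Mapping.single j 1) else 0)" for j and h :: "('a, 'n) mps"
  show "h = const_mps (eval0_mps h) + (\<Sum>j\<in>UNIV. var_mps j * Dv j h)" for h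
  proof (rule mps_eqI)
    fix m :: "'n \<Rightarrow>\<^sub>0 nat"
    show "coeff_mps h m = coeff_mps (const_mps (eval0_mps h) + (\<Sum>j\<in>UNIV. var_mps j * Dv j h)) m"
    proof (cases "m = 0")
      case True
      then show ?thesis by (simp add: coeff_const_mps coeff_var_mult)
    next
      case False
      then obtain i where "lookup m i > 0" by (metis gr0I lookup_zero poly_mapping_eqI)
      then have ix: "lookup m (ix m) > 0" unfolding ix_def by (rule someI)
      have "coeff_mps (var_mps j * Dv j h) m = (if j = ix m then coeff_mps h m else 0)" for j
      proof (cases "lookup m j > 0")
        case True
        then have "m - Poly_Mapping.single j 1 + Poly_Mapping.single j 1 = m"
          by (intro poly_mapping_eqI) (auto simp: lookup_add lookup_minus lookup_single when_def)
        then show ?thesis using True by (auto simp: coeff_var_mult Dv_def Abs_mps_inverse)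
      next
        case False
        then show ?thesis using ix by (auto simp: coeff_var_mult)
      qed
      then show ?thesis using False by (simp add: coeff_const_mps)
    qed
  qed
  show "vanishes_to P (Dv j h)" if "vanishes_to (Suc P) h" for h P j
    using that by (auto simp: vanishes_to_def Dv_def Abs_mps_inverse mdeg_add simp del: One_nat_def)
qed

text \<open>Functions \<open>z\<close> that agree with the coordinates to first order generate the maximal ideal, so an
  operator commuting with them is determined by its value at \<open>1\<close>.\<close>

lemma commuting_operator_eq_0:
  fixes T :: "('a::comm_ring_1, 'n::finite) mps \<Rightarrow> ('a, 'n) mps"
  assumes T: "additive_map T" and Tc: "\<And>c h. T (const_mps c * h) = const_mps c * T h"
    and z: "\<And>j. vanishes_to 2 (z j - var_mps j)" and Tz: "\<And>j h. T (z j * h) = z j * T h"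
    and T1: "T 1 = 0"
  shows "T h = 0"
proof -
  interpret additive_map T by fact
  obtain Dv :: "'n \<Rightarrow> ('a, 'n) mps \<Rightarrow> ('a, 'n) mps" where
    Dv: "\<And>h. h = const_mps (eval0_mps h) + (\<Sum>j\<in>UNIV. var_mps j * Dv j h)"
    and Dv_van: "\<And>h P j. vanishes_to (Suc P) h \<Longrightarrow> vanishes_to P (Dv j h)"
    by (rule var_division) blast
  have z1: "vanishes_to 1 (z j)" for j
  proof -
    have "vanishes_to 1 (var_mps j :: ('a, 'n) mps)" by (auto simp: vanishes_to_def mdeg_eq_0_iff)
    then have "vanishes_to 1 ((z j - var_mps j) + var_mps j)"
      using vanishes_to_mono[OF z[of j], of 1] by (intro vanishes_to_add) auto
    then show ?thesis by simp
  qed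
  \<comment> \<open>Successive approximation: after division by the variables and replacement of
    these by the z_j, the remainder has higher order, and the quotients converge.\<close>
  have gen: "\<exists>q. h = (\<Sum>j\<in>UNIV. z j * q j)" if h0: "eval0_mps h = 0" for h
  proof -
    define hs where "hs p = ((\<lambda>h. \<Sum>j\<in>UNIV. (var_mps j - z j) * Dv j h) ^^ p) h" for p
    have hs_Suc: "hs (Suc p) = (\<Sum>j\<in>UNIV. (var_mps j - z j) * Dv j (hs p))" for p
      by (simp add: hs_def)
    have z': "vanishes_to 2 (var_mps j - z j)" for j
      using z[of j] by (simp add: vanishes_to_def)
    have van: "vanishes_to (Suc p) (hs p)" for p
    proof (induction p)
      case 0
      then show ?case using h0 by (simp add: hs_def vanishes_to_def mdeg_eq_0_iff)
    next
      case (Suc p)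
      have "vanishes_to (2 + p) (hs (Suc p))"
        unfolding hs_Suc by (intro vanishes_to_sum vanishes_to_mult z' Dv_van Suc)
      then show ?case by simp
    qed
    have step: "hs p = (\<Sum>j\<in>UNIV. z j * Dv j (hs p)) + hs (Suc p)" for p
    proof -
      have "eval0_mps (hs p) = 0" using van[of p] by (simp add: vanishes_to_def)
      then have "hs p = (\<Sum>j\<in>UNIV. var_mps j * Dv j (hs p))" using Dv[of "hs p"] by simp
      then show ?thesis by (simp add: hs_Suc left_diff_distrib sum_subtractf)
    qed
    have tel: "h = (\<Sum>j\<in>UNIV. z j * (\<Sum>p<P. Dv j (hs p))) + hs P" for P
    proof (induction P)
      case 0
      show ?case by (simp add: hs_def)
    next
      case (Suc P)
      then show ?case using step[of P] by (simp add: distrib_left sum.distrib)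
    qed
    have "\<exists>q. \<forall>P. vanishes_to P (q - (\<Sum>p<P. Dv j (hs p)))" for j
      using mps_limit[of "\<lambda>p. Dv j (hs p)"] Dv_van[OF van] by metis
    then obtain q where q: "\<And>j P. vanishes_to P (q j - (\<Sum>p<P. Dv j (hs p)))" by metis
    have "vanishes_to P (h - (\<Sum>j\<in>UNIV. z j * q j))" for P
    proof -
      have "h - (\<Sum>j\<in>UNIV. z j * q j) = hs P + (\<Sum>j\<in>UNIV. z j * - (q j - (\<Sum>p<P. Dv j (hs p))))"
        by (subst tel[of P]) (simp add: right_diff_distrib sum_subtractf sum_negf)
      moreover have "vanishes_to P (hs P)" using van[of P] by (rule vanishes_to_mono) simp
      moreover have "vanishes_to (0 + P) (z j * - (q j - (\<Sum>p<P. Dv j (hs p))))" for j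
        using q[where j = j and P = P] by (intro vanishes_to_mult) (auto simp: vanishes_to_def)
      ultimately show ?thesis by (auto intro: vanishes_to_add vanishes_to_sum)
    qed
    then have "h - (\<Sum>j\<in>UNIV. z j * q j) = 0" by (rule vanishes_to_all_imp_0)
    then show ?thesis by auto
  qed
  \<comment> \<open>Split off the constant, killed because T 1 = 0, and pull a z_j out of T; each
    round gains one order.\<close>
  have "vanishes_to P (T h)" for P h
  proof (induction P arbitrary: h)
    case (Suc P)
    have "eval0_mps (h - const_mps (eval0_mps h)) = 0" by simp
    then obtain q where "h - const_mps (eval0_mps h) = (\<Sum>j\<in>UNIV. z j * q j)" using gen by blast
    then have "h = const_mps (eval0_mps h) * 1 + (\<Sum>j\<in>UNIV. z j * q j)" by (simp add: diff_eq_eq add.commute)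
    then have "T h = (\<Sum>j\<in>UNIV. z j * T (q j))"
      using Tc[of "eval0_mps h" 1] T1 by (metis (no_types, lifting) add add_0 mult_zero_right sum sum.cong Tz)
    moreover have "vanishes_to (1 + P) (\<Sum>j\<in>UNIV. z j * T (q j))"
      by (intro vanishes_to_sum vanishes_to_mult z1 Suc)
    ultimately show ?case by simp
  qed simp
  then show ?thesis by (rule vanishes_to_all_imp_0)
qed

text \<open>\<open>I\<close> is the stationary phase transform of the function \<open>f\<close>, \<open>Ih\<close> the one of its Legendre
  transform, written in the coordinates of the former. Their composition commutes with
  multiplication by the functions \<open>\<partial>\<^sub>i f\<close>.\<close>

locale legendre =
  fixes f m minv :: "('k::field_char_0, 'n::finite) mps" and G :: "'n \<Rightarrow> 'n \<Rightarrow> ('k, 'n) mps"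
  assumes G_sym: "G i j = G j i"
    and G_H: "(\<Sum>j\<in>UNIV. G i j * hessian f $ j $ l) = (if i = l then 1 else 0)"
    and m_inv: "m * minv = 1" and m_square: "m ^ 2 = det (hessian f)"
begin

definition "phi = shift_mps f - const_mps f - (\<Sum>i\<in>UNIV. const_mps (pderiv_mps i f) * var_mps i)"

text \<open>The Legendre transform, read in the coordinates x, is L = f - sum x_i d_i f, and in the
  variables y = df its gradient is -x. So \<open>psi\<close> is its remainder L(t+u) - L(t) + sum
  t_i (d_i f(t+u) - d_i f(t)).\<close>

definition "psi = shift_mps f - const_mps f - (\<Sum>i\<in>UNIV. shift_mps (pderiv_mps i f) * var_mps i)"

lemma hess: "hessian f $ i $ j = pderiv_mps i (pderiv_mps j f)"
  by (simp add: hessian_def)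

lemma sum_delta: "(\<Sum>j\<in>UNIV. x j * (if i = j then 1 else 0)) = (x i :: 'b::comm_ring_1)" for i :: "'m::finite"
  by (simp add: if_distrib cong: if_cong)

lemma d_phi: "pderiv_mps i phi = shift_mps (pderiv_mps i f) - const_mps (pderiv_mps i f)"
  by (simp add: phi_def pderiv_shift_mps pderiv_var_mps sum_delta)

lemma d_psi: "pderiv_mps i psi = - (\<Sum>j\<in>UNIV. shift_mps (hessian f $ i $ j) * var_mps j)"
  by (simp add: psi_def pderiv_shift_mps pderiv_mps_mult pderiv_var_mps sum.distrib sum_delta hess)

lemma dd_psi: "eval0_mps (pderiv_mps j (pderiv_mps i psi)) = - hessian f $ i $ j"
  by (simp add: d_psi pderiv_mps_mult pderiv_var_mps sum.distrib sum_delta)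

sublocale p: phase phi G
proof
  show "eval0_mps phi = 0" by (simp add: phi_def)
  show "eval0_mps (pderiv_mps i phi) = 0" for i by (simp add: d_phi)
  show "(\<Sum>j\<in>UNIV. G i j * eval0_mps (pderiv_mps j (pderiv_mps l phi))) = (if i = l then 1 else 0)" for i l
    using G_H[of i l] by (simp add: d_phi pderiv_shift_mps hess)
qed (rule G_sym)

sublocale q: phase psi "\<lambda>i j. - G i j"
proof
  show "eval0_mps psi = 0" by (simp add: psi_def)
  show "eval0_mps (pderiv_mps i psi) = 0" for i by (simp add: d_psi)
  show "(\<Sum>j\<in>UNIV. - G i j * eval0_mps (pderiv_mps j (pderiv_mps l psi))) = (if i = l then 1 else 0)" for i l
    using G_H[of i l] by (simp add: dd_psi hess pderiv_mps_commute)
qed (simp add: G_sym)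

section \<open>The two transforms and their commutation with d_i f and with the Legendre
  transform\<close>

definition "I k h = p.stat k (shift_mps h)"

text \<open>Up to constants, the density in y = df brings det H = m^2, and each of the two Gaussian
  integrals brings 1/m, one before and one after the second expansion. This leaves h m inside and
  \<open>minv\<close> outside.\<close>

definition "Ih k h = minv * q.stat k (shift_mps (h * m))"

lemma I_additive: "additive_map (I k)"
  by standard (simp add: I_def sh.add additive_map.add[OF p.stat_additive])

lemma Ih_additive: "additive_map (Ih k)"
  by standard (simp add: Ih_def sh.add distrib_left distrib_right additive_map.add[OF q.stat_additive])

sublocale I: additive_map "I k" for k by (rule I_additive)
sublocale Ih: additive_map "Ih k" for k by (rule Ih_additive)

lemma I_const: "I k (const_mps c * h) = const_mps c * I k h"
  by (simp add: I_def sh.mult shift_const_mps p.stat_const)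

lemma Ih_const: "Ih k (const_mps c * h) = const_mps c * Ih k h"
  unfolding Ih_def mult.assoc sh.mult[of "const_mps c"] shift_const_mps q.stat_const by (rule mult.left_commute)

lemma I_0: "I 0 h = h"
  by (simp add: I_def p.stat_0)

lemma Ih_0: "Ih 0 h = h"
proof -
  have "Ih 0 h = h * (m * minv)" by (simp add: Ih_def q.stat_0 mult_ac)
  then show ?thesis by (simp add: m_inv)
qed

abbreviation fd :: "'n \<Rightarrow> ('k, 'n) mps" where "fd i \<equiv> pderiv_mps i f"

lemma I_fd: "I (Suc k) (fd i * h) = fd i * I (Suc k) h - I k (pderiv_mps i h)"
proof -
  interpret st: additive_map "p.stat l" for l by (rule p.stat_additive)
  have "p.stat (Suc k) (shift_mps h * pderiv_mps i phi) = - p.stat k (pderiv_mps i (shift_mps h))"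
    by (rule p.stat_by_parts)
  moreover have "shift_mps h * pderiv_mps i phi = shift_mps (fd i * h) - const_mps (fd i) * shift_mps h"
    by (simp add: d_phi sh.mult algebra_simps)
  ultimately have "p.stat (Suc k) (shift_mps (fd i * h) - const_mps (fd i) * shift_mps h) = - p.stat k (pderiv_mps i (shift_mps h))"
    by (simp only:)
  then show ?thesis
    unfolding st.diff p.stat_const pderiv_shift_mps I_def by (simp add: algebra_simps)
qed

lemma two_times: "(2 :: ('k, 'n) mps) * (const_mps (1 / 2) * x) = x"
  using const_mps_inverse_of_nat[of 2, where 'a = 'k and 'b = 'n] by (simp add: mult.assoc[symmetric])

text \<open>Differentiating in the base point brings down d_i f(t+u) - d_i f(t), once the
  u-derivative of the phase is removed by parts. The trace term of \<open>stat_derivation\<close>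
  cancels against the derivative of \<open>minv\<close>, by Jacobi's formula for m^2 = det
  H.\<close>

lemma Ih_fd: "Ih (Suc k) (fd i * h) = fd i * Ih (Suc k) h + pderiv_mps i (Ih k h)"
proof -
  interpret st: additive_map "q.stat l" for l by (rule q.stat_additive)
  define X where "X = shift_mps (h * m)"
  define tr where "tr = (\<Sum>a\<in>UNIV. \<Sum>b\<in>UNIV. - G a b * pderiv_mps i (q.H b a))"
  have tr: "tr = (\<Sum>a\<in>UNIV. \<Sum>b\<in>UNIV. pderiv_mps i (hessian f $ a $ b) * G b a)"
    by (simp add: tr_def q.H_def dd_psi G_sym[of _ "_::'n"] mult.commute)
  have "pderiv_mps i (det (hessian f)) = det (hessian f) * tr"
    using derivation.jacobi_formula[OF derivation_pderiv_mps, of "\<chi> a b. G a b" "hessian f" i] G_H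
    by (simp add: tr)
  then have "2 * m * pderiv_mps i m = m * m * tr"
    unfolding m_square[symmetric] by (simp add: power2_eq_square pderiv_mps_mult algebra_simps)
  then have "minv * (2 * m * pderiv_mps i m) = minv * (m * m * tr)" by simp
  then have "(m * minv) * (2 * pderiv_mps i m) = (m * minv) * (m * tr)" by (simp only: mult_ac)
  then have dm: "2 * pderiv_mps i m = m * tr" by (simp add: m_inv)
  have "pderiv_mps i minv * m + minv * pderiv_mps i m = pderiv_mps i (m * minv)"
    by (simp add: pderiv_mps_mult mult.commute)
  then have "pderiv_mps i minv * m = - (minv * pderiv_mps i m)"
    unfolding m_inv by (simp add: eq_neg_iff_add_eq_0)
  then have "2 * (pderiv_mps i minv * m) = - (minv * (2 * pderiv_mps i m))" by (simp only: mult_minus_right mult.left_commute)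
  also have "\<dots> = - ((m * minv) * tr)" unfolding dm by (simp only: mult_ac)
  finally have dminv: "2 * (pderiv_mps i minv * m) = - tr" by (simp add: m_inv)
  have dminv': "pderiv_mps i minv = - (const_mps (1 / 2) * tr * minv)"
  proof -
    have "pderiv_mps i minv = pderiv_mps i minv * (m * minv)" by (simp add: m_inv)
    also have "\<dots> = (2 * (const_mps (1 / 2) * (pderiv_mps i minv * m))) * minv"
      by (simp only: two_times mult.assoc)
    also have "\<dots> = const_mps (1 / 2) * (2 * (pderiv_mps i minv * m)) * minv" by (simp only: mult_ac)
    finally show ?thesis unfolding dminv by simp
  qed
  have "map_mps (pderiv_mps i) psi - pderiv_mps i psi = shift_mps (fd i) - const_mps (fd i)"
  proof -
    interpret D: derivation "pderiv_mps i :: ('k, 'n) mps \<Rightarrow> _" by (rule derivation_pderiv_mps)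
    interpret D': derivation "map_mps (pderiv_mps i) :: (('k, 'n) mps, 'n) mps \<Rightarrow> _"
      by (rule D.map_mps_derivation)
    show ?thesis
      by (simp add: psi_def D'.diff D'.sum D'.mult D.map_mps_var D.map_mps_const map_pderiv_shift_mps
          pderiv_shift_mps pderiv_mps_mult pderiv_var_mps sum.distrib sum_delta)
  qed
  then have split: "X * map_mps (pderiv_mps i) psi = X * pderiv_mps i psi + (shift_mps (fd i * h * m) - const_mps (fd i) * X)"
  proof -
    have "map_mps (pderiv_mps i) psi = pderiv_mps i psi + (shift_mps (fd i) - const_mps (fd i))"
      using \<open>map_mps (pderiv_mps i) psi - pderiv_mps i psi = _\<close> by (simp add: diff_eq_eq)
    then show ?thesis by (simp add: X_def sh.mult distrib_left right_diff_distrib mult_ac)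
  qed
  have "pderiv_mps i (q.stat k X) = q.stat k (map_mps (pderiv_mps i) X)
      + q.stat (Suc k) (X * map_mps (pderiv_mps i) psi) + const_mps (1 / 2) * tr * q.stat k X"
    unfolding tr_def by (rule q.stat_derivation[OF derivation_pderiv_mps]) simp
  also have "q.stat (Suc k) (X * map_mps (pderiv_mps i) psi) = - q.stat k (pderiv_mps i X)
      + (q.stat (Suc k) (shift_mps (fd i * h * m)) - fd i * q.stat (Suc k) X)"
    unfolding split st.add st.diff q.stat_const q.stat_by_parts ..
  also have "map_mps (pderiv_mps i) X = pderiv_mps i X"
    by (simp add: X_def map_pderiv_shift_mps pderiv_shift_mps)
  finally have fin: "pderiv_mps i (q.stat k X) = q.stat (Suc k) (shift_mps (fd i * h * m)) - fd i * q.stat (Suc k) X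
     + const_mps (1 / 2) * tr * q.stat k X" by simp
  then show ?thesis
    unfolding Ih_def pderiv_mps_mult dminv' fin[unfolded X_def] by (simp add: algebra_simps)
qed

definition "L = f - (\<Sum>i\<in>UNIV. fd i * var_mps i)"

definition eul :: "('k, 'n) mps \<Rightarrow> ('k, 'n) mps" where
  "eul h = (\<Sum>i\<in>UNIV. var_mps i * pderiv_mps i h)"

lemma sum_pderiv_var: "(\<Sum>i\<in>UNIV. pderiv_mps i (var_mps i * h)) = of_nat CARD('n) * h + eul h"
  by (simp add: eul_def pderiv_mps_mult pderiv_var_mps sum.distrib)

lemma const_card: "const_mps (of_nat CARD('n) / 2 + of_nat k) = const_mps (of_nat CARD('n) / 2) + (of_nat k :: ('k, 'n) mps)"
  by (simp add: const_mps_add const_mps_of_nat)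

lemma const_half: "const_mps (of_nat CARD('n) / 2) + const_mps (of_nat CARD('n) / 2) = (of_nat CARD('n) :: ('k, 'n) mps)"
  by (simp add: const_mps_of_nat flip: const_mps_add)

text \<open>Writing u_i in the phase as the difference of the coordinate at t + u and at t turns the
  scaling rule \<open>p.stat_phase\<close> into a commutation rule with \<open>L\<close>. The Euler
  operator arises from moving the d_i f through \<open>I\<close>.\<close>

lemma I_L: "I (Suc k) (L * h) = L * I (Suc k) h + I k (eul h) + (const_mps (of_nat CARD('n) / 2) - of_nat k) * I k h"
proof -
  interpret st: additive_map "p.stat l" for l by (rule p.stat_additive)
  have eq: "phi * shift_mps h = shift_mps (f * h) - const_mps f * shift_mps h
      - (\<Sum>i\<in>UNIV. const_mps (fd i) * shift_mps (var_mps i * h) - const_mps (fd i * var_mps i) * shift_mps h)"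
  proof -
    have "var_mps i = shift_mps (var_mps i) - const_mps (var_mps i :: ('k, 'n) mps)" for i
      by (simp add: shift_var_mps)
    then have e: "phi = shift_mps f - const_mps f - (\<Sum>i\<in>UNIV. const_mps (fd i) * (shift_mps (var_mps i) - const_mps (var_mps i)))"
      unfolding phi_def by presburger
    show ?thesis unfolding e by (simp add: sh.mult const_mps_mult sum_distrib_left sum_distrib_right algebra_simps)
  qed
  have "p.stat (Suc k) (phi * shift_mps h) = - const_mps (of_nat CARD('n) / 2 + of_nat k) * p.stat k (shift_mps h)"
    by (rule p.stat_phase)
  then have "I (Suc k) (f * h) - f * I (Suc k) h
      - (\<Sum>i\<in>UNIV. fd i * I (Suc k) (var_mps i * h) - fd i * var_mps i * I (Suc k) h)
     = - const_mps (of_nat CARD('n) / 2 + of_nat k) * I k h"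
    unfolding eq st.diff st.sum p.stat_const I_def .
  moreover have "fd i * I (Suc k) (var_mps i * h) = I (Suc k) (fd i * var_mps i * h) + I k (pderiv_mps i (var_mps i * h))" for i
    using I_fd[of k i "var_mps i * h"] by (simp add: mult.assoc)
  ultimately have "I (Suc k) (f * h) - f * I (Suc k) h
      - ((\<Sum>i\<in>UNIV. I (Suc k) (fd i * var_mps i * h)) + I k (\<Sum>i\<in>UNIV. pderiv_mps i (var_mps i * h)) - (\<Sum>i\<in>UNIV. fd i * var_mps i) * I (Suc k) h)
     = - const_mps (of_nat CARD('n) / 2 + of_nat k) * I k h"
    by (simp only: sum_subtractf sum.distrib I.sum sum_distrib_right)
  moreover have IL: "I (Suc k) (L * h) = I (Suc k) (f * h) - (\<Sum>i\<in>UNIV. I (Suc k) (fd i * var_mps i * h))"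
    by (simp add: L_def left_diff_distrib I.diff sum_distrib_right I.sum)
  moreover have LI: "L * I (Suc k) h = f * I (Suc k) h - (\<Sum>i\<in>UNIV. fd i * var_mps i) * I (Suc k) h"
    by (simp add: L_def left_diff_distrib)
  ultimately have "I (Suc k) (L * h) - L * I (Suc k) h - (of_nat CARD('n) * I k h + I k (eul h))
     = - const_mps (of_nat CARD('n) / 2 + of_nat k) * I k h"
    unfolding sum_pderiv_var I.add I.of_nat_mult IL LI by (simp add: algebra_simps)
  then show ?thesis
    unfolding const_card const_half[symmetric] by (simp add: algebra_simps)
qed

lemma Ih_L: "Ih (Suc k) (L * h) = L * Ih (Suc k) h - eul (Ih k h) - (const_mps (of_nat CARD('n) / 2) + of_nat k) * Ih k h"
proof -
  interpret st: additive_map "q.stat l" for l by (rule q.stat_additive)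
  have eq: "psi * shift_mps (h * m) = shift_mps (f * h * m) - const_mps f * shift_mps (h * m)
      - (\<Sum>i\<in>UNIV. shift_mps (fd i * var_mps i * h * m) - const_mps (var_mps i) * shift_mps (fd i * h * m))"
  proof -
    have "var_mps i = shift_mps (var_mps i) - const_mps (var_mps i :: ('k, 'n) mps)" for i
      by (simp add: shift_var_mps)
    then have e: "psi = shift_mps f - const_mps f - (\<Sum>i\<in>UNIV. shift_mps (fd i) * (shift_mps (var_mps i) - const_mps (var_mps i)))"
      unfolding psi_def by presburger
    show ?thesis unfolding e by (simp add: sh.mult sum_distrib_left sum_distrib_right algebra_simps)
  qed
  have "q.stat (Suc k) (psi * shift_mps (h * m)) = - const_mps (of_nat CARD('n) / 2 + of_nat k) * q.stat k (shift_mps (h * m))"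
    by (rule q.stat_phase)
  then have "minv * (q.stat (Suc k) (shift_mps (f * h * m)) - f * q.stat (Suc k) (shift_mps (h * m))
      - (\<Sum>i\<in>UNIV. q.stat (Suc k) (shift_mps (fd i * var_mps i * h * m)) - var_mps i * q.stat (Suc k) (shift_mps (fd i * h * m))))
     = minv * (- const_mps (of_nat CARD('n) / 2 + of_nat k) * q.stat k (shift_mps (h * m)))"
    unfolding eq st.diff st.sum q.stat_const by simp
  then have "Ih (Suc k) (f * h) - f * Ih (Suc k) h
      - (\<Sum>i\<in>UNIV. Ih (Suc k) (fd i * var_mps i * h) - var_mps i * Ih (Suc k) (fd i * h))
     = - const_mps (of_nat CARD('n) / 2 + of_nat k) * Ih k h"
    unfolding Ih_def by (simp add: sum_distrib_left right_diff_distrib mult_ac)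
  moreover have IL: "Ih (Suc k) (L * h) = Ih (Suc k) (f * h) - (\<Sum>i\<in>UNIV. Ih (Suc k) (fd i * var_mps i * h))"
    by (simp add: L_def left_diff_distrib Ih.diff sum_distrib_right Ih.sum)
  moreover have "(\<Sum>i\<in>UNIV. var_mps i * Ih (Suc k) (fd i * h)) = (\<Sum>i\<in>UNIV. fd i * var_mps i) * Ih (Suc k) h + eul (Ih k h)"
    unfolding Ih_fd by (simp add: eul_def distrib_left sum.distrib sum_distrib_left sum_distrib_right mult_ac)
  moreover have LI: "L * Ih (Suc k) h = f * Ih (Suc k) h - (\<Sum>i\<in>UNIV. fd i * var_mps i) * Ih (Suc k) h"
    by (simp add: L_def left_diff_distrib)
  ultimately show ?thesis unfolding const_card IL LI by (simp add: algebra_simps sum_subtractf)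
qed

text \<open>The coefficient of hbar^k in the composition of the two transforms.\<close>

definition "C k h = (\<Sum>a\<le>k. I a (Ih (k - a) h))"

lemma C_additive: "additive_map (C k)"
  by standard (simp add: C_def Ih.add I.add sum.distrib)

lemma C_0: "C 0 h = h"
  by (simp add: C_def I_0 Ih_0)

text \<open>The derivative terms of \<open>Ih_fd\<close> and \<open>I_fd\<close> have opposite signs
  and neighbouring indices, so they cancel in the convolution.\<close>

lemma C_fd: "C k (fd i * h) = fd i * C k h"
proof (cases k)
  case (Suc K)
  have "(\<Sum>a\<le>Suc K. I a (Ih (Suc K - a) (fd i * h)))
     = (\<Sum>a\<le>Suc K. I a (fd i * Ih (Suc K - a) h)) + (\<Sum>a\<le>K. I a (pderiv_mps i (Ih (K - a) h)))"
  proof -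
    have "(\<Sum>a\<le>K. I a (Ih (Suc K - a) (fd i * h))) = (\<Sum>a\<le>K. I a (fd i * Ih (Suc K - a) h) + I a (pderiv_mps i (Ih (K - a) h)))"
      by (rule sum.cong[OF refl]) (simp add: Suc_diff_le Ih_fd I.add)
    then show ?thesis by (simp add: sum.distrib Ih_0)
  qed
  also have "(\<Sum>a\<le>Suc K. I a (fd i * Ih (Suc K - a) h)) = fd i * (\<Sum>a\<le>Suc K. I a (Ih (Suc K - a) h))
     - (\<Sum>a\<le>K. I a (pderiv_mps i (Ih (K - a) h)))"
    unfolding sum.atMost_Suc_shift
    by (simp add: I_0 I_fd sum_subtractf distrib_left sum_distrib_left)
  finally show ?thesis using Suc by (simp add: C_def)
qed (simp add: C_0)

text \<open>The Euler terms and the n/2 cancel in the convolution; the numbers -a and -(K - a) that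
  depend on the index add up to -K.\<close>

lemma C_L: "C (Suc K) (L * h) = L * C (Suc K) h - of_nat K * C K h"
proof -
  let ?n = "const_mps (of_nat CARD('n) / 2) :: ('k, 'n) mps"
  have Inc: "I a (const_mps c * x) = const_mps c * I a x" for a c x by (rule I_const)
  have "(\<Sum>a\<le>Suc K. I a (Ih (Suc K - a) (L * h)))
     = (\<Sum>a\<le>Suc K. I a (L * Ih (Suc K - a) h)) - (\<Sum>a\<le>K. I a (eul (Ih (K - a) h)))
       - (\<Sum>a\<le>K. (?n + of_nat (K - a)) * I a (Ih (K - a) h))"
  proof -
    have "(\<Sum>a\<le>K. I a (Ih (Suc K - a) (L * h))) = (\<Sum>a\<le>K. I a (L * Ih (Suc K - a) h) - I a (eul (Ih (K - a) h))
       - (?n + of_nat (K - a)) * I a (Ih (K - a) h))"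
      by (rule sum.cong[OF refl]) (simp add: Suc_diff_le Ih_L I.add I.diff distrib_right Inc I.of_nat_mult del: of_nat_diff)
    then show ?thesis by (simp add: sum_subtractf Ih_0)
  qed
  also have "(\<Sum>a\<le>Suc K. I a (L * Ih (Suc K - a) h)) = L * (\<Sum>a\<le>Suc K. I a (Ih (Suc K - a) h))
     + (\<Sum>a\<le>K. I a (eul (Ih (K - a) h))) + (\<Sum>a\<le>K. (?n - of_nat a) * I a (Ih (K - a) h))"
    unfolding sum.atMost_Suc_shift
    by (simp add: I_0 I_L sum.distrib distrib_left sum_distrib_left)
  also have "L * (\<Sum>a\<le>Suc K. I a (Ih (Suc K - a) h)) + (\<Sum>a\<le>K. I a (eul (Ih (K - a) h)))
       + (\<Sum>a\<le>K. (?n - of_nat a) * I a (Ih (K - a) h)) - (\<Sum>a\<le>K. I a (eul (Ih (K - a) h)))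
       - (\<Sum>a\<le>K. (?n + of_nat (K - a)) * I a (Ih (K - a) h))
     = L * (\<Sum>a\<le>Suc K. I a (Ih (Suc K - a) h)) - (\<Sum>a\<le>K. of_nat K * I a (Ih (K - a) h))"
  proof -
    have "(\<Sum>a\<le>K. (?n - of_nat a) * I a (Ih (K - a) h)) - (\<Sum>a\<le>K. (?n + of_nat (K - a)) * I a (Ih (K - a) h))
       = - (\<Sum>a\<le>K. of_nat K * I a (Ih (K - a) h))"
      unfolding sum_subtractf[symmetric] sum_negf[symmetric]
    proof (rule sum.cong[OF refl])
      fix a assume "a \<in> {..K}"
      then have "(of_nat K :: ('k, 'n) mps) = of_nat a + of_nat (K - a)" by (simp flip: of_nat_add)
      then show "(?n - of_nat a) * I a (Ih (K - a) h) - (?n + of_nat (K - a)) * I a (Ih (K - a) h) = - (of_nat K * I a (Ih (K - a) h))"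
        by (simp add: algebra_simps)
    qed
    then show ?thesis by (simp add: algebra_simps)
  qed
  finally show ?thesis by (simp add: C_def sum_distrib_left)
qed

lemma C_const: "C k (const_mps c * h) = const_mps c * C k h"
  by (simp add: C_def Ih_const I_const sum_distrib_left)

lemma C_mult: "C k h = h * C k 1"
proof -
  \<comment> \<open>Combinations of the d_i f, normalized by the inverse Hessian at the origin so as
    to agree with the coordinates to first order.\<close>
  define z where "z j = (\<Sum>i\<in>UNIV. const_mps (eval0_mps (G j i)) * (fd i - const_mps (eval0_mps (fd i))))" for j
  define T where "T h = C k h - h * C k 1" for h
  interpret C: additive_map "C k" by (rule C_additive)
  have "T h = 0"
  proof (rule commuting_operator_eq_0[of T z])
    show "additive_map T" by standard (simp add: T_def C.add algebra_simps)
    show "T (const_mps c * h) = const_mps c * T h" for c h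
      unfolding T_def C_const by (simp add: algebra_simps)
    have Cz: "C k (z j * h) = z j * C k h" for j h
    proof -
      have e: "z j * h = (\<Sum>i\<in>UNIV. const_mps (eval0_mps (G j i)) * (fd i * h - const_mps (eval0_mps (fd i)) * h))" for h
        by (simp add: z_def sum_distrib_left sum_distrib_right algebra_simps)
      show ?thesis unfolding e by (simp only: C.sum C_const C.diff C_fd)
    qed
    show "T (z j * h) = z j * T h" for j h
      unfolding T_def Cz by (simp add: algebra_simps)
    show "T 1 = 0" by (simp add: T_def)
    show "vanishes_to 2 (z j - var_mps j)" for j
      unfolding numeral_2_eq_2
    proof (intro vanishes_to_SucI)
      show "eval0_mps (z j - var_mps j) = 0" by (simp add: z_def)
      fix i
      have "(\<Sum>l\<in>UNIV. eval0_mps (G j l) * eval0_mps (pderiv_mps i (fd l))) = eval0_mps (\<Sum>l\<in>UNIV. G j l * hessian f $ l $ i)"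
        by (simp add: hess pderiv_mps_commute)
      then show "eval0_mps (pderiv_mps i (z j - var_mps j)) = 0"
        by (auto simp: z_def pderiv_var_mps G_H)
    qed simp
  qed
  then show ?thesis by (simp add: T_def)
qed

text \<open>Being a multiplication operator, C commutes with L, so \<open>C_L\<close> says that k
  C_k = 0.\<close>

theorem C_eq_0: "k \<ge> 1 \<Longrightarrow> C k h = 0"
proof -
  assume k: "k \<ge> 1"
  have "C (Suc k) (L * h) = L * C (Suc k) h"
    by (subst C_mult, subst (2) C_mult) simp
  then have "of_nat k * C k h = 0" using C_L[of k h] by simp
  then show ?thesis using k by simp
qed

text \<open>The convolution of the two sequences is trivial and both start with the identity, so if
  one has no higher terms, neither has the other.\<close>

theorem I_vanishes_iff: "(\<forall>k\<ge>1. I k h = 0) \<longleftrightarrow> (\<forall>k\<ge>1. Ih k h = 0)"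
proof
  assume z: "\<forall>k\<ge>1. Ih k h = 0"
  show "\<forall>k\<ge>1. I k h = 0"
  proof (intro allI impI)
    fix k :: nat assume k: "k \<ge> 1"
    have "C k h = (\<Sum>a\<le>k. if a = k then I k h else 0)"
      unfolding C_def by (rule sum.cong) (use z in \<open>auto simp: Ih_0\<close>)
    then show "I k h = 0" using C_eq_0[OF k] by simp
  qed
next
  assume z: "\<forall>k\<ge>1. I k h = 0"
  have "k \<ge> 1 \<longrightarrow> Ih k h = 0" for k
  proof (induction k rule: less_induct)
    case (less k)
    show ?case
    proof
      assume k: "k \<ge> 1"
      have "C k h = (\<Sum>a\<le>k. if a = 0 then Ih k h else 0)"
        unfolding C_def
      proof (rule sum.cong[OF refl])
        fix a assume "a \<in> {..k}"
        then consider "a = 0" | "a = k" "a \<ge> 1" | "a \<ge> 1" "k - a \<ge> 1" "k - a < k" by force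
        then show "I a (Ih (k - a) h) = (if a = 0 then Ih k h else 0)"
          by cases (use z less in \<open>auto simp: I_0 Ih_0\<close>)
      qed
      then show "Ih k h = 0" using C_eq_0[OF k] by simp
    qed
  qed
  then show "\<forall>k\<ge>1. Ih k h = 0" by blast
qed

end

section \<open>Admissible pairs at points with invertible Hessian matrix\<close>

lemma to_merom_hom: "ring_hom_1 (to_merom :: ('a::idom, 'n::finite) mps \<Rightarrow> _)"
  by standard (simp_all add: One_fract_def)

lemma to_merom_eq_0_iff: "to_merom h = 0 \<longleftrightarrow> h = 0"
  by (simp add: Zero_fract_def eq_fract)

text \<open>As \<open>G\<close> inverts the Hessian over power series, all ingredients of the
  coefficient are images under the embedding into the fraction field. The choice in
  \<open>matrix_inv\<close> is pinned down by uniqueness of inverses.\<close>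

lemma stationary_phase_coeff_eq:
  fixes f g :: "('k::field_char_0, 'n::finite) mps"
  defines "\<phi> \<equiv> shift_mps f - const_mps f - (\<Sum>i\<in>UNIV. const_mps (pderiv_mps i f) * var_mps i)"
  assumes ph: "phase \<phi> G"
  shows "stationary_phase_coeff f g k = to_merom (phase.stat \<phi> G k (shift_mps g))"
proof -
  interpret ph: phase \<phi> G by (rule ph)
  interpret \<mu>: ring_hom_1 "to_merom :: ('k, 'n) mps \<Rightarrow> _" by (rule to_merom_hom)
  let ?\<mu> = "map_mps to_merom :: (('k, 'n) mps, 'n) mps \<Rightarrow> _"
  interpret M: ring_hom_1 ?\<mu> by (rule \<mu>.map_mps_hom)
  have inv_nat: "1 / of_nat l = to_merom (const_mps (1 / of_nat l) :: ('k, 'n) mps)" if "l > 0" for l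
  proof -
    have "of_nat l * to_merom (const_mps (1 / of_nat l) :: ('k, 'n) mps) = 1"
      using const_mps_inverse_of_nat[OF that, where 'a = 'k and 'b = 'n] by (metis \<mu>.mult \<mu>.of_nat \<mu>.one)
    moreover from this have "of_nat l \<noteq> (0 :: ('k, 'n) merom)" by auto
    ultimately show ?thesis by (simp add: field_simps)
  qed
  have half: "1 / 2 = to_merom (const_mps (1 / 2) :: ('k, 'n) mps)"
    using inv_nat[of 2] by simp
  have mhalf: "- 1 / 2 = to_merom (const_mps (- 1 / 2) :: ('k, 'n) mps)"
  proof -
    have "- 1 / 2 = - (1 / 2 :: ('k, 'n) merom)" "(- 1 / 2 :: 'k) = - (1 / 2)" by (rule minus_divide_left[symmetric])+
    then show ?thesis by (simp only: half const_mps_uminus \<mu>.uminus)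
  qed
  have Hess: "hessian f $ i $ j = ph.H i j" for i j
  proof -
    have "pderiv_mps j \<phi> = shift_mps (pderiv_mps j f) - const_mps (pderiv_mps j f)"
      by (simp add: \<phi>_def pderiv_shift_mps pderiv_var_mps if_distrib[of "\<lambda>x. _ * x"] cong: if_cong)
    then show ?thesis by (simp add: ph.H_def hessian_def pderiv_shift_mps)
  qed
  have inv: "matrix_inv (hessian_at f) $ i $ j = to_merom (G i j)" for i j
  proof -
    define B :: "('k, 'n) merom ^ 'n ^ 'n" where "B = (\<chi> i j. to_merom (G i j))"
    have d: "to_merom (if i = j then 1 else 0 :: ('k, 'n) mps) = (if i = j then 1 else 0)" for i j :: 'n
      by simp
    have BA: "B ** hessian_at f = mat 1" and AB: "hessian_at f ** B = mat 1"
      by (simp_all add: vec_eq_iff matrix_matrix_mult_def mat_def B_def hessian_at_def Hess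
          flip: \<mu>.mult \<mu>.sum) (simp_all add: ph.GH ph.HG d)
    have "matrix_inv (hessian_at f) = B"
      unfolding matrix_inv_def
    proof (rule some_equality)
      show "hessian_at f ** B = mat 1 \<and> B ** hessian_at f = mat 1" using AB BA by simp
      show "B' = B" if "hessian_at f ** B' = mat 1 \<and> B' ** hessian_at f = mat 1" for B'
        using that BA by (metis matrix_mul_assoc matrix_mul_lid matrix_mul_rid)
    qed
    then show ?thesis by (simp add: B_def)
  qed
  have lap: "phase_laplacian f (?\<mu> X) = ?\<mu> (glap G X)" for X
    unfolding phase_laplacian_def glap_def mhalf inv
    by (simp add: M.mult M.sum \<mu>.map_mps_const \<mu>.map_mps_pderiv)
  have lap_pow: "(phase_laplacian f ^^ l) (?\<mu> X) = ?\<mu> ((glap G ^^ l) X)" for l X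
    by (induction l) (simp_all add: lap)
  have "?\<mu> \<phi> = at_shift f - const_mps (to_merom f) - (\<Sum>i\<in>UNIV. const_mps (to_merom (pderiv_mps i f)) * var_mps i)"
    by (simp add: \<phi>_def at_shift_def M.diff M.sum M.mult \<mu>.map_mps_const \<mu>.map_mps_var)
  moreover have "?\<mu> ph.quad = const_mps (1 / 2) * (\<Sum>i\<in>UNIV. \<Sum>j\<in>UNIV. const_mps (hessian_at f $ i $ j) * var_mps i * var_mps j)"
    by (simp add: half M.mult M.sum \<mu>.map_mps_const \<mu>.map_mps_var ph.quad_def ph.Hv_def
        hessian_at_def Hess sum_distrib_left sum_distrib_right mult_ac)
  ultimately have rest: "taylor_rest f = ?\<mu> ph.rest"
    by (simp add: taylor_rest_def ph.rest_def M.diff)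
  show ?thesis
    unfolding stationary_phase_coeff_def ph.stat_def \<mu>.sum
  proof (rule sum.cong[OF refl])
    fix v
    have c: "1 / of_nat (fact v * fact (k + v)) = to_merom (const_mps (1 / fact v) * const_mps (1 / fact (k + v)) :: ('k, 'n) mps)"
      by (subst inv_nat) (simp_all flip: const_mps_mult)
    show "1 / of_nat (fact v * fact (k + v)) * eval0_mps ((phase_laplacian f ^^ (k + v)) (at_shift g * taylor_rest f ^ v))
       = to_merom (const_mps (1 / fact v) * gmom G (k + v) (shift_mps g * ph.rest ^ v))"
      unfolding c rest at_shift_def M.power[symmetric] M.mult[symmetric] lap_pow gmom_def
      by (simp only: coeff_map_mps \<mu>.mult mult.assoc)
  qed
qed

section \<open>Classes of germs\<close>

text \<open>The operations by which charts and amplitudes are constructed. Square roots are demanded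
  for units, which covers those of the coordinates and of det H.\<close>

locale germ_class =
  fixes \<G> :: "('k::field_char_0, 'n::finite) mps set"
  assumes const: "const_mps c \<in> \<G>" and var: "var_mps i \<in> \<G>"
    and add: "x \<in> \<G> \<Longrightarrow> y \<in> \<G> \<Longrightarrow> x + y \<in> \<G>" and mult: "x \<in> \<G> \<Longrightarrow> y \<in> \<G> \<Longrightarrow> x * y \<in> \<G>"
    and pderiv: "x \<in> \<G> \<Longrightarrow> pderiv_mps i x \<in> \<G>"
    and inv: "x \<in> \<G> \<Longrightarrow> x * y = 1 \<Longrightarrow> y \<in> \<G>"
    and root: "y ^ 2 \<in> \<G> \<Longrightarrow> y dvd 1 \<Longrightarrow> y \<in> \<G>"
begin

lemma zero: "0 \<in> \<G>" and one: "1 \<in> \<G>"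
  using const[of 0] const[of 1] by simp_all

lemma uminus: "x \<in> \<G> \<Longrightarrow> - x \<in> \<G>"
  using mult[OF const[of "- 1"]] by (simp add: const_mps_uminus)

lemma sum: "(\<And>x. x \<in> A \<Longrightarrow> f x \<in> \<G>) \<Longrightarrow> sum f A \<in> \<G>"
  by (induction A rule: infinite_finite_induct) (auto intro: add zero)

lemma prod: "(\<And>x. x \<in> A \<Longrightarrow> f x \<in> \<G>) \<Longrightarrow> prod f A \<in> \<G>"
  by (induction A rule: infinite_finite_induct) (auto intro: mult one)

lemma power: "x \<in> \<G> \<Longrightarrow> x ^ k \<in> \<G>"
  by (induction k) (auto intro: mult one)

lemma det: "(\<And>i j. A $ i $ j \<in> \<G>) \<Longrightarrow> det A \<in> \<G>" for A :: "('k, 'n) mps ^ 'm::finite ^ 'm"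
proof -
  assume A: "\<And>i j. A $ i $ j \<in> \<G>"
  have "of_int (sign p) \<in> \<G>" for p :: "'m \<Rightarrow> 'm"
    by (simp add: sign_def one uminus)
  then show ?thesis unfolding det_def by (intro sum mult prod A)
qed

end

lemma germ_class_formal: "germ_class formal_germs"
  by standard (simp_all add: formal_germs_def)

subsection \<open>Analytic germs\<close>

definition low :: "nat \<Rightarrow> ('n::finite \<Rightarrow>\<^sub>0 nat) set" where "low N = {m. mdeg m < N}"

lemma finite_low [simp]: "finite (low N :: ('n::finite \<Rightarrow>\<^sub>0 nat) set)"
proof (rule finite_subset)
  have "\<exists>n. finite {a :: 'n \<Rightarrow>\<^sub>0 nat. \<forall>i. lookup a i \<le> lookup n i} \<and> (\<forall>i. lookup n i = N)"
  proof -
    have "finite {x :: 'n. N \<noteq> 0}" by simp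
    then have "lookup (Abs_poly_mapping (\<lambda>i :: 'n. N)) = (\<lambda>i. N)" by (intro lookup_Abs_poly_mapping) simp
    then show ?thesis using finite_le_multi_index by metis
  qed
  then obtain n :: "'n \<Rightarrow>\<^sub>0 nat" where n: "finite {a :: 'n \<Rightarrow>\<^sub>0 nat. \<forall>i. lookup a i \<le> lookup n i}" "\<And>i. lookup n i = N"
    by blast
  show "finite {a :: 'n \<Rightarrow>\<^sub>0 nat. \<forall>i. lookup a i \<le> N}" using n by simp
  have "lookup m i \<le> mdeg m" for m :: "'n \<Rightarrow>\<^sub>0 nat" and i by (rule member_le_sum) auto
  then show "low N \<subseteq> {a :: 'n \<Rightarrow>\<^sub>0 nat. \<forall>i. lookup a i \<le> N}"
    unfolding low_def using le_less_trans less_imp_le by blast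
qed

lemma low_iff: "m \<in> low N \<longleftrightarrow> mdeg m < N"
  by (simp add: low_def)

text \<open>Bounds on truncated sums replace summability, and the truncation index serves as
  induction variable for implicitly given series.\<close>

definition pnorm :: "nat \<Rightarrow> real \<Rightarrow> (complex, 'n::finite) mps \<Rightarrow> real" where
  "pnorm N r f = (\<Sum>m\<in>low N. norm (coeff_mps f m) * r ^ mdeg m)"

lemma pnorm_nonneg: "r > 0 \<Longrightarrow> pnorm N r f \<ge> 0"
  by (auto simp: pnorm_def intro!: sum_nonneg)

lemma analytic_iff: "f \<in> analytic_germs \<longleftrightarrow> (\<exists>r>0. \<exists>B. \<forall>N. pnorm N r f \<le> B)"
proof
  assume "f \<in> analytic_germs"
  then obtain r where r: "r > 0" "(\<lambda>m. norm (coeff_mps f m) * r ^ mdeg m) summable_on UNIV"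
    by (auto simp: analytic_germs_def)
  have "pnorm N r f \<le> infsum (\<lambda>m. norm (coeff_mps f m) * r ^ mdeg m) UNIV" for N
    unfolding pnorm_def using r by (intro finite_sum_le_infsum) auto
  then show "\<exists>r>0. \<exists>B. \<forall>N. pnorm N r f \<le> B" using r by blast
next
  assume "\<exists>r>0. \<exists>B. \<forall>N. pnorm N r f \<le> B"
  then obtain r B where r: "r > 0" "\<And>N. pnorm N r f \<le> B" by blast
  have "(\<lambda>m. norm (coeff_mps f m) * r ^ mdeg m) summable_on UNIV"
  proof (rule nonneg_bdd_above_summable_on)
    show "bdd_above (sum (\<lambda>m. norm (coeff_mps f m) * r ^ mdeg m) ` {F. F \<subseteq> UNIV \<and> finite F})"
    proof (rule bdd_aboveI2)
      fix F :: "('a \<Rightarrow>\<^sub>0 nat) set" assume "F \<in> {F. F \<subseteq> UNIV \<and> finite F}"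
      then have F: "finite F" by simp
      have "F \<subseteq> low (Suc (Max (mdeg ` F)))" using F by (auto simp: low_iff less_Suc_eq_le)
      then have "(\<Sum>m\<in>F. norm (coeff_mps f m) * r ^ mdeg m) \<le> pnorm (Suc (Max (mdeg ` F))) r f"
        unfolding pnorm_def using r by (intro sum_mono2) auto
      then show "(\<Sum>m\<in>F. norm (coeff_mps f m) * r ^ mdeg m) \<le> B" using r(2) by (rule order.trans)
    qed
  qed (use r in auto)
  then show "f \<in> analytic_germs" using r by (auto simp: analytic_germs_def)
qed

lemma analyticI: "r > 0 \<Longrightarrow> (\<And>N. pnorm N r f \<le> B) \<Longrightarrow> f \<in> analytic_germs"
  by (auto simp: analytic_iff)

lemma pnorm_mono: "0 < r' \<Longrightarrow> r' \<le> r \<Longrightarrow> pnorm N r' f \<le> pnorm N r f"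
  unfolding pnorm_def by (intro sum_mono mult_left_mono power_mono) auto

lemma analytic_pair:
  assumes "f \<in> analytic_germs" "g \<in> analytic_germs"
  obtains r B where "r > 0" "B \<ge> 0" "\<And>N. pnorm N r f \<le> B" "\<And>N. pnorm N r g \<le> B"
proof -
  obtain r B s C where r: "r > 0" "\<And>N. pnorm N r f \<le> B" and s: "s > 0" "\<And>N. pnorm N s g \<le> C"
    using assms by (auto simp: analytic_iff)
  show ?thesis
  proof (rule that[of "min r s" "max 0 (max B C)"])
    show "pnorm N (min r s) f \<le> max 0 (max B C)" for N
      using pnorm_mono[of "min r s" r N f] r s by (smt (verit) min_less_iff_conj)
    show "pnorm N (min r s) g \<le> max 0 (max B C)" for N
      using pnorm_mono[of "min r s" s N g] r s by (smt (verit) min_less_iff_conj)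
  qed (use r s in auto)
qed

lemma pnorm_add: "r > 0 \<Longrightarrow> pnorm N r (f + g) \<le> pnorm N r f + pnorm N r g"
  unfolding pnorm_def sum.distrib[symmetric]
  by (intro sum_mono) (auto simp flip: distrib_right intro!: mult_right_mono norm_triangle_ineq)

text \<open>The sets A and B allow a sharper truncation: a factor without constant term forces the
  other one to lower degree, as in \<open>pnorm_mult_left\<close> and
  \<open>pnorm_mult_both\<close>.\<close>

lemma pnorm_mult_gen:
  assumes r: "r > 0" and fin: "finite A" "finite B"
    and AB: "\<And>a b. mdeg (a + b) < N \<Longrightarrow> coeff_mps f a \<noteq> 0 \<Longrightarrow> coeff_mps g b \<noteq> 0 \<Longrightarrow> a \<in> A \<and> b \<in> B"
  shows "pnorm N r (f * g) \<le> (\<Sum>m\<in>A. norm (coeff_mps f m) * r ^ mdeg m) * (\<Sum>m\<in>B. norm (coeff_mps g m) * r ^ mdeg m)"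
proof -
  define T where "T a b = norm (coeff_mps f a) * r ^ mdeg a * (norm (coeff_mps g b) * r ^ mdeg b)" for a b
  have T: "T a b \<ge> 0" for a b using r by (simp add: T_def)
  have "pnorm N r (f * g) \<le> (\<Sum>m\<in>low N. \<Sum>(a, b)\<in>{(a, b). a + b = m}. T a b)"
    unfolding pnorm_def
  proof (rule sum_mono)
    fix m :: "'a \<Rightarrow>\<^sub>0 nat" assume "m \<in> low N"
    have "norm (coeff_mps (f * g) m) \<le> (\<Sum>(a, b)\<in>{(a, b). a + b = m}. norm (coeff_mps f a) * norm (coeff_mps g b))"
      unfolding coeff_mps_mult by (rule order.trans[OF norm_sum]) (simp add: case_prod_unfold norm_mult)
    then have "norm (coeff_mps (f * g) m) * r ^ mdeg m
        \<le> (\<Sum>(a, b)\<in>{(a, b). a + b = m}. norm (coeff_mps f a) * norm (coeff_mps g b)) * r ^ mdeg m"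
      using r by (intro mult_right_mono) auto
    also have "\<dots> = (\<Sum>(a, b)\<in>{(a, b). a + b = m}. T a b)"
      unfolding sum_distrib_right by (rule sum.cong) (auto simp: T_def mdeg_add power_add)
    finally show "norm (coeff_mps (f * g) m) * r ^ mdeg m \<le> (\<Sum>(a, b)\<in>{(a, b). a + b = m}. T a b)" .
  qed
  also have "\<dots> = (\<Sum>(m, x)\<in>Sigma (low N) (\<lambda>m. {(a, b). a + b = m}). T (fst x) (snd x))"
    by (subst sum.Sigma[symmetric]) (auto simp: finite_splits finite_splits[unfolded case_prod_unfold] case_prod_unfold)
  also have "\<dots> = (\<Sum>(a, b)\<in>{(a, b). a + b \<in> low N}. T a b)"
    by (rule sum.reindex_bij_witness[where i = "\<lambda>(a, b). (a + b, (a, b))" and j = snd]) auto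
  also have "\<dots> \<le> (\<Sum>(a, b)\<in>A \<times> B. T a b)"
  proof -
    have fin': "finite {(a, b). a + b \<in> (low N :: ('a \<Rightarrow>\<^sub>0 nat) set)}"
      by (rule finite_subset[of _ "low N \<times> low N"]) (auto simp: low_iff mdeg_add)
    have "(\<Sum>(a, b)\<in>{(a, b). a + b \<in> low N}. T a b) = (\<Sum>(a, b)\<in>{(a, b). a + b \<in> low N} \<inter> A \<times> B. T a b)"
      by (rule sum.mono_neutral_right) (use fin' AB in \<open>auto simp: T_def low_iff\<close>)
    also have "\<dots> \<le> (\<Sum>(a, b)\<in>A \<times> B. T a b)"
      by (rule sum_mono2) (use fin T in auto)
    finally show ?thesis .
  qed
  also have "\<dots> = (\<Sum>m\<in>A. norm (coeff_mps f m) * r ^ mdeg m) * (\<Sum>m\<in>B. norm (coeff_mps g m) * r ^ mdeg m)"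
    by (simp add: T_def sum_product sum.cartesian_product)
  finally show ?thesis .
qed

lemma pnorm_mult: "r > 0 \<Longrightarrow> pnorm N r (f * g) \<le> pnorm N r f * pnorm N r g"
  unfolding pnorm_def[of N r f] pnorm_def[of N r g] by (rule pnorm_mult_gen) (auto simp: low_iff mdeg_add)

lemma pnorm_mult_left:
  assumes "r > 0" "eval0_mps f = 0"
  shows "pnorm (Suc N) r (f * g) \<le> pnorm (Suc N) r f * pnorm N r g"
  unfolding pnorm_def[of _ r f] pnorm_def[of _ r g]
proof (rule pnorm_mult_gen[OF assms(1) finite_low finite_low])
  fix a b assume ab: "mdeg (a + b) < Suc N" "coeff_mps f a \<noteq> 0"
  then have "a \<noteq> 0" using assms by auto
  then have "mdeg a > 0" using mdeg_eq_0_iff by blast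
  then show "a \<in> low (Suc N) \<and> b \<in> low N" using ab by (auto simp: low_iff mdeg_add)
qed

lemma pnorm_mult_both:
  assumes "r > 0" "eval0_mps f = 0" "eval0_mps g = 0"
  shows "pnorm (Suc N) r (f * g) \<le> pnorm N r f * pnorm N r g"
  unfolding pnorm_def[of _ r f] pnorm_def[of _ r g]
proof (rule pnorm_mult_gen[OF assms(1) finite_low finite_low])
  fix a b assume ab: "mdeg (a + b) < Suc N" "coeff_mps f a \<noteq> 0" "coeff_mps g b \<noteq> 0"
  then have "a \<noteq> 0" "b \<noteq> 0" using assms by auto
  then have "mdeg a > 0" "mdeg b > 0" using mdeg_eq_0_iff by blast+
  then show "a \<in> low N \<and> b \<in> low N" using ab by (auto simp: low_iff mdeg_add)
qed

lemma pnorm_const: "pnorm N r (const_mps c :: (complex, 'n::finite) mps) \<le> norm c"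
proof -
  have "pnorm N r (const_mps c :: (complex, 'n) mps) = (\<Sum>m\<in>(low N :: ('n \<Rightarrow>\<^sub>0 nat) set). if m = 0 then norm c else 0)"
    unfolding pnorm_def by (rule sum.cong) (auto simp: coeff_const_mps)
  then show ?thesis by simp
qed

text \<open>Shrinking the radius by a factor e <= 1 multiplies each nonconstant term by at most
  e.\<close>

lemma analytic_small:
  assumes h: "h \<in> analytic_germs" "eval0_mps h = 0"
  obtains r where "r > 0" "\<And>N. pnorm N r h \<le> 1 / 2"
proof -
  obtain r B where r: "r > 0" "B \<ge> 0" "\<And>N. pnorm N r h \<le> B"
    using analytic_pair[OF h(1) h(1)] by metis
  define e where "e = 1 / (2 * (B + 1))"
  have e: "0 < e" "e \<le> 1" "e * B \<le> 1 / 2" using r by (auto simp: e_def field_simps)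
  have "pnorm N (e * r) h \<le> e * pnorm N r h" for N
    unfolding pnorm_def sum_distrib_left
  proof (rule sum_mono)
    fix m :: "'a \<Rightarrow>\<^sub>0 nat"
    show "norm (coeff_mps h m) * (e * r) ^ mdeg m \<le> e * (norm (coeff_mps h m) * r ^ mdeg m)"
    proof (cases "m = 0")
      case False
      then obtain d where d: "mdeg m = Suc d" using mdeg_eq_0_iff not0_implies_Suc by blast
      have "e ^ Suc d \<le> e" using e by (simp add: mult_left_le power_le_one)
      then have "e ^ Suc d * (norm (coeff_mps h m) * r ^ Suc d) \<le> e * (norm (coeff_mps h m) * r ^ Suc d)"
        using r by (intro mult_right_mono) auto
      then show ?thesis unfolding d power_mult_distrib by (simp add: mult_ac)
    qed (use h in simp)
  qed
  then have "pnorm N (e * r) h \<le> 1 / 2" for N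
    using e r(3)[of N] by (smt (verit) mult_left_mono)
  then show ?thesis using that[of "e * r"] e r by simp
qed

lemma analytic_const: "const_mps c \<in> analytic_germs"
  using analyticI[of 1 "const_mps c" "norm c"] pnorm_const by force

lemma analytic_add: "f \<in> analytic_germs \<Longrightarrow> g \<in> analytic_germs \<Longrightarrow> f + g \<in> analytic_germs"
proof -
  assume "f \<in> analytic_germs" "g \<in> analytic_germs"
  then obtain r B where r: "r > 0" "B \<ge> 0" "\<And>N. pnorm N r f \<le> B" "\<And>N. pnorm N r g \<le> B"
    using analytic_pair by metis
  have "pnorm N r (f + g) \<le> B + B" for N
    by (rule order.trans[OF pnorm_add[OF r(1)]]) (intro add_mono r)
  then show ?thesis using r(1) by (intro analyticI)
qed

lemma analytic_mult: "f \<in> analytic_germs \<Longrightarrow> g \<in> analytic_germs \<Longrightarrow> f * g \<in> analytic_germs"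
proof -
  assume "f \<in> analytic_germs" "g \<in> analytic_germs"
  then obtain r B where r: "r > 0" "B \<ge> 0" "\<And>N. pnorm N r f \<le> B" "\<And>N. pnorm N r g \<le> B"
    using analytic_pair by metis
  have "pnorm N r (f * g) \<le> B * B" for N
    by (rule order.trans[OF pnorm_mult[OF r(1)]]) (intro mult_mono r pnorm_nonneg)
  then show ?thesis using r(1) by (intro analyticI)
qed

lemma analytic_diff: "f \<in> analytic_germs \<Longrightarrow> g \<in> analytic_germs \<Longrightarrow> f - g \<in> analytic_germs"
  using analytic_add[OF _ analytic_mult[OF analytic_const[of "- 1"]], of f g] by (simp add: const_mps_uminus)

lemma germ_class_analytic: "germ_class (analytic_germs :: (complex, 'n::finite) mps set)"
proof
  fix x y :: "(complex, 'n) mps" and c i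
  show "const_mps c \<in> (analytic_germs :: (complex, 'n) mps set)" by (rule analytic_const)
  show "x \<in> analytic_germs \<Longrightarrow> y \<in> analytic_germs \<Longrightarrow> x + y \<in> analytic_germs" by (rule analytic_add)
  show "x \<in> analytic_germs \<Longrightarrow> y \<in> analytic_germs \<Longrightarrow> x * y \<in> analytic_germs" by (rule analytic_mult)
  show "var_mps i \<in> (analytic_germs :: (complex, 'n) mps set)"
  proof (rule analyticI[of 1])
    fix N
    have "pnorm N 1 (var_mps i :: (complex, 'n) mps) = (\<Sum>m\<in>low N. if m = Poly_Mapping.single i 1 then 1 else 0)"
      unfolding pnorm_def by (rule sum.cong) (auto simp: var_mps.rep_eq)
    then show "pnorm N 1 (var_mps i :: (complex, 'n) mps) \<le> 1" by simp
  qed simp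
  show "pderiv_mps i x \<in> analytic_germs" if "x \<in> analytic_germs"
  proof -
    from that obtain r B where r: "r > 0" "B \<ge> 0" "\<And>N. pnorm N r x \<le> B"
      using analytic_pair by metis
    let ?e = "Poly_Mapping.single i (1::nat)"
    \<comment> \<open>Halving the radius pays for the factor \<open>Suc (lookup m i)\<close>, which
      is at most 2 to the degree.\<close>
    have "pnorm N (r / 2) (pderiv_mps i x) \<le> B / r" for N
    proof -
      have "norm (coeff_mps (pderiv_mps i x) m) * (r / 2) ^ mdeg m
          \<le> norm (coeff_mps x (m + ?e)) * r ^ mdeg (m + ?e) / r" for m
      proof -
        have "lookup m i \<le> mdeg m" by (rule member_le_sum) auto
        then have "real (Suc (lookup m i)) \<le> 2 ^ mdeg m"
          using self_le_ge2_pow[of 2 "lookup m i"] by (metis (mono_tags, opaque_lifting) Suc_leI less_exp numeral_power_le_of_nat_cancel_iff of_nat_le_iff of_nat_numeral of_nat_power order.strict_trans1 power_increasing_iff one_less_numeral_iff semiring_norm(76))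
        then have "real (Suc (lookup m i)) * (r / 2) ^ mdeg m \<le> 2 ^ mdeg m * (r / 2) ^ mdeg m"
          using r by (intro mult_right_mono) auto
        also have "\<dots> = r ^ mdeg m" by (simp flip: power_mult_distrib)
        finally have "norm (coeff_mps x (m + ?e)) * (real (Suc (lookup m i)) * (r / 2) ^ mdeg m)
            \<le> norm (coeff_mps x (m + ?e)) * r ^ mdeg m" by (rule mult_left_mono) simp
        moreover have "r ^ mdeg (m + ?e) / r = r ^ mdeg m"
          using r unfolding mdeg_add by simp
        ultimately show ?thesis
          by (simp add: coeff_pderiv_mps norm_mult mult_ac del: of_nat_Suc One_nat_def) (metis mult.commute times_divide_eq_right)
      qed
      then have "pnorm N (r / 2) (pderiv_mps i x) \<le> (\<Sum>m\<in>low N. norm (coeff_mps x (m + ?e)) * r ^ mdeg (m + ?e)) / r"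
        unfolding pnorm_def sum_divide_distrib by (intro sum_mono)
      also have "(\<Sum>m\<in>low N. norm (coeff_mps x (m + ?e)) * r ^ mdeg (m + ?e))
          = (\<Sum>m\<in>(\<lambda>m. m + ?e) ` low N. norm (coeff_mps x m) * r ^ mdeg m)"
        by (subst sum.reindex) (auto simp: inj_on_def)
      also have "\<dots> \<le> pnorm (Suc N) r x"
        unfolding pnorm_def by (rule sum_mono2) (use r in \<open>auto simp: low_iff mdeg_add simp del: One_nat_def\<close>)
      also have "\<dots> \<le> B" by (rule r)
      finally show ?thesis using r by (simp add: divide_right_mono)
    qed
    then show ?thesis using r by (intro analyticI[of "r / 2"]) auto
  qed
  show "y \<in> analytic_germs" if x: "x \<in> analytic_germs" and xy: "x * y = 1"
  proof -
    define c where "c = eval0_mps x"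
    have "c * eval0_mps y = 1" using xy unfolding c_def by (metis eval0_mult eval0_one)
    then have c: "c \<noteq> 0" by auto
    define h where "h = 1 - const_mps (1 / c) * x"
    define Y where "Y = const_mps c * y"
    have cc: "const_mps (1 / c) * (const_mps c * z) = (z :: (complex, 'n) mps)" for z
      using c by (simp add: mult.assoc[symmetric] flip: const_mps_mult)
    have Y: "Y = 1 + h * Y"
    proof -
      have "const_mps (1 / c) * x * Y = const_mps (1 / c) * (const_mps c * (x * y))" by (simp add: Y_def mult_ac)
      also have "\<dots> = 1" unfolding cc by (rule xy)
      finally show ?thesis by (simp add: h_def left_diff_distrib)
    qed
    have "h \<in> analytic_germs" unfolding h_def
      using analytic_const[of 1] by (intro analytic_diff analytic_mult analytic_const x) simp
    moreover have "eval0_mps h = 0" using c by (simp add: h_def c_def)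
    ultimately obtain r where r: "r > 0" "\<And>N. pnorm N r h \<le> 1 / 2" using analytic_small by metis
    \<comment> \<open>The equation Y = 1 + h Y with h of norm at most 1/2 reproduces the bound: 1 +
      2/2 = 2.\<close>
    have "pnorm N r Y \<le> 2" for N
    proof (induction N)
      case 0
      have "low 0 = ({} :: ('n \<Rightarrow>\<^sub>0 nat) set)" by (auto simp: low_iff)
      then show ?case by (simp add: pnorm_def)
    next
      case (Suc N)
      have "const_mps 1 + h * Y = Y" using Y[symmetric] by simp
      then have "pnorm (Suc N) r Y \<le> pnorm (Suc N) r (const_mps 1 :: (complex, 'n) mps) + pnorm (Suc N) r (h * Y)"
        using pnorm_add[OF r(1), of "Suc N" "const_mps 1" "h * Y"] by (simp only:)
      also have "pnorm (Suc N) r (const_mps 1 :: (complex, 'n) mps) \<le> 1" using pnorm_const[of "Suc N" r 1, where 'n = 'n] by simp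
      also have "pnorm (Suc N) r (h * Y) \<le> pnorm (Suc N) r h * pnorm N r Y"
        by (rule pnorm_mult_left[OF r(1) \<open>eval0_mps h = 0\<close>])
      also have "\<dots> \<le> 1 / 2 * 2" by (intro mult_mono r Suc pnorm_nonneg) auto
      finally show ?case by simp
    qed
    then have "Y \<in> analytic_germs" using r by (intro analyticI)
    then have "const_mps (1 / c) * Y \<in> analytic_germs" by (intro analytic_mult analytic_const)
    then show ?thesis by (simp add: Y_def cc)
  qed
  show "y \<in> analytic_germs" if x: "y ^ 2 \<in> analytic_germs" and y: "y dvd 1"
  proof -
    define c where "c = eval0_mps y"
    have c: "c \<noteq> 0" using y mps_unit_iff by (auto simp: c_def)
    define h where "h = 1 - const_mps (1 / c ^ 2) * y ^ 2"
    define z where "z = 1 - const_mps (1 / c) * y"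
    have "const_mps (1 / c ^ 2) * y ^ 2 = (const_mps (1 / c) * y) ^ 2"
      by (simp add: power_mult_distrib power_one_over flip: const_mps_power)
    then have "h = 1 - (1 - z) ^ 2" by (simp add: h_def z_def)
    then have "h = 2 * z - z * z" by (simp add: power2_eq_square algebra_simps)
    then have hz: "2 * z = h + z * z" by simp
    have z: "z = const_mps (1 / 2) * h + const_mps (1 / 2) * (z * z)"
    proof -
      have "z = const_mps (1 / 2) * (2 * z)"
        using const_mps_inverse_of_nat[of 2, where 'a = complex and 'b = 'n] by (simp add: mult_ac mult.assoc[symmetric])
      then show ?thesis unfolding hz by (simp add: distrib_left)
    qed
    have "h \<in> analytic_germs" unfolding h_def
      using analytic_const[of 1] by (intro analytic_diff analytic_mult analytic_const x) simp
    moreover have "eval0_mps h = 0" "eval0_mps z = 0" using c by (simp_all add: h_def z_def c_def)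
    ultimately obtain r where r: "r > 0" "\<And>N. pnorm N r h \<le> 1 / 2" using analytic_small by metis
    have half: "pnorm N r (const_mps (1 / 2) * f) \<le> 1 / 2 * pnorm N r f" for N and f :: "(complex, 'n) mps"
      unfolding pnorm_def sum_distrib_left by (rule sum_mono) (simp add: norm_mult norm_divide)
    \<comment> \<open>z solves z = (h + z^2) / 2, and 1/4 + 1/8 stays below 1/2.\<close>
    have "pnorm N r z \<le> 1 / 2" for N
    proof (induction N)
      case 0
      have "low 0 = ({} :: ('n \<Rightarrow>\<^sub>0 nat) set)" by (auto simp: low_iff)
      then show ?case by (simp add: pnorm_def)
    next
      case (Suc N)
      have "pnorm (Suc N) r z \<le> pnorm (Suc N) r (const_mps (1 / 2) * h) + pnorm (Suc N) r (const_mps (1 / 2) * (z * z))"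
        by (subst z) (rule pnorm_add[OF r(1)])
      also have "\<dots> \<le> 1 / 2 * pnorm (Suc N) r h + 1 / 2 * pnorm (Suc N) r (z * z)"
        by (intro add_mono half)
      also have "pnorm (Suc N) r (z * z) \<le> pnorm N r z * pnorm N r z"
        by (rule pnorm_mult_both[OF r(1) \<open>eval0_mps z = 0\<close> \<open>eval0_mps z = 0\<close>])
      also have "pnorm N r z * pnorm N r z \<le> 1 / 2 * (1 / 2)" by (intro mult_mono Suc pnorm_nonneg r) auto
      also have "pnorm (Suc N) r h \<le> 1 / 2" by (rule r)
      finally show ?case by simp
    qed
    then have "z \<in> analytic_germs" using r by (intro analyticI)
    then have "const_mps c * (const_mps 1 - z) \<in> analytic_germs"
      by (intro analytic_mult analytic_diff analytic_const)
    moreover have "const_mps c * (const_mps 1 - z) = y"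
      using c by (simp add: z_def mult.assoc[symmetric] flip: const_mps_mult)
    ultimately show ?thesis by simp
  qed
qed

section \<open>Polynomials on the cone\<close>

lemma ring_hom_id: "ring_hom_1 (id :: 'a::comm_ring_1 \<Rightarrow> 'a)"
  by standard simp_all

lemma ring_hom_poly_const: "ring_hom_1 (\<lambda>c :: 'a::comm_ring_1. [:c:])"
  by standard (simp_all add: one_pCons)

lemma eval_mpoly_comp:
  assumes "ring_hom_1 \<phi>"
  shows "eval_mpoly \<phi> (eval_mpoly mconst F Y) x = eval_mpoly \<phi> F (\<lambda>i. eval_mpoly \<phi> (Y i) x)"
  using ring_hom_eval_mpoly[OF ring_hom_mconst eval_mpoly_hom[OF assms], of F Y x]
  by (simp add: eval_mconst[OF assms])

lemma vanishing_family:
  fixes c :: "('v \<Rightarrow>\<^sub>0 nat) \<Rightarrow> 'k::field_char_0"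
  assumes "finite A" "finite M" "\<And>m m'. m \<in> M \<Longrightarrow> m' \<in> M \<Longrightarrow> \<forall>i\<in>A. lookup m i = lookup m' i \<Longrightarrow> m = m'"
    and "\<And>x :: 'v \<Rightarrow> 'k. (\<Sum>m\<in>M. c m * (\<Prod>i\<in>A. x i ^ lookup m i)) = 0" "m \<in> M"
  shows "c m = 0"
  using assms
proof (induction A arbitrary: M m rule: finite_induct)
  case empty
  then have "M = {m}" by auto
  then show ?case using empty by simp
next
  case (insert a A)
  define K where "K = Suc (Max ((\<lambda>m. lookup m a) ` M))"
  define F where "F k x = (\<Sum>m\<in>{m \<in> M. lookup m a = k}. c m * (\<Prod>i\<in>A. x i ^ lookup m i))" for k and x :: "'v \<Rightarrow> 'k"
  have K: "lookup m a < K" if "m \<in> M" for m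
    using that insert.prems(1) by (simp add: K_def less_Suc_eq_le)
  have "F (lookup m a) x = 0" for x
  proof -
    have "poly (\<Sum>k<K. monom (F k x) k) t = 0" for t
    proof -
      define y where "y = x(a := t)"
      have "(\<Sum>m\<in>{m \<in> M. lookup m a = k}. c m * (\<Prod>i\<in>insert a A. y i ^ lookup m i)) = F k x * t ^ k" for k
      proof -
        have "(\<Prod>i\<in>A. y i ^ e i) = (\<Prod>i\<in>A. x i ^ e i)" for e :: "'v \<Rightarrow> nat"
          by (rule prod.cong) (use insert.hyps in \<open>auto simp: y_def\<close>)
        then show ?thesis using insert.hyps by (simp add: F_def sum_distrib_left y_def mult_ac)
      qed
      then have "(\<Sum>k<K. F k x * t ^ k) = (\<Sum>k<K. \<Sum>m\<in>{m \<in> M. lookup m a = k}. c m * (\<Prod>i\<in>insert a A. y i ^ lookup m i))"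
        by simp
      also have "\<dots> = (\<Sum>m\<in>M. c m * (\<Prod>i\<in>insert a A. y i ^ lookup m i))"
        by (rule sum.group) (use insert.prems K in auto)
      finally show ?thesis using insert.prems(3) by (simp add: poly_sum poly_monom)
    qed
    then have "(\<Sum>k<K. monom (F k x) k) = 0" using poly_all_0_iff_0 by blast
    then have "coeff (\<Sum>k<K. monom (F k x) k) (lookup m a) = 0" by simp
    then show ?thesis using K[OF insert.prems(4)] by (simp add: coeff_sum)
  qed
  then show ?case
    unfolding F_def by (intro insert.IH[of "{m' \<in> M. lookup m' a = lookup m a}" m]) (use insert.prems in auto)
qed

lemma mpoly_eqI_eval:
  fixes F :: "('k::field_char_0, 'v::finite) mpoly"
  assumes "\<And>x. eval_mpoly id F x = 0" shows "F = 0"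
proof (rule ccontr)
  assume "F \<noteq> 0"
  then obtain m where m: "m \<in> keys F" by (metis keys_eq_empty all_not_in_conv)
  have "lookup F m = 0"
    by (rule vanishing_family[of UNIV "keys F" "lookup F" m])
       (use assms m in \<open>auto simp: eval_mpoly_def intro: poly_mapping_eqI\<close>)
  then show False using m by (auto simp: in_keys_iff)
qed

text \<open>An identity at all points over an infinite field is a formal one and can be evaluated in
  any algebra. This carries equations of the cones over to power series.\<close>

lemma polynomial_identity_transfer:
  fixes F :: "('k::field_char_0, 'v::finite) mpoly" and \<phi> :: "'k \<Rightarrow> 'b::comm_ring_1"
  assumes z: "\<And>x. eval_mpoly id F (\<lambda>i. eval_mpoly id (Y i) x) = 0" and \<phi>: "ring_hom_1 \<phi>"
  shows "eval_mpoly \<phi> F (\<lambda>i. eval_mpoly \<phi> (Y i) x) = 0"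
proof -
  have "eval_mpoly mconst F Y = 0"
    by (rule mpoly_eqI_eval) (simp add: eval_mpoly_comp[OF ring_hom_id] z)
  then show ?thesis using eval_mpoly_comp[OF \<phi>, of F Y x] by (simp add: eval_mpoly_def)
qed

lemma poly_eval_mpoly:
  fixes F :: "('k::comm_ring_1, 'v::finite) mpoly"
  shows "poly (eval_mpoly (\<lambda>c. [:c:]) F X) t = eval_mpoly id F (\<lambda>i. poly (X i) t)"
proof -
  have "ring_hom_1 (\<lambda>p :: 'k poly. poly p t)" by standard simp_all
  from ring_hom_eval_mpoly[OF ring_hom_poly_const this, of F X] show ?thesis by (simp add: id_def)
qed

text \<open>Density along a curve: a polynomial in t that vanishes off the zeros of q vanishes
  identically.\<close>

lemma vanishing_on_curve:
  fixes F :: "('k::field_char_0, 'v::finite) mpoly" and X :: "'v \<Rightarrow> 'k poly"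
  assumes "q \<noteq> 0" "\<And>t. poly q t \<noteq> 0 \<Longrightarrow> eval_mpoly id F (\<lambda>i. poly (X i) t) = 0"
  shows "eval_mpoly id F (\<lambda>i. poly (X i) t) = 0"
proof -
  let ?E = "eval_mpoly (\<lambda>c. [:c:]) F X"
  have "poly (q * ?E) t = 0" for t
    using assms(2)[of t] by (auto simp: poly_eval_mpoly)
  then have "q * ?E = 0" using poly_all_0_iff_0 by blast
  then have "?E = 0" using assms(1) by simp
  then show ?thesis using poly_eval_mpoly[of F X t] by simp
qed

lemma mpoly_chain_rule:
  fixes F :: "('k::field_char_0, 'v::finite) mpoly" and X :: "'v \<Rightarrow> 'k poly"
  shows "poly (Polynomial.pderiv (eval_mpoly (\<lambda>c. [:c:]) F X)) t
     = (\<Sum>i\<in>UNIV. mpoly_pderiv_at i F (\<chi> j. poly (X j) t) * poly (Polynomial.pderiv (X i)) t)"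
proof -
  interpret D: derivation "Polynomial.pderiv :: 'k poly \<Rightarrow> _"
    by standard (simp_all add: pderiv_add pderiv_mult mult.commute add.commute)
  have c: "Polynomial.pderiv [:a:] = 0" for a :: 'k by (simp add: pderiv_pCons)
  have pw: "Polynomial.pderiv (p ^ k) = smult (of_nat k) (p ^ (k - 1) * Polynomial.pderiv p)" for p :: "'k poly" and k
    by (cases k) (simp_all add: pderiv_power_Suc del: power_Suc of_nat_Suc)
  have mono: "poly (Polynomial.pderiv (\<Prod>i\<in>UNIV. X i ^ e i)) t
     = (\<Sum>i\<in>UNIV. of_nat (e i) * (\<Prod>j\<in>UNIV. poly (X j) t ^ (if j = i then e j - 1 else e j)) * poly (Polynomial.pderiv (X i)) t)"
    for e :: "'v \<Rightarrow> nat"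
  proof -
    have "poly (X i) t ^ (e i - 1) * (\<Prod>j\<in>UNIV - {i}. poly (X j) t ^ e j)
        = (\<Prod>j\<in>UNIV. poly (X j) t ^ (if j = i then e j - 1 else e j))" for i
      by (subst prod.remove[of UNIV i]) (auto intro!: prod.cong)
    then show ?thesis
      by (simp add: D.derivation_prod poly_sum poly_prod pw mult_ac)
  qed
  have "poly (Polynomial.pderiv (eval_mpoly (\<lambda>c. [:c:]) F X)) t
     = (\<Sum>m\<in>keys F. \<Sum>i\<in>UNIV. lookup F m * (of_nat (lookup m i) * (\<Prod>j\<in>UNIV. poly (X j) t ^ (if j = i then lookup m j - 1 else lookup m j))
         * poly (Polynomial.pderiv (X i)) t))"
    by (simp add: eval_mpoly_def D.sum D.mult c poly_sum mono sum_distrib_left pderiv_smult)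
  also have "\<dots> = (\<Sum>i\<in>UNIV. mpoly_pderiv_at i F (\<chi> j. poly (X j) t) * poly (Polynomial.pderiv (X i)) t)"
    unfolding mpoly_pderiv_at_def sum_distrib_right by (subst sum.swap) (simp add: mult_ac)
  finally show ?thesis .
qed

subsection \<open>Even polynomials and norms\<close>

lemma mvar_power: "(mvar i :: ('k::comm_ring_1, 'v) mpoly) ^ k = Poly_Mapping.single (Poly_Mapping.single i k) 1"
  by (induction k) (simp_all add: mult_single flip: single_add)

lemma prod_mvar: "(\<Prod>i\<in>UNIV. (mvar i :: ('k::comm_ring_1, 'v::finite) mpoly) ^ lookup m i) = Poly_Mapping.single m 1"
proof -
  have "(\<Prod>i\<in>A. (mvar i :: ('k, 'v) mpoly) ^ lookup m i) = Poly_Mapping.single (\<Sum>i\<in>A. Poly_Mapping.single i (lookup m i)) 1"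
    if "finite A" for A
    using that by (induction A rule: finite_induct) (simp_all add: mvar_power mult_single del: One_nat_def)
  moreover have "(\<Sum>i\<in>UNIV. Poly_Mapping.single i (lookup m i)) = m"
    by (intro poly_mapping_eqI) (simp add: lookup_sum lookup_single when_def)
  ultimately show ?thesis by simp
qed

lemma even_keys:
  fixes E :: "('k::field_char_0, 'v::finite) mpoly"
  assumes flip: "eval_mpoly mconst E (\<lambda>j. if j = i then - mvar j else mvar j) = E" and m: "m \<in> keys E"
  shows "even (lookup m i)"
proof (rule ccontr)
  assume odd: "odd (lookup m i)"
  have "(\<Prod>j\<in>UNIV. (if j = i then - mvar j else mvar j :: ('k, 'v) mpoly) ^ lookup l j)
     = (- 1) ^ lookup l i * Poly_Mapping.single l 1" for l
  proof -
    have "(\<Prod>j\<in>UNIV. (if j = i then - mvar j else mvar j :: ('k, 'v) mpoly) ^ lookup l j)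
       = (\<Prod>j\<in>UNIV. (if j = i then (- 1) ^ lookup l i else 1) * mvar j ^ lookup l j)"
    proof (rule prod.cong[OF refl])
      fix j
      show "(if j = i then - mvar j else mvar j :: ('k, 'v) mpoly) ^ lookup l j = (if j = i then (- 1) ^ lookup l i else 1) * mvar j ^ lookup l j"
        using power_minus[of "mvar j :: ('k, 'v) mpoly" "lookup l j"] by auto
    qed
    then show ?thesis by (simp add: prod.distrib prod_mvar del: One_nat_def)
  qed
  moreover have "mconst c * ((- 1) ^ k * Poly_Mapping.single l 1) = Poly_Mapping.single l ((- 1) ^ k * c)" for c :: 'k and k and l :: "'v \<Rightarrow>\<^sub>0 nat"
    by (cases "even k") (simp_all add: mult_single single_uminus)
  ultimately have "eval_mpoly mconst E (\<lambda>j. if j = i then - mvar j else mvar j)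
     = (\<Sum>l\<in>keys E. Poly_Mapping.single l ((- 1) ^ lookup l i * lookup E l))"
    by (simp add: eval_mpoly_def)
  then have "lookup E m = (\<Sum>l\<in>keys E. lookup (Poly_Mapping.single l ((- 1) ^ lookup l i * lookup E l)) m)"
    using flip by (simp flip: lookup_sum)
  also have "\<dots> = (- 1) ^ lookup m i * lookup E m"
    using m by (simp add: lookup_single when_def)
  finally have "lookup E m = 0" using odd by simp
  then show False using m by (simp add: in_keys_iff)
qed

definition halve :: "('k::comm_ring_1, 'v) mpoly \<Rightarrow> ('k, 'v) mpoly" where
  "halve E = (\<Sum>m\<in>keys E. Poly_Mapping.single (Poly_Mapping.map (\<lambda>k. k div 2) m) (lookup E m))"

lemma eval_halve:
  fixes \<phi> :: "'k::comm_ring_1 \<Rightarrow> 'b::comm_ring_1" and E :: "('k, 'v::finite) mpoly"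
  assumes \<phi>: "ring_hom_1 \<phi>" and ev: "\<And>m i. m \<in> keys E \<Longrightarrow> even (lookup m i)"
  shows "eval_mpoly \<phi> (halve E) (\<lambda>i. x i ^ 2) = eval_mpoly \<phi> E x"
proof -
  interpret h: ring_hom_1 "\<lambda>F. eval_mpoly \<phi> F (\<lambda>i. x i ^ 2)" by (rule eval_mpoly_hom[OF \<phi>])
  show ?thesis
    unfolding halve_def h.sum eval_mpoly_single[OF \<phi>] eval_mpoly_def[of \<phi> E]
  proof (rule sum.cong[OF refl])
    fix m assume m: "m \<in> keys E"
    have "(x i ^ 2) ^ lookup (Poly_Mapping.map (\<lambda>k. k div 2) m) i = x i ^ lookup m i" for i
      using ev[OF m, of i] by (simp add: Poly_Mapping.map.rep_eq when_def flip: power_mult)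
    then show "\<phi> (lookup E m) * (\<Prod>i\<in>UNIV. (x i ^ 2) ^ lookup (Poly_Mapping.map (\<lambda>k. k div 2) m) i)
        = \<phi> (lookup E m) * (\<Prod>i\<in>UNIV. x i ^ lookup m i)" by simp
  qed
qed

definition sg :: "'v set \<Rightarrow> 'v \<Rightarrow> 'a::comm_ring_1" where "sg T i = (if i \<in> T then - 1 else 1)"

text \<open>Sign choices up to a global sign: \<open>First\<close> keeps its sign.\<close>

definition signs :: "'n::finite cone_index set set" where "signs = Pow (UNIV - {First})"

definition signed_prod :: "'n::finite cone_index set \<Rightarrow> ('k::comm_ring_1, 'n cone_index) mpoly" where
  "signed_prod S = (\<Prod>T\<in>signs. \<Sum>i\<in>S. sg T i * mvar i)"

lemma card_signs_even: "even (card (signs :: 'n::finite cone_index set set))"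
proof -
  have "Last \<in> UNIV - {First :: 'n cone_index}" by simp
  then have "card (UNIV - {First :: 'n cone_index}) > 0" by (metis card_gt_0_iff empty_iff finite)
  then show ?thesis by (simp add: signs_def card_Pow)
qed

text \<open>Flipping a coordinate other than \<open>First\<close> permutes the factors. Flipping
  \<open>First\<close>, if it occurs, permutes them up to a sign each, and their number is
  even.\<close>

lemma signed_prod_flip:
  "eval_mpoly mconst (signed_prod S :: ('k::field_char_0, 'n::finite cone_index) mpoly) (\<lambda>j. if j = i then - mvar j else mvar j) = signed_prod S"
proof -
  let ?f = "\<lambda>j. if j = i then - mvar j else mvar j :: ('k, 'n cone_index) mpoly"
  interpret h: ring_hom_1 "\<lambda>F. eval_mpoly mconst F ?f" by (rule eval_mpoly_hom[OF ring_hom_mconst])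
  have "eval_mpoly mconst (sg T j) ?f = sg T j" for T :: "'n cone_index set" and j
    by (simp add: sg_def h.uminus)
  then have E: "eval_mpoly mconst (signed_prod S) ?f = (\<Prod>T\<in>signs. \<Sum>j\<in>S. sg T j * ?f j)"
    by (simp add: signed_prod_def h.prod h.sum h.mult eval_mvar[OF ring_hom_mconst] del: One_nat_def)
  show ?thesis
  proof (cases "i = First")
    case False
    define \<tau> where "\<tau> T = (if i \<in> T then T - {i} else insert i T)" for T
    have "(\<Prod>T\<in>signs. \<Sum>j\<in>S. sg T j * ?f j) = (\<Prod>T\<in>signs. \<Sum>j\<in>S. sg (\<tau> T) j * mvar j)"
      by (intro prod.cong sum.cong refl) (auto simp: sg_def \<tau>_def)
    also have "\<dots> = signed_prod S" unfolding signed_prod_def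
      by (rule prod.reindex_bij_witness[where i = \<tau> and j = \<tau>]) (use False in \<open>auto simp: \<tau>_def signs_def\<close>)
    finally show ?thesis using E by simp
  next
    case True
    define \<tau> where "\<tau> T = UNIV - {First} - T" for T :: "'n cone_index set"
    show ?thesis
    proof (cases "First \<in> S")
      case FS: True
      have "(\<Sum>j\<in>S. sg T j * ?f j) = - (\<Sum>j\<in>S. sg (\<tau> T) j * mvar j)" if "T \<in> signs" for T
        unfolding sum_negf[symmetric]
        by (rule sum.cong[OF refl]) (use that True in \<open>auto simp: sg_def \<tau>_def signs_def\<close>)
      then have "(\<Prod>T\<in>signs. \<Sum>j\<in>S. sg T j * ?f j) = (\<Prod>T\<in>signs. (- 1) * (\<Sum>j\<in>S. sg (\<tau> T) j * mvar j))"
        by simp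
      also have "\<dots> = (\<Prod>T\<in>signs. \<Sum>j\<in>S. sg (\<tau> T) j * (mvar j :: ('k, 'n cone_index) mpoly))"
        unfolding prod.distrib using card_signs_even[where 'n = 'n] by simp
      also have "\<dots> = signed_prod S" unfolding signed_prod_def
        by (rule prod.reindex_bij_witness[where i = \<tau> and j = \<tau>]) (auto simp: \<tau>_def signs_def)
      finally show ?thesis using E by simp
    next
      case False
      have "(\<Prod>T\<in>signs. \<Sum>j\<in>S. sg T j * ?f j) = signed_prod S"
        unfolding signed_prod_def by (intro prod.cong sum.cong refl) (use False True in auto)
      then show ?thesis using E by simp
    qed
  qed
qed

text \<open>The norm of the sum of the roots of x_i over S: the product over the sign choices is
  even in each root, hence a polynomial in x. For S = \<open>UNIV\<close> it vanishes on the
  cone.\<close>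

definition norm_poly :: "'n::finite cone_index set \<Rightarrow> ('k::field_char_0, 'n cone_index) mpoly" where
  "norm_poly S = halve (signed_prod S)"

lemma eval_norm_poly:
  fixes \<phi> :: "'k::field_char_0 \<Rightarrow> 'b::comm_ring_1"
  assumes \<phi>: "ring_hom_1 \<phi>"
  shows "eval_mpoly \<phi> (norm_poly S) (\<lambda>i. u i ^ 2) = (\<Prod>T\<in>signs. \<Sum>i\<in>S. sg T i * u i)"
proof -
  interpret h: ring_hom_1 "\<lambda>F. eval_mpoly \<phi> F u" by (rule eval_mpoly_hom[OF \<phi>])
  have "eval_mpoly \<phi> (norm_poly S) (\<lambda>i. u i ^ 2) = eval_mpoly \<phi> (signed_prod S) u"
    unfolding norm_poly_def by (rule eval_halve[OF \<phi>]) (rule even_keys[OF signed_prod_flip])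
  also have "\<dots> = (\<Prod>T\<in>signs. \<Sum>i\<in>S. sg T i * u i)"
  proof -
    have "eval_mpoly \<phi> (sg T i) u = sg T i" for T :: "'a cone_index set" and i
      by (simp add: sg_def h.uminus)
    then show ?thesis by (simp add: signed_prod_def h.prod h.sum h.mult eval_mvar[OF \<phi>] del: One_nat_def)
  qed
  finally show ?thesis .
qed

subsection \<open>Generic points\<close>

text \<open>The nonempty sets of coordinates among u_0, ..., u_n, those of the chart.\<close>

definition finite_sets :: "'n::finite cone_index set set" where
  "finite_sets = Pow (UNIV - {Last}) - {{}}"

text \<open>Asking for all signed sums makes this a condition on the squares u_i^2, i.e. on the
  point of the cone (\<open>generic_vec_iff\<close>).\<close>

definition generic_vec :: "('n::finite cone_index \<Rightarrow> 'k::field_char_0) \<Rightarrow> bool" where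
  "generic_vec u \<longleftrightarrow> (\<Sum>i\<in>UNIV. u i) = 0 \<and> (\<forall>S\<in>finite_sets. \<forall>T\<in>signs. (\<Sum>i\<in>S. sg T i * u i) \<noteq> 0)"

definition disc_poly :: "('k::field_char_0, 'n::finite cone_index) mpoly" where
  "disc_poly = (\<Prod>S\<in>finite_sets. norm_poly S)"

lemma eval_disc_poly:
  assumes "ring_hom_1 \<phi>"
  shows "eval_mpoly \<phi> disc_poly (\<lambda>i. u i ^ 2) = (\<Prod>S\<in>finite_sets. \<Prod>T\<in>signs. \<Sum>i\<in>S. sg T i * u i)"
proof -
  interpret h: ring_hom_1 "\<lambda>F. eval_mpoly \<phi> F (\<lambda>i. u i ^ 2)" by (rule eval_mpoly_hom[OF assms])
  show ?thesis by (simp add: disc_poly_def h.prod eval_norm_poly[OF assms])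
qed

lemma generic_vec_iff:
  "generic_vec u \<longleftrightarrow> (\<Sum>i\<in>UNIV. u i) = 0 \<and> eval_mpoly id disc_poly (\<lambda>i. u i ^ 2) \<noteq> 0"
  by (simp add: generic_vec_def eval_disc_poly[OF ring_hom_id])

lemma generic_vec_scale: "generic_vec u \<Longrightarrow> c \<noteq> 0 \<Longrightarrow> generic_vec (\<lambda>i. c * u i)"
proof -
  assume u: "generic_vec u" and c: "c \<noteq> 0"
  have "(\<Sum>i\<in>S. sg T i * (c * u i)) = c * (\<Sum>i\<in>S. sg T i * u i)" for S T
    by (simp add: sum_distrib_left mult.left_commute)
  then show ?thesis using u c by (simp add: generic_vec_def flip: sum_distrib_left)
qed

lemma generic_vec_subset: "generic_vec u \<Longrightarrow> S \<in> finite_sets \<Longrightarrow> (\<Sum>i\<in>S. u i) \<noteq> 0"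
proof -
  assume "generic_vec u" "S \<in> finite_sets"
  then have "(\<Sum>i\<in>S. sg {} i * u i) \<noteq> 0" unfolding generic_vec_def signs_def by blast
  then show ?thesis by (simp add: sg_def)
qed

lemma generic_vec_nonzero: "generic_vec u \<Longrightarrow> u i \<noteq> 0"
proof (cases "i = Last")
  case False
  assume "generic_vec u"
  then show ?thesis using generic_vec_subset[of u "{i}"] False by (simp add: finite_sets_def)
next
  case True
  assume u: "generic_vec u"
  have "(\<Sum>i\<in>UNIV - {Last}. u i) \<noteq> 0"
    by (rule generic_vec_subset[OF u]) (auto simp: finite_sets_def intro: exI[of _ First])
  moreover have "(\<Sum>i\<in>UNIV. u i) = u Last + (\<Sum>i\<in>UNIV - {Last}. u i)" by (rule sum.remove) auto
  ultimately show ?thesis using u True by (auto simp: generic_vec_def)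
qed

text \<open>With u_i = t^(e i) for distinct exponents each signed sum is a nonzero polynomial in t,
  and some t avoids all the zeros.\<close>

lemma generic_vec_exists: "\<exists>u :: 'n::finite cone_index \<Rightarrow> 'k::field_char_0. generic_vec u"
proof -
  obtain e :: "'n cone_index \<Rightarrow> nat" where e: "inj e"
    using finite_imp_inj_to_nat_seg[of "UNIV :: 'n cone_index set"] by auto
  define g :: "'k poly" where "g = (\<Prod>S\<in>finite_sets. \<Prod>T\<in>signs. \<Sum>i\<in>S. smult (sg T i) (monom 1 (e i)))"
  have "(\<Sum>i\<in>S. smult (sg T i) (monom 1 (e i))) \<noteq> (0 :: 'k poly)" if "S \<in> finite_sets" for S and T :: "'n cone_index set"
  proof
    assume z: "(\<Sum>i\<in>S. smult (sg T i) (monom 1 (e i))) = (0 :: 'k poly)"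
    from that obtain j where j: "j \<in> S" by (auto simp: finite_sets_def)
    have "coeff (\<Sum>i\<in>S. smult (sg T i) (monom 1 (e i)) :: 'k poly) (e j) = (\<Sum>i\<in>S. if i = j then sg T j else 0)"
      unfolding coeff_sum by (rule sum.cong) (use e in \<open>auto simp: inj_def\<close>)
    then show False using z j by (auto simp: sg_def split: if_splits)
  qed
  then have "g \<noteq> 0" by (simp add: g_def)
  then obtain t where t: "poly g t \<noteq> 0" using poly_all_0_iff_0 by blast
  define u where "u i = (if i = Last then - (\<Sum>j\<in>UNIV - {Last}. t ^ e j) else t ^ e i)" for i
  have "generic_vec u"
    unfolding generic_vec_def
  proof (intro conjI ballI)
    have "(\<Sum>i\<in>UNIV. u i) = u Last + (\<Sum>i\<in>UNIV - {Last}. u i)" by (rule sum.remove) auto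
    also have "(\<Sum>i\<in>UNIV - {Last}. u i) = (\<Sum>i\<in>UNIV - {Last}. t ^ e i)" by (rule sum.cong) (auto simp: u_def)
    finally show "(\<Sum>i\<in>UNIV. u i) = 0" by (simp add: u_def)
    fix S T :: "'n cone_index set" assume S: "S \<in> finite_sets" and T: "T \<in> (signs :: 'n cone_index set set)"
    have "poly g t = (\<Prod>S\<in>finite_sets. \<Prod>T\<in>signs. \<Sum>i\<in>S. sg T i * t ^ e i)"
      by (simp add: g_def poly_prod poly_sum poly_monom)
    then have "(\<Sum>i\<in>S. sg T i * t ^ e i) \<noteq> 0" using t S T by auto
    moreover have "(\<Sum>i\<in>S. sg T i * u i) = (\<Sum>i\<in>S. sg T i * t ^ e i)"
      by (rule sum.cong) (use S in \<open>auto simp: u_def finite_sets_def\<close>)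
    ultimately show "(\<Sum>i\<in>S. sg T i * u i) \<noteq> 0" by simp
  qed
  then show ?thesis by blast
qed

text \<open>Flipping the signs in T changes the sum 0 into -2 times the sum over T. If T contains
  \<open>Last\<close>, pass to the complement.\<close>

lemma generic_vec_signs:
  assumes u: "generic_vec u" and T: "T \<in> signs" "T \<noteq> {}"
  shows "(\<Sum>i\<in>UNIV. sg T i * u i) \<noteq> 0"
proof -
  have "(\<Sum>i\<in>UNIV. sg T i * u i) = (\<Sum>i\<in>UNIV. u i - 2 * (if i \<in> T then u i else 0))"
    by (rule sum.cong) (auto simp: sg_def)
  also have "\<dots> = - 2 * (\<Sum>i\<in>T. u i)"
    using u by (simp add: sum_subtractf generic_vec_def flip: sum_distrib_left sum.inter_restrict)
  finally have eq: "(\<Sum>i\<in>UNIV. sg T i * u i) = - 2 * (\<Sum>i\<in>T. u i)" .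
  have "(\<Sum>i\<in>T. u i) \<noteq> 0"
  proof (cases "Last \<in> T")
    case False
    then show ?thesis using generic_vec_subset[OF u, of T] T by (auto simp: finite_sets_def)
  next
    case True
    have "(\<Sum>i\<in>UNIV - T. u i) \<noteq> 0"
      by (rule generic_vec_subset[OF u]) (use T True in \<open>auto simp: finite_sets_def signs_def\<close>)
    moreover have "(\<Sum>i\<in>UNIV. u i) = (\<Sum>i\<in>UNIV - T. u i) + (\<Sum>i\<in>T. u i)"
      by (rule sum.subset_diff) auto
    ultimately show ?thesis using u by (auto simp: generic_vec_def)
  qed
  then show ?thesis by (simp add: eq)
qed

subsection \<open>The cone\<close>

text \<open>Parametrizes the hyperplane of sum zero by the coordinates other than
  \<open>Last\<close>, so that statements about its points become polynomial identities.\<close>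

definition hyper :: "'n::finite cone_index \<Rightarrow> ('k::comm_ring_1, 'n cone_index) mpoly" where
  "hyper i = (if i = Last then - (\<Sum>j\<in>UNIV - {Last}. mvar j) else mvar i)"

lemma eval_hyper:
  assumes "ring_hom_1 \<phi>" "\<And>i. i \<noteq> Last \<Longrightarrow> x i = u i" "(\<Sum>i\<in>UNIV. u i) = 0"
  shows "eval_mpoly \<phi> (hyper i) x = u i"
proof -
  interpret h: ring_hom_1 "\<lambda>F. eval_mpoly \<phi> F x" by (rule eval_mpoly_hom[OF assms(1)])
  have "(\<Sum>i\<in>UNIV. u i) = u Last + (\<Sum>i\<in>UNIV - {Last}. u i)" by (rule sum.remove) auto
  then have "u Last = - (\<Sum>i\<in>UNIV - {Last}. u i)" using assms(3) by (simp add: eq_neg_iff_add_eq_0)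
  moreover have "(\<Sum>i\<in>UNIV - {Last}. x i) = (\<Sum>i\<in>UNIV - {Last}. u i)" by (rule sum.cong) (use assms(2) in auto)
  ultimately show ?thesis
    using assms(2) by (auto simp: hyper_def h.uminus h.sum eval_mvar[OF assms(1)] simp del: One_nat_def)
qed

lemma sum_eval_hyper:
  assumes "ring_hom_1 \<phi>"
  shows "(\<Sum>i\<in>UNIV. eval_mpoly \<phi> (hyper i) x) = 0"
proof -
  let ?u = "\<lambda>i. if i = Last then - (\<Sum>j\<in>UNIV - {Last}. x j) else x i"
  have "(\<Sum>i\<in>UNIV. ?u i) = ?u Last + (\<Sum>i\<in>UNIV - {Last}. ?u i)" by (rule sum.remove) auto
  also have "(\<Sum>i\<in>UNIV - {Last}. ?u i) = (\<Sum>i\<in>UNIV - {Last}. x i)" by (rule sum.cong) auto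
  finally have z: "(\<Sum>i\<in>UNIV. ?u i) = 0" by simp
  show ?thesis using eval_hyper[OF assms, of x ?u] z by simp
qed

lemma sqrt_cone_iff: "x \<in> sqrt_cone \<longleftrightarrow> (\<exists>u. (\<Sum>i\<in>UNIV. u i) = 0 \<and> (\<forall>i. x $ i = u i ^ 2))"
proof
  assume "\<exists>u. (\<Sum>i\<in>UNIV. u i) = 0 \<and> (\<forall>i. x $ i = u i ^ 2)"
  then obtain u where "(\<Sum>i\<in>UNIV. u i) = 0" "\<forall>i. x $ i = u i ^ 2" by blast
  then show "x \<in> sqrt_cone" unfolding sqrt_cone_def by (intro CollectI exI[of _ "\<chi> i. u i"]) simp
qed (auto simp: sqrt_cone_def)

lemma cone_ideal:
  fixes F :: "('a::field, 'b::finite cone_index) mpoly"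
  shows "F \<in> vanishing_ideal sqrt_cone \<longleftrightarrow> (\<forall>u. (\<Sum>i\<in>UNIV. u i) = 0 \<longrightarrow> eval_mpoly id F (\<lambda>i. u i ^ 2) = 0)"
proof
  assume F: "F \<in> vanishing_ideal sqrt_cone"
  show "\<forall>u. (\<Sum>i\<in>UNIV. u i) = 0 \<longrightarrow> eval_mpoly id F (\<lambda>i. u i ^ 2) = 0"
  proof (intro allI impI)
    fix u :: "'b cone_index \<Rightarrow> 'a" assume "(\<Sum>i\<in>UNIV. u i) = 0"
    then have "(\<chi> i. u i ^ 2) \<in> sqrt_cone" unfolding sqrt_cone_iff by (intro exI[of _ u]) simp
    then have "eval_at F (\<chi> i. u i ^ 2) = 0" using F unfolding vanishing_ideal_def by blast
    then show "eval_mpoly id F (\<lambda>i. u i ^ 2) = 0" by (simp add: vec_lambda_inverse)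
  qed
next
  assume F: "\<forall>u. (\<Sum>i\<in>UNIV. u i) = 0 \<longrightarrow> eval_mpoly id F (\<lambda>i. u i ^ 2) = 0"
  show "F \<in> vanishing_ideal sqrt_cone"
    unfolding vanishing_ideal_def
  proof (intro CollectI ballI)
    fix x :: "'a ^ 'b cone_index" assume "x \<in> sqrt_cone"
    then obtain u where u: "(\<Sum>i\<in>UNIV. u i) = 0" "\<forall>i. x $ i = u i ^ 2" unfolding sqrt_cone_iff by blast
    have "($) x = (\<lambda>i. u i ^ 2)" using u(2) by auto
    then show "eval_at F x = 0" using F u(1) by simp
  qed
qed

lemma cone_ideal_transfer:
  fixes \<phi> :: "'k::field_char_0 \<Rightarrow> 'b::comm_ring_1"
  assumes F: "F \<in> vanishing_ideal sqrt_cone" and \<phi>: "ring_hom_1 \<phi>" and u: "(\<Sum>i\<in>UNIV. u i) = 0"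
  shows "eval_mpoly \<phi> F (\<lambda>i. u i ^ 2) = 0"
proof -
  have sq: "eval_mpoly h (hyper i ^ 2) x = eval_mpoly h (hyper i) x ^ 2" if "ring_hom_1 h" for h :: "'k \<Rightarrow> 'c::comm_ring_1" and i x
    using ring_hom_1.power[OF eval_mpoly_hom[OF that]] .
  have "eval_mpoly id F (\<lambda>i. eval_mpoly id (hyper i ^ 2) x) = 0" for x
    using F sum_eval_hyper[OF ring_hom_id, of x] unfolding cone_ideal sq[OF ring_hom_id] by blast
  then have "eval_mpoly \<phi> F (\<lambda>i. eval_mpoly \<phi> (hyper i ^ 2) u) = 0"
    by (rule polynomial_identity_transfer[OF _ \<phi>])
  then show ?thesis by (simp add: sq[OF \<phi>] eval_hyper[OF \<phi> _ u])
qed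

lemma norm_poly_in_ideal: "norm_poly UNIV \<in> vanishing_ideal sqrt_cone"
proof -
  have "{} \<in> signs" by (simp add: signs_def)
  then show ?thesis
    unfolding cone_ideal eval_norm_poly[OF ring_hom_id]
    by (intro allI impI prod_zero) (auto simp: sg_def intro!: bexI[of _ "{}"])
qed

text \<open>Join u to a generic vector by a line inside the hyperplane.\<close>

lemma vanishing_generic:
  fixes F :: "('k::field_char_0, 'n::finite cone_index) mpoly"
  assumes F: "\<And>u. generic_vec u \<Longrightarrow> eval_mpoly id F (\<lambda>i. u i ^ 2) = 0" and u: "(\<Sum>i\<in>UNIV. u i) = 0"
  shows "eval_mpoly id F (\<lambda>i. u i ^ 2) = 0"
proof -
  obtain v :: "'n cone_index \<Rightarrow> 'k" where v: "generic_vec v" using generic_vec_exists by blast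
  define X where "X i = [:u i, v i - u i:] ^ 2" for i
  have X: "poly (X i) t = (u i + t * (v i - u i)) ^ 2" for i t by (simp add: X_def)
  have sum: "(\<Sum>i\<in>UNIV. u i + t * (v i - u i)) = 0" for t
    using u v by (simp add: sum.distrib sum_subtractf generic_vec_def flip: sum_distrib_left)
  have "eval_mpoly id F (\<lambda>i. poly (X i) 0) = 0"
  proof (rule vanishing_on_curve[of "eval_mpoly (\<lambda>c. [:c:]) disc_poly X"])
    have "poly (eval_mpoly (\<lambda>c. [:c:]) disc_poly X) 1 \<noteq> 0"
      using v unfolding poly_eval_mpoly X generic_vec_iff by simp
    then show "eval_mpoly (\<lambda>c. [:c:]) disc_poly X \<noteq> 0" by auto
    fix t assume "poly (eval_mpoly (\<lambda>c. [:c:]) disc_poly X) t \<noteq> 0"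
    then have "generic_vec (\<lambda>i. u i + t * (v i - u i))"
      unfolding poly_eval_mpoly X generic_vec_iff using sum by simp
    then show "eval_mpoly id F (\<lambda>i. poly (X i) t) = 0" unfolding X by (rule F)
  qed
  then show ?thesis by (simp add: X)
qed

text \<open>At u exactly the factor without sign changes vanishes, and along u + t e_i it is t. So
  the derivative is the product of the other factors, independent of i, and the gradient is
  proportional to 1/u.\<close>

lemma cone_gradient:
  fixes u :: "'n::finite cone_index \<Rightarrow> 'k::field_char_0"
  assumes u: "generic_vec u"
  obtains R where "R \<noteq> 0" "\<And>i. mpoly_pderiv_at i (norm_poly UNIV) (\<chi> j. u j ^ 2) * (2 * u i) = R"
proof -
  define R where "R = (\<Prod>T\<in>signs - {{}}. \<Sum>i\<in>UNIV. sg T i * u i)"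
  have empty: "{} \<in> (signs :: 'n cone_index set set)" by (simp add: signs_def)
  have "R \<noteq> 0" using generic_vec_signs[OF u] by (simp add: R_def)
  moreover have "mpoly_pderiv_at i (norm_poly UNIV) (\<chi> j. u j ^ 2) * (2 * u i) = R" for i
  proof -
    define X where "X j = [:u j, if j = i then 1 else 0:] ^ 2" for j
    define P where "P = (\<Prod>T\<in>signs - {{}}. \<Sum>j\<in>UNIV. sg T j * [:u j, if j = i then 1 else 0:])"
    have sgp: "poly (sg T j) t = sg T j" for T j and t :: 'k by (simp add: sg_def)
    have "eval_mpoly (\<lambda>c. [:c:]) (norm_poly UNIV) X = (\<Prod>T\<in>signs. \<Sum>j\<in>UNIV. sg T j * [:u j, if j = i then 1 else 0:])"
      unfolding X_def by (rule eval_norm_poly[OF ring_hom_poly_const])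
    also have "\<dots> = (\<Sum>j\<in>UNIV. sg {} j * [:u j, if j = i then 1 else 0:]) * P"
      unfolding P_def by (rule prod.remove) (use empty in auto)
    also have "(\<Sum>j\<in>UNIV. sg {} j * [:u j, if j = i then 1 else 0:]) = [:0, 1:]"
    proof -
      have "poly (\<Sum>j\<in>UNIV. sg {} j * [:u j, if j = i then 1 else 0:]) t = poly [:0, 1:] t" for t
        using u by (simp add: poly_sum sg_def sum.distrib generic_vec_def if_distrib[of "\<lambda>x. _ * x"] cong: if_cong)
      then show ?thesis using poly_eq_poly_eq_iff by blast
    qed
    finally have "poly (Polynomial.pderiv (eval_mpoly (\<lambda>c. [:c:]) (norm_poly UNIV) X)) 0 = poly P 0"
      by (simp add: pderiv_mult pderiv_pCons)
    also have "poly P 0 = R" by (simp add: P_def R_def poly_prod poly_sum sgp mult.commute)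
    finally have "(\<Sum>j\<in>UNIV. mpoly_pderiv_at j (norm_poly UNIV) (\<chi> j. poly (X j) 0) * poly (Polynomial.pderiv (X j)) 0) = R"
      unfolding mpoly_chain_rule .
    moreover have "poly (Polynomial.pderiv (X j)) 0 = (if j = i then 2 * u i else 0)" for j
      by (simp add: X_def power2_eq_square pderiv_mult pderiv_pCons)
    moreover have "poly (X j) 0 = u j ^ 2" for j by (simp add: X_def)
    ultimately show ?thesis by (simp add: if_distrib[of "\<lambda>x. _ * x"] cong: if_cong)
  qed
  ultimately show ?thesis using that by blast
qed

lemma cone_smooth:
  assumes u: "generic_vec u"
  shows "smooth_point sqrt_cone (\<chi> i. u i ^ 2)"
    and "w \<in> zariski_tangent_space sqrt_cone (\<chi> i. u i ^ 2) \<Longrightarrow> (\<Sum>i\<in>UNIV. (1 / u i) * w $ i) = 0"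
proof -
  let ?p = "\<chi> i. u i ^ 2"
  obtain R where R: "R \<noteq> 0" "\<And>i. mpoly_pderiv_at i (norm_poly UNIV) ?p * (2 * u i) = R"
    using cone_gradient[OF u] by metis
  have d: "mpoly_pderiv_at i (norm_poly UNIV) ?p = R / 2 * (1 / u i)" for i
    using R(2)[of i] generic_vec_nonzero[OF u, of i] by (simp add: field_simps)
  show T: "(\<Sum>i\<in>UNIV. (1 / u i) * w $ i) = 0" if "w \<in> zariski_tangent_space sqrt_cone ?p" for w
  proof -
    have "(\<Sum>i\<in>UNIV. mpoly_pderiv_at i (norm_poly UNIV) ?p * w $ i) = 0"
      using that norm_poly_in_ideal unfolding zariski_tangent_space_def by blast
    then have "R / 2 * (\<Sum>i\<in>UNIV. (1 / u i) * w $ i) = 0"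
      unfolding d sum_distrib_left by (simp add: mult.assoc)
    then show ?thesis using R(1) by simp
  qed
  have "(\<chi> i. if i = First then 1 else 0) \<notin> zariski_tangent_space sqrt_cone ?p"
  proof
    assume "(\<chi> i. if i = First then 1 else 0) \<in> zariski_tangent_space sqrt_cone ?p"
    from T[OF this] show False
      using generic_vec_nonzero[OF u, of First] by (simp add: if_distrib[of "\<lambda>x. _ * x"] cong: if_cong)
  qed
  moreover have "?p \<in> sqrt_cone" using u by (auto simp: sqrt_cone_iff generic_vec_def)
  ultimately show "smooth_point sqrt_cone ?p" by (auto simp: smooth_point_def)
qed

subsection \<open>The dual cone\<close>

text \<open>The sum of the reciprocals of the y_i with denominators cleared.\<close>

definition elem :: "('v::finite \<Rightarrow> 'a::comm_ring_1) \<Rightarrow> 'a" where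
  "elem y = (\<Sum>i\<in>UNIV. \<Prod>j\<in>UNIV - {i}. y j)"

definition dual_poly :: "('k::comm_ring_1, 'v::finite) mpoly" where
  "dual_poly = elem mvar"

lemma eval_dual_poly:
  assumes "ring_hom_1 \<phi>"
  shows "eval_mpoly \<phi> dual_poly y = elem y"
proof -
  interpret h: ring_hom_1 "\<lambda>F. eval_mpoly \<phi> F y" by (rule eval_mpoly_hom[OF assms])
  show ?thesis by (simp add: dual_poly_def elem_def h.sum h.prod eval_mvar[OF assms] del: One_nat_def)
qed

lemma elem_two_zeros: "i \<noteq> j \<Longrightarrow> y i = 0 \<Longrightarrow> y j = 0 \<Longrightarrow> elem y = 0"
  unfolding elem_def
proof (rule sum.neutral, rule ballI)
  fix l assume *: "i \<noteq> j" "y i = 0" "y j = 0"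
  show "(\<Prod>j\<in>UNIV - {l}. y j) = 0"
    by (rule prod_zero) (use * in \<open>auto intro: bexI[of _ i] bexI[of _ j]\<close>)
qed

lemma elem_nonzero: "(\<And>i. y i \<noteq> 0) \<Longrightarrow> elem y = prod y UNIV * (\<Sum>i\<in>UNIV. 1 / y i)"
  for y :: "'v::finite \<Rightarrow> 'k::field"
proof -
  assume y: "\<And>i. y i \<noteq> 0"
  have "(\<Prod>j\<in>UNIV - {i}. y j) = prod y UNIV * (1 / y i)" for i
    using prod.remove[of UNIV i y] y[of i] by simp
  then show ?thesis by (simp add: elem_def sum_distrib_left)
qed

lemma elem_inverse:
  fixes y u :: "'v::finite \<Rightarrow> 'k::field"
  assumes "\<And>i. y i * u i = c" "c \<noteq> 0" "(\<Sum>i\<in>UNIV. u i) = 0" shows "elem y = 0"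
proof -
  have nz: "y i \<noteq> 0" for i using assms(1)[of i] assms(2) by auto
  have "1 / y i = (1 / c) * u i" for i using assms(1)[of i] assms(2) nz[of i] by (simp add: field_simps)
  then show ?thesis using elem_nonzero[of y, OF nz] assms(3) by (simp flip: sum_divide_distrib)
qed

lemma elem_zero_cases:
  fixes y :: "'v::finite \<Rightarrow> 'k::field"
  assumes "elem y = 0"
  obtains "\<And>i. y i \<noteq> 0" "(\<Sum>i\<in>UNIV. 1 / y i) = 0" | i j where "i \<noteq> j" "y i = 0" "y j = 0"
proof (cases "\<exists>i. y i = 0")
  case False
  then have nz: "\<And>i. y i \<noteq> 0" by blast
  then have "prod y UNIV \<noteq> 0" by simp
  then show ?thesis using that(1) nz assms elem_nonzero[of y, OF nz] by simp
next
  case True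
  then obtain i where i: "y i = 0" by blast
  have z: "(\<Prod>j\<in>UNIV - {l}. y j) = 0" if "l \<noteq> i" for l
    by (rule prod_zero) (use that i in auto)
  have "(\<Sum>l\<in>UNIV - {i}. \<Prod>j\<in>UNIV - {l}. y j) = 0"
    by (rule sum.neutral, rule ballI, rule z) simp
  then have "elem y = (\<Prod>j\<in>UNIV - {i}. y j)"
    unfolding elem_def sum.remove[OF finite UNIV_I[of i]] by (simp only: add_0_right)
  then obtain j where "j \<in> UNIV - {i}" "y j = 0" using assms by (auto simp: prod_zero_iff)
  then show ?thesis using that(2)[of i j] i by auto
qed

definition conormals :: "('k::field ^ 'n::finite cone_index) set" where
  "conormals = {y. \<exists>p. smooth_point sqrt_cone p \<and> (\<forall>w\<in>zariski_tangent_space sqrt_cone p. (\<Sum>i\<in>UNIV. y $ i * w $ i) = 0)}"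

lemma dual_cone_conormals: "dual_cone sqrt_cone = zariski_closure conormals"
  by (simp add: dual_cone_def conormals_def)

lemma conormal_generic:
  assumes "generic_vec u" shows "(\<chi> i. 1 / u i) \<in> conormals"
  unfolding conormals_def using cone_smooth[OF assms] by auto

lemma tangent_curve:
  fixes X :: "'n::finite cone_index \<Rightarrow> 'k::field_char_0 poly"
  assumes "\<And>t. (\<chi> i. poly (X i) t) \<in> S"
  shows "(\<chi> i. poly (Polynomial.pderiv (X i)) 0) \<in> zariski_tangent_space S (\<chi> i. poly (X i) 0)"
  unfolding zariski_tangent_space_def
proof (intro CollectI ballI)
  fix F assume F: "F \<in> vanishing_ideal S"
  have "poly (eval_mpoly (\<lambda>c. [:c:]) F X) t = 0" for t
    proof -
    have "eval_at F (\<chi> i. poly (X i) t) = 0" using F assms[of t] unfolding vanishing_ideal_def by blast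
    then show ?thesis by (simp add: poly_eval_mpoly vec_lambda_inverse)
  qed
  then have "eval_mpoly (\<lambda>c. [:c:]) F X = 0" using poly_all_0_iff_0 by blast
  then have "(\<Sum>i\<in>UNIV. mpoly_pderiv_at i F (\<chi> j. poly (X j) 0) * poly (Polynomial.pderiv (X i)) 0) = 0"
    using mpoly_chain_rule[of F X 0] by simp
  then show "(\<Sum>i\<in>UNIV. mpoly_pderiv_at i F (\<chi> j. poly (X j) 0) * (\<chi> i. poly (Polynomial.pderiv (X i)) 0) $ i) = 0"
    by simp
qed

text \<open>Points with some u_i = 0 and the vertex are covered as well; the tangent vectors come
  from polynomial curves in the cone.\<close>

lemma conormals_elem:
  fixes y :: "'k::{alg_closed_field, field_char_0} ^ 'n::finite cone_index"
  assumes "y \<in> conormals" shows "elem (($) y) = 0"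
proof -
  obtain p where p: "p \<in> sqrt_cone"
    and y: "\<And>w. w \<in> zariski_tangent_space sqrt_cone p \<Longrightarrow> (\<Sum>i\<in>UNIV. y $ i * w $ i) = 0"
    using assms by (auto simp: conormals_def smooth_point_def)
  obtain u where u: "(\<Sum>i\<in>UNIV. u i) = 0" and pu: "\<And>i. p $ i = u i ^ 2" using p by (auto simp: sqrt_cone_iff)
  have single: "(\<Sum>l\<in>UNIV. x l * ((if l = i then 1 else 0) - (if l = j then 1 else 0))) = x i - (x j :: 'k)"
    for x :: "'n cone_index \<Rightarrow> 'k" and i j
    by (simp add: right_diff_distrib sum_subtractf if_distrib[of "\<lambda>z. _ * z"] cong: if_cong)
  \<comment> \<open>The curve of squares of u + t (e_i - e_j) lies in the cone.\<close>
  have eq: "y $ i * u i = y $ j * u j" for i j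
  proof -
    define a where "a l = (if l = i then 1 else 0) - (if l = j then 1 else 0 :: 'k)" for l
    define X where "X l = [:u l, a l:] ^ 2" for l
    have X: "poly (X l) t = (u l + t * a l) ^ 2" for l t by (simp add: X_def)
    have "(\<Sum>l\<in>UNIV. a l) = 0" using single[of "\<lambda>_. 1" i j] by (simp add: a_def)
    then have "(\<Sum>l\<in>UNIV. u l + t * a l) = 0" for t using u by (simp add: sum.distrib flip: sum_distrib_left)
    then have "(\<chi> l. poly (X l) t) \<in> sqrt_cone" for t
      unfolding X sqrt_cone_iff by (intro exI[of _ "\<lambda>l. u l + t * a l"]) simp
    from tangent_curve[OF this] have "(\<chi> i. poly (Polynomial.pderiv (X i)) 0) \<in> zariski_tangent_space sqrt_cone p"
      by (simp add: X flip: pu)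
    from y[OF this] have "(\<Sum>l\<in>UNIV. 2 * (y $ l * u l) * a l) = 0"
      by (simp add: X_def power2_eq_square pderiv_mult pderiv_pCons mult_ac)
    then show ?thesis unfolding a_def single by simp
  qed
  show ?thesis
  proof (cases "u = (\<lambda>_. 0)")
    case False
    then obtain i where i: "u i \<noteq> 0" by auto
    show ?thesis
    proof (cases "y $ i * u i = 0")
      case True
      have "\<exists>j. j \<noteq> i \<and> u j \<noteq> 0"
      proof (rule ccontr)
        assume "\<nexists>j. j \<noteq> i \<and> u j \<noteq> 0"
        then have "(\<Sum>j\<in>UNIV. u j) = u i" by (subst sum.remove[of UNIV i]) (auto intro!: sum.neutral)
        then show False using u i by simp
      qed
      then obtain j where j: "j \<noteq> i" "u j \<noteq> 0" by blast
      have "y $ i = 0" "y $ j = 0" using True eq[of i j] i j by auto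
      then show ?thesis using elem_two_zeros[of i j "($) y"] j by auto
    next
      case False
      show ?thesis by (rule elem_inverse[OF eq[of _ i] False u])
    qed
  next
    case True
    \<comment> \<open>At the vertex the line t (e_i + e_j) lies in the cone, since t has a square
      root.\<close>
    have add: "y $ i + y $ j = 0" if "i \<noteq> j" for i j
    proof -
      define a where "a l = (if l = i then 1 else 0) - (if l = j then 1 else 0 :: 'k)" for l
      define X where "X l = [:0, a l ^ 2:]" for l
      have X: "poly (X l) t = t * a l ^ 2" for l t by (simp add: X_def)
      have a: "(\<Sum>l\<in>UNIV. a l) = 0" using single[of "\<lambda>_. 1" i j] by (simp add: a_def)
      have "(\<chi> l. poly (X l) t) \<in> sqrt_cone" for t
      proof -
        obtain \<tau> where \<tau>: "\<tau> ^ 2 = t" using nth_root_exists[of 2 t] by auto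
        show ?thesis unfolding X sqrt_cone_iff
          by (intro exI[of _ "\<lambda>l. \<tau> * a l"]) (use a \<tau> in \<open>auto simp: power_mult_distrib simp flip: sum_distrib_left\<close>)
      qed
      from tangent_curve[OF this] have "(\<chi> i. poly (Polynomial.pderiv (X i)) 0) \<in> zariski_tangent_space sqrt_cone (\<chi> i. 0)"
        by (simp add: X)
      moreover have "p = (\<chi> i. 0)" using pu True by (simp add: vec_eq_iff)
      ultimately have "(\<Sum>l\<in>UNIV. y $ l * a l ^ 2) = 0" using y[of "\<chi> i. poly (Polynomial.pderiv (X i)) 0"]
        by (simp add: X_def pderiv_pCons)
      moreover have "a l ^ 2 = (if l = i then 1 else 0) + (if l = j then 1 else 0)" for l
        using that by (auto simp: a_def)
      ultimately show ?thesis
        by (simp add: distrib_left sum.distrib if_distrib[of "\<lambda>z. _ * z"] cong: if_cong)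
    qed
    fix m :: 'n
    \<comment> \<open>Three distinct coordinates are combined; \<open>Mid undefined\<close> stands
      for any middle one.\<close>
    have "y $ First + y $ Last = 0" "y $ First + y $ Mid undefined = 0" "y $ Mid undefined + y $ Last = 0"
      by (rule add; simp)+
    then have "2 * y $ First = 0" by (simp add: algebra_simps eq_neg_iff_add_eq_0[symmetric])
    then have "y $ First = 0" by simp
    moreover from this have "y $ Last = 0" using add[of First Last] by simp
    ultimately show ?thesis using elem_two_zeros[of First Last "($) y"] by simp
  qed
qed

text \<open>The reciprocals along a line of vectors become polynomial in t after multiplication by
  prod_j U_j(t) / P, which is 1 at t = 0; such a rescaling keeps vectors generic.\<close>

lemma vanishing_conormals_nonzero:
  fixes F :: "('k::field_char_0, 'n::finite cone_index) mpoly"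
  assumes F: "\<And>u. generic_vec u \<Longrightarrow> eval_mpoly id F (\<lambda>i. 1 / u i) = 0"
    and nz: "\<And>i. y i \<noteq> 0" and y: "(\<Sum>i\<in>UNIV. 1 / y i) = 0"
  shows "eval_mpoly id F y = 0"
proof -
  obtain v :: "'n cone_index \<Rightarrow> 'k" where v: "generic_vec v" using generic_vec_exists by blast
  define u where "u i = 1 / y i" for i
  have un: "u i \<noteq> 0" for i using nz by (simp add: u_def)
  define U where "U i = [:u i, v i - u i:]" for i
  have U: "poly (U i) t = u i + t * (v i - u i)" for i t by (simp add: U_def)
  define P where "P = prod u UNIV"
  have P: "P \<noteq> 0" using un by (simp add: P_def)
  define X where "X i = smult (1 / P) (\<Prod>j\<in>UNIV - {i}. U j)" for i
  have X: "poly (X i) t = (\<Prod>j\<in>UNIV. poly (U j) t) / P / poly (U i) t" if "poly (U i) t \<noteq> 0" for i t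
    using that prod.remove[of UNIV i "\<lambda>j. poly (U j) t"] by (simp add: X_def poly_prod)
  have sum: "(\<Sum>i\<in>UNIV. poly (U i) t) = 0" for t
    using y v by (simp add: U sum.distrib sum_subtractf generic_vec_def u_def flip: sum_distrib_left)
  let ?q = "eval_mpoly (\<lambda>c. [:c:]) disc_poly (\<lambda>i. U i ^ 2)"
  have q: "poly ?q t = eval_mpoly id disc_poly (\<lambda>i. poly (U i) t ^ 2)" for t
    unfolding poly_eval_mpoly poly_power ..
  have "eval_mpoly id F (\<lambda>i. poly (X i) 0) = 0"
  proof (rule vanishing_on_curve[of ?q])
    have "poly ?q 1 \<noteq> 0" using v unfolding q U generic_vec_iff by simp
    then show "?q \<noteq> 0" by auto
    fix t assume "poly ?q t \<noteq> 0"
    then have g: "generic_vec (\<lambda>i. poly (U i) t)"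
      unfolding q generic_vec_iff using sum by simp
    define c where "c = P / (\<Prod>j\<in>UNIV. poly (U j) t)"
    have nzt: "poly (U i) t \<noteq> 0" for i using generic_vec_nonzero[OF g] .
    then have c: "c \<noteq> 0" using P by (simp add: c_def)
    have "(\<lambda>i. poly (X i) t) = (\<lambda>i. 1 / (c * poly (U i) t))"
      by (rule ext) (use X[OF nzt] in \<open>simp add: c_def\<close>)
    then show "eval_mpoly id F (\<lambda>i. poly (X i) t) = 0" using F[OF generic_vec_scale[OF g c]] by simp
  qed
  moreover have "poly (X i) 0 = y i" for i
    using X[of i 0] un[of i] P by (simp add: U P_def u_def)
  ultimately show ?thesis by simp
qed

text \<open>A zero of \<open>elem\<close> with a zero coordinate has two of them. It is reached by a
  polynomial curve whose general point has nonzero coordinates with reciprocals summing to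
  0.\<close>

lemma vanishing_conormals:
  fixes F :: "('k::field_char_0, 'n::finite cone_index) mpoly"
  assumes F: "\<And>u. generic_vec u \<Longrightarrow> eval_mpoly id F (\<lambda>i. 1 / u i) = 0" and y: "elem y = 0"
  shows "eval_mpoly id F y = 0"
  using y
proof (cases rule: elem_zero_cases)
  case 1
  then show ?thesis using vanishing_conormals_nonzero[of F y] F by blast
next
  case (2 i j)
  define R where "R = UNIV - {i, j}"
  define Y where "Y l = [:y l, 1:]" for l
  define B where "B = (\<Prod>l\<in>R. Y l)"
  define A where "A = (\<Sum>l\<in>R. \<Prod>l'\<in>R - {l}. Y l')"
  define \<tau> :: "'k poly" where "\<tau> = [:0, 1:]"
  \<comment> \<open>With s = 1 + t A the reciprocals add up to 1/(s t B) - 1/(t B) + A/(s B) = 0,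
    where A/B is the sum of the 1/Y_l.\<close>
  define X where "X l = (if l = i then (1 + \<tau> * A) * (\<tau> * B) else if l = j then - (\<tau> * B) else (1 + \<tau> * A) * Y l)" for l
  define q where "q = (1 + \<tau> * A) * \<tau> * B"
  have "poly (1 + \<tau> * A) 0 = 1" by (simp add: \<tau>_def)
  then have "1 + \<tau> * A \<noteq> 0" by (metis poly_0 zero_neq_one)
  moreover have "Y l \<noteq> 0" for l by (simp add: Y_def)
  ultimately have q: "q \<noteq> 0" by (auto simp: q_def \<tau>_def B_def)
  have "eval_mpoly id F (\<lambda>i. poly (X i) 0) = 0"
  proof (rule vanishing_on_curve[OF q])
    fix t assume "poly q t \<noteq> 0"
    then have s: "poly (1 + \<tau> * A) t \<noteq> 0" and t: "t \<noteq> 0" and B: "poly B t \<noteq> 0" by (auto simp: q_def \<tau>_def)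
    have Y: "poly (Y l) t \<noteq> 0" if "l \<in> R" for l
      using B that by (auto simp: B_def poly_prod)
    let ?a = "poly A t" and ?s = "poly (1 + \<tau> * A) t"
    have "(\<Prod>l'\<in>R - {l}. poly (Y l') t) = poly B t * (1 / poly (Y l) t)" if "l \<in> R" for l
      using that Y[OF that] prod.remove[of R l "\<lambda>l. poly (Y l) t"] by (simp add: B_def poly_prod R_def)
    then have a: "?a = poly B t * (\<Sum>l\<in>R. 1 / poly (Y l) t)"
      by (simp add: A_def poly_sum poly_prod sum_distrib_left)
    show "eval_mpoly id F (\<lambda>i. poly (X i) t) = 0"
    proof (rule vanishing_conormals_nonzero[OF F])
      show "poly (X l) t \<noteq> 0" for l
        using s t B Y[of l] by (auto simp: X_def R_def \<tau>_def)
      have "(\<Sum>l\<in>UNIV. 1 / poly (X l) t) = 1 / poly (X i) t + (1 / poly (X j) t + (\<Sum>l\<in>R. 1 / poly (X l) t))"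
      proof -
        have "(\<Sum>l\<in>UNIV. 1 / poly (X l) t) = 1 / poly (X i) t + (\<Sum>l\<in>UNIV - {i}. 1 / poly (X l) t)"
          by (rule sum.remove) auto
        also have "(\<Sum>l\<in>UNIV - {i}. 1 / poly (X l) t) = 1 / poly (X j) t + (\<Sum>l\<in>UNIV - {i} - {j}. 1 / poly (X l) t)"
          by (rule sum.remove) (use 2 in auto)
        also have "UNIV - {i} - {j} = R" by (auto simp: R_def)
        finally show ?thesis .
      qed
      also have "(\<Sum>l\<in>R. 1 / poly (X l) t) = (\<Sum>l\<in>R. (1 / ?s) * (1 / poly (Y l) t))"
        by (rule sum.cong) (auto simp: X_def R_def)
      also have "\<dots> = (1 / ?s) * (?a / poly B t)" unfolding sum_distrib_left[symmetric] a using B by simp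
      also have "poly (X i) t = ?s * (t * poly B t)" by (simp add: X_def \<tau>_def)
      also have "poly (X j) t = - (t * poly B t)" using 2 by (simp add: X_def \<tau>_def)
      also have "1 / (?s * (t * poly B t)) + (1 / - (t * poly B t) + 1 / ?s * (?a / poly B t)) = 0"
      proof -
        have "1 / (x * (t * b)) + (1 / - (t * b) + 1 / x * (e / b)) = 0"
          if "x = 1 + t * e" "x \<noteq> 0" "b \<noteq> 0" for x b e :: 'k
        proof -
          have "1 / (x * (t * b)) + (1 / - (t * b) + 1 / x * (e / b)) = (1 - x + t * e) / (x * (t * b))"
            using that(2,3) t by (simp add: field_simps)
          then show ?thesis using that(1) by simp
        qed
        moreover have "?s = 1 + t * ?a" by (simp add: \<tau>_def)
        ultimately show ?thesis using s B by blast
      qed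
      finally show "(\<Sum>l\<in>UNIV. 1 / poly (X l) t) = 0" .
    qed
  qed
  moreover have "poly (X l) 0 = y l" for l
    using 2 by (auto simp: X_def \<tau>_def Y_def)
  ultimately show ?thesis by simp
qed

lemma dual_cone_eq: "(dual_cone sqrt_cone :: ('k::{alg_closed_field, field_char_0} ^ 'n::finite cone_index) set) = {y. elem (($) y) = 0}"
proof (intro set_eqI iffI)
  fix y :: "'k ^ 'n cone_index"
  assume "y \<in> dual_cone sqrt_cone"
  moreover have "dual_poly \<in> vanishing_ideal (conormals :: ('k ^ 'n cone_index) set)"
    by (auto simp: vanishing_ideal_def eval_dual_poly[OF ring_hom_id] conormals_elem)
  ultimately have "eval_at dual_poly y = 0" by (auto simp: dual_cone_conormals zariski_closure_def)
  then show "y \<in> {y. elem (($) y) = 0}" by (simp add: eval_dual_poly[OF ring_hom_id])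
next
  fix y :: "'k ^ 'n cone_index"
  assume y: "y \<in> {y. elem (($) y) = 0}"
  show "y \<in> dual_cone sqrt_cone"
    unfolding dual_cone_conormals zariski_closure_def
  proof (intro CollectI ballI)
    fix F :: "('k, 'n cone_index) mpoly" assume F: "F \<in> vanishing_ideal conormals"
    show "eval_at F y = 0"
    proof (rule vanishing_conormals)
      fix u :: "'n cone_index \<Rightarrow> 'k" assume "generic_vec u"
      then have "eval_at F (\<chi> i. 1 / u i) = 0" using F conormal_generic unfolding vanishing_ideal_def by blast
      then show "eval_mpoly id F (\<lambda>i. 1 / u i) = 0" by (simp add: vec_lambda_inverse)
    qed (use y in simp)
  qed
qed

text \<open>The multiples of 1/u, made polynomial by the product of the u_j, parametrize points of
  the dual cone.\<close>

lemma dual_ideal_transfer: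
  fixes \<phi> :: "'k::{alg_closed_field, field_char_0} \<Rightarrow> 'b::comm_ring_1" and F :: "('k, 'n::finite cone_index) mpoly"
  assumes F: "F \<in> vanishing_ideal (dual_cone sqrt_cone)" and \<phi>: "ring_hom_1 \<phi>" and u: "(\<Sum>i\<in>UNIV. u i) = 0"
  shows "eval_mpoly \<phi> F (\<lambda>i. s * (\<Prod>j\<in>UNIV - {i}. u j)) = 0"
proof -
  \<comment> \<open>\<open>hyper\<close> does not read the variable \<open>Last\<close>, which is
    thus free to carry the scale s.\<close>
  define Y :: "'n cone_index \<Rightarrow> ('k, 'n cone_index) mpoly" where "Y i = mvar Last * (\<Prod>j\<in>UNIV - {i}. hyper j)" for i :: "'n cone_index"
  have Y: "eval_mpoly h (Y i) x = x Last * (\<Prod>j\<in>UNIV - {i}. eval_mpoly h (hyper j) x)"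
    if "ring_hom_1 h" for h :: "'k \<Rightarrow> 'c::comm_ring_1" and i x
  proof -
    interpret h: ring_hom_1 "\<lambda>F. eval_mpoly h F x" by (rule eval_mpoly_hom[OF that])
    show ?thesis by (simp add: Y_def h.mult h.prod eval_mvar[OF that] del: One_nat_def)
  qed
  have "eval_mpoly id F (\<lambda>i. eval_mpoly id (Y i) x) = 0" for x
  proof -
    define v where "v i = eval_mpoly id (hyper i) x" for i
    define y where "y i = eval_mpoly id (Y i) x" for i
    have y: "y i = x Last * (\<Prod>j\<in>UNIV - {i}. v j)" for i by (simp add: y_def v_def Y[OF ring_hom_id])
    have sv: "(\<Sum>i\<in>UNIV. v i) = 0" unfolding v_def by (rule sum_eval_hyper[OF ring_hom_id])
    have "elem y = 0"
    proof (cases "x Last * prod v UNIV = 0")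
      case False
      have "y i * v i = x Last * prod v UNIV" for i
        using prod.remove[of UNIV i v] by (simp add: y mult_ac)
      then show ?thesis using elem_inverse[OF _ False sv] by blast
    next
      case True
      have "\<exists>a. \<forall>i. i \<noteq> a \<longrightarrow> y i = 0"
      proof (cases "x Last = 0")
        case False
        then obtain a where a: "v a = 0" using True by (auto simp: prod_zero_iff)
        have "y i = 0" if "i \<noteq> a" for i
          unfolding y using prod_zero[of "UNIV - {i}" v] a that by auto
        then show ?thesis by blast
      qed (auto simp: y)
      then obtain a where a: "\<And>i. i \<noteq> a \<Longrightarrow> y i = 0" by blast
      obtain i j where "i \<noteq> j" "i \<noteq> a" "j \<noteq> a" using that by (cases a) (metis cone_index.distinct)+
      then show ?thesis using elem_two_zeros[of i j y] a by auto
    qed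
    then have "(\<chi> i. y i) \<in> dual_cone sqrt_cone" unfolding dual_cone_eq by (simp add: vec_lambda_inverse)
    then have "eval_at F (\<chi> i. y i) = 0" using F unfolding vanishing_ideal_def by blast
    then show ?thesis by (simp add: vec_lambda_inverse y_def)
  qed
  from polynomial_identity_transfer[OF this \<phi>, of "u(Last := s)"]
  show ?thesis by (simp add: Y[OF \<phi>] eval_hyper[OF \<phi> _ u])
qed

subsection \<open>Exceptional loci\<close>

lemma zero_locus_closed: "zariski_closure {x. eval_at F x = 0} = {x. eval_at F x = 0}"
proof
  have "F \<in> vanishing_ideal {x. eval_at F x = 0}" by (simp add: vanishing_ideal_def)
  then show "zariski_closure {x. eval_at F x = 0} \<subseteq> {x. eval_at F x = 0}" by (auto simp: zariski_closure_def)
qed (auto simp: zariski_closure_def vanishing_ideal_def)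

lemma cone_generically:
  assumes "\<And>u :: 'n::finite cone_index \<Rightarrow> 'k::field_char_0. generic_vec u \<Longrightarrow> P (\<chi> i. u i ^ 2)"
  shows "generically_on sqrt_cone P"
  unfolding generically_on_def
proof (intro conjI exI[of _ "{x. eval_at disc_poly x = 0}"])
  have "(\<chi> i. 0) \<in> (sqrt_cone :: ('k ^ 'n cone_index) set)" unfolding sqrt_cone_iff by (intro exI[of _ "\<lambda>_. 0"]) simp
  then show "sqrt_cone \<noteq> ({} :: ('k ^ 'n cone_index) set)" by blast
  let ?Z = "{x :: 'k ^ 'n cone_index. eval_at disc_poly x = 0}"
  have sq: "($) x = (\<lambda>i. u i ^ 2)" if "\<And>i. x $ i = u i ^ 2" for x :: "'k ^ 'n cone_index" and u
    using that by auto
  show "\<forall>p\<in>sqrt_cone - ?Z. P p"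
  proof
    fix p assume p: "p \<in> sqrt_cone - ?Z"
    then obtain u where u: "(\<Sum>i\<in>UNIV. u i) = 0" "\<And>i. p $ i = u i ^ 2" by (auto simp: sqrt_cone_iff)
    then have "generic_vec u" using p sq[OF u(2)] by (simp add: generic_vec_iff)
    moreover have "p = (\<chi> i. u i ^ 2)" using u by (simp add: vec_eq_iff)
    ultimately show "P p" using assms by simp
  qed
  show "sqrt_cone \<subseteq> zariski_closure (sqrt_cone - ?Z)"
  proof
    fix x :: "'k ^ 'n cone_index" assume "x \<in> sqrt_cone"
    then obtain u where u: "(\<Sum>i\<in>UNIV. u i) = 0" "\<And>i. x $ i = u i ^ 2" by (auto simp: sqrt_cone_iff)
    show "x \<in> zariski_closure (sqrt_cone - ?Z)"
      unfolding zariski_closure_def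
    proof (intro CollectI ballI)
      fix F :: "('k, 'n cone_index) mpoly" assume F: "F \<in> vanishing_ideal (sqrt_cone - ?Z)"
      have "eval_mpoly id F (\<lambda>i. v i ^ 2) = 0" if v: "generic_vec v" for v
      proof -
        have "(\<chi> i. v i ^ 2) \<in> sqrt_cone - ?Z"
          using v by (auto simp: sqrt_cone_iff generic_vec_iff vec_lambda_inverse)
        then have "eval_at F (\<chi> i. v i ^ 2) = 0" using F unfolding vanishing_ideal_def by blast
        then show ?thesis by (simp add: vec_lambda_inverse)
      qed
      from vanishing_generic[OF this u(1)] show "eval_at F x = 0" using sq[OF u(2)] by simp
    qed
  qed
qed (rule zero_locus_closed)

text \<open>Clears denominators in the condition that no y_i and no sum of 1/y_i over a member of
  \<open>finite_sets\<close> is zero.\<close>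

definition dual_disc :: "('k::comm_ring_1, 'n::finite cone_index) mpoly" where
  "dual_disc = prod mvar UNIV * (\<Prod>S\<in>finite_sets. \<Sum>i\<in>S. \<Prod>j\<in>S - {i}. mvar j)"

lemma eval_dual_disc:
  assumes "ring_hom_1 \<phi>"
  shows "eval_mpoly \<phi> (dual_disc :: ('k::comm_ring_1, 'n::finite cone_index) mpoly) y
     = prod y UNIV * (\<Prod>S\<in>finite_sets. \<Sum>i\<in>S. \<Prod>j\<in>S - {i}. y j)"
proof -
  interpret h: ring_hom_1 "\<lambda>F. eval_mpoly \<phi> F y" by (rule eval_mpoly_hom[OF assms])
  show ?thesis by (simp add: dual_disc_def h.mult h.sum h.prod eval_mvar[OF assms] del: One_nat_def)
qed

lemma eval_dual_disc_nonzero: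
  fixes y :: "'n::finite cone_index \<Rightarrow> 'k::field"
  shows "eval_mpoly id dual_disc y \<noteq> 0 \<longleftrightarrow> (\<forall>i. y i \<noteq> 0) \<and> (\<forall>S\<in>finite_sets. (\<Sum>i\<in>S. 1 / y i) \<noteq> 0)"
proof (cases "\<forall>i. y i \<noteq> 0")
  case True
  have "(\<Sum>i\<in>S. \<Prod>j\<in>S - {i}. y j) = prod y S * (\<Sum>i\<in>S. 1 / y i)" for S
  proof -
    have "(\<Prod>j\<in>S - {i}. y j) = prod y S * (1 / y i)" if "i \<in> S" for i
      using prod.remove[of S i y] that True finite_subset[of S UNIV] by simp
    then show ?thesis by (simp add: sum_distrib_left)
  qed
  then show ?thesis using True by (simp add: eval_dual_disc[OF ring_hom_id])
next
  case False
  then have "prod y UNIV = 0" by (simp add: prod_zero_iff)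
  then show ?thesis using False by (simp add: eval_dual_disc[OF ring_hom_id])
qed

lemma dual_cone_generically:
  assumes "\<And>y :: 'k::{alg_closed_field, field_char_0} ^ 'n::finite cone_index. (\<And>i. y $ i \<noteq> 0) \<Longrightarrow> (\<Sum>i\<in>UNIV. 1 / y $ i) = 0 \<Longrightarrow>
     (\<And>S. S \<in> finite_sets \<Longrightarrow> (\<Sum>i\<in>S. 1 / y $ i) \<noteq> 0) \<Longrightarrow> P y"
  shows "generically_on (dual_cone sqrt_cone) P"
  unfolding generically_on_def
proof (intro conjI exI[of _ "{x. eval_at dual_disc x = 0}"])
  let ?D = "dual_cone sqrt_cone :: ('k ^ 'n cone_index) set"
  let ?Z = "{x :: 'k ^ 'n cone_index. eval_at dual_disc x = 0}"
  have "0 \<in> ?D" unfolding dual_cone_eq using elem_two_zeros[of First Last "($) 0"] by simp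
  then show "?D \<noteq> {}" by blast
  show "\<forall>p\<in>?D - ?Z. P p"
  proof
    fix y assume y: "y \<in> ?D - ?Z"
    then have nz: "\<forall>i. y $ i \<noteq> 0" "\<forall>S\<in>finite_sets. (\<Sum>i\<in>S. 1 / y $ i) \<noteq> 0"
      using eval_dual_disc_nonzero[of "($) y"] by auto
    moreover have "(\<Sum>i\<in>UNIV. 1 / y $ i) = 0"
      using y nz elem_nonzero[of "($) y"] by (auto simp: dual_cone_eq)
    ultimately show "P y" by (intro assms) auto
  qed
  show "?D \<subseteq> zariski_closure (?D - ?Z)"
  proof
    fix y assume y: "y \<in> ?D"
    show "y \<in> zariski_closure (?D - ?Z)"
      unfolding zariski_closure_def
    proof (intro CollectI ballI)
      fix F :: "('k, 'n cone_index) mpoly" assume F: "F \<in> vanishing_ideal (?D - ?Z)"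
      show "eval_at F y = 0"
      proof (rule vanishing_conormals)
        fix u :: "'n cone_index \<Rightarrow> 'k" assume u: "generic_vec u"
        have "elem (\<lambda>i. 1 / u i) = 0"
          using u generic_vec_nonzero[OF u] by (subst elem_nonzero) (auto simp: generic_vec_def)
        moreover have "eval_mpoly id dual_disc (\<lambda>i. 1 / u i) \<noteq> 0"
          unfolding eval_dual_disc_nonzero using generic_vec_nonzero[OF u] generic_vec_subset[OF u] by simp
        ultimately have "(\<chi> i. 1 / u i) \<in> ?D - ?Z" by (simp add: dual_cone_eq vec_lambda_inverse)
        then have "eval_at F (\<chi> i. 1 / u i) = 0" using F unfolding vanishing_ideal_def by blast
        then show "eval_mpoly id F (\<lambda>i. 1 / u i) = 0" by (simp add: vec_lambda_inverse)
      qed (use y in \<open>simp add: dual_cone_eq\<close>)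
    qed
  qed
qed (rule zero_locus_closed)

lemma dual_cone_smooth:
  fixes y :: "'k::{alg_closed_field, field_char_0} ^ 'n::finite cone_index"
  assumes nz: "\<And>i. y $ i \<noteq> 0" and y: "(\<Sum>i\<in>UNIV. 1 / y $ i) = 0"
  shows "smooth_point (dual_cone sqrt_cone) y"
proof -
  let ?D = "dual_cone sqrt_cone :: ('k ^ 'n cone_index) set"
  have yD: "y \<in> ?D" using elem_nonzero[of "($) y"] nz y by (simp add: dual_cone_eq)
  define X where "X j = [:y $ j, if j = First then 1 else 0:]" for j
  define P where "P = (\<Prod>j\<in>UNIV - {First}. y $ j)"
  have "mpoly_pderiv_at First dual_poly y = - P / y $ First"
  proof -
    have "eval_mpoly (\<lambda>c. [:c:]) dual_poly X = [:elem (($) y), - P / y $ First:]"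
    proof -
      have "poly (elem X) t = poly [:elem (($) y), - P / y $ First:] t" for t
      proof -
        have 1: "(\<Prod>j\<in>UNIV - {First}. poly (X j) t) = P"
          unfolding P_def by (rule prod.cong) (auto simp: X_def)
        have 2: "(\<Prod>j\<in>UNIV - {i}. poly (X j) t) = (y $ First + t) * P * (1 / y $ i)" if "i \<noteq> First" for i
        proof -
          have "(\<Prod>j\<in>UNIV - {i}. poly (X j) t) = poly (X First) t * (\<Prod>j\<in>UNIV - {i} - {First}. poly (X j) t)"
            by (rule prod.remove) (use that in auto)
          also have "(\<Prod>j\<in>UNIV - {i} - {First}. poly (X j) t) = (\<Prod>j\<in>UNIV - {First} - {i}. y $ j)"
            by (rule prod.cong) (auto simp: X_def)
          also have "\<dots> = P * (1 / y $ i)"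
            using prod.remove[of "UNIV - {First}" i "($) y"] nz[of i] that by (simp add: P_def)
          finally show ?thesis by (simp add: X_def)
        qed
        have r: "(\<Sum>i\<in>UNIV - {First}. 1 / y $ i) = - (1 / y $ First)"
          using y sum.remove[of UNIV First "\<lambda>i. 1 / y $ i"] by (simp add: eq_neg_iff_add_eq_0 add.commute)
        have "poly (elem X) t = P + (\<Sum>i\<in>UNIV - {First}. (y $ First + t) * P * (1 / y $ i))"
          unfolding elem_def poly_sum poly_prod by (subst sum.remove[of UNIV First]) (simp_all add: 1 2)
        also have "\<dots> = P + (y $ First + t) * P * (- (1 / y $ First))"
          unfolding sum_distrib_left[symmetric] r ..
        also have "\<dots> = t * (- P / y $ First)" using nz[of First] by (simp add: field_simps)
        also have "elem (($) y) = 0" using yD by (simp add: dual_cone_eq)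
        ultimately show ?thesis using \<open>elem (($) y) = 0\<close> by simp
      qed
      then show ?thesis using poly_eq_poly_eq_iff unfolding eval_dual_poly[OF ring_hom_poly_const] by blast
    qed
    then have "(\<Sum>i\<in>UNIV. mpoly_pderiv_at i dual_poly (\<chi> j. poly (X j) 0) * poly (Polynomial.pderiv (X i)) 0) = - P / y $ First"
      unfolding mpoly_chain_rule[symmetric] by (simp add: pderiv_pCons)
    moreover have "(\<chi> j. poly (X j) 0) = y" by (simp add: X_def vec_eq_iff)
    moreover have "poly (Polynomial.pderiv (X i)) 0 = (if i = First then 1 else 0)" for i
      by (simp add: X_def pderiv_pCons)
    ultimately show ?thesis by (simp add: if_distrib[of "\<lambda>x. _ * x"] cong: if_cong)
  qed
  moreover have "P \<noteq> 0" using nz by (simp add: P_def)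
  ultimately have d: "mpoly_pderiv_at First dual_poly y \<noteq> 0" using nz by simp
  have "dual_poly \<in> vanishing_ideal ?D"
    by (simp add: vanishing_ideal_def dual_cone_eq eval_dual_poly[OF ring_hom_id])
  then have "(\<chi> i. if i = First then 1 else 0) \<notin> zariski_tangent_space ?D y"
    using d by (auto simp: zariski_tangent_space_def if_distrib[of "\<lambda>x. _ * x"] cong: if_cong intro!: bexI[of _ dual_poly])
  then show ?thesis using yD by (auto simp: smooth_point_def)
qed

section \<open>The space of amplitudes\<close>

text \<open>After normalization of the constant term, 1 - z is a root of 1 - h if z = (h + z^2) / 2;
  the iteration gains one order per step.\<close>

lemma mps_sqrt_exists:
  fixes x :: "('k::field_char_0, 'n::finite) mps"
  assumes "eval0_mps x = c ^ 2" "c \<noteq> 0"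
  obtains y where "y ^ 2 = x" "eval0_mps y = c"
proof -
  define h where "h = 1 - const_mps (1 / c ^ 2) * x"
  have h0: "eval0_mps h = 0" using assms by (simp add: h_def)
  define z where "z N = ((\<lambda>z. const_mps (1 / 2) * (h + z ^ 2)) ^^ N) 0" for N
  have z: "z 0 = 0" "z (Suc N) = const_mps (1 / 2) * (h + z N ^ 2)" for N by (simp_all add: z_def)
  have one_iff: "vanishes_to 1 X \<longleftrightarrow> eval0_mps X = 0" for X :: "('k, 'n) mps"
    by (auto simp: vanishes_to_def mdeg_eq_0_iff)
  have scal: "vanishes_to p (const_mps c * X)" if "vanishes_to p X" for p c and X :: "('k, 'n) mps"
    using that by (simp add: vanishes_to_def)
  have z0: "eval0_mps (z N) = 0" for N by (induction N) (simp_all add: z h0)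
  have d: "vanishes_to (Suc p) (z (Suc p) - z p)" for p
  proof (induction p)
    case 0
    have "eval0_mps (z (Suc 0) - z 0) = 0" using z0 by simp
    then show ?case using one_iff by simp
  next
    case (Suc p)
    have "z (Suc (Suc p)) - z (Suc p) = const_mps (1 / 2) * ((z (Suc p) - z p) * (z (Suc p) + z p))"
      unfolding z(2)[of "Suc p"] z(2)[of p] right_diff_distrib[symmetric]
      by (simp add: power2_eq_square algebra_simps)
    moreover have "vanishes_to (Suc p + 1) ((z (Suc p) - z p) * (z (Suc p) + z p))"
      by (intro vanishes_to_mult Suc one_iff[THEN iffD2]) (simp add: z0)
    ultimately show ?case using scal by simp
  qed
  have v: "vanishes_to p (z (Suc p) - z p)" for p using vanishes_to_mono[OF d[of p], of p] by simp
  have "\<exists>q. \<forall>P. vanishes_to P (q - (\<Sum>p<P. z (Suc p) - z p))"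
    by (rule mps_limit[of "\<lambda>p. z (Suc p) - z p", OF v]) blast
  then obtain q where "\<forall>P. vanishes_to P (q - (\<Sum>p<P. z (Suc p) - z p))" ..
  then have q: "vanishes_to P (q - z P)" for P by (simp add: sum_lessThan_telescope z(1))
  have q0: "eval0_mps q = 0" using q[of 1] one_iff[of "q - z 1"] z0[of 1] by simp
  have "q - const_mps (1 / 2) * (h + q ^ 2) = 0"
  proof (rule vanishes_to_all_imp_0)
    fix P
    have "q - const_mps (1 / 2) * (h + q ^ 2) = (q - z (Suc P)) + const_mps (- 1 / 2) * ((q - z P) * (q + z P))"
      by (simp add: z power2_eq_square algebra_simps const_mps_uminus)
    moreover have "vanishes_to P (q - z (Suc P))" by (rule vanishes_to_mono[OF q]) simp
    moreover have "vanishes_to (P + 0) ((q - z P) * (q + z P))"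
      by (intro vanishes_to_mult q vanishes_to_0)
    ultimately show "vanishes_to P (q - const_mps (1 / 2) * (h + q ^ 2))"
      by (simp only: vanishes_to_add scal add_0_right)
  qed
  then have "2 * q = 2 * (const_mps (1 / 2) * (h + q ^ 2))" by simp
  also have "\<dots> = h + q ^ 2"
    using const_mps_inverse_of_nat[of 2, where 'a = 'k and 'b = 'n] by (simp add: mult.assoc[symmetric])
  finally have "(1 - q) ^ 2 = 1 - h" by (simp add: power2_eq_square algebra_simps)
  then have "(const_mps c * (1 - q)) ^ 2 = const_mps (c ^ 2) * (const_mps (1 / c ^ 2) * x)"
    by (simp add: power_mult_distrib h_def const_mps_power)
  also have "\<dots> = x" using assms(2) by (simp add: mult.assoc[symmetric] flip: const_mps_mult)
  finally show ?thesis using that[of "const_mps c * (1 - q)"] q0 by simp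
qed

text \<open>Over the fraction field one-sided inverses of square matrices are two-sided.\<close>

lemma mps_inverse_commute:
  fixes A B :: "'n::finite \<Rightarrow> 'n \<Rightarrow> ('k::field_char_0, 'm::finite) mps"
  assumes "\<And>i l. (\<Sum>j\<in>UNIV. A i j * B j l) = (if i = l then 1 else 0)"
  shows "(\<Sum>j\<in>UNIV. B i j * A j l) = (if i = l then 1 else 0)"
proof -
  interpret \<mu>: ring_hom_1 "to_merom :: ('k, 'm) mps \<Rightarrow> _" by (rule to_merom_hom)
  let ?A = "\<chi> i j. to_merom (A i j)" and ?B = "\<chi> i j. to_merom (B i j)"
  have AB: "(\<Sum>j\<in>UNIV. to_merom (X i j) * to_merom (Y j l)) = to_merom (\<Sum>j\<in>UNIV. X i j * Y j l)"
    for X Y :: "'n \<Rightarrow> 'n \<Rightarrow> ('k, 'm) mps" and i l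
    by (simp only: \<mu>.sum \<mu>.mult)
  have "(?A ** ?B) $ i $ l = (mat 1 :: ('k, 'm) merom ^ 'n ^ 'n) $ i $ l" for i l
    unfolding matrix_matrix_mult_def mat_def vec_lambda_beta AB assms
    by (cases "i = l") (simp_all only: simp_thms if_True if_False \<mu>.one \<mu>.zero)
  then have "?A ** ?B = mat 1" by (simp only: vec_eq_iff) simp
  then have "?B ** ?A = mat 1" by (simp only: matrix_left_right_inverse)
  then have "(?B ** ?A) $ i $ l = (if i = l then 1 else 0)" by (simp add: mat_def)
  then have "to_merom (\<Sum>j\<in>UNIV. B i j * A j l) = (if i = l then 1 else 0)"
    unfolding matrix_matrix_mult_def vec_lambda_beta AB .
  then have "to_merom ((\<Sum>j\<in>UNIV. B i j * A j l) - (if i = l then 1 else 0)) = 0"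
    by (cases "i = l") (simp_all only: simp_thms if_True if_False \<mu>.diff \<mu>.one \<mu>.zero diff_self)
  then have "(\<Sum>j\<in>UNIV. B i j * A j l) - (if i = l then 1 else 0) = 0" by (rule to_merom_eq_0_iff[THEN iffD1])
  then show ?thesis by (simp only: right_minus_eq)
qed

text \<open>The functionals form one linear map, injective on V, into the polynomials of degree
  below N, which serve as a model space of dimension N.\<close>

lemma (in vector_space) card_le_functionals:
  assumes "length \<Psi> = N"
    and lin: "\<And>\<psi> x y. \<psi> \<in> set \<Psi> \<Longrightarrow> \<psi> (x + y) = \<psi> x + \<psi> y" "\<And>\<psi> c x. \<psi> \<in> set \<Psi> \<Longrightarrow> \<psi> (scale c x) = c * \<psi> x"
    and inj: "\<And>x. x \<in> V \<Longrightarrow> \<forall>\<psi>\<in>set \<Psi>. \<psi> x = 0 \<Longrightarrow> x = 0"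
    and V: "subspace V" and B: "B \<subseteq> V" "independent B"
  shows "finite B \<and> card B \<le> N"
proof -
  interpret P: vector_space "smult :: 'a \<Rightarrow> 'a poly \<Rightarrow> 'a poly"
    by standard (simp_all add: smult_add_left smult_add_right)
  interpret VP: vector_space_pair scale "smult :: 'a \<Rightarrow> 'a poly \<Rightarrow> 'a poly" ..
  define \<Phi> where "\<Phi> x = (\<Sum>j<N. monom ((\<Psi> ! j) x) j)" for x
  have mem: "\<Psi> ! j \<in> set \<Psi>" if "j < N" for j using that assms(1) by simp
  have coeff: "coeff (\<Phi> x) j = (\<Psi> ! j) x" if "j < N" for x j
    using that by (simp add: \<Phi>_def coeff_sum)
  have linear: "Vector_Spaces.linear scale smult \<Phi>"
    unfolding Vector_Spaces.linear_iff
  proof (intro conjI allI)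
    show "vector_space scale" "vector_space (smult :: 'a \<Rightarrow> 'a poly \<Rightarrow> 'a poly)"
      by (rule vector_space_axioms P.vector_space_axioms)+
    show "\<Phi> (x + y) = \<Phi> x + \<Phi> y" for x y
      using lin(1)[OF mem] by (simp add: \<Phi>_def add_monom flip: sum.distrib)
    show "\<Phi> (scale c x) = smult c (\<Phi> x)" for c x
    proof -
      have "smult c (sum f A) = (\<Sum>i\<in>A. smult c (f i))" for f :: "nat \<Rightarrow> 'a poly" and A
        by (induction A rule: infinite_finite_induct) (simp_all add: smult_add_right)
      then show ?thesis using lin(2)[OF mem] by (simp add: \<Phi>_def smult_monom)
    qed
  qed
  have "inj_on \<Phi> (span B)"
  proof (rule inj_onI)
    fix x y assume xy: "x \<in> span B" "y \<in> span B" "\<Phi> x = \<Phi> y"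
    have "x - y \<in> V" using span_diff[OF xy(1,2)] span_minimal[OF B(1) V] by blast
    moreover have "\<psi> (x - y) = 0" if \<psi>: "\<psi> \<in> set \<Psi>" for \<psi>
    proof -
      obtain j where j: "j < N" "\<psi> = \<Psi> ! j" using \<psi> assms(1) by (auto simp: in_set_conv_nth)
      have "\<psi> x = \<psi> y" using coeff[OF j(1), of x] coeff[OF j(1), of y] xy(3) j(2) by simp
      moreover have "\<psi> x = \<psi> (x - y) + \<psi> y" using lin(1)[OF \<psi>, of "x - y" y] by simp
      ultimately show ?thesis by simp
    qed
    ultimately show "x = y" using inj by (metis right_minus_eq)
  qed
  then have "P.independent (\<Phi> ` B)" using VP.linear_independent_injective_image[OF linear B(2)] by blast
  moreover have "\<Phi> ` B \<subseteq> P.span ((\<lambda>j. monom 1 j) ` {..<N})"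
  proof
    fix p assume "p \<in> \<Phi> ` B"
    then obtain x where x: "p = (\<Sum>j<N. monom ((\<Psi> ! j) x) j)" by (auto simp: \<Phi>_def)
    have "monom a j = smult a (monom 1 j)" for a :: 'a and j by (simp add: smult_monom)
    then show "p \<in> P.span ((\<lambda>j. monom 1 j) ` {..<N})"
      unfolding x by (metis (no_types, lifting) P.span_base P.span_scale P.span_sum imageI)
  qed
  ultimately have "finite (\<Phi> ` B) \<and> card (\<Phi> ` B) \<le> card ((\<lambda>j. monom 1 j :: 'a poly) ` {..<N})"
    by (intro P.independent_span_bound) simp_all
  moreover have "card ((\<lambda>j. monom 1 j :: 'a poly) ` {..<N}) \<le> N"
    using card_image_le[of "{..<N}" "\<lambda>j. monom 1 j :: 'a poly"] by simp
  moreover have "inj_on \<Phi> B" using \<open>inj_on \<Phi> (span B)\<close> by (rule inj_on_subset) (rule span_superset)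
  ultimately show ?thesis using finite_imageD card_image[of \<Phi> B] by fastforce
qed

lemma (in vector_space) dim_from_functionals:
  assumes "length \<Psi> = N"
    and "\<And>\<psi> x y. \<psi> \<in> set \<Psi> \<Longrightarrow> \<psi> (x + y) = \<psi> x + \<psi> y" "\<And>\<psi> c x. \<psi> \<in> set \<Psi> \<Longrightarrow> \<psi> (scale c x) = c * \<psi> x"
    and "\<And>x. x \<in> V \<Longrightarrow> \<forall>\<psi>\<in>set \<Psi>. \<psi> x = 0 \<Longrightarrow> x = 0"
    and V: "subspace V" and I: "finite I" "card I = N" "\<And>i. i \<in> I \<Longrightarrow> e i \<in> V"
    and indep: "\<And>a i. (\<Sum>i\<in>I. scale (a i) (e i)) = 0 \<Longrightarrow> i \<in> I \<Longrightarrow> a i = 0"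
  shows "(\<exists>B. finite B \<and> span B = V) \<and> dim V = N"
proof -
  obtain B where B: "B \<subseteq> V" "independent B" "V \<subseteq> span B" using maximal_independent_subset by blast
  have "finite B \<and> card B \<le> N" by (rule card_le_functionals[OF assms(1-5) B(1,2)])
  then have fin: "finite B" "card B \<le> N" by simp_all
  have inj: "inj_on e I"
  proof (rule inj_onI, rule ccontr)
    fix i j assume ij: "i \<in> I" "j \<in> I" "e i = e j" "i \<noteq> j"
    let ?a = "\<lambda>l. if l = i then 1 else if l = j then - 1 else (0 :: 'a)"
    have "(\<Sum>l\<in>I. scale (?a l) (e l)) = scale (?a i) (e i) + (scale (?a j) (e j) + (\<Sum>l\<in>I - {i} - {j}. scale (?a l) (e l)))"
      using ij I(1) by (subst sum.remove[of I i], simp_all, subst sum.remove[of "I - {i}" j]) auto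
    also have "(\<Sum>l\<in>I - {i} - {j}. scale (?a l) (e l)) = 0" by (rule sum.neutral) auto
    finally have "?a i = 0" using ij by (intro indep[of ?a]) simp_all
    then show False by simp
  qed
  have "independent (e ` I)"
    unfolding independent_explicit_finite_subsets
  proof (intro allI impI ballI)
    fix A u v assume A: "A \<subseteq> e ` I" "finite A" "(\<Sum>v\<in>A. scale (u v) v) = 0" "v \<in> A"
    let ?a = "\<lambda>i. if e i \<in> A then u (e i) else 0"
    obtain i where i: "i \<in> I" "v = e i" using A by blast
    have "(\<Sum>i\<in>I. scale (?a i) (e i)) = (\<Sum>w\<in>e ` I. scale (if w \<in> A then u w else 0) w)"
      by (simp add: sum.reindex[OF inj])
    also have "\<dots> = (\<Sum>w\<in>A. scale (if w \<in> A then u w else 0) w)"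
      by (rule sum.mono_neutral_right) (use A I in auto)
    also have "\<dots> = (\<Sum>v\<in>A. scale (u v) v)" by (rule sum.cong) auto
    finally have "?a i = 0" using A by (intro indep[OF _ i(1)]) simp
    then show "u v = 0" using A i by simp
  qed
  moreover have "e ` I \<subseteq> span B" using I(3) B(3) by blast
  ultimately have "card (e ` I) \<le> card B" using independent_span_bound[OF fin(1)] by blast
  then have "card B = N" using fin(2) I(2) card_image[OF inj] by simp
  moreover have span: "span B = V" by (rule span_subspace[OF B(1,3) V])
  moreover have "span V = V" using span_eq_iff V by blast
  ultimately show ?thesis using fin(1) span dim_eq_card[OF _ B(2), of V] by metis
qed

lemma (in germ_class) amp_of_mem:
  assumes "cone_phase w winv r rinv \<kappa> \<kappa>inv c J" and w: "\<And>l. w l \<in> \<G>" and r: "r \<in> \<G>" and xs: "xs \<in> orderings"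
  shows "cone_phase.amp_of w r xs \<in> \<G>"
proof -
  interpret cone_phase w winv r rinv \<kappa> \<kappa>inv c J by fact
  have "eval0_mps (wy.qf rS xs) \<in> \<G>" for xs
  proof (induction xs)
    case (Cons x xs)
    have "ri (set (x # xs)) \<in> \<G>"
      by (rule inv[OF _ ri]) (auto intro!: sum w)
    then show ?case unfolding eval_qf by (intro mult w Cons)
  qed (simp add: one)
  moreover have "W \<in> \<G>" unfolding W_def by (rule det) (simp add: pderiv w)
  ultimately show ?thesis
    unfolding amp_of_def eval0_mult eval_w by (intro mult power uminus w r)
qed

text \<open>m is 1 for the cone and a square root of det H for its dual; multiplication by m
  identifies the amplitudes with the solutions for the cone phase.\<close>

lemma germ_rank_cone_phase:
  fixes \<G> :: "('k::field_char_0, 'n::finite) mps set"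
  assumes \<G>: "germ_class \<G>" and cp: "cone_phase w winv r rinv \<kappa> \<kappa>inv c J"
    and w: "\<And>l. w l \<in> \<G>" and r: "r \<in> \<G>" and m: "m \<in> \<G>" "m * minv = 1"
    and f: "amplitudes \<G> f = {g \<in> \<G>. cone_phase.amp w winv r rinv \<kappa> \<kappa>inv J (m * g)}"
  shows "germ_rank \<G> f = enat (fact (CARD('n) + 1))"
proof -
  interpret germ_class \<G> by fact
  interpret cone_phase w winv r rinv \<kappa> \<kappa>inv c J by fact
  let ?V = "{g \<in> \<G>. amp (m * g)}"
  have st: "additive_map (ph.stat k)" for k by (rule ph.stat_additive)
  have amp_add: "amp (x + y)" if "amp x" "amp y" for x y
    using that by (simp add: amp_def sh.add additive_map.add[OF st])
  have amp_const: "amp (const_mps a * x)" if "amp x" for a x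
    using that by (simp add: amp_def sh.mult shift_const_mps ph.stat_const)
  have amp_0: "amp 0" by (simp add: amp_def sh.zero additive_map.zero[OF st])
  have sub: "mps.subspace ?V"
  proof (rule mps.subspaceI)
    show "0 \<in> ?V" by (simp add: zero amp_0)
    show "x + y \<in> ?V" if "x \<in> ?V" "y \<in> ?V" for x y
      using that by (simp add: add distrib_left amp_add)
    show "scale_mps a x \<in> ?V" if "x \<in> ?V" for a x
      using that amp_const[of "m * x" a] by (simp add: scale_mps_eq mult const mult.left_commute)
  qed
  obtain \<Psi> where P: "length \<Psi> = fact (CARD('n) + 1)"
    "\<forall>\<psi>\<in>set \<Psi>. (\<forall>h h'. \<psi> (h + h') = \<psi> h + \<psi> h') \<and> (\<forall>x h. \<psi> (const_mps x * h) = x * \<psi> h)"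
    "\<forall>h. amp h \<longrightarrow> (\<forall>\<psi>\<in>set \<Psi>. \<psi> h = 0) \<longrightarrow> h = 0"
    using amp_functionals by (elim exE conjE)
  have \<Psi>: "\<psi> (h + h') = \<psi> h + \<psi> h'" "\<psi> (const_mps x * h) = x * \<psi> h" if "\<psi> \<in> set \<Psi>" for \<psi> h h' x
    using bspec[OF P(2) that] by (simp_all only:)
  define \<Psi>' where "\<Psi>' = map (\<lambda>\<psi> h. \<psi> (m * h)) \<Psi>"
  have minv: "minv \<in> \<G>" using inv[OF m] .
  have mm: "m * (minv * x) = x" for x using m(2) by (simp add: mult.assoc[symmetric])
  have dims: "(\<exists>B. finite B \<and> mps.span B = ?V) \<and> mps.dim ?V = fact (CARD('n) + 1)"
  proof (rule mps.dim_from_functionals[of \<Psi>' _ ?V orderings "\<lambda>xs. minv * amp_of xs"];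
         (rule sub finite_orderings)?)
    show "length \<Psi>' = fact (CARD('n) + 1)" by (simp add: \<Psi>'_def P(1))
    show "\<psi> (x + y) = \<psi> x + \<psi> y" if "\<psi> \<in> set \<Psi>'" for \<psi> x y
      using that by (auto simp: \<Psi>'_def distrib_left \<Psi>(1))
    show "\<psi> (scale_mps a x) = a * \<psi> x" if "\<psi> \<in> set \<Psi>'" for \<psi> a x
      using that by (auto simp: \<Psi>'_def scale_mps_eq mult.left_commute[of m] \<Psi>(2))
    show "x = 0" if "x \<in> ?V" "\<forall>\<psi>\<in>set \<Psi>'. \<psi> x = 0" for x
    proof -
      have "m * x = 0" by (rule P(3)[rule_format]) (use that in \<open>auto simp: \<Psi>'_def\<close>)
      then have "minv * (m * x) = 0" by simp
      then show ?thesis using m(2) by (simp add: mult.assoc[symmetric] mult.commute)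
    qed
    show "card (orderings :: 'n option list set) = fact (CARD('n) + 1)"
      using card_orderings[where 'i = "'n option"] by simp
    show "minv * amp_of xs \<in> ?V" if "xs \<in> orderings" for xs
      using that by (simp add: mm amp_amp_of mult minv amp_of_mem[OF cp w r])
    show "a xs = 0" if z: "(\<Sum>xs\<in>orderings. scale_mps (a xs) (minv * amp_of xs)) = 0" and "xs \<in> orderings" for a xs
    proof (rule amp_of_independent[OF _ that(2)])
      have "m * (\<Sum>xs\<in>orderings. scale_mps (a xs) (minv * amp_of xs)) = (\<Sum>xs\<in>orderings. const_mps (a xs) * amp_of xs)"
        unfolding sum_distrib_left
      proof (rule sum.cong[OF refl])
        fix xs
        show "m * scale_mps (a xs) (minv * amp_of xs) = const_mps (a xs) * amp_of xs"
          using mm[of "const_mps (a xs) * amp_of xs"] by (simp only: scale_mps_eq mult_ac)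
      qed
      then show "(\<Sum>xs\<in>orderings. const_mps (a xs) * amp_of xs) = 0" using z by simp
    qed
  qed
  then show ?thesis unfolding germ_rank_def f by simp
qed

section \<open>Charts of the two cones\<close>

lemma sum_delta_left: "(\<Sum>j\<in>UNIV. (if i = j then 1 else 0) * x j) = (x i :: 'b::comm_ring_1)" for i :: "'m::finite"
  by (simp add: if_distrib[of "\<lambda>z. z * _"] cong: if_cong)

lemma sum_delta_right: "(\<Sum>j\<in>UNIV. x j * (if i = j then 1 else 0)) = (x i :: 'b::comm_ring_1)" for i :: "'m::finite"
  by (simp add: if_distrib cong: if_cong)

locale cone_chart =
  fixes N Ninv :: "'n::finite cone_index \<Rightarrow> 'n cone_index \<Rightarrow> 'k::field_char_0"
    and a :: "'n \<Rightarrow> 'k" and f :: "('k, 'n) mps" and x :: "'n cone_index \<Rightarrow> ('k, 'n) mps"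
  assumes N_Ninv: "(\<Sum>j\<in>UNIV. N i j * Ninv j l) = (if i = l then 1 else 0)"
    and Ninv_N: "(\<Sum>j\<in>UNIV. Ninv i j * N j l) = (if i = l then 1 else 0)"
    and x: "x l = (\<Sum>j\<in>UNIV. const_mps (N l j) * graph_point a f j)"
begin

abbreviation gp :: "'n cone_index \<Rightarrow> ('k, 'n) mps" where "gp \<equiv> graph_point a f"

lemma gp_eq: "gp i = (\<Sum>l\<in>UNIV. const_mps (Ninv i l) * x l)"
proof -
  have "(\<Sum>l\<in>UNIV. const_mps (Ninv i l) * x l) = (\<Sum>j\<in>UNIV. const_mps (\<Sum>l\<in>UNIV. Ninv i l * N l j) * gp j)"
    unfolding x sum_distrib_left const_mps_sum sum_distrib_right
    by (subst sum.swap) (simp add: const_mps_mult mult_ac)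
  moreover have "(const_mps (if i = j then 1 else 0) :: ('k, 'n) mps) = (if i = j then 1 else 0)" for j by simp
  ultimately show ?thesis unfolding Ninv_N by (simp only: sum_delta_left)
qed

text \<open>x is \<sigma> times functions h_l of w_l alone: squares for the cone, reciprocals for
  its dual. The graph variables are quotients of linear forms in h, in which \<sigma>
  cancels.\<close>

lemma chart_jacobian:
  assumes \<sigma>: "\<sigma> * \<sigma>inv = 1" and w0: "w First = 1" and ws: "(\<Sum>l\<in>UNIV. w l) = 0"
    and dh: "\<And>i l. pderiv_mps i (h l) = h' l * pderiv_mps i (w l)"
    and xh: "\<And>l. x l = \<sigma> * h l"
  shows "\<exists>J. (\<forall>i j. (\<Sum>b\<in>UNIV. J j b * pderiv_mps i (w (Mid b))) = (if i = j then 1 else 0)) \<and>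
    (\<forall>b c. (\<Sum>j\<in>UNIV. pderiv_mps j (w (Mid b)) * J j c) = (if c = b then 1 else 0))"
proof -
  define A where "A j l = (const_mps (Ninv j l) :: ('k, 'n) mps)" for j l
  \<comment> \<open>The derivative of gp (Mid j) / gp First in w_b, with w_Last moving in the
    opposite direction.\<close>
  define J where "J j b = \<sigma> * ((A (Mid j) (Mid b) - gp (Mid j) * A First (Mid b)) * h' (Mid b)
     - (A (Mid j) Last - gp (Mid j) * A First Last) * h' Last)" for j b
  have dA: "pderiv_mps i (A j l * y) = A j l * pderiv_mps i y" for i j l y by (simp add: A_def)
  have JV: "(\<Sum>b\<in>UNIV. J j b * pderiv_mps i (w (Mid b))) = (if i = j then 1 else 0)" for i j
  proof -
    define S where "S k = (\<Sum>l\<in>UNIV. A k l * h l)" for k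
    define T where "T k = (\<Sum>l\<in>UNIV. A k l * (h' l * pderiv_mps i (w l)))" for k
    have gS: "gp k = \<sigma> * S k" for k
      unfolding gp_eq S_def sum_distrib_left A_def xh by (simp add: mult.left_commute)
    have dS: "pderiv_mps i (gp k) = pderiv_mps i \<sigma> * S k + \<sigma> * T k" for k
      unfolding gS pderiv_mps_mult by (simp add: S_def T_def pderiv_mps_sum dA dh)
    have S0: "\<sigma> * S First = 1" using gS[of First] by simp
    have 0: "pderiv_mps i \<sigma> * S First + \<sigma> * T First = 0" using dS[of First] by simp
    have "pderiv_mps i (gp (Mid j)) = (if i = j then 1 else 0)" by (simp add: pderiv_var_mps)
    then have \<delta>: "pderiv_mps i \<sigma> * S (Mid j) + \<sigma> * T (Mid j) = (if i = j then 1 else 0)" unfolding dS .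
    have dw0: "pderiv_mps i (w First) = 0" by (simp add: w0)
    have "(\<Sum>l\<in>UNIV. pderiv_mps i (w l)) = 0" using ws by (metis pderiv_mps_0 pderiv_mps_sum)
    then have dwL: "pderiv_mps i (w Last) = - (\<Sum>b\<in>UNIV. pderiv_mps i (w (Mid b)))"
      unfolding sum_cone_index dw0 by (simp add: eq_neg_iff_add_eq_0 add.commute)
    have T: "T k = (\<Sum>b\<in>UNIV. (A k (Mid b) * h' (Mid b) - A k Last * h' Last) * pderiv_mps i (w (Mid b)))" for k
      unfolding T_def sum_cone_index dw0 dwL
      by (simp add: left_diff_distrib sum_subtractf sum_distrib_left mult.assoc)
    have "(\<Sum>b\<in>UNIV. J j b * pderiv_mps i (w (Mid b))) = \<sigma> * (T (Mid j) - gp (Mid j) * T First)"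
      unfolding T sum_distrib_left sum_subtractf[symmetric] J_def
      by (rule sum.cong) (simp_all add: algebra_simps)
    also have "\<dots> = (\<sigma> * T (Mid j)) - gp (Mid j) * (\<sigma> * T First)" by (simp add: algebra_simps)
    also have "\<sigma> * T First = - (pderiv_mps i \<sigma> * S First)" using 0 by (simp add: eq_neg_iff_add_eq_0 add.commute)
    also have "gp (Mid j) * - (pderiv_mps i \<sigma> * S First) = - (pderiv_mps i \<sigma> * S (Mid j)) * (\<sigma> * S First)"
      unfolding gS by (simp only: mult_minus_left mult_minus_right mult_ac)
    finally show ?thesis unfolding S0 using \<delta> by (simp add: add.commute)
  qed
  moreover have "(\<Sum>j\<in>UNIV. J j b * pderiv_mps j (w (Mid c))) = (if b = c then 1 else 0)" for b c
  proof (rule mps_inverse_commute[of "\<lambda>i b. pderiv_mps i (w (Mid b))" "\<lambda>b j. J j b"])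
    show "(\<Sum>b\<in>UNIV. pderiv_mps i (w (Mid b)) * J j b) = (if i = j then 1 else 0)" for i j
      using JV[of j i] by (simp only: mult.commute)
  qed
  then have "(\<Sum>j\<in>UNIV. pderiv_mps j (w (Mid b)) * J j c) = (if c = b then 1 else 0)" for b c
    by (simp only: mult.commute)
  ultimately show ?thesis by (intro exI[of _ J] conjI allI)
qed

text \<open>A form vanishing on the point and its derivatives is \<zeta>_Last times the conormal of
  the graph, whose last entry is 1. All its entries are multiples of \<zeta>_Last, so one unit entry
  in the coordinates x makes \<zeta>_Last a unit.\<close>

lemma conormal:
  assumes q: "(\<Sum>l\<in>UNIV. q l * x l) = 0" "\<And>i. (\<Sum>l\<in>UNIV. q l * pderiv_mps i (x l)) = 0"
  defines "\<zeta> \<equiv> \<lambda>j. \<Sum>l\<in>UNIV. q l * const_mps (N l j)"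
  shows "\<zeta> First = - (\<Sum>i\<in>UNIV. \<zeta> (Mid i) * gp (Mid i)) - \<zeta> Last * f"
    and "\<zeta> (Mid i) = - (\<zeta> Last * pderiv_mps i f)"
    and "q First dvd 1 \<Longrightarrow> \<zeta> Last dvd 1"
proof -
  have sw: "(\<Sum>l\<in>UNIV. q l * (\<Sum>j\<in>UNIV. const_mps (N l j) * y j)) = (\<Sum>j\<in>UNIV. \<zeta> j * y j)" for y
    unfolding \<zeta>_def sum_distrib_left sum_distrib_right by (subst sum.swap) (simp add: mult.assoc)
  have "(\<Sum>j\<in>UNIV. \<zeta> j * gp j) = 0" using q(1) unfolding x sw .
  then show 1: "\<zeta> First = - (\<Sum>i\<in>UNIV. \<zeta> (Mid i) * gp (Mid i)) - \<zeta> Last * f"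
    unfolding sum_cone_index by (simp add: eq_diff_eq eq_neg_iff_add_eq_0 add_ac del: graph_point.simps(2))
  have "(\<Sum>j\<in>UNIV. \<zeta> j * pderiv_mps i (gp j)) = 0" for i
    using q(2)[of i] unfolding x pderiv_mps_sum pderiv_const_mult sw .
  then have "\<zeta> (Mid i) + \<zeta> Last * pderiv_mps i f = 0" for i
    unfolding sum_cone_index by (simp add: pderiv_var_mps if_distrib cong: if_cong)
  then show 2: "\<zeta> (Mid i) = - (\<zeta> Last * pderiv_mps i f)" for i by (simp add: eq_neg_iff_add_eq_0)
  show "\<zeta> Last dvd 1" if "q First dvd 1"
  proof -
    have "(\<Sum>j\<in>UNIV. \<zeta> j * const_mps (Ninv j First)) = (\<Sum>l\<in>UNIV. q l * const_mps (\<Sum>j\<in>UNIV. N l j * Ninv j First))"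
      unfolding sw[symmetric] by (simp add: const_mps_sum const_mps_mult)
    also have "\<dots> = q First"
      unfolding N_Ninv by (simp add: if_distrib cong: if_cong)
    finally have "q First = (\<Sum>j\<in>UNIV. \<zeta> j * const_mps (Ninv j First))" ..
    moreover have "\<zeta> Last dvd \<zeta> j" for j
    proof (cases j)
      case First
      show ?thesis unfolding First 1 by (intro dvd_diff dvd_minus_iff[THEN iffD2] dvd_sum) (auto simp: 2)
    qed (auto simp: 2)
    ultimately have "\<zeta> Last dvd q First" by (simp add: dvd_sum)
    then show ?thesis using that dvd_trans by blast
  qed
qed

lemma shift_gp: "shift_mps (gp (Mid i)) = const_mps (gp (Mid i)) + var_mps i"
  by (simp add: sh.add shift_const_mps shift_var_mps const_mps_add)

lemma shift_x: "shift_mps (x l) = (\<Sum>j\<in>UNIV. const_mps (const_mps (N l j)) * shift_mps (gp j))"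
  unfolding x by (simp add: sh.sum sh.mult shift_const_mps)

text \<open>The form 1/w at t is conormal to the cone. Paired with x(t+u) it gives \<zeta>_Last
  times the Taylor remainder of f, so \<kappa> is the inverse of \<zeta>_Last. The constants c read
  off the graph coordinate equal to 1, which yields 1/r^2 as a quadratic form.\<close>

theorem sqrt_phase:
  assumes u: "\<And>l. u l ^ 2 = x l" and uinv: "\<And>l. u l * uinv l = 1" and sum: "(\<Sum>l\<in>UNIV. u l) = 0"
    and subset: "\<And>S. S \<noteq> {} \<Longrightarrow> (\<Sum>i\<in>S. u (chart_index i)) dvd 1"
  defines "w \<equiv> \<lambda>l. u l * uinv First" and "winv \<equiv> \<lambda>l. uinv l * u First"
  obtains \<kappa> \<kappa>inv c J where "cone_phase w winv (u First) (uinv First) \<kappa> \<kappa>inv c J"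
    "cone_phase.phi w winv (u First) \<kappa> = shift_mps f - const_mps f - (\<Sum>i\<in>UNIV. const_mps (pderiv_mps i f) * var_mps i)"
proof -
  let ?r = "u First"
  have w_First: "w First = 1" by (simp add: w_def uinv)
  have w_sum: "(\<Sum>l\<in>UNIV. w l) = 0" using sum by (simp add: w_def flip: sum_distrib_right)
  have w_inv: "w l * winv l = 1" for l
  proof -
    have "w l * winv l = (u l * uinv l) * (u First * uinv First)" by (simp add: w_def winv_def mult_ac)
    then show ?thesis by (simp add: uinv)
  qed
  have rw: "?r ^ 2 * w l ^ 2 = x l" for l
  proof -
    have "?r ^ 2 * w l ^ 2 = (u First * uinv First) ^ 2 * u l ^ 2" by (simp add: w_def power_mult_distrib mult_ac)
    then show ?thesis by (simp add: uinv u)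
  qed
  have wx: "winv l * x l = ?r ^ 2 * w l" for l
  proof -
    have "winv l * x l = ?r ^ 2 * w l * (w l * winv l)" unfolding rw[symmetric] by (simp add: power2_eq_square mult_ac)
    then show ?thesis by (simp add: w_inv)
  qed
  have q1: "(\<Sum>l\<in>UNIV. winv l * x l) = 0" unfolding wx using w_sum by (simp flip: sum_distrib_left)
  have q2: "(\<Sum>l\<in>UNIV. winv l * pderiv_mps i (x l)) = 0" for i
  proof -
    have "winv l * pderiv_mps i (x l) = pderiv_mps i (?r ^ 2) * w l + 2 * ?r ^ 2 * pderiv_mps i (w l)" for l
    proof -
      have "winv l * pderiv_mps i (x l) = (w l * winv l) * (pderiv_mps i (?r ^ 2) * w l + 2 * ?r ^ 2 * pderiv_mps i (w l))"
        unfolding rw[symmetric] pderiv_mps_mult power2_eq_square[of "w l"] by (simp add: algebra_simps)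
      then show ?thesis by (simp add: w_inv)
    qed
    moreover have "(\<Sum>l\<in>UNIV. pderiv_mps i (w l)) = 0" using w_sum by (metis pderiv_mps_0 pderiv_mps_sum)
    ultimately show ?thesis using w_sum by (simp add: sum.distrib flip: sum_distrib_left)
  qed
  define \<zeta> where "\<zeta> j = (\<Sum>l\<in>UNIV. winv l * const_mps (N l j))" for j
  note con = conormal[OF q1 q2, folded \<zeta>_def]
  have "winv First dvd 1" using w_inv[of First] by (metis dvd_triv_right)
  then obtain \<kappa> where \<kappa>: "\<zeta> Last * \<kappa> = 1" using con(3) by (metis dvdE)
  have r1: "?r ^ 2 * uinv First ^ 2 = 1" unfolding power_mult_distrib[symmetric] uinv by simp
  have dh: "pderiv_mps i (w l ^ 2) = 2 * w l * pderiv_mps i (w l)" for i l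
    by (simp add: power2_eq_square pderiv_mps_mult algebra_simps)
  obtain J where J: "\<forall>i j. (\<Sum>b\<in>UNIV. J j b * pderiv_mps i (w (Mid b))) = (if i = j then 1 else 0)"
    "\<forall>b c. (\<Sum>j\<in>UNIV. pderiv_mps j (w (Mid b)) * J j c) = (if c = b then 1 else 0)"
    using chart_jacobian[OF r1 w_First w_sum dh rw[symmetric]] by (elim exE conjE)
  have cp: "cone_phase w winv ?r (uinv First) \<kappa> (\<zeta> Last) (Ninv First) J"
  proof
    show "?r ^ 2 * (\<Sum>l\<in>UNIV. const_mps (Ninv First l) * w l ^ 2) = 1"
    proof -
      have "?r ^ 2 * (\<Sum>l\<in>UNIV. const_mps (Ninv First l) * w l ^ 2) = (\<Sum>l\<in>UNIV. const_mps (Ninv First l) * x l)"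
        unfolding rw[symmetric] sum_distrib_left by (simp add: mult.left_commute)
      then show ?thesis using gp_eq[of First] by simp
    qed
    show "(\<Sum>i\<in>S. w (chart_index i)) dvd 1" if "S \<noteq> {}" for S
    proof -
      have "(\<Sum>i\<in>S. w (chart_index i)) = (\<Sum>i\<in>S. u (chart_index i)) * uinv First"
        by (simp add: w_def sum_distrib_right)
      moreover have "uinv First dvd 1" using uinv[of First] by (metis dvd_triv_right)
      ultimately show ?thesis using subset[OF that] by (metis mult_dvd_mono mult_1)
    qed
  qed (use w_First w_sum w_inv uinv \<kappa> J in \<open>auto simp: mult.commute\<close>)
  have phi: "cone_phase.phi w winv ?r \<kappa> = shift_mps f - const_mps f - (\<Sum>i\<in>UNIV. const_mps (pderiv_mps i f) * var_mps i)"
  proof -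
    have "(\<Sum>l\<in>UNIV. const_mps (winv l) * shift_mps (?r ^ 2 * w l ^ 2)) = (\<Sum>j\<in>UNIV. const_mps (\<zeta> j) * shift_mps (gp j))"
      unfolding rw shift_x \<zeta>_def sum_distrib_left const_mps_sum const_mps_mult sum_distrib_right
      by (subst sum.swap) (simp add: mult.assoc)
    also have "\<dots> = const_mps (\<zeta> Last) * (shift_mps f - const_mps f - (\<Sum>i\<in>UNIV. const_mps (pderiv_mps i f) * var_mps i))"
      unfolding sum_cone_index shift_gp con(1,2)
      by (simp add: const_mps_diff const_mps_uminus const_mps_sum const_mps_mult sum.distrib sum_negf sum_subtractf
          algebra_simps sum_distrib_left del: graph_point.simps(2))
    finally have "cone_phase.phi w winv ?r \<kappa> = const_mps (\<kappa> * \<zeta> Last) * (shift_mps f - const_mps f - (\<Sum>i\<in>UNIV. const_mps (pderiv_mps i f) * var_mps i))"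
      unfolding cone_phase.phi_def[OF cp] by (simp only: const_mps_mult mult.assoc)
    then show ?thesis using \<kappa> by (simp add: mult.commute)
  qed
  show ?thesis by (rule that[OF cp phi])
qed

text \<open>Point and conormal exchange roles: x is proportional to 1/w and w^2 is conormal. The
  conormal is taken at t + u and the point at t, which produces the Legendre dual phase; r^2 =
  1/\<zeta>_Last normalizes the conormal.\<close>

theorem dual_phase:
  assumes root: "\<And>y :: ('k, 'n) mps. y dvd 1 \<Longrightarrow> \<exists>r. r ^ 2 = y"
    and xinv: "\<And>l. x l * xinv l = 1" and sum: "(\<Sum>l\<in>UNIV. xinv l) = 0"
    and subset: "\<And>S. S \<noteq> {} \<Longrightarrow> (\<Sum>i\<in>S. xinv (chart_index i)) dvd 1"
  defines "w \<equiv> \<lambda>l. x First * xinv l" and "winv \<equiv> \<lambda>l. x l * xinv First"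
  obtains r rinv \<kappa> \<kappa>inv c J where "cone_phase w winv r rinv \<kappa> \<kappa>inv c J"
    "cone_phase.phi w winv r \<kappa> = shift_mps f - const_mps f - (\<Sum>i\<in>UNIV. shift_mps (pderiv_mps i f) * var_mps i)"
    "(\<Sum>l\<in>UNIV. w l ^ 2 * const_mps (N l Last)) * r ^ 2 = 1"
proof -
  let ?\<sigma> = "x First"
  have w_First: "w First = 1" by (simp add: w_def xinv)
  have w_sum: "(\<Sum>l\<in>UNIV. w l) = 0" using sum by (simp add: w_def flip: sum_distrib_left)
  have w_inv: "w l * winv l = 1" for l
  proof -
    have "w l * winv l = (x l * xinv l) * (x First * xinv First)" by (simp add: w_def winv_def mult_ac)
    then show ?thesis by (simp add: xinv)
  qed
  have \<sigma>w: "x l = ?\<sigma> * winv l" for l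
  proof -
    have "?\<sigma> * winv l = (x First * xinv First) * x l" by (simp add: winv_def mult_ac)
    then show ?thesis by (simp add: xinv)
  qed
  have wx: "w l * x l = ?\<sigma>" for l
  proof -
    have "w l * x l = x First * (x l * xinv l)" by (simp add: w_def mult_ac)
    then show ?thesis by (simp add: xinv)
  qed
  have wwx: "w l ^ 2 * x l = ?\<sigma> * w l" for l using wx[of l] by (simp add: power2_eq_square mult_ac)
  have ws: "(\<Sum>l\<in>UNIV. pderiv_mps i (w l)) = 0" for i using w_sum by (metis pderiv_mps_0 pderiv_mps_sum)
  have q1: "(\<Sum>l\<in>UNIV. w l ^ 2 * x l) = 0" unfolding wwx using w_sum by (simp flip: sum_distrib_left)
  have q2: "(\<Sum>l\<in>UNIV. w l ^ 2 * pderiv_mps i (x l)) = 0" for i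
  proof -
    have "w l ^ 2 * pderiv_mps i (x l) = w l * pderiv_mps i ?\<sigma> - ?\<sigma> * pderiv_mps i (w l)" for l
    proof -
      have "pderiv_mps i ?\<sigma> = pderiv_mps i (w l) * x l + w l * pderiv_mps i (x l)"
        unfolding wx[of l, symmetric] by (rule pderiv_mps_mult)
      then have "w l * pderiv_mps i ?\<sigma> = pderiv_mps i (w l) * (w l * x l) + w l ^ 2 * pderiv_mps i (x l)"
        by (simp add: power2_eq_square algebra_simps)
      then show ?thesis unfolding wx by (simp add: mult.commute)
    qed
    then show ?thesis using w_sum ws[of i] by (simp add: sum_subtractf flip: sum_distrib_left sum_distrib_right)
  qed
  define \<zeta> where "\<zeta> j = (\<Sum>l\<in>UNIV. w l ^ 2 * const_mps (N l j))" for j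
  note con = conormal[OF q1 q2, folded \<zeta>_def]
  have "\<zeta> Last dvd 1" by (rule con(3)) (simp add: w_First)
  then obtain \<zeta>inv where \<zeta>inv: "\<zeta> Last * \<zeta>inv = 1" by (metis dvdE)
  then have "\<zeta>inv dvd 1" by (metis dvd_triv_right)
  then obtain r where r: "r ^ 2 = \<zeta>inv" using root by blast
  define rinv where "rinv = r * \<zeta> Last"
  have r_inv: "r * rinv = 1" using \<zeta>inv unfolding rinv_def mult.assoc[symmetric] power2_eq_square[symmetric] r by (simp add: mult.commute)
  have dh: "pderiv_mps i (winv l) = - (winv l ^ 2) * pderiv_mps i (w l)" for i l
  proof -
    have "pderiv_mps i (w l * winv l) = 0" by (simp add: w_inv)
    then have "pderiv_mps i (w l) * winv l + w l * pderiv_mps i (winv l) = 0" by (simp add: pderiv_mps_mult)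
    then have "winv l * (pderiv_mps i (w l) * winv l + w l * pderiv_mps i (winv l)) = 0" by simp
    then have "winv l ^ 2 * pderiv_mps i (w l) + (w l * winv l) * pderiv_mps i (winv l) = 0"
      by (simp add: power2_eq_square algebra_simps)
    then show ?thesis unfolding w_inv by (simp add: add_eq_0_iff)
  qed
  obtain J where J: "\<forall>i j. (\<Sum>b\<in>UNIV. J j b * pderiv_mps i (w (Mid b))) = (if i = j then 1 else 0)"
    "\<forall>b c. (\<Sum>j\<in>UNIV. pderiv_mps j (w (Mid b)) * J j c) = (if c = b then 1 else 0)"
    using chart_jacobian[OF xinv[of First] w_First w_sum dh \<sigma>w] by (elim exE conjE)
  have cp: "cone_phase w winv r rinv (- ?\<sigma>) (- xinv First) (\<lambda>l. N l Last) J"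
  proof
    show "r ^ 2 * (\<Sum>l\<in>UNIV. const_mps (N l Last) * w l ^ 2) = 1"
      using \<zeta>inv by (simp add: r \<zeta>_def mult.commute)
    show "(\<Sum>i\<in>S. w (chart_index i)) dvd 1" if "S \<noteq> {}" for S
    proof -
      have "(\<Sum>i\<in>S. w (chart_index i)) = ?\<sigma> * (\<Sum>i\<in>S. xinv (chart_index i))"
        by (simp add: w_def sum_distrib_left)
      moreover have "?\<sigma> dvd 1" using xinv[of First] by (metis dvd_triv_left)
      ultimately show ?thesis using subset[OF that] by (metis mult_dvd_mono mult_1)
    qed
  qed (use w_First w_sum w_inv r_inv xinv J in auto)
  have phi: "cone_phase.phi w winv r (- ?\<sigma>) = shift_mps f - const_mps f - (\<Sum>i\<in>UNIV. shift_mps (pderiv_mps i f) * var_mps i)"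
  proof -
    let ?\<psi> = "shift_mps f - const_mps f - (\<Sum>i\<in>UNIV. shift_mps (pderiv_mps i f) * var_mps i)"
    have s\<zeta>: "shift_mps (\<zeta> j) = (\<Sum>l\<in>UNIV. shift_mps (w l ^ 2) * const_mps (const_mps (N l j)))" for j
      unfolding \<zeta>_def by (simp add: sh.sum sh.mult shift_const_mps)
    have cx: "const_mps (x l) = (\<Sum>j\<in>UNIV. const_mps (const_mps (N l j)) * const_mps (gp j))" for l
      unfolding x by (simp add: const_mps_sum const_mps_mult)
    have "(\<Sum>l\<in>UNIV. const_mps (x l) * shift_mps (w l ^ 2)) = (\<Sum>j\<in>UNIV. shift_mps (\<zeta> j) * const_mps (gp j))"
      unfolding s\<zeta> cx sum_distrib_left sum_distrib_right
      by (subst sum.swap) (simp add: mult_ac)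
    also have "\<dots> = - shift_mps (\<zeta> Last) * ?\<psi>"
    proof -
      have "shift_mps (\<zeta> First) = - (\<Sum>i\<in>UNIV. shift_mps (\<zeta> (Mid i)) * (const_mps (gp (Mid i)) + var_mps i)) - shift_mps (\<zeta> Last) * shift_mps f"
        unfolding con(1) sh.diff sh.uminus sh.sum sh.mult shift_gp ..
      moreover have "shift_mps (\<zeta> (Mid i)) = - (shift_mps (\<zeta> Last) * shift_mps (pderiv_mps i f))" for i
        unfolding con(2) sh.uminus sh.mult ..
      ultimately show ?thesis unfolding sum_cone_index
        by (simp add: sum.distrib sum_negf sum_subtractf algebra_simps sum_distrib_left del: graph_point.simps(2))
    qed
    finally have e: "(\<Sum>l\<in>UNIV. const_mps (x l) * shift_mps (w l ^ 2)) = - shift_mps (\<zeta> Last) * ?\<psi>" .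
    have "cone_phase.phi w winv r (- ?\<sigma>) = - (\<Sum>l\<in>UNIV. const_mps (?\<sigma> * winv l) * (shift_mps (r ^ 2) * shift_mps (w l ^ 2)))"
      unfolding cone_phase.phi_def[OF cp] sh.mult
      by (simp add: sum_distrib_left sum_negf const_mps_uminus const_mps_mult mult.assoc)
    also have "\<dots> = - shift_mps (r ^ 2) * (\<Sum>l\<in>UNIV. const_mps (x l) * shift_mps (w l ^ 2))"
      unfolding \<sigma>w[symmetric] by (simp add: sum_distrib_left sum_negf mult.left_commute)
    also have "\<dots> = shift_mps (\<zeta> Last * r ^ 2) * ?\<psi>"
      unfolding e sh.mult by (simp only: mult_minus_left mult_minus_right minus_minus mult_ac)
    finally show ?thesis using \<zeta>inv by (simp add: r)
  qed
  show ?thesis by (rule that[OF cp phi]) (use \<zeta>inv in \<open>simp add: \<zeta>_def r\<close>)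
qed

end

lemma det_hessian_unit:
  fixes f :: "('k::field_char_0, 'n::finite) mps"
  assumes "\<And>i l. (\<Sum>j\<in>UNIV. G i j * hessian f $ j $ l) = (if i = l then 1 else 0)"
  shows "det (hessian f) dvd 1"
proof -
  have "(\<chi> i j. G i j) ** hessian f = mat 1"
    by (simp add: matrix_matrix_mult_def mat_def vec_eq_iff assms)
  then have "det (\<chi> i j. G i j) * det (hessian f) = 1" by (metis det_mul det_I)
  then show ?thesis by (metis dvd_triv_right)
qed

lemma phase_hessian:
  fixes f :: "('k::field_char_0, 'n::finite) mps"
  assumes "phase (shift_mps f - const_mps f - (\<Sum>i\<in>UNIV. const_mps (pderiv_mps i f) * var_mps i)) G"
  shows "(\<Sum>j\<in>UNIV. G i j * hessian f $ j $ l) = (if i = l then 1 else 0)"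
  using phase.G_H[OF assms, of i l]
  by (simp add: pderiv_shift_mps pderiv_var_mps pderiv_mps_mult hessian_def sum_delta_right)

lemma legendre_phase_hessian:
  fixes f :: "('k::field_char_0, 'n::finite) mps"
  assumes "phase (shift_mps f - const_mps f - (\<Sum>i\<in>UNIV. shift_mps (pderiv_mps i f) * var_mps i)) G"
  shows "(\<Sum>j\<in>UNIV. - G i j * hessian f $ j $ l) = (if i = l then 1 else 0)"
proof -
  have "pderiv_mps l (shift_mps f - const_mps f - (\<Sum>i\<in>UNIV. shift_mps (pderiv_mps i f) * var_mps i))
     = - (\<Sum>m\<in>UNIV. shift_mps (hessian f $ l $ m) * var_mps m)" for l
    by (simp add: pderiv_shift_mps pderiv_mps_mult pderiv_var_mps sum.distrib hessian_def sum_delta_right)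
  then have "eval0_mps (pderiv_mps j (pderiv_mps l (shift_mps f - const_mps f - (\<Sum>i\<in>UNIV. shift_mps (pderiv_mps i f) * var_mps i))))
     = - hessian f $ j $ l" for j l
    by (simp add: pderiv_mps_mult pderiv_var_mps sum.distrib hessian_def pderiv_mps_commute sum_delta_right)
  then show ?thesis using phase.G_H[OF assms, of i l] by simp
qed

section \<open>Ranks\<close>

lemma mps_root:
  fixes x :: "('k::{alg_closed_field, field_char_0}, 'n::finite) mps"
  assumes "x dvd 1" shows "\<exists>y. y ^ 2 = x"
proof -
  obtain c where c: "c ^ 2 = eval0_mps x" using nth_root_exists[of 2 "eval0_mps x"] by auto
  moreover have "c \<noteq> 0" using c assms[unfolded mps_unit_iff] by auto
  ultimately show ?thesis using mps_sqrt_exists[of x c] by metis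
qed

lemma unit_inverses:
  fixes u :: "'i \<Rightarrow> 'b::comm_semiring_1"
  assumes "\<And>l. u l dvd 1" shows "\<exists>v. \<forall>l. u l * v l = 1"
proof (rule choice, rule allI)
  show "\<exists>v. u l * v = 1" for l using assms[of l] by (elim dvdE) metis
qed

lemma graph_germ_chart:
  fixes f :: "('k::field_char_0, 'n::finite) mps"
  assumes "graph_germ C N p f"
  shows "\<exists>Ninv a x z. cone_chart (\<lambda>i j. N $ i $ j) Ninv a f x \<and> z \<noteq> 0 \<and>
    (\<forall>l. eval0_mps (x l) = p $ l / z) \<and> (\<forall>F\<in>vanishing_ideal C. eval_mpoly const_mps F x = 0) \<and>
    det (hessian f) \<noteq> 0"
proof -
  obtain N' where N': "N ** N' = mat 1" "N' ** N = mat 1" using assms by (auto simp: graph_germ_def invertible_def)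
  obtain z where z: "p = N *v z" "z $ First \<noteq> 0" "eval0_mps f = z $ Last / z $ First"
    "\<forall>F\<in>vanishing_ideal C. eval_mpoly const_mps F (\<lambda>i. \<Sum>j\<in>UNIV. const_mps (N $ i $ j) *
          graph_point (\<lambda>l. z $ Mid l / z $ First) f j) = 0"
    using assms unfolding graph_germ_def by blast
  define a where "a l = z $ Mid l / z $ First" for l
  define x where "x i = (\<Sum>j\<in>UNIV. const_mps (N $ i $ j) * graph_point a f j)" for i
  have mm: "(\<Sum>j\<in>UNIV. A $ i $ j * B $ j $ l) = (A ** B) $ i $ l" for A B :: "'k ^ 'n cone_index ^ 'n cone_index" and i l
    by (simp add: matrix_matrix_mult_def)
  have "cone_chart (\<lambda>i j. N $ i $ j) (\<lambda>i j. N' $ i $ j) a f x"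
    by standard (simp_all add: mm N' mat_def x_def)
  moreover have "eval0_mps (x l) = p $ l / z $ First" for l
  proof -
    have "eval0_mps (graph_point a f j) = z $ j / z $ First" for j
      using z(2,3) by (cases j) (simp_all add: a_def)
    then show ?thesis unfolding x_def z(1) by (simp add: matrix_vector_mult_def sum_divide_distrib)
  qed
  moreover have "eval_mpoly const_mps F x = 0" if "F \<in> vanishing_ideal C" for F
    using z(4) that unfolding x_def a_def by blast
  moreover have "det (hessian f) \<noteq> 0" using assms by (simp add: graph_germ_def)
  ultimately show ?thesis using z(2) by (intro exI[of _ "\<lambda>i j. N' $ i $ j"] exI[of _ a] exI[of _ x] exI[of _ "z $ First"]) blast
qed

lemma amplitudes_sqrt_phase:
  fixes f :: "('k::field_char_0, 'n::finite) mps"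
  assumes cp: "cone_phase w winv r rinv \<kappa> \<kappa>inv c J" and det: "det (hessian f) \<noteq> 0"
    and phi: "cone_phase.phi w winv r \<kappa> = shift_mps f - const_mps f - (\<Sum>i\<in>UNIV. const_mps (pderiv_mps i f) * var_mps i)"
  shows "amplitudes \<G> f = {g \<in> \<G>. cone_phase.amp w winv r rinv \<kappa> \<kappa>inv J (1 * g)}"
proof -
  interpret cone_phase w winv r rinv \<kappa> \<kappa>inv c J by fact
  have "stationary_phase_coeff f g k = to_merom (ph.stat k (shift_mps g))" for g k
    unfolding phi by (rule stationary_phase_coeff_eq) (rule ph.phase_axioms[unfolded phi])
  then have "stationary_phase_coeff f g k = 0 \<longleftrightarrow> ph.stat k (shift_mps g) = 0" for g k
    by (simp only: to_merom_eq_0_iff)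
  moreover have "amp 0" by (simp add: amp_def additive_map.zero[OF ph.stat_additive])
  ultimately show ?thesis using det by (auto simp: amplitudes_def admissible_pair_def amp_def)
qed

text \<open>\<open>L.I_vanishes_iff\<close> exchanges the expansion for f with that for its Legendre
  transform, at the price of the factor m.\<close>

lemma amplitudes_dual_phase:
  fixes f :: "('k::field_char_0, 'n::finite) mps"
  assumes cp: "cone_phase w winv r rinv \<kappa> \<kappa>inv c J" and m: "m * minv = 1" "m ^ 2 = det (hessian f)"
    and phi: "cone_phase.phi w winv r \<kappa> = shift_mps f - const_mps f - (\<Sum>i\<in>UNIV. shift_mps (pderiv_mps i f) * var_mps i)"
  shows "amplitudes \<G> f = {g \<in> \<G>. cone_phase.amp w winv r rinv \<kappa> \<kappa>inv J (m * g)}"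
proof -
  interpret cone_phase w winv r rinv \<kappa> \<kappa>inv c J by fact
  interpret L: legendre f m minv "\<lambda>i j. - G i j"
  proof
    show "- G i j = - G j i" for i j by (simp add: ph.G_sym)
    show "(\<Sum>j\<in>UNIV. - G i j * hessian f $ j $ l) = (if i = l then 1 else 0)" for i l
      by (rule legendre_phase_hessian) (rule ph.phase_axioms[unfolded phi])
  qed (rule m)+
  have "stationary_phase_coeff f g k = to_merom (L.I k g)" for g k
    unfolding L.I_def L.phi_def by (rule stationary_phase_coeff_eq) (rule L.p.phase_axioms[unfolded L.phi_def])
  then have st: "stationary_phase_coeff f g k = 0 \<longleftrightarrow> L.I k g = 0" for g k
    by (simp only: to_merom_eq_0_iff)
  have "minv \<noteq> 0" "m \<noteq> 0" using m(1) by auto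
  moreover have "L.psi = phi" by (simp add: L.psi_def phi)
  ultimately have "L.Ih k g = 0 \<longleftrightarrow> ph.stat k (shift_mps (m * g)) = 0" for g k
    by (simp add: L.Ih_def mult.commute[of m])
  then have "(\<forall>k\<ge>1. stationary_phase_coeff f g k = 0) \<longleftrightarrow> amp (m * g)" for g
    unfolding st L.I_vanishes_iff amp_def by simp
  moreover have "amp 0" by (simp add: amp_def additive_map.zero[OF ph.stat_additive])
  moreover have "det (hessian f) \<noteq> 0" using m(2) \<open>m \<noteq> 0\<close> by (metis zero_eq_power2)
  ultimately show ?thesis by (auto simp: amplitudes_def admissible_pair_def)
qed

lemma (in germ_class) chart_mem:
  assumes "cone_chart N Ninv a f x" "f \<in> \<G>" shows "x l \<in> \<G>"
proof -
  interpret cone_chart N Ninv a f x by fact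
  have "gp j \<in> \<G>" for j
    by (cases j) (use assms(2) in \<open>auto intro!: add const var one\<close>)
  then show ?thesis unfolding x by (intro sum mult const)
qed

lemma chart_sum_nonzero:
  fixes v :: "'n::finite cone_index \<Rightarrow> 'k::field"
  assumes "\<And>S. S \<in> finite_sets \<Longrightarrow> (\<Sum>i\<in>S. v i) \<noteq> 0" "S \<noteq> {}"
  shows "(\<Sum>i\<in>S. v (chart_index i)) \<noteq> 0"
proof -
  have "inj_on chart_index S" by (auto simp: inj_on_def split: option.splits)
  then have "(\<Sum>i\<in>S. v (chart_index i)) = (\<Sum>i\<in>chart_index ` S. v i)" by (simp add: sum.reindex)
  moreover have "chart_index ` S \<in> finite_sets"
    using assms(2) by (auto simp: finite_sets_def split: option.splits)
  ultimately show ?thesis using assms(1) by simp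
qed

lemma chart_sum_unit:
  fixes v :: "'n::finite cone_index \<Rightarrow> ('k::field, 'n) mps"
  assumes "\<And>S. S \<in> finite_sets \<Longrightarrow> (\<Sum>i\<in>S. e i) \<noteq> 0" "S \<noteq> {}" "b \<noteq> 0"
    and "\<And>l. eval0_mps (v l) = b * e l"
  shows "(\<Sum>i\<in>S. v (chart_index i)) dvd 1"
proof -
  have "eval0_mps (\<Sum>i\<in>S. v (chart_index i)) = b * (\<Sum>i\<in>S. e (chart_index i))"
    by (simp add: assms(4) sum_distrib_left)
  then show ?thesis using chart_sum_nonzero[OF assms(1,2)] assms(3) by (simp add: mps_unit_iff)
qed

text \<open>Roots of the coordinates along the graph are chosen with values proportional to u. The
  norm polynomial makes one of their signed sums vanish, and genericity at the base point excludes
  all nontrivial sign choices.\<close>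

theorem sqrt_cone_germ_rank:
  fixes f :: "('k::{alg_closed_field, field_char_0}, 'n::finite) mps"
  assumes \<G>: "germ_class \<G>" and f: "f \<in> \<G>" and u: "generic_vec u"
    and g: "graph_germ sqrt_cone N (\<chi> i. u i ^ 2) f"
  shows "germ_rank \<G> f = enat (fact (CARD('n) + 1))"
proof -
  interpret germ_class \<G> by fact
  obtain Ninv a x z where c: "cone_chart (\<lambda>i j. N $ i $ j) Ninv a f x" "z \<noteq> 0"
    "\<forall>l. eval0_mps (x l) = (\<chi> i. u i ^ 2) $ l / z"
    "\<forall>F\<in>vanishing_ideal sqrt_cone. eval_mpoly const_mps F x = 0" "det (hessian f) \<noteq> 0"
    using graph_germ_chart[OF g] by (elim exE conjE)
  obtain \<rho> where \<rho>: "\<rho> ^ 2 = 1 / z" using nth_root_exists[of 2 "1 / z"] by auto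
  then have \<rho>0: "\<rho> \<noteq> 0" using c(2) by auto
  note un = generic_vec_nonzero[OF u]
  have "\<exists>y. y ^ 2 = x l \<and> eval0_mps y = \<rho> * u l" for l
  proof -
    have "eval0_mps (x l) = (\<rho> * u l) ^ 2" unfolding c(3)[rule_format] power_mult_distrib \<rho> by simp
    moreover have "\<rho> * u l \<noteq> 0" using \<rho>0 un by simp
    ultimately show ?thesis using mps_sqrt_exists by metis
  qed
  then obtain U where U: "\<And>l. U l ^ 2 = x l" "\<And>l. eval0_mps (U l) = \<rho> * u l" by metis
  have Uu: "U l dvd 1" for l using U(2) \<rho>0 un by (simp add: mps_unit_iff)
  obtain Ui where "\<forall>l. U l * Ui l = 1" using unit_inverses[of U, OF Uu] by (elim exE)
  then have Ui: "U l * Ui l = 1" for l by blast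
  have UG: "U l \<in> \<G>" for l by (rule root[OF _ Uu]) (simp add: U(1) chart_mem[OF c(1) f])
  have sum0: "(\<Sum>l\<in>UNIV. U l) = 0"
  proof -
    have "eval_mpoly const_mps (norm_poly UNIV) x = 0" using c(4) norm_poly_in_ideal by blast
    then have "eval_mpoly const_mps (norm_poly UNIV) (\<lambda>l. U l ^ 2) = 0" by (simp add: U(1))
    then have "(\<Prod>T\<in>signs. \<Sum>i\<in>UNIV. sg T i * U i) = 0" unfolding eval_norm_poly[OF ring_hom_const_mps] .
    then obtain T where T: "T \<in> signs" "(\<Sum>i\<in>UNIV. sg T i * U i) = 0" by (auto simp: prod_zero_iff)
    have "eval0_mps (sg T i * U i) = \<rho> * (sg T i * u i)" for i
      by (simp add: sg_def U(2))
    then have "eval0_mps (\<Sum>i\<in>UNIV. sg T i * U i) = \<rho> * (\<Sum>i\<in>UNIV. sg T i * u i)"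
      by (simp add: sum_distrib_left del: eval0_mult)
    then have "(\<Sum>i\<in>UNIV. sg T i * u i) = 0" using T(2) \<rho>0 by simp
    then have "T = {}" using generic_vec_signs[OF u T(1)] by blast
    then show ?thesis using T(2) by (simp add: sg_def)
  qed
  have sub: "(\<Sum>i\<in>S. U (chart_index i)) dvd 1" if "S \<noteq> {}" for S
    by (rule chart_sum_unit[OF generic_vec_subset[OF u] that \<rho>0 U(2)])
  show ?thesis
  proof (rule cone_chart.sqrt_phase[OF c(1) U(1) Ui sum0 sub])
    fix \<kappa> \<kappa>inv c' J
    assume cp: "cone_phase (\<lambda>l. U l * Ui First) (\<lambda>l. Ui l * U First) (U First) (Ui First) \<kappa> \<kappa>inv c' J"
      and phi: "cone_phase.phi (\<lambda>l. U l * Ui First) (\<lambda>l. Ui l * U First) (U First) \<kappa> =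
        shift_mps f - const_mps f - (\<Sum>i\<in>UNIV. const_mps (pderiv_mps i f) * var_mps i)"
    show "germ_rank \<G> f = enat (fact (CARD('n) + 1))"
      by (rule germ_rank_cone_phase[OF \<G> cp _ UG one _ amplitudes_sqrt_phase[OF cp c(5) phi]])
         (auto intro!: mult UG inv[OF UG Ui])
  qed
qed

theorem dual_cone_germ_rank:
  fixes f :: "('k::{alg_closed_field, field_char_0}, 'n::finite) mps"
  assumes \<G>: "germ_class \<G>" and f: "f \<in> \<G>" and y: "\<And>i. y $ i \<noteq> 0"
    and sub: "\<And>S. S \<in> finite_sets \<Longrightarrow> (\<Sum>i\<in>S. 1 / y $ i) \<noteq> 0"
    and g: "graph_germ (dual_cone sqrt_cone) N y f"
  shows "germ_rank \<G> f = enat (fact (CARD('n) + 1))"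
proof -
  interpret germ_class \<G> by fact
  obtain Ninv a x z where c: "cone_chart (\<lambda>i j. N $ i $ j) Ninv a f x" "z \<noteq> 0"
    "\<forall>l. eval0_mps (x l) = y $ l / z"
    "\<forall>F\<in>vanishing_ideal (dual_cone sqrt_cone). eval_mpoly const_mps F x = 0" "det (hessian f) \<noteq> 0"
    using graph_germ_chart[OF g] by (elim exE conjE)
  have xu: "x l dvd 1" for l using y c(2,3) by (simp add: mps_unit_iff)
  obtain xi where "\<forall>l. x l * xi l = 1" using unit_inverses[of x, OF xu] by (elim exE)
  then have xi: "x l * xi l = 1" for l by blast
  have xG: "x l \<in> \<G>" for l by (rule chart_mem[OF c(1) f])
  have xiG: "xi l \<in> \<G>" for l by (rule inv[OF xG xi])
  have sum0: "(\<Sum>l\<in>UNIV. xi l) = 0"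
  proof -
    have "dual_poly \<in> vanishing_ideal (dual_cone sqrt_cone :: ('k ^ 'n cone_index) set)"
      by (simp add: vanishing_ideal_def dual_cone_eq eval_dual_poly[OF ring_hom_id])
    then have "eval_mpoly const_mps dual_poly x = 0" using c(4) by blast
    then have "elem x = 0" unfolding eval_dual_poly[OF ring_hom_const_mps] .
    moreover have "(\<Prod>j\<in>UNIV - {i}. x j) = prod x UNIV * xi i" for i
    proof -
      have "prod x UNIV * xi i = (x i * xi i) * (\<Prod>j\<in>UNIV - {i}. x j)"
        using prod.remove[of UNIV i x] by (simp add: mult_ac)
      then show ?thesis by (simp add: xi)
    qed
    ultimately have "prod x UNIV * (\<Sum>l\<in>UNIV. xi l) = 0" by (simp add: elem_def sum_distrib_left)
    moreover have "x l \<noteq> 0" for l using xi[of l] by auto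
    ultimately show ?thesis by simp
  qed
  have ev: "eval0_mps (xi l) = z * (1 / y $ l)" for l
  proof -
    have "eval0_mps (x l * xi l) = 1" by (simp only: xi eval0_one)
    then show ?thesis using c(2) y[of l] by (simp add: c(3) field_simps)
  qed
  have sub': "(\<Sum>i\<in>S. xi (chart_index i)) dvd 1" if "S \<noteq> {}" for S
    by (rule chart_sum_unit[OF sub that c(2) ev])
  show ?thesis
  proof (rule cone_chart.dual_phase[OF c(1) mps_root xi sum0 sub'])
    fix r rinv \<kappa> \<kappa>inv c' J
    assume cp: "cone_phase (\<lambda>l. x First * xi l) (\<lambda>l. x l * xi First) r rinv \<kappa> \<kappa>inv c' J"
      and phi: "cone_phase.phi (\<lambda>l. x First * xi l) (\<lambda>l. x l * xi First) r \<kappa> =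
        shift_mps f - const_mps f - (\<Sum>i\<in>UNIV. shift_mps (pderiv_mps i f) * var_mps i)"
      and r: "(\<Sum>l\<in>UNIV. (x First * xi l) ^ 2 * const_mps (N $ l $ Last)) * r ^ 2 = 1"
    interpret cp: cone_phase "\<lambda>l. x First * xi l" "\<lambda>l. x l * xi First" r rinv \<kappa> \<kappa>inv c' J by (rule cp)
    have "det (hessian f) dvd 1"
      by (rule det_hessian_unit, rule legendre_phase_hessian) (rule cp.ph.phase_axioms[unfolded phi])
    then obtain m where m: "m ^ 2 = det (hessian f)" using mps_root by blast
    have "m dvd 1" using \<open>det (hessian f) dvd 1\<close> m by (metis dvd_power dvd_trans pos2)
    then obtain minv where minv: "m * minv = 1" by (metis dvdE)
    have "det (hessian f) \<in> \<G>" by (rule det) (simp add: hessian_def pderiv f)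
    then have mG: "m \<in> \<G>" using root[OF _ \<open>m dvd 1\<close>] m by simp
    have "r ^ 2 \<in> \<G>" by (rule inv[OF _ r]) (intro sum mult power const xG xiG)
    moreover have "r dvd 1" using cp.r_inv by (metis dvd_triv_left)
    ultimately have rG: "r \<in> \<G>" using root by blast
    show "germ_rank \<G> f = enat (fact (CARD('n) + 1))"
      by (rule germ_rank_cone_phase[OF \<G> cp _ rG mG minv amplitudes_dual_phase[OF cp minv m phi]])
         (intro mult xG xiG)
  qed
qed

section \<open>Existence of graph germs\<close>

lemma graph_germ_mat_1:
  assumes "smooth_point C p" "p $ First \<noteq> 0" "eval0_mps f = p $ Last / p $ First"
    and "\<And>F. F \<in> vanishing_ideal C \<Longrightarrow> eval_mpoly const_mps F (graph_point (\<lambda>l. p $ Mid l / p $ First) f) = 0"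
    and "det (hessian f) \<noteq> 0"
  shows "graph_germ C (mat 1) p (f :: ('k::field_char_0, 'n::finite) mps)"
  unfolding graph_germ_def
proof (intro conjI exI[of _ p])
  show "invertible (mat 1 :: 'k ^ 'n cone_index ^ 'n cone_index)"
    by (auto simp: invertible_def intro: exI[of _ "mat 1"])
  have "const_mps ((mat 1 :: 'k ^ 'n cone_index ^ 'n cone_index) $ i $ j) = (if i = j then 1 else (0 :: ('k, 'n) mps))" for i j
    by (simp add: mat_def)
  then show "\<forall>F\<in>vanishing_ideal C. eval_mpoly const_mps F (\<lambda>i. \<Sum>j\<in>UNIV. const_mps ((mat 1 :: 'k ^ 'n cone_index ^ 'n cone_index) $ i $ j) *
      graph_point (\<lambda>l. p $ Mid l / p $ First) f j) = 0"
    using assms(4) by (simp add: sum_delta_left)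
qed (use assms in simp_all)

lemma cone_chart_id: "cone_chart (\<lambda>i j. if i = j then 1 else 0) (\<lambda>i j. if i = j then 1 else 0) a f (graph_point a f)"
proof
  show "graph_point a f l = (\<Sum>j\<in>UNIV. const_mps (if l = j then 1 else 0) * graph_point a f j)" for l
  proof -
    have "const_mps (if l = j then 1 else 0 :: 'b) = (if l = j then 1 else (0 :: ('b, 'a) mps))" for j by simp
    then show ?thesis by (simp only: sum_delta_left)
  qed
qed (simp_all add: sum_delta_left)

text \<open>In the identity chart f is the square of 1 plus the roots of the x_l, on the branches
  with values u_l / u_0.\<close>

lemma (in germ_class) sqrt_cone_germ_exists:
  assumes u: "generic_vec u"
  shows "\<exists>N. \<exists>f\<in>\<G>. graph_germ sqrt_cone N (\<chi> i. u i ^ 2) f"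
proof -
  note un = generic_vec_nonzero[OF u]
  let ?p = "\<chi> i. u i ^ 2"
  define a where "a l = ?p $ Mid l / ?p $ First" for l
  have "\<exists>y. y ^ 2 = const_mps (a l) + var_mps l \<and> eval0_mps y = u (Mid l) / u First" for l :: 'n
    by (rule mps_sqrt_exists[of "const_mps (a l) + var_mps l" "u (Mid l) / u First"])
       (use un in \<open>auto simp: a_def power_divide\<close>)
  then obtain s where s: "\<And>l. s l ^ 2 = const_mps (a l) + var_mps l" "\<And>l. eval0_mps (s l) = u (Mid l) / u First"
    by metis
  define S where "S = 1 + (\<Sum>l\<in>UNIV. s l)"
  define f where "f = S ^ 2"
  define U where "U i = (case i of First \<Rightarrow> 1 | Mid l \<Rightarrow> s l | Last \<Rightarrow> - S)" for i
  have U: "U i ^ 2 = graph_point a f i" for i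
    by (cases i) (simp_all add: U_def s f_def)
  have sum0: "(\<Sum>i\<in>UNIV. U i) = 0" unfolding sum_cone_index by (simp add: U_def S_def)
  have SL: "eval0_mps S = - (u Last / u First)"
  proof -
    have "u First + (\<Sum>l\<in>UNIV. u (Mid l)) + u Last = 0" using u unfolding generic_vec_def sum_cone_index by blast
    then have "u First + (\<Sum>l\<in>UNIV. u (Mid l)) = - u Last" by (simp add: eq_neg_iff_add_eq_0)
    then have "(u First + (\<Sum>l\<in>UNIV. u (Mid l))) / u First = - (u Last / u First)" by simp
    then show ?thesis using un[of First] by (simp add: S_def s add_divide_distrib sum_divide_distrib)
  qed
  have ev: "eval0_mps (U i) = (1 / u First) * u i" for i
    using un[of First] by (cases i) (simp_all add: U_def s SL)
  have Uu: "U i dvd 1" for i using un by (simp add: mps_unit_iff ev)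
  obtain Ui where "\<forall>l. U l * Ui l = 1" using unit_inverses[of U, OF Uu] by (elim exE)
  then have Ui: "U l * Ui l = 1" for l by blast
  have sub: "(\<Sum>i\<in>S. U (chart_index i)) dvd 1" if "S \<noteq> {}" for S
  proof (rule chart_sum_unit[OF generic_vec_subset[OF u] that])
    show "1 / u First \<noteq> 0" using un[of First] by simp
  qed (assumption | rule ev)+
  have det: "det (hessian f) \<noteq> 0"
  proof (rule cone_chart.sqrt_phase[OF cone_chart_id U Ui sum0 sub])
    fix \<kappa> \<kappa>inv c' J
    assume cp: "cone_phase (\<lambda>l. U l * Ui First) (\<lambda>l. Ui l * U First) (U First) (Ui First) \<kappa> \<kappa>inv c' J"
      and phi: "cone_phase.phi (\<lambda>l. U l * Ui First) (\<lambda>l. Ui l * U First) (U First) \<kappa> =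
        shift_mps f - const_mps f - (\<Sum>i\<in>UNIV. const_mps (pderiv_mps i f) * var_mps i)"
    interpret cp: cone_phase "\<lambda>l. U l * Ui First" "\<lambda>l. Ui l * U First" "U First" "Ui First" \<kappa> \<kappa>inv c' J by (rule cp)
    have "det (hessian f) dvd 1"
      by (rule det_hessian_unit, rule phase_hessian) (rule cp.ph.phase_axioms[unfolded phi])
    then show ?thesis by auto
  qed
  have "s l \<in> \<G>" for l
  proof (rule root)
    show "s l ^ 2 \<in> \<G>" unfolding s(1) by (intro add const var)
    show "s l dvd 1" using Uu[of "Mid l"] by (simp add: U_def)
  qed
  then have "f \<in> \<G>" unfolding f_def S_def by (intro power add one sum)
  moreover have "graph_germ sqrt_cone (mat 1) ?p f"
  proof (rule graph_germ_mat_1[OF cone_smooth(1)[OF u] _ _ _ det])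
    show "?p $ First \<noteq> 0" using un by simp
    show "eval0_mps f = ?p $ Last / ?p $ First" by (simp add: f_def SL power_divide)
    fix F :: "('k, 'n cone_index) mpoly" assume "F \<in> vanishing_ideal sqrt_cone"
    from cone_ideal_transfer[OF this ring_hom_const_mps sum0]
    show "eval_mpoly const_mps F (graph_point (\<lambda>l. ?p $ Mid l / ?p $ First) f) = 0"
      unfolding U a_def .
  qed
  ultimately show ?thesis by blast
qed

text \<open>In the identity chart f = -1 / (1 + sum 1/x_l).\<close>

lemma dual_cone_germ_exists:
  fixes y :: "'k::{alg_closed_field, field_char_0} ^ 'n::finite cone_index"
  assumes \<G>: "germ_class \<G>" and y: "\<And>i. y $ i \<noteq> 0" and y_sum: "(\<Sum>i\<in>UNIV. 1 / y $ i) = 0"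
    and y_sub: "\<And>S. S \<in> finite_sets \<Longrightarrow> (\<Sum>i\<in>S. 1 / y $ i) \<noteq> 0"
  shows "\<exists>N. \<exists>f\<in>\<G>. graph_germ (dual_cone sqrt_cone) N y f"
proof -
  interpret germ_class \<G> by fact
  define a where "a l = y $ Mid l / y $ First" for l
  define b where "b l = (const_mps (a l) + var_mps l :: ('k, 'n) mps)" for l
  have b0: "eval0_mps (b l) = y $ Mid l / y $ First" for l by (simp add: b_def a_def)
  have bu: "b l dvd 1" for l using y by (simp add: mps_unit_iff b0)
  obtain bi where "\<forall>l. b l * bi l = 1" using unit_inverses[of b, OF bu] by (elim exE)
  then have bi: "b l * bi l = 1" for l by blast
  have bi0: "eval0_mps (bi l) = y $ First / y $ Mid l" for l
  proof -
    have "eval0_mps (b l * bi l) = 1" by (simp only: bi eval0_one)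
    then show ?thesis using y[of "Mid l"] y[of First] by (simp add: b0 field_simps)
  qed
  define S where "S = 1 + (\<Sum>l\<in>UNIV. bi l)"
  have SL: "eval0_mps S = - (y $ First / y $ Last)"
  proof -
    have "1 / y $ First + (\<Sum>l\<in>UNIV. 1 / y $ Mid l) + 1 / y $ Last = 0" using y_sum unfolding sum_cone_index .
    then have "1 / y $ First + (\<Sum>l\<in>UNIV. 1 / y $ Mid l) = - (1 / y $ Last)" by (simp add: eq_neg_iff_add_eq_0)
    then have "y $ First * (1 / y $ First + (\<Sum>l\<in>UNIV. 1 / y $ Mid l)) = - (y $ First / y $ Last)" by simp
    then show ?thesis using y[of First] by (simp add: S_def bi0 distrib_left sum_distrib_left)
  qed
  then have "S dvd 1" using y by (simp add: mps_unit_iff)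
  then obtain Si where Si: "S * Si = 1" by (metis dvdE)
  define f where "f = - Si"
  have f0: "eval0_mps f = y $ Last / y $ First"
  proof -
    have "eval0_mps (S * Si) = 1" by (simp only: Si eval0_one)
    then show ?thesis using y[of Last] y[of First] by (simp add: SL f_def field_simps)
  qed
  let ?x = "graph_point a f"
  define xi where "xi i = (case i of First \<Rightarrow> 1 | Mid l \<Rightarrow> bi l | Last \<Rightarrow> - S)" for i
  have xi: "?x i * xi i = 1" for i
    using bi Si by (cases i) (simp_all add: xi_def f_def b_def mult.commute)
  have sum0: "(\<Sum>i\<in>UNIV. xi i) = 0" unfolding sum_cone_index by (simp add: xi_def S_def)
  have ev: "eval0_mps (xi i) = y $ First * (1 / y $ i)" for i
    using y by (cases i) (simp_all add: xi_def SL bi0)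
  have sub: "(\<Sum>i\<in>S. xi (chart_index i)) dvd 1" if "S \<noteq> {}" for S
    by (rule chart_sum_unit[OF y_sub that y ev])
  have det: "det (hessian f) \<noteq> 0"
  proof (rule cone_chart.dual_phase[OF cone_chart_id mps_root xi sum0 sub])
    fix r rinv \<kappa> \<kappa>inv c' J
    assume cp: "cone_phase (\<lambda>l. ?x First * xi l) (\<lambda>l. ?x l * xi First) r rinv \<kappa> \<kappa>inv c' J"
      and phi: "cone_phase.phi (\<lambda>l. ?x First * xi l) (\<lambda>l. ?x l * xi First) r \<kappa> =
        shift_mps f - const_mps f - (\<Sum>i\<in>UNIV. shift_mps (pderiv_mps i f) * var_mps i)"
    interpret cp: cone_phase "\<lambda>l. ?x First * xi l" "\<lambda>l. ?x l * xi First" r rinv \<kappa> \<kappa>inv c' J by (rule cp)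
    have "det (hessian f) dvd 1"
      by (rule det_hessian_unit, rule legendre_phase_hessian) (rule cp.ph.phase_axioms[unfolded phi])
    then show ?thesis by auto
  qed
  have "bi l \<in> \<G>" for l by (rule inv[OF _ bi]) (auto simp: b_def intro!: add const var)
  then have "S \<in> \<G>" unfolding S_def by (intro add one sum)
  then have "f \<in> \<G>" unfolding f_def by (intro uminus inv[OF _ Si])
  moreover have "graph_germ (dual_cone sqrt_cone) (mat 1) y f"
  proof (rule graph_germ_mat_1[OF dual_cone_smooth[OF y y_sum] y f0 _ det])
    fix F :: "('k, 'n cone_index) mpoly" assume F: "F \<in> vanishing_ideal (dual_cone sqrt_cone)"
    have "prod ?x UNIV * (\<Prod>j\<in>UNIV - {i}. xi j) = ?x i" for i
    proof -
      have "prod ?x UNIV * (\<Prod>j\<in>UNIV - {i}. xi j) = ?x i * (\<Prod>j\<in>UNIV - {i}. ?x j * xi j)"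
        unfolding prod.distrib using prod.remove[of UNIV i ?x] by (simp add: mult.assoc)
      then show ?thesis by (simp add: xi)
    qed
    then show "eval_mpoly const_mps F (graph_point (\<lambda>l. y $ Mid l / y $ First) f) = 0"
      using dual_ideal_transfer[OF F ring_hom_const_mps sum0, of "prod ?x UNIV"] by (simp add: a_def[abs_def])
  qed
  ultimately show ?thesis by blast
qed

lemma generic_germ_sqrt_cone:
  fixes \<G> :: "('k::{alg_closed_field, field_char_0}, 'n::finite) mps set"
  assumes "germ_class \<G>" and P: "\<And>f. germ_rank \<G> f = enat (fact (CARD('n) + 1)) \<Longrightarrow> P f"
  shows "generic_germ \<G> sqrt_cone P"
  unfolding generic_germ_def
proof (rule cone_generically, intro conjI allI ballI impI)
  fix u :: "'n cone_index \<Rightarrow> 'k" assume u: "generic_vec u"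
  show "\<exists>N. \<exists>f\<in>\<G>. graph_germ sqrt_cone N (\<chi> i. u i ^ 2) f"
    by (rule germ_class.sqrt_cone_germ_exists[OF assms(1) u])
  show "P f" if "f \<in> \<G>" "graph_germ sqrt_cone N (\<chi> i. u i ^ 2) f" for N f
    by (rule P, rule sqrt_cone_germ_rank[OF assms(1) that(1) u that(2)])
qed

lemma generic_germ_dual_cone:
  fixes \<G> :: "('k::{alg_closed_field, field_char_0}, 'n::finite) mps set"
  assumes "germ_class \<G>" and P: "\<And>f. germ_rank \<G> f = enat (fact (CARD('n) + 1)) \<Longrightarrow> P f"
  shows "generic_germ \<G> (dual_cone sqrt_cone) P"
  unfolding generic_germ_def
proof (rule dual_cone_generically, intro conjI allI ballI impI)
  fix y :: "'k ^ 'n cone_index"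
  assume y: "\<And>i. y $ i \<noteq> 0" "(\<Sum>i\<in>UNIV. 1 / y $ i) = 0" "\<And>S. S \<in> finite_sets \<Longrightarrow> (\<Sum>i\<in>S. 1 / y $ i) \<noteq> 0"
  show "\<exists>N. \<exists>f\<in>\<G>. graph_germ (dual_cone sqrt_cone) N y f"
    by (rule dual_cone_germ_exists[OF assms(1) y])
  show "P f" if "f \<in> \<G>" "graph_germ (dual_cone sqrt_cone) N y f" for N f
    by (rule P, rule dual_cone_germ_rank[OF assms(1) that(1) y(1,3) that(2)])
qed

lemma cones_admissible_rank:
  fixes \<G> :: "('k::{alg_closed_field, field_char_0}, 'n::finite) mps set"
  assumes "germ_class \<G>"
  shows "cone_admissible \<G> sqrt_cone" "cone_has_rank \<G> sqrt_cone (fact (CARD('n) + 1))"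
    "cone_admissible \<G> (dual_cone sqrt_cone)" "cone_has_rank \<G> (dual_cone sqrt_cone) (fact (CARD('n) + 1))"
  unfolding cone_admissible_def cone_has_rank_def
  by (intro generic_germ_sqrt_cone generic_germ_dual_cone assms; simp add: germ_admissible_def zero_enat_def)+

theorem theorem5p5p1:
  fixes C :: "('k::{alg_closed_field, field_char_0} ^ 'n::finite cone_index) set"
    and D :: "(complex ^ 'n cone_index) set"
  assumes "CARD('n) \<ge> 2"
    and "C = sqrt_cone"
    and "D = sqrt_cone"
  shows "(cone_admissible formal_germs C \<and>
           cone_has_rank formal_germs C (fact (CARD('n) + 1)) \<and>
           cone_admissible formal_germs (dual_cone C) \<and>
           cone_has_rank formal_germs (dual_cone C) (fact (CARD('n) + 1))) \<and>
         (cone_admissible analytic_germs D \<and>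
           cone_has_rank analytic_germs D (fact (CARD('n) + 1)) \<and>
           cone_admissible analytic_germs (dual_cone D) \<and>
           cone_has_rank analytic_germs (dual_cone D) (fact (CARD('n) + 1)))"
  unfolding assms(2,3)
  by (intro conjI cones_admissible_rank germ_class_formal germ_class_analytic)

end
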